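(* Let $k$ be a commutative unital ring and let $A$ be an associative unital $k$-algebra that is projective as a $k$-module. Let $P_\bullet\to A$ be an $A^e$-projective resolution of $A$ with differential $d_i:P_i\to P_{i-1}$ ($i\ge 1$) and augmentation $d_0:P_0\to A$. Let $m\ge 0$, let $t\in \mathrm{Hom}_{A^e}(P_m,A)$ be a cocycle (i.e. $t\,d_{m+1}=0$), and let $t_\bullet:P_{m+\bullet}\to P_\bullet$ be a chain map lifting $t$, that is, a family of $A^e$-linear maps $t_i:P_{m+i}\to P_i$ ($i\ge 0$) with $d_0t_0=t$ and $d_it_i=t_{i-1}d_{m+i}$ for all $i\ge 1$. Then, for every integer $n\ge m$ and every cycle $a\otimes_{A^e}p\in A\otimes_{A^e}P_n$, $$[a\otimes_{A^e}p]\cap[t]=(-1)^{m(n-m)}\big[a\otimes_{A^e}t_{n-m}(p)\big]\quad\text{in } HH_{n-m}(A).$$ In particular, $\widetilde{\cap}=(-1)^{m(n-m)}\cap$ on $HH_n(A)\otimes HH^m(A)$, and the two products coincide whenever $m$ or $n-m$ is even.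
   Context: $A^e=A\otimes_k A^{op}$ is the enveloping algebra, with product $(a\otimes b)(a'\otimes b')=aa'\otimes b'b$; $A$-bimodules (with $k$ acting symmetrically) are identified with left and with right $A^e$-modules, so that in $N\otimes_{A^e}Y$ one has $(c\,x\,a)\otimes y=x\otimes(a\,y\,c)$ for $a,c\in A$. The bar resolution $\mathrm{Bar}(A)_\bullet$ of $A$ has $\mathrm{Bar}(A)_n=A^{\otimes(n+2)}$ (tensor over $k$) with differential $d_n(a_0\otimes\cdots\otimes a_{n+1})=\sum_{i=0}^n(-1)^i a_0\otimes\cdots\otimes a_ia_{i+1}\otimes\cdots\otimes a_{n+1}$, and its augmentation is the multiplication $A\otimes A\to A$. Hochschild homology and cohomology are $HH_n(A)=H_n(A\otimes_{A^e}\mathrm{Bar}(A)_\bullet)$ and $HH^m(A)=H^m(\mathrm{Hom}_{A^e}(\mathrm{Bar}(A)_\bullet,A))$. Since $A$ is $k$-projective, the bar resolution is an $A^e$-projective resolution, and these (co)homologies are canonically identified (via comparison chain maps over $\mathrm{id}_A$) with those computed from any $A^e$-projective resolution $P_\bullet\to A$. Brackets $[-]$ denote (co)homology classes. The cap product $\cap: HH_n(A)\otimes HH^m(A)\to HH_{n-m}(A)$, $0\le m\le n$, is defined on the bar resolution by $$[x\otimes_{A^e}a_0\otimes\cdots\otimes a_{n+1}]\cap[t]=[x\,t(a_0\otimes\cdots\otimes a_m\otimes 1)\otimes_{A^e}1\otimes a_{m+1}\otimes\cdots\otimes a_{n+1}]$$ (extended linearly to cycles), where $A\otimes_A A$ is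 identified with $A$; for a general resolution it is transported along the canonical identifications. The product $\widetilde{\cap}: HH_n(A)\otimes HH^m(A)\to HH_{n-m}(A)$ is the well-defined product induced by $(a\otimes_{A^e}p)\,\widetilde{\cap}\,t:=a\otimes_{A^e}t_{n-m}(p)$ for a cycle $a\otimes_{A^e}p\in A\otimes_{A^e}P_n$ and a cocycle $t\in\mathrm{Hom}_{A^e}(P_m,A)$ with chain map $t_\bullet$ lifting $t$ (such a lift always exists, and the resulting class does not depend on the lift or the resolution). *)

theory Defs
  imports "HOL-Algebra.Module" "HOL-Algebra.AbelCoset" "HOL-Algebra.Free_Abelian_Groups"
begin

section \<open>Modules over a ring that need not be commutative\<close>

text \<open>
  The library locale \<^locale>\<open>module\<close> requires a commutative base ring, so left modules over an
  arbitrary ring are introduced here, on the same records. A right module is represented by the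
  same record type, \<open>r \<odot> x\<close> standing for \<open>x \<cdot> r\<close>.
\<close>

locale left_module = R?: ring R + M?: abelian_group M
  for R :: "('r, 'x) ring_scheme" (structure) and M :: "('r, 'm, 'y) module_scheme" (structure) +
  assumes smult_closed:
      "\<lbrakk>a \<in> carrier R; x \<in> carrier M\<rbrakk> \<Longrightarrow> a \<odot>\<^bsub>M\<^esub> x \<in> carrier M"
    and smult_l_distr:
      "\<lbrakk>a \<in> carrier R; b \<in> carrier R; x \<in> carrier M\<rbrakk>
        \<Longrightarrow> (a \<oplus> b) \<odot>\<^bsub>M\<^esub> x = a \<odot>\<^bsub>M\<^esub> x \<oplus>\<^bsub>M\<^esub> b \<odot>\<^bsub>M\<^esub> x"
    and smult_r_distr:
      "\<lbrakk>a \<in> carrier R; x \<in> carrier M; y \<in> carrier M\<rbrakk>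
        \<Longrightarrow> a \<odot>\<^bsub>M\<^esub> (x \<oplus>\<^bsub>M\<^esub> y) = a \<odot>\<^bsub>M\<^esub> x \<oplus>\<^bsub>M\<^esub> a \<odot>\<^bsub>M\<^esub> y"
    and smult_assoc1:
      "\<lbrakk>a \<in> carrier R; b \<in> carrier R; x \<in> carrier M\<rbrakk>
        \<Longrightarrow> (a \<otimes> b) \<odot>\<^bsub>M\<^esub> x = a \<odot>\<^bsub>M\<^esub> (b \<odot>\<^bsub>M\<^esub> x)"
    and smult_one:
      "x \<in> carrier M \<Longrightarrow> \<one> \<odot>\<^bsub>M\<^esub> x = x"

definition linear_maps ::
    "('r, 'x) ring_scheme \<Rightarrow> ('r, 'm, 'y) module_scheme \<Rightarrow> ('r, 'n, 'z) module_scheme \<Rightarrow> ('m \<Rightarrow> 'n) set"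
  where "linear_maps R M N =
    {f \<in> carrier M \<rightarrow> carrier N.
       (\<forall>x\<in>carrier M. \<forall>y\<in>carrier M. f (x \<oplus>\<^bsub>M\<^esub> y) = f x \<oplus>\<^bsub>N\<^esub> f y) \<and>
       (\<forall>r\<in>carrier R. \<forall>x\<in>carrier M. f (r \<odot>\<^bsub>M\<^esub> x) = r \<odot>\<^bsub>N\<^esub> f x)}"

text \<open>The free left module \<open>R\<^sup>(\<^sup>I\<^sup>)\<close>.\<close>

definition free_module :: "('r, 'x) ring_scheme \<Rightarrow> 'i set \<Rightarrow> ('r, 'i \<Rightarrow> 'r) module"
  where "free_module R I =
    \<lparr>carrier = {f \<in> I \<rightarrow>\<^sub>E carrier R. finite {i \<in> I. f i \<noteq> \<zero>\<^bsub>R\<^esub>}},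
     mult = undefined, one = undefined,
     ring.zero = (\<lambda>i\<in>I. \<zero>\<^bsub>R\<^esub>), ring.add = (\<lambda>f g. \<lambda>i\<in>I. f i \<oplus>\<^bsub>R\<^esub> g i),
     smult = (\<lambda>r f. \<lambda>i\<in>I. r \<otimes>\<^bsub>R\<^esub> f i)\<rparr>"

text \<open>
  A module is projective iff it is a direct summand (equivalently, a retract) of a free module.
  The index set may be taken inside the type of \<open>M\<close>: if \<open>M\<close> is a retract of any free module,
  then it is a retract of the free module on its own carrier. The lifting property would quantify
  over modules carried by arbitrary types, which a formula cannot do; it is derived as
  \<open>projective_module_lift\<close> below.
\<close>

definition projective_module :: "('r, 'x) ring_scheme \<Rightarrow> ('r, 'm, 'y) module_scheme \<Rightarrow> bool"
  where "projective_module R M \<longleftrightarrow> left_module R M \<and>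
    (\<exists>I :: 'm set. \<exists>s \<in> linear_maps R M (free_module R I). \<exists>q \<in> linear_maps R (free_module R I) M.
       \<forall>x\<in>carrier M. q (s x) = x)"

locale assoc_algebra = module k A + A?: ring A
  for k :: "('k, 'x) ring_scheme" (structure) and A :: "('k, 'a, 'y) module_scheme" (structure) +
  assumes smult_assoc_left:
      "\<lbrakk>r \<in> carrier k; x \<in> carrier A; y \<in> carrier A\<rbrakk>
        \<Longrightarrow> (r \<odot>\<^bsub>A\<^esub> x) \<otimes>\<^bsub>A\<^esub> y = r \<odot>\<^bsub>A\<^esub> (x \<otimes>\<^bsub>A\<^esub> y)"
    and smult_assoc_right:
      "\<lbrakk>r \<in> carrier k; x \<in> carrier A; y \<in> carrier A\<rbrakk>
        \<Longrightarrow> x \<otimes>\<^bsub>A\<^esub> (r \<odot>\<^bsub>A\<^esub> y) = r \<odot>\<^bsub>A\<^esub> (x \<otimes>\<^bsub>A\<^esub> y)"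


section \<open>Abelian groups given by generators and relations\<close>

definition additive_group :: "('g, 'x) monoid_scheme \<Rightarrow> 'g ring"
  where "additive_group G =
    \<lparr>carrier = carrier G, mult = undefined, one = undefined,
     ring.zero = \<one>\<^bsub>G\<^esub>, ring.add = (\<lambda>x y. x \<otimes>\<^bsub>G\<^esub> y)\<rparr>"

definition relations_span :: "'x set \<Rightarrow> ('x \<Rightarrow>\<^sub>0 int) set \<Rightarrow> ('x \<Rightarrow>\<^sub>0 int) set"
  where "relations_span S Rel = generate (free_Abelian_group S) Rel"

definition presented_group :: "'x set \<Rightarrow> ('x \<Rightarrow>\<^sub>0 int) set \<Rightarrow> ('x \<Rightarrow>\<^sub>0 int) set ring"
  where "presented_group S Rel = additive_group (free_Abelian_group S Mod relations_span S Rel)"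

definition generator :: "'x set \<Rightarrow> ('x \<Rightarrow>\<^sub>0 int) set \<Rightarrow> 'x \<Rightarrow> ('x \<Rightarrow>\<^sub>0 int) set"
  where "generator S Rel x = relations_span S Rel #>\<^bsub>free_Abelian_group S\<^esub> frag_of x"

definition linear_extension :: "('g, 'z) ring_scheme \<Rightarrow> ('x \<Rightarrow> 'g) \<Rightarrow> ('x \<Rightarrow>\<^sub>0 int) \<Rightarrow> 'g"
  where "linear_extension G f c =
    (\<Oplus>\<^bsub>G\<^esub>x\<in>Poly_Mapping.keys c. [Poly_Mapping.lookup c x] \<cdot>\<^bsub>G\<^esub> f x)"

text \<open>
  The additive map out of a presented group with prescribed values on the generators. It is only
  meaningful if the linear extension kills the relations, see \<open>induced_generator\<close>
  and \<open>induced_add\<close>.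
\<close>

definition induced :: "('g, 'z) ring_scheme \<Rightarrow> ('x \<Rightarrow> 'g) \<Rightarrow> ('x \<Rightarrow>\<^sub>0 int) set \<Rightarrow> 'g"
  where "induced G f X = the_elem (linear_extension G f ` X)"


section \<open>Tensor products\<close>

text \<open>\<open>N \<otimes>\<^sub>R Y\<close> for a right \<open>R\<close>-module \<open>N\<close> and a left \<open>R\<close>-module \<open>Y\<close>.\<close>

definition tensor_relations ::
    "('r, 'x) ring_scheme \<Rightarrow> ('r, 'n, 'y) module_scheme \<Rightarrow> ('r, 'm, 'z) module_scheme \<Rightarrow> ('n \<times> 'm \<Rightarrow>\<^sub>0 int) set"
  where "tensor_relations R N Y =
    {frag_of (x \<oplus>\<^bsub>N\<^esub> x', y) - frag_of (x, y) - frag_of (x', y) | x x' y.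
        x \<in> carrier N \<and> x' \<in> carrier N \<and> y \<in> carrier Y} \<union>
    {frag_of (x, y \<oplus>\<^bsub>Y\<^esub> y') - frag_of (x, y) - frag_of (x, y') | x y y'.
        x \<in> carrier N \<and> y \<in> carrier Y \<and> y' \<in> carrier Y} \<union>
    {frag_of (r \<odot>\<^bsub>N\<^esub> x, y) - frag_of (x, r \<odot>\<^bsub>Y\<^esub> y) | r x y.
        r \<in> carrier R \<and> x \<in> carrier N \<and> y \<in> carrier Y}"

definition tensor ::
    "('r, 'x) ring_scheme \<Rightarrow> ('r, 'n, 'y) module_scheme \<Rightarrow> ('r, 'm, 'z) module_scheme \<Rightarrow> ('n \<times> 'm \<Rightarrow>\<^sub>0 int) set ring"
  where "tensor R N Y = presented_group (carrier N \<times> carrier Y) (tensor_relations R N Y)"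

definition pure_tensor ::
    "('r, 'x) ring_scheme \<Rightarrow> ('r, 'n, 'y) module_scheme \<Rightarrow> ('r, 'm, 'z) module_scheme \<Rightarrow> 'n \<Rightarrow> 'm \<Rightarrow> ('n \<times> 'm \<Rightarrow>\<^sub>0 int) set"
  where "pure_tensor R N Y x y = generator (carrier N \<times> carrier Y) (tensor_relations R N Y) (x, y)"

text \<open>\<open>id\<^sub>N \<otimes> f : N \<otimes>\<^sub>R Y \<rightarrow> N \<otimes>\<^sub>R Y'\<close> for a linear map \<open>f : Y \<rightarrow> Y'\<close>.\<close>

definition tensor_map ::
    "('r, 'x) ring_scheme \<Rightarrow> ('r, 'n, 'y) module_scheme \<Rightarrow> ('r, 'm, 'z) module_scheme
      \<Rightarrow> ('l \<Rightarrow> 'm) \<Rightarrow> ('n \<times> 'l \<Rightarrow>\<^sub>0 int) set \<Rightarrow> ('n \<times> 'm \<Rightarrow>\<^sub>0 int) set"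
  where "tensor_map R N Y' f = induced (tensor R N Y') (\<lambda>(x, y). pure_tensor R N Y' x (f y))"

text \<open>
  The tensor power \<open>A\<^sup>\<otimes>\<^sup>N\<close> over \<open>k\<close>, generated by the lists of length \<open>N\<close>
  (the tuples \<open>a\<^sub>0 \<otimes> \<dots> \<otimes> a\<^sub>N\<^sub>-\<^sub>1\<close>), as an abelian group. For \<open>N = 0\<close> this group is
  \<open>\<int>\<close> rather than \<open>k\<close>, but only \<open>N \<ge> 1\<close> is ever used.
\<close>

definition tuples :: "('a, 'x) ring_scheme \<Rightarrow> nat \<Rightarrow> 'a list set"
  where "tuples A N = {xs. length xs = N \<and> set xs \<subseteq> carrier A}"

definition power_relations ::
    "('k, 'x) ring_scheme \<Rightarrow> ('k, 'a, 'y) module_scheme \<Rightarrow> nat \<Rightarrow> ('a list \<Rightarrow>\<^sub>0 int) set"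
  where "power_relations k A N =
    {frag_of (xs[i := a \<oplus>\<^bsub>A\<^esub> b]) - frag_of (xs[i := a]) - frag_of (xs[i := b]) | xs i a b.
        xs \<in> tuples A N \<and> i < N \<and> a \<in> carrier A \<and> b \<in> carrier A} \<union>
    {frag_of (xs[i := r \<odot>\<^bsub>A\<^esub> xs ! i]) - frag_of (xs[j := r \<odot>\<^bsub>A\<^esub> xs ! j]) | xs i j r.
        xs \<in> tuples A N \<and> i < N \<and> j < N \<and> r \<in> carrier k}"

definition tensor_power ::
    "('k, 'x) ring_scheme \<Rightarrow> ('k, 'a, 'y) module_scheme \<Rightarrow> nat \<Rightarrow> ('a list \<Rightarrow>\<^sub>0 int) set ring"
  where "tensor_power k A N = presented_group (tuples A N) (power_relations k A N)"

definition pure_power ::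
    "('k, 'x) ring_scheme \<Rightarrow> ('k, 'a, 'y) module_scheme \<Rightarrow> 'a list \<Rightarrow> ('a list \<Rightarrow>\<^sub>0 int) set"
  where "pure_power k A xs =
    generator (tuples A (length xs)) (power_relations k A (length xs)) xs"


section \<open>The enveloping algebra\<close>

type_synonym 'a env = "('a \<times> 'a \<Rightarrow>\<^sub>0 int) set"

definition enveloping :: "('k, 'x) ring_scheme \<Rightarrow> ('k, 'a, 'y) module_scheme \<Rightarrow> 'a env ring"
  where "enveloping k A =
    \<lparr>carrier = carrier (tensor k A A),
     mult = (\<lambda>X Y. induced (tensor k A A) (\<lambda>(a, b).
               induced (tensor k A A) (\<lambda>(a', b'). pure_tensor k A A (a \<otimes>\<^bsub>A\<^esub> a') (b' \<otimes>\<^bsub>A\<^esub> b)) Y) X),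
     one = pure_tensor k A A \<one>\<^bsub>A\<^esub> \<one>\<^bsub>A\<^esub>,
     ring.zero = ring.zero (tensor k A A), ring.add = ring.add (tensor k A A)\<rparr>"

text \<open>\<open>A\<close> as a left \<open>A\<^sup>e\<close>-module, \<open>(a \<otimes> c) y = a y c\<close>, and as a right one, \<open>x (a \<otimes> c) = c x a\<close>.\<close>

definition left_regular ::
    "('k, 'x) ring_scheme \<Rightarrow> ('k, 'a, 'y) module_scheme \<Rightarrow> ('a env, 'a) module"
  where "left_regular k A =
    \<lparr>carrier = carrier A, mult = monoid.mult A, one = one A, ring.zero = ring.zero A, ring.add = ring.add A,
     smult = (\<lambda>X y. induced A (\<lambda>(a, c). a \<otimes>\<^bsub>A\<^esub> y \<otimes>\<^bsub>A\<^esub> c) X)\<rparr>"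

definition right_regular ::
    "('k, 'x) ring_scheme \<Rightarrow> ('k, 'a, 'y) module_scheme \<Rightarrow> ('a env, 'a) module"
  where "right_regular k A =
    \<lparr>carrier = carrier A, mult = monoid.mult A, one = one A, ring.zero = ring.zero A, ring.add = ring.add A,
     smult = (\<lambda>X x. induced A (\<lambda>(a, c). c \<otimes>\<^bsub>A\<^esub> x \<otimes>\<^bsub>A\<^esub> a) X)\<rparr>"


section \<open>Augmented complexes and projective resolutions\<close>

text \<open>
  The differential \<open>bd P i\<close> maps degree \<open>i\<close> to degree \<open>i - 1\<close> and is used for \<open>i \<ge> 1\<close> only; what is
  usually written \<open>d\<^sub>0\<close> is the augmentation \<open>aug P\<close>.
\<close>

record ('r, 'p, 'm) aug_complex =
  Ch :: "nat \<Rightarrow> ('r, 'p) module"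
  bd :: "nat \<Rightarrow> 'p \<Rightarrow> 'p"
  aug :: "'p \<Rightarrow> 'm"

definition projective_resolution ::
    "('r, 'x) ring_scheme \<Rightarrow> ('r, 'm, 'y) module_scheme \<Rightarrow> ('r, 'p, 'm) aug_complex \<Rightarrow> bool"
  where "projective_resolution R M P \<longleftrightarrow>
    (\<forall>i. projective_module R (Ch P i)) \<and>
    (\<forall>i\<ge>1. bd P i \<in> linear_maps R (Ch P i) (Ch P (i - 1))) \<and>
    aug P \<in> linear_maps R (Ch P 0) M \<and>
    aug P ` carrier (Ch P 0) = carrier M \<and>
    {x \<in> carrier (Ch P 0). aug P x = \<zero>\<^bsub>M\<^esub>} = bd P 1 ` carrier (Ch P 1) \<and>
    (\<forall>i\<ge>1. {x \<in> carrier (Ch P i). bd P i x = \<zero>\<^bsub>Ch P (i - 1)\<^esub>} = bd P (i + 1) ` carrier (Ch P (i + 1)))"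

definition comparison_map ::
    "('r, 'x) ring_scheme \<Rightarrow> ('r, 'p, 'm) aug_complex \<Rightarrow> ('r, 'q, 'm) aug_complex \<Rightarrow> (nat \<Rightarrow> 'p \<Rightarrow> 'q) \<Rightarrow> bool"
  where "comparison_map R P Q \<phi> \<longleftrightarrow>
    (\<forall>i. \<phi> i \<in> linear_maps R (Ch P i) (Ch Q i)) \<and>
    (\<forall>x\<in>carrier (Ch P 0). aug Q (\<phi> 0 x) = aug P x) \<and>
    (\<forall>i\<ge>1. \<forall>x\<in>carrier (Ch P i). bd Q i (\<phi> i x) = \<phi> (i - 1) (bd P i x))"

definition chain_lift ::
    "('r, 'x) ring_scheme \<Rightarrow> ('r, 'p, 'm) aug_complex \<Rightarrow> nat \<Rightarrow> ('p \<Rightarrow> 'm) \<Rightarrow> (nat \<Rightarrow> 'p \<Rightarrow> 'p) \<Rightarrow> bool"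
  where "chain_lift R P m t \<tau> \<longleftrightarrow>
    (\<forall>i. \<tau> i \<in> linear_maps R (Ch P (m + i)) (Ch P i)) \<and>
    (\<forall>x\<in>carrier (Ch P m). aug P (\<tau> 0 x) = t x) \<and>
    (\<forall>i\<ge>1. \<forall>x\<in>carrier (Ch P (m + i)). bd P i (\<tau> i x) = \<tau> (i - 1) (bd P (m + i) x))"


section \<open>The bar resolution\<close>

definition bar_module ::
    "('k, 'x) ring_scheme \<Rightarrow> ('k, 'a, 'y) module_scheme \<Rightarrow> nat \<Rightarrow> ('a env, ('a list \<Rightarrow>\<^sub>0 int) set) module"
  where "bar_module k A n =
    \<lparr>carrier = carrier (tensor_power k A (n + 2)), mult = undefined, one = undefined,
     ring.zero = ring.zero (tensor_power k A (n + 2)), ring.add = ring.add (tensor_power k A (n + 2)),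
     smult = (\<lambda>X \<beta>. induced (tensor_power k A (n + 2)) (\<lambda>(a, c).
                induced (tensor_power k A (n + 2)) (\<lambda>xs.
                  pure_power k A (xs[0 := a \<otimes>\<^bsub>A\<^esub> xs ! 0, n + 1 := xs ! (n + 1) \<otimes>\<^bsub>A\<^esub> c])) \<beta>) X)\<rparr>"

definition contract :: "('a, 'x) ring_scheme \<Rightarrow> nat \<Rightarrow> 'a list \<Rightarrow> 'a list"
  where "contract A i xs = take i xs @ [xs ! i \<otimes>\<^bsub>A\<^esub> xs ! (i + 1)] @ drop (i + 2) xs"

definition bar_diff ::
    "('k, 'x) ring_scheme \<Rightarrow> ('k, 'a, 'y) module_scheme \<Rightarrow> nat
      \<Rightarrow> ('a list \<Rightarrow>\<^sub>0 int) set \<Rightarrow> ('a list \<Rightarrow>\<^sub>0 int) set"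
  where "bar_diff k A n = induced (tensor_power k A (n + 1)) (\<lambda>xs.
    \<Oplus>\<^bsub>tensor_power k A (n + 1)\<^esub>i\<in>{0..n}.
      [((- 1) ^ i :: int)] \<cdot>\<^bsub>tensor_power k A (n + 1)\<^esub> pure_power k A (contract A i xs))"

definition bar ::
    "('k, 'x) ring_scheme \<Rightarrow> ('k, 'a, 'y) module_scheme \<Rightarrow> ('a env, ('a list \<Rightarrow>\<^sub>0 int) set, 'a) aug_complex"
  where "bar k A =
    \<lparr>Ch = bar_module k A, bd = bar_diff k A,
     aug = induced A (\<lambda>xs. xs ! 0 \<otimes>\<^bsub>A\<^esub> xs ! 1)\<rparr>"


section \<open>Homology and cohomology of complexes of abelian groups\<close>

definition cycles :: "(nat \<Rightarrow> ('c, 'x) ring_scheme) \<Rightarrow> (nat \<Rightarrow> 'c \<Rightarrow> 'c) \<Rightarrow> nat \<Rightarrow> 'c set"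
  where "cycles C d n = {z \<in> carrier (C n). n = 0 \<or> d n z = \<zero>\<^bsub>C (n - 1)\<^esub>}"

definition boundaries :: "(nat \<Rightarrow> ('c, 'x) ring_scheme) \<Rightarrow> (nat \<Rightarrow> 'c \<Rightarrow> 'c) \<Rightarrow> nat \<Rightarrow> 'c set"
  where "boundaries C d n = d (n + 1) ` carrier (C (n + 1))"

definition homology :: "(nat \<Rightarrow> ('c, 'x) ring_scheme) \<Rightarrow> (nat \<Rightarrow> 'c \<Rightarrow> 'c) \<Rightarrow> nat \<Rightarrow> 'c set ring"
  where "homology C d n =
    additive_group ((C n)\<lparr>carrier := cycles C d n\<rparr> A_Mod boundaries C d n)"

definition cocycles :: "(nat \<Rightarrow> ('c, 'x) ring_scheme) \<Rightarrow> (nat \<Rightarrow> 'c \<Rightarrow> 'c) \<Rightarrow> nat \<Rightarrow> 'c set"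
  where "cocycles C \<delta> m = {t \<in> carrier (C m). \<delta> m t = \<zero>\<^bsub>C (m + 1)\<^esub>}"

definition coboundaries :: "(nat \<Rightarrow> ('c, 'x) ring_scheme) \<Rightarrow> (nat \<Rightarrow> 'c \<Rightarrow> 'c) \<Rightarrow> nat \<Rightarrow> 'c set"
  where "coboundaries C \<delta> m = (if m = 0 then {\<zero>\<^bsub>C 0\<^esub>} else \<delta> (m - 1) ` carrier (C (m - 1)))"

definition cohomology :: "(nat \<Rightarrow> ('c, 'x) ring_scheme) \<Rightarrow> (nat \<Rightarrow> 'c \<Rightarrow> 'c) \<Rightarrow> nat \<Rightarrow> 'c set ring"
  where "cohomology C \<delta> m =
    additive_group ((C m)\<lparr>carrier := cocycles C \<delta> m\<rparr> A_Mod coboundaries C \<delta> m)"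


section \<open>Hochschild homology and cohomology\<close>

text \<open>
  All notions take the resolution as an argument; \<open>P = bar k A\<close> gives the definition of
  \<open>HH\<^sub>n(A)\<close> and \<open>HH\<^sup>m(A)\<close>.
\<close>

definition chains ::
    "('k, 'x) ring_scheme \<Rightarrow> ('k, 'a, 'y) module_scheme \<Rightarrow> ('a env, 'p, 'a) aug_complex
      \<Rightarrow> nat \<Rightarrow> ('a \<times> 'p \<Rightarrow>\<^sub>0 int) set ring"
  where "chains k A P n = tensor (enveloping k A) (right_regular k A) (Ch P n)"

definition chain_map ::
    "('k, 'x) ring_scheme \<Rightarrow> ('k, 'a, 'y) module_scheme \<Rightarrow> ('a env, 'q, 'a) aug_complex \<Rightarrow> nat
      \<Rightarrow> ('p \<Rightarrow> 'q) \<Rightarrow> ('a \<times> 'p \<Rightarrow>\<^sub>0 int) set \<Rightarrow> ('a \<times> 'q \<Rightarrow>\<^sub>0 int) set"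
  where "chain_map k A Q n f = tensor_map (enveloping k A) (right_regular k A) (Ch Q n) f"

definition chain_diff ::
    "('k, 'x) ring_scheme \<Rightarrow> ('k, 'a, 'y) module_scheme \<Rightarrow> ('a env, 'p, 'a) aug_complex
      \<Rightarrow> nat \<Rightarrow> ('a \<times> 'p \<Rightarrow>\<^sub>0 int) set \<Rightarrow> ('a \<times> 'p \<Rightarrow>\<^sub>0 int) set"
  where "chain_diff k A P n = chain_map k A P (n - 1) (bd P n)"

definition HH_cycles ::
    "('k, 'x) ring_scheme \<Rightarrow> ('k, 'a, 'y) module_scheme \<Rightarrow> ('a env, 'p, 'a) aug_complex
      \<Rightarrow> nat \<Rightarrow> ('a \<times> 'p \<Rightarrow>\<^sub>0 int) set set"
  where "HH_cycles k A P n = cycles (chains k A P) (chain_diff k A P) n"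

definition HH ::
    "('k, 'x) ring_scheme \<Rightarrow> ('k, 'a, 'y) module_scheme \<Rightarrow> ('a env, 'p, 'a) aug_complex
      \<Rightarrow> nat \<Rightarrow> ('a \<times> 'p \<Rightarrow>\<^sub>0 int) set set ring"
  where "HH k A P n = homology (chains k A P) (chain_diff k A P) n"

definition HH_class ::
    "('k, 'x) ring_scheme \<Rightarrow> ('k, 'a, 'y) module_scheme \<Rightarrow> ('a env, 'p, 'a) aug_complex
      \<Rightarrow> nat \<Rightarrow> ('a \<times> 'p \<Rightarrow>\<^sub>0 int) set \<Rightarrow> ('a \<times> 'p \<Rightarrow>\<^sub>0 int) set set"
  where "HH_class k A P n z =
    boundaries (chains k A P) (chain_diff k A P) n +>\<^bsub>chains k A P n\<^esub> z"

text \<open>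
  Cochains are taken to be extensional functions, so that equality of cochains is equality on
  the carrier.
\<close>

definition cochains ::
    "('k, 'x) ring_scheme \<Rightarrow> ('k, 'a, 'y) module_scheme \<Rightarrow> ('a env, 'p, 'a) aug_complex
      \<Rightarrow> nat \<Rightarrow> ('p \<Rightarrow> 'a) ring"
  where "cochains k A P m =
    \<lparr>carrier = linear_maps (enveloping k A) (Ch P m) (left_regular k A) \<inter> extensional (carrier (Ch P m)),
     mult = undefined, one = undefined,
     ring.zero = (\<lambda>x\<in>carrier (Ch P m). \<zero>\<^bsub>A\<^esub>),
     ring.add = (\<lambda>f g. \<lambda>x\<in>carrier (Ch P m). f x \<oplus>\<^bsub>A\<^esub> g x)\<rparr>"

definition cochain_diff ::
    "('a env, 'p, 'a) aug_complex \<Rightarrow> nat \<Rightarrow> ('p \<Rightarrow> 'a) \<Rightarrow> 'p \<Rightarrow> 'a"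
  where "cochain_diff P m t = (\<lambda>x\<in>carrier (Ch P (m + 1)). t (bd P (m + 1) x))"

definition HHco_cocycles ::
    "('k, 'x) ring_scheme \<Rightarrow> ('k, 'a, 'y) module_scheme \<Rightarrow> ('a env, 'p, 'a) aug_complex
      \<Rightarrow> nat \<Rightarrow> ('p \<Rightarrow> 'a) set"
  where "HHco_cocycles k A P m = cocycles (cochains k A P) (cochain_diff P) m"

definition HHco ::
    "('k, 'x) ring_scheme \<Rightarrow> ('k, 'a, 'y) module_scheme \<Rightarrow> ('a env, 'p, 'a) aug_complex
      \<Rightarrow> nat \<Rightarrow> ('p \<Rightarrow> 'a) set ring"
  where "HHco k A P m = cohomology (cochains k A P) (cochain_diff P) m"

definition HHco_class ::
    "('k, 'x) ring_scheme \<Rightarrow> ('k, 'a, 'y) module_scheme \<Rightarrow> ('a env, 'p, 'a) aug_complex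
      \<Rightarrow> nat \<Rightarrow> ('p \<Rightarrow> 'a) \<Rightarrow> ('p \<Rightarrow> 'a) set"
  where "HHco_class k A P m t =
    coboundaries (cochains k A P) (cochain_diff P) m +>\<^bsub>cochains k A P m\<^esub> t"

text \<open>
  The canonical identifications \<open>H\<^sub>n(A \<otimes> P) \<cong> H\<^sub>n(A \<otimes> Q)\<close> and \<open>H\<^sup>m(Hom(P, A)) \<cong> H\<^sup>m(Hom(Q, A))\<close>, induced by any
  comparison map \<open>P \<rightarrow> Q\<close>, respectively \<open>Q \<rightarrow> P\<close>. Here and below \<open>THE\<close> refers to the value
  common to all choices of representatives and of comparison maps.
\<close>

definition HH_ident ::
    "('k, 'x) ring_scheme \<Rightarrow> ('k, 'a, 'y) module_scheme
      \<Rightarrow> ('a env, 'p, 'a) aug_complex \<Rightarrow> ('a env, 'q, 'a) aug_complex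
      \<Rightarrow> nat \<Rightarrow> ('a \<times> 'p \<Rightarrow>\<^sub>0 int) set set \<Rightarrow> ('a \<times> 'q \<Rightarrow>\<^sub>0 int) set set"
  where "HH_ident k A P Q n \<xi> =
    (THE w. \<exists>\<phi> z. comparison_map (enveloping k A) P Q \<phi> \<and> z \<in> \<xi> \<and>
       w = HH_class k A Q n (chain_map k A Q n (\<phi> n) z))"

definition HHco_ident ::
    "('k, 'x) ring_scheme \<Rightarrow> ('k, 'a, 'y) module_scheme
      \<Rightarrow> ('a env, 'p, 'a) aug_complex \<Rightarrow> ('a env, 'q, 'a) aug_complex
      \<Rightarrow> nat \<Rightarrow> ('p \<Rightarrow> 'a) set \<Rightarrow> ('q \<Rightarrow> 'a) set"
  where "HHco_ident k A P Q m \<eta> =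
    (THE w. \<exists>\<psi> t. comparison_map (enveloping k A) Q P \<psi> \<and> t \<in> \<eta> \<and>
       w = HHco_class k A Q m (\<lambda>x\<in>carrier (Ch Q m). t (\<psi> m x)))"


section \<open>The two products\<close>

definition bar_cap_chain ::
    "('k, 'x) ring_scheme \<Rightarrow> ('k, 'a, 'y) module_scheme \<Rightarrow> nat \<Rightarrow> nat
      \<Rightarrow> (('a list \<Rightarrow>\<^sub>0 int) set \<Rightarrow> 'a)
      \<Rightarrow> ('a \<times> ('a list \<Rightarrow>\<^sub>0 int) set \<Rightarrow>\<^sub>0 int) set \<Rightarrow> ('a \<times> ('a list \<Rightarrow>\<^sub>0 int) set \<Rightarrow>\<^sub>0 int) set"
  where "bar_cap_chain k A n m t =
    induced (chains k A (bar k A) (n - m)) (\<lambda>(x, \<beta>).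
      induced (chains k A (bar k A) (n - m)) (\<lambda>xs.
        pure_tensor (enveloping k A) (right_regular k A) (bar_module k A (n - m))
          (x \<otimes>\<^bsub>A\<^esub> t (pure_power k A (take (m + 1) xs @ [\<one>\<^bsub>A\<^esub>])))
          (pure_power k A (\<one>\<^bsub>A\<^esub> # drop (m + 1) xs))) \<beta>)"

definition bar_cap ::
    "('k, 'x) ring_scheme \<Rightarrow> ('k, 'a, 'y) module_scheme \<Rightarrow> nat \<Rightarrow> nat
      \<Rightarrow> ('a \<times> ('a list \<Rightarrow>\<^sub>0 int) set \<Rightarrow>\<^sub>0 int) set set \<Rightarrow> (('a list \<Rightarrow>\<^sub>0 int) set \<Rightarrow> 'a) set
      \<Rightarrow> ('a \<times> ('a list \<Rightarrow>\<^sub>0 int) set \<Rightarrow>\<^sub>0 int) set set"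
  where "bar_cap k A n m \<xi> \<eta> =
    (THE w. \<exists>z\<in>\<xi>. \<exists>t\<in>\<eta>. w = HH_class k A (bar k A) (n - m) (bar_cap_chain k A n m t z))"

definition cap ::
    "('k, 'x) ring_scheme \<Rightarrow> ('k, 'a, 'y) module_scheme \<Rightarrow> ('a env, 'p, 'a) aug_complex
      \<Rightarrow> nat \<Rightarrow> nat \<Rightarrow> ('a \<times> 'p \<Rightarrow>\<^sub>0 int) set set \<Rightarrow> ('p \<Rightarrow> 'a) set \<Rightarrow> ('a \<times> 'p \<Rightarrow>\<^sub>0 int) set set"
  where "cap k A P n m \<xi> \<eta> =
    HH_ident k A (bar k A) P (n - m)
      (bar_cap k A n m (HH_ident k A P (bar k A) n \<xi>) (HHco_ident k A P (bar k A) m \<eta>))"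

definition cap_tilde ::
    "('k, 'x) ring_scheme \<Rightarrow> ('k, 'a, 'y) module_scheme \<Rightarrow> ('a env, 'p, 'a) aug_complex
      \<Rightarrow> nat \<Rightarrow> nat \<Rightarrow> ('a \<times> 'p \<Rightarrow>\<^sub>0 int) set set \<Rightarrow> ('p \<Rightarrow> 'a) set \<Rightarrow> ('a \<times> 'p \<Rightarrow>\<^sub>0 int) set set"
  where "cap_tilde k A P n m \<xi> \<eta> =
    (THE w. \<exists>z\<in>\<xi>. \<exists>t\<in>\<eta>. \<exists>\<tau>. chain_lift (enveloping k A) P m t \<tau> \<and>
       w = HH_class k A P (n - m) (chain_map k A P (n - m) (\<tau> (n - m)) z))"


section \<open>Agreement of the definitions with the defining formulas\<close>

text \<open>
  The values on generators of the maps defined through \<^const>\<open>induced\<close>, and the lifting property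
  of projective modules.
\<close>

subsection \<open>Projective modules\<close>

lemma linear_maps_closed: "\<lbrakk>f \<in> linear_maps R M N; x \<in> carrier M\<rbrakk> \<Longrightarrow> f x \<in> carrier N"
  and linear_maps_add: "\<lbrakk>f \<in> linear_maps R M N; x \<in> carrier M; y \<in> carrier M\<rbrakk>
        \<Longrightarrow> f (x \<oplus>\<^bsub>M\<^esub> y) = f x \<oplus>\<^bsub>N\<^esub> f y"
  and linear_maps_smult: "\<lbrakk>f \<in> linear_maps R M N; r \<in> carrier R; x \<in> carrier M\<rbrakk>
        \<Longrightarrow> f (r \<odot>\<^bsub>M\<^esub> x) = r \<odot>\<^bsub>N\<^esub> f x"
  by (auto simp: linear_maps_def)

context left_module begin

lemma smult_l_null: "x \<in> carrier M \<Longrightarrow> \<zero> \<odot>\<^bsub>M\<^esub> x = \<zero>\<^bsub>M\<^esub>"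
  by (metis M.add.r_cancel_one R.l_zero R.zero_closed smult_closed smult_l_distr)

lemma smult_r_null: "a \<in> carrier R \<Longrightarrow> a \<odot>\<^bsub>M\<^esub> \<zero>\<^bsub>M\<^esub> = \<zero>\<^bsub>M\<^esub>"
  by (metis M.add.r_cancel_one M.l_zero M.zero_closed smult_closed smult_r_distr)

lemma smult_finsum:
  assumes "a \<in> carrier R" "finite T" "f \<in> T \<rightarrow> carrier M"
  shows "a \<odot>\<^bsub>M\<^esub> (\<Oplus>\<^bsub>M\<^esub>i\<in>T. f i) = (\<Oplus>\<^bsub>M\<^esub>i\<in>T. a \<odot>\<^bsub>M\<^esub> f i)"
  using assms(2,3)
proof (induction T)
  case empty then show ?case using assms(1) by (simp add: smult_r_null)
next
  case (insert i T)
  then show ?case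
    using assms(1) by (simp add: smult_r_distr smult_closed Pi_iff M.finsum_closed)
qed

end

lemma projective_module_lift:
  fixes P :: "('r, 'p, 'y) module_scheme"
  assumes P: "projective_module R P" and "left_module R N" and "left_module R L"
    and g: "g \<in> linear_maps R N L" "g ` carrier N = carrier L" and f: "f \<in> linear_maps R P L"
  obtains h where "h \<in> linear_maps R P N" "\<And>x. x \<in> carrier P \<Longrightarrow> g (h x) = f x"
proof -
  interpret N: left_module R N by fact
  interpret L: left_module R L by fact
  obtain I :: "'p set" and s q where s: "s \<in> linear_maps R P (free_module R I)" and q: "q \<in> linear_maps R (free_module R I) P"
    and qs: "\<And>x. x \<in> carrier P \<Longrightarrow> q (s x) = x"
    using P unfolding projective_module_def by blast
  interpret P: left_module R P using P by (simp add: projective_module_def)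
  let ?F = "free_module R I"
  define supp where "supp c = {i \<in> I. c i \<noteq> \<zero>\<^bsub>R\<^esub>}" for c
  define e where "e i = (\<lambda>j\<in>I. if j = i then \<one>\<^bsub>R\<^esub> else \<zero>\<^bsub>R\<^esub>)" for i
  have F: "c \<in> carrier ?F \<longleftrightarrow> c \<in> I \<rightarrow>\<^sub>E carrier R \<and> finite (supp c)" for c
    by (simp add: free_module_def supp_def)
  have Fc: "c i \<in> carrier R" if "c \<in> carrier ?F" "i \<in> I" for c i
    using that F by auto
  have add: "(c \<oplus>\<^bsub>?F\<^esub> d) = (\<lambda>i\<in>I. c i \<oplus>\<^bsub>R\<^esub> d i)" for c d by (simp add: free_module_def)
  have smult: "(r \<odot>\<^bsub>?F\<^esub> c) = (\<lambda>i\<in>I. r \<otimes>\<^bsub>R\<^esub> c i)" for r c by (simp add: free_module_def)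
  have e_F: "e i \<in> carrier ?F" if "i \<in> I" for i
  proof -
    have "supp (e i) \<subseteq> {i}" by (auto simp: supp_def e_def)
    then show ?thesis using that by (auto simp: F e_def intro: finite_subset)
  qed
  have smult_F: "r \<odot>\<^bsub>?F\<^esub> c \<in> carrier ?F" if "r \<in> carrier R" "c \<in> carrier ?F" for r c
  proof -
    have "supp (r \<odot>\<^bsub>?F\<^esub> c) \<subseteq> supp c" using that by (auto simp: supp_def smult)
    then show ?thesis using that Fc unfolding F by (auto simp: smult intro: finite_subset)
  qed
  have add_F: "c \<oplus>\<^bsub>?F\<^esub> d \<in> carrier ?F" if "c \<in> carrier ?F" "d \<in> carrier ?F" for c d
  proof -
    have "supp (c \<oplus>\<^bsub>?F\<^esub> d) \<subseteq> supp c \<union> supp d" using that by (auto simp: supp_def add)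
    then show ?thesis using that Fc unfolding F
      by (auto simp: add intro!: finite_subset[of "supp (\<lambda>i\<in>I. c i \<oplus>\<^bsub>R\<^esub> d i)" "supp c \<union> supp d"])
  qed
  have fq: "f (q c) \<in> carrier L" if "c \<in> carrier ?F" for c
    using f q that by (auto simp: linear_maps_def)
  have "\<forall>i\<in>I. \<exists>y\<in>carrier N. g y = f (q (e i))"
    using fq[OF e_F] g(2) by (metis imageE)
  then obtain y where y: "\<And>i. i \<in> I \<Longrightarrow> y i \<in> carrier N" "\<And>i. i \<in> I \<Longrightarrow> g (y i) = f (q (e i))"
    by metis
  define u where "u c = (\<Oplus>\<^bsub>N\<^esub>i\<in>supp c. c i \<odot>\<^bsub>N\<^esub> y i)" for c
  have u_eq: "u c = (\<Oplus>\<^bsub>N\<^esub>i\<in>T. c i \<odot>\<^bsub>N\<^esub> y i)"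
    if "c \<in> carrier ?F" "finite T" "supp c \<subseteq> T" "T \<subseteq> I" for c T
    unfolding u_def using that Fc y
    by (intro N.M.add.finprod_mono_neutral_cong_left)
       (auto simp: supp_def N.smult_l_null N.smult_closed subset_iff)
  have u: "u \<in> linear_maps R ?F N"
    unfolding linear_maps_def
  proof (intro CollectI conjI ballI)
    show "u \<in> carrier ?F \<rightarrow> carrier N"
      unfolding u_def using Fc y by (auto simp: supp_def intro!: N.M.finsum_closed N.smult_closed)
  next
    fix c d assume cd: "c \<in> carrier ?F" "d \<in> carrier ?F"
    let ?T = "supp c \<union> supp d"
    have T: "finite ?T" "?T \<subseteq> I" using cd by (auto simp: F) (auto simp: supp_def)
    have in_T: "i \<in> I" if "i \<in> ?T" for i using T that by blast
    have "supp (c \<oplus>\<^bsub>?F\<^esub> d) \<subseteq> ?T" using cd by (auto simp: supp_def add)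
    then have "u (c \<oplus>\<^bsub>?F\<^esub> d) = (\<Oplus>\<^bsub>N\<^esub>i\<in>?T. (c \<oplus>\<^bsub>?F\<^esub> d) i \<odot>\<^bsub>N\<^esub> y i)"
      using T add_F[OF cd] by (intro u_eq)
    also have "\<dots> = (\<Oplus>\<^bsub>N\<^esub>i\<in>?T. c i \<odot>\<^bsub>N\<^esub> y i \<oplus>\<^bsub>N\<^esub> d i \<odot>\<^bsub>N\<^esub> y i)"
      by (rule N.M.finsum_cong')
         (use in_T cd Fc y in \<open>simp_all del: Un_iff add: Pi_iff add N.smult_l_distr N.smult_closed\<close>)
    also have "\<dots> = u c \<oplus>\<^bsub>N\<^esub> u d"
      using T cd in_T Fc y u_eq[of c ?T] u_eq[of d ?T]
      by (subst N.M.finsum_addf) (auto simp del: Un_iff intro!: N.smult_closed)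
    finally show "u (c \<oplus>\<^bsub>?F\<^esub> d) = u c \<oplus>\<^bsub>N\<^esub> u d" .
  next
    fix r c assume rc: "r \<in> carrier R" "c \<in> carrier ?F"
    have T: "finite (supp c)" "supp c \<subseteq> I" using rc by (auto simp: F) (auto simp: supp_def)
    have "supp (r \<odot>\<^bsub>?F\<^esub> c) \<subseteq> supp c" using rc by (auto simp: supp_def smult)
    then have "u (r \<odot>\<^bsub>?F\<^esub> c) = (\<Oplus>\<^bsub>N\<^esub>i\<in>supp c. (r \<odot>\<^bsub>?F\<^esub> c) i \<odot>\<^bsub>N\<^esub> y i)"
      using T smult_F[OF rc] by (intro u_eq)
    also have "\<dots> = (\<Oplus>\<^bsub>N\<^esub>i\<in>supp c. r \<odot>\<^bsub>N\<^esub> (c i \<odot>\<^bsub>N\<^esub> y i))"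
      by (rule N.M.finsum_cong')
         (use T rc Fc y in \<open>auto simp: subset_iff smult N.smult_assoc1 intro!: N.smult_closed\<close>)
    also have "\<dots> = r \<odot>\<^bsub>N\<^esub> u c"
      unfolding u_def using T rc Fc y
      by (intro N.smult_finsum[symmetric]) (auto intro!: N.smult_closed)
    finally show "u (r \<odot>\<^bsub>?F\<^esub> c) = r \<odot>\<^bsub>N\<^esub> u c" .
  qed
  have gu: "g (u c) = f (q c)" if "c \<in> carrier ?F" for c
  proof -
    have "c \<in> carrier ?F \<Longrightarrow> supp c \<subseteq> T \<Longrightarrow> g (u c) = f (q c)" if "finite T" for T
      using that
    proof (induction T arbitrary: c)
      case empty
      have zc: "\<zero>\<^bsub>R\<^esub> \<odot>\<^bsub>?F\<^esub> c = c"
      proof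
        fix j show "(\<zero>\<^bsub>R\<^esub> \<odot>\<^bsub>?F\<^esub> c) j = c j"
        proof (cases "j \<in> I")
          case True then show ?thesis using empty(2) Fc[OF empty(1)] by (auto simp: smult supp_def)
        next
          case False
          then have "c j = undefined" using empty(1) unfolding F by (blast intro: PiE_arb)
          then show ?thesis using False by (simp add: smult)
        qed
      qed
      note uc = linear_maps_closed[OF u empty(1)] and qc = linear_maps_closed[OF q empty(1)]
      have "g (u (\<zero>\<^bsub>R\<^esub> \<odot>\<^bsub>?F\<^esub> c)) = \<zero>\<^bsub>L\<^esub>"
        unfolding linear_maps_smult[OF u N.R.zero_closed empty(1)] linear_maps_smult[OF g(1) N.R.zero_closed uc]
        by (rule L.smult_l_null[OF linear_maps_closed[OF g(1) uc]])
      moreover have "f (q (\<zero>\<^bsub>R\<^esub> \<odot>\<^bsub>?F\<^esub> c)) = \<zero>\<^bsub>L\<^esub>"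
        unfolding linear_maps_smult[OF q N.R.zero_closed empty(1)] linear_maps_smult[OF f N.R.zero_closed qc]
        by (rule L.smult_l_null[OF linear_maps_closed[OF f qc]])
      ultimately have "g (u c) = f (q c)" by (simp add: zc)
      then show ?case by simp
    next
      case (insert i T)
      show ?case
      proof (cases "i \<in> I")
        case False
        then show ?thesis using insert by (auto simp: supp_def)
      next
        case True
        define d where "d = (\<lambda>j\<in>I. if j = i then \<zero>\<^bsub>R\<^esub> else c j)"
        have ds: "supp d \<subseteq> T" "supp d \<subseteq> supp c" using insert.prems by (auto simp: supp_def d_def)
        have d: "d \<in> carrier ?F"
        proof -
          have "finite (supp d)" using ds(2) insert.prems(1) by (auto simp: F intro: finite_subset)
          moreover have "d \<in> I \<rightarrow>\<^sub>E carrier R" using Fc[OF insert.prems(1)] by (auto simp: d_def)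
          ultimately show ?thesis by (simp add: F)
        qed
        have ci: "c i \<in> carrier R" using insert.prems True Fc by auto
        let ?b = "c i \<odot>\<^bsub>?F\<^esub> e i"
        have b: "?b \<in> carrier ?F" using smult_F[OF ci e_F[OF True]] .
        have c: "c = d \<oplus>\<^bsub>?F\<^esub> ?b"
        proof
          fix j show "c j = (d \<oplus>\<^bsub>?F\<^esub> ?b) j"
          proof (cases "j \<in> I")
            case True then show ?thesis
              using ci Fc[OF insert.prems(1)] by (simp add: add smult d_def e_def)
          next
            case False
            then have "c j = undefined" using insert.prems(1) unfolding F by (blast intro: PiE_arb)
            then show ?thesis using False by (simp add: add)
          qed
        qed
        have ue: "u (e i) = y i"
        proof -
          have "u (e i) = (\<Oplus>\<^bsub>N\<^esub>j\<in>{i}. e i j \<odot>\<^bsub>N\<^esub> y j)"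
            by (rule u_eq) (use True e_F in \<open>auto simp: supp_def e_def\<close>)
          then show ?thesis using True y by (simp add: e_def N.smult_one N.smult_closed)
        qed
        have "g (u c) = g (u (d \<oplus>\<^bsub>?F\<^esub> ?b))" using c by simp
        also have "\<dots> = g (u d) \<oplus>\<^bsub>L\<^esub> c i \<odot>\<^bsub>L\<^esub> g (u (e i))"
          using d b ci e_F[OF True]
          by (simp add: linear_maps_add[OF u] linear_maps_smult[OF u] linear_maps_closed[OF u]
              linear_maps_add[OF g(1)] linear_maps_smult[OF g(1)] N.smult_closed)
        also have "\<dots> = f (q d) \<oplus>\<^bsub>L\<^esub> c i \<odot>\<^bsub>L\<^esub> f (q (e i))"
          using insert.IH[OF d ds(1)] ue y True by simp
        also have "\<dots> = f (q (d \<oplus>\<^bsub>?F\<^esub> ?b))"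
          using d b ci e_F[OF True]
          by (simp add: linear_maps_add[OF q] linear_maps_smult[OF q] linear_maps_closed[OF q]
              linear_maps_add[OF f] linear_maps_smult[OF f] P.smult_closed)
        also have "\<dots> = f (q c)" using c by simp
        finally show ?thesis .
      qed
    qed
    then show ?thesis using that F by blast
  qed
  show ?thesis
  proof
    show "(\<lambda>x. u (s x)) \<in> linear_maps R P N"
      using u s by (auto simp: linear_maps_def Pi_iff)
    show "g (u (s x)) = f x" if "x \<in> carrier P" for x
    proof -
      have "s x \<in> carrier ?F" using s that by (auto simp: linear_maps_def)
      then show ?thesis using gu qs[OF that] by simp
    qed
  qed
qed

subsection \<open>Presented groups and tensor products\<close>

lemma abelian_group_additive_group:
  assumes "comm_group G" shows "abelian_group (additive_group G)"
proof -
  interpret comm_group G by fact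
  have "comm_group (add_monoid (additive_group G))"
    unfolding additive_group_def
    by (rule comm_groupI) (auto simp: m_assoc intro: m_comm l_inv_ex)
  then show ?thesis
    by (intro abelian_group.intro abelian_group_axioms.intro abelian_monoid.intro)
       (auto simp: comm_group_def)
qed

lemma subgroup_relations_span:
  assumes "Rel \<subseteq> carrier (free_Abelian_group S)"
  shows "subgroup (relations_span S Rel) (free_Abelian_group S)"
  unfolding relations_span_def using group.generate_is_subgroup[OF group_free_Abelian_group assms] .

lemma abelian_group_presented_group:
  assumes "Rel \<subseteq> carrier (free_Abelian_group S)"
  shows "abelian_group (presented_group S Rel)"
proof -
  interpret F: comm_group "free_Abelian_group S" by (rule abelian_free_Abelian_group)
  show ?thesis
    unfolding presented_group_def
    by (intro abelian_group_additive_group F.abelian_FactGroup subgroup_relations_span assms)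
qed

lemma linear_extension_hom:
  assumes "abelian_group G" and f: "f \<in> S \<rightarrow> carrier G"
  shows "linear_extension G f \<in> hom (free_Abelian_group S) (add_monoid G)"
proof -
  interpret abelian_group G by fact
  have closed: "[n] \<cdot>\<^bsub>G\<^esub> f x \<in> carrier G" if "x \<in> S" for x and n :: int
    using that f by (auto intro: add.int_pow_closed)
  have ext: "linear_extension G f c = (\<Oplus>\<^bsub>G\<^esub>x\<in>T. [Poly_Mapping.lookup c x] \<cdot>\<^bsub>G\<^esub> f x)"
    if "finite T" "Poly_Mapping.keys c \<subseteq> T" "T \<subseteq> S" for c T
    unfolding linear_extension_def
    using that closed
    by (intro add.finprod_mono_neutral_cong_left)
       (auto simp: in_keys_iff add_pow_def)
  show ?thesis
  proof (rule homI)
    fix c assume "c \<in> carrier (free_Abelian_group S)"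
    then show "linear_extension G f c \<in> carrier (add_monoid G)"
      unfolding linear_extension_def using closed by (auto intro!: finsum_closed)
  next
    fix c d assume cd: "c \<in> carrier (free_Abelian_group S)" "d \<in> carrier (free_Abelian_group S)"
    let ?T = "Poly_Mapping.keys c \<union> Poly_Mapping.keys d"
    have T: "finite ?T" "?T \<subseteq> S" using cd by auto
    have "linear_extension G f (c + d) = (\<Oplus>\<^bsub>G\<^esub>x\<in>?T. [Poly_Mapping.lookup (c + d) x] \<cdot>\<^bsub>G\<^esub> f x)"
      by (rule ext) (use T keys_add[of c d] in auto)
    also have "\<dots> = (\<Oplus>\<^bsub>G\<^esub>x\<in>?T. [Poly_Mapping.lookup c x] \<cdot>\<^bsub>G\<^esub> f x \<oplus>\<^bsub>G\<^esub> [Poly_Mapping.lookup d x] \<cdot>\<^bsub>G\<^esub> f x)"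
    proof (rule finsum_cong')
      fix x assume "x \<in> ?T"
      then have "f x \<in> carrier G" using T f by auto
      then show "[Poly_Mapping.lookup (c + d) x] \<cdot>\<^bsub>G\<^esub> f x =
          [Poly_Mapping.lookup c x] \<cdot>\<^bsub>G\<^esub> f x \<oplus>\<^bsub>G\<^esub> [Poly_Mapping.lookup d x] \<cdot>\<^bsub>G\<^esub> f x"
        by (metis add.int_pow_mult lookup_add)
    qed (use T closed in auto)
    also have "\<dots> = linear_extension G f c \<oplus>\<^bsub>G\<^esub> linear_extension G f d"
      using T closed ext[of ?T c] ext[of ?T d] by (subst finsum_addf) auto
    finally show "linear_extension G f (c \<otimes>\<^bsub>free_Abelian_group S\<^esub> d) =
        linear_extension G f c \<otimes>\<^bsub>add_monoid G\<^esub> linear_extension G f d"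
      by simp
  qed
qed

lemma linear_extension_frag_of:
  assumes "abelian_group G" and "f x \<in> carrier G"
  shows "linear_extension G f (frag_of x) = f x"
proof -
  interpret abelian_group G by fact
  show ?thesis using assms(2) by (simp add: linear_extension_def add.int_pow_1)
qed

lemma induced_coset:
  assumes "abelian_group G" and f: "f \<in> S \<rightarrow> carrier G"
    and Rel: "Rel \<subseteq> carrier (free_Abelian_group S)"
    and kill: "\<And>r. r \<in> Rel \<Longrightarrow> linear_extension G f r = \<zero>\<^bsub>G\<^esub>"
    and c: "c \<in> carrier (free_Abelian_group S)"
  shows "induced G f (relations_span S Rel #>\<^bsub>free_Abelian_group S\<^esub> c) = linear_extension G f c"
proof -
  interpret G: abelian_group G by fact
  interpret h: group_hom "free_Abelian_group S" "add_monoid G" "linear_extension G f"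
    using linear_extension_hom[OF assms(1) f] G.a_group
    by (auto simp: group_hom_def group_hom_axioms_def)
  have sub: "relations_span S Rel \<subseteq> kernel (free_Abelian_group S) (add_monoid G) (linear_extension G f)"
    unfolding relations_span_def
    by (rule h.G.generate_subgroup_incl[OF _ h.subgroup_kernel])
       (use Rel kill in \<open>force simp: kernel_def\<close>)
  have "linear_extension G f ` (relations_span S Rel #>\<^bsub>free_Abelian_group S\<^esub> c) = {linear_extension G f c}"
  proof -
    have "linear_extension G f (r \<otimes>\<^bsub>free_Abelian_group S\<^esub> c) = linear_extension G f c"
      if "r \<in> relations_span S Rel" for r
    proof -
      have r: "r \<in> carrier (free_Abelian_group S)" "linear_extension G f r = \<zero>\<^bsub>G\<^esub>"
        using sub that by (auto simp: kernel_def)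
      have "linear_extension G f (r \<otimes>\<^bsub>free_Abelian_group S\<^esub> c) =
          linear_extension G f r \<oplus>\<^bsub>G\<^esub> linear_extension G f c"
        using h.hom_mult[OF r(1) c] by simp
      then show ?thesis using r h.hom_closed[OF c] by simp
    qed
    moreover have "0 \<in> relations_span S Rel"
      using subgroup.one_closed[OF subgroup_relations_span[OF Rel]] by simp
    ultimately show ?thesis unfolding r_coset_def by fastforce
  qed
  then show ?thesis by (simp add: induced_def)
qed

lemma induced_generator:
  assumes "abelian_group G" "f \<in> S \<rightarrow> carrier G" "Rel \<subseteq> carrier (free_Abelian_group S)"
    and "\<And>r. r \<in> Rel \<Longrightarrow> linear_extension G f r = \<zero>\<^bsub>G\<^esub>" and "x \<in> S"
  shows "induced G f (generator S Rel x) = f x"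
  unfolding generator_def
  by (subst induced_coset[OF assms(1-4)])
     (use assms in \<open>auto intro!: linear_extension_frag_of\<close>)

lemma induced_add:
  assumes "abelian_group G" "f \<in> S \<rightarrow> carrier G" and Rel: "Rel \<subseteq> carrier (free_Abelian_group S)"
    and "\<And>r. r \<in> Rel \<Longrightarrow> linear_extension G f r = \<zero>\<^bsub>G\<^esub>"
  shows "induced G f \<in> hom (add_monoid (presented_group S Rel)) (add_monoid G)"
proof (rule homI)
  note coset = induced_coset[OF assms]
  note lin = linear_extension_hom[OF assms(1,2)]
  interpret F: comm_group "free_Abelian_group S" by (rule abelian_free_Abelian_group)
  interpret N: normal "relations_span S Rel" "free_Abelian_group S"
    by (rule F.subgroup_imp_normal[OF subgroup_relations_span[OF Rel]])
  have car: "\<exists>c \<in> carrier (free_Abelian_group S). X = relations_span S Rel #>\<^bsub>free_Abelian_group S\<^esub> c"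
    if "X \<in> carrier (add_monoid (presented_group S Rel))" for X
    using that by (auto simp: presented_group_def additive_group_def FactGroup_def RCOSETS_def)
  show "induced G f X \<in> carrier (add_monoid G)" if "X \<in> carrier (add_monoid (presented_group S Rel))" for X
    using car[OF that] coset hom_in_carrier[OF lin] by auto
  show "induced G f (X \<otimes>\<^bsub>add_monoid (presented_group S Rel)\<^esub> Y) =
      induced G f X \<otimes>\<^bsub>add_monoid G\<^esub> induced G f Y"
    if XY: "X \<in> carrier (add_monoid (presented_group S Rel))" "Y \<in> carrier (add_monoid (presented_group S Rel))"
    for X Y
  proof -
    obtain c d where c: "c \<in> carrier (free_Abelian_group S)" "X = relations_span S Rel #>\<^bsub>free_Abelian_group S\<^esub> c"
      and d: "d \<in> carrier (free_Abelian_group S)" "Y = relations_span S Rel #>\<^bsub>free_Abelian_group S\<^esub> d"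
      using car XY by meson
    have "X \<otimes>\<^bsub>add_monoid (presented_group S Rel)\<^esub> Y =
        relations_span S Rel #>\<^bsub>free_Abelian_group S\<^esub> (c \<otimes>\<^bsub>free_Abelian_group S\<^esub> d)"
      using c d N.rcos_sum by (simp add: presented_group_def additive_group_def FactGroup_def)
    then show ?thesis
      using c d coset hom_mult[OF lin] F.m_closed by metis
  qed
qed

lemma linear_extension_diff:
  assumes "abelian_group G" "f \<in> S \<rightarrow> carrier G"
    and "c \<in> carrier (free_Abelian_group S)" "d \<in> carrier (free_Abelian_group S)"
  shows "linear_extension G f (c - d) = linear_extension G f c \<ominus>\<^bsub>G\<^esub> linear_extension G f d"
proof -
  interpret G: abelian_group G by fact
  interpret h: group_hom "free_Abelian_group S" "add_monoid G" "linear_extension G f"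
    using linear_extension_hom[OF assms(1,2)] G.a_group
    by (auto simp: group_hom_def group_hom_axioms_def)
  have "linear_extension G f (c \<otimes>\<^bsub>free_Abelian_group S\<^esub> inv\<^bsub>free_Abelian_group S\<^esub> d) =
      linear_extension G f c \<otimes>\<^bsub>add_monoid G\<^esub> inv\<^bsub>add_monoid G\<^esub> linear_extension G f d"
    using assms(3,4) by (metis h.hom_mult h.hom_inv h.G.inv_closed)
  then show ?thesis
    using assms(4) by (simp add: a_minus_def a_inv_def)
qed

lemma generator_closed:
  assumes "x \<in> S"
  shows "generator S Rel x \<in> carrier (presented_group S Rel)"
  using assms
  by (auto simp: generator_def presented_group_def additive_group_def FactGroup_def RCOSETS_def)

lemma generator_relation_sum:
  assumes Rel: "Rel \<subseteq> carrier (free_Abelian_group S)" and S: "x \<in> S" "y \<in> S" "z \<in> S"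
    and r: "frag_of x - frag_of y - frag_of z \<in> Rel"
  shows "generator S Rel x = generator S Rel y \<oplus>\<^bsub>presented_group S Rel\<^esub> generator S Rel z"
proof -
  interpret F: comm_group "free_Abelian_group S" by (rule abelian_free_Abelian_group)
  interpret N: normal "relations_span S Rel" "free_Abelian_group S"
    by (rule F.subgroup_imp_normal[OF subgroup_relations_span[OF Rel]])
  have yz: "frag_of y + frag_of z \<in> carrier (free_Abelian_group S)"
    using S F.m_closed[of "frag_of y" "frag_of z"] by simp
  have "frag_of x - frag_of y - frag_of z \<in> relations_span S Rel"
    using r by (simp add: relations_span_def generate.incl)
  then have "frag_of x \<in> relations_span S Rel #>\<^bsub>free_Abelian_group S\<^esub> (frag_of y + frag_of z)"
    unfolding r_coset_def by (force simp: algebra_simps)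
  then have "relations_span S Rel #>\<^bsub>free_Abelian_group S\<^esub> frag_of x =
      relations_span S Rel #>\<^bsub>free_Abelian_group S\<^esub> (frag_of y + frag_of z)"
    using F.repr_independence[OF _ yz N.subgroup_axioms] by simp
  then show ?thesis
    using S N.rcos_sum[of "frag_of y" "frag_of z"]
    by (simp add: generator_def presented_group_def additive_group_def FactGroup_def)
qed

lemma generator_relation_eq:
  assumes Rel: "Rel \<subseteq> carrier (free_Abelian_group S)" and S: "x \<in> S" "y \<in> S"
    and r: "frag_of x - frag_of y \<in> Rel"
  shows "generator S Rel x = generator S Rel y"
proof -
  interpret F: comm_group "free_Abelian_group S" by (rule abelian_free_Abelian_group)
  have "frag_of x - frag_of y \<in> relations_span S Rel"
    using r by (simp add: relations_span_def generate.incl)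
  then have "frag_of x \<in> relations_span S Rel #>\<^bsub>free_Abelian_group S\<^esub> frag_of y"
    unfolding r_coset_def by (force simp: algebra_simps)
  then show ?thesis
    using F.repr_independence[OF _ _ subgroup_relations_span[OF Rel]] S
    by (simp add: generator_def)
qed

locale balanced_pair = left_module R Y + N: abelian_group N
  for R :: "('r, 'x) ring_scheme" (structure) and Y :: "('r, 'm, 'y) module_scheme" (structure)
    and N :: "('r, 'n, 'z) module_scheme" (structure) +
  assumes N_smult_closed: "\<lbrakk>r \<in> carrier R; x \<in> carrier N\<rbrakk> \<Longrightarrow> r \<odot>\<^bsub>N\<^esub> x \<in> carrier N"
begin

lemma tensor_relations_closed:
  "tensor_relations R N Y \<subseteq> carrier (free_Abelian_group (carrier N \<times> carrier Y))"
proof -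
  interpret F: comm_group "free_Abelian_group (carrier N \<times> carrier Y)"
    by (rule abelian_free_Abelian_group)
  have diff: "c - d \<in> carrier (free_Abelian_group (carrier N \<times> carrier Y))"
    if "c \<in> carrier (free_Abelian_group (carrier N \<times> carrier Y))"
       "d \<in> carrier (free_Abelian_group (carrier N \<times> carrier Y))" for c d
    using that keys_diff[of c d] by auto
  show ?thesis
    unfolding tensor_relations_def
    by (auto simp del: carrier_free_Abelian_group_iff intro!: diff
        simp: frag_of_in_free_Abelian_group N_smult_closed smult_closed)
qed

lemma abelian_group_tensor: "abelian_group (tensor R N Y)"
  unfolding tensor_def by (rule abelian_group_presented_group[OF tensor_relations_closed])

lemma pure_tensor_closed:
  "\<lbrakk>x \<in> carrier N; y \<in> carrier Y\<rbrakk> \<Longrightarrow> pure_tensor R N Y x y \<in> carrier (tensor R N Y)"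
  unfolding tensor_def pure_tensor_def by (rule generator_closed) simp

lemma pure_tensor_add_left:
  assumes "x \<in> carrier N" "x' \<in> carrier N" "y \<in> carrier Y"
  shows "pure_tensor R N Y (x \<oplus>\<^bsub>N\<^esub> x') y =
    pure_tensor R N Y x y \<oplus>\<^bsub>tensor R N Y\<^esub> pure_tensor R N Y x' y"
  unfolding tensor_def pure_tensor_def
  by (rule generator_relation_sum[OF tensor_relations_closed])
     (use assms in \<open>auto simp: tensor_relations_def\<close>)

lemma pure_tensor_add_right:
  assumes "x \<in> carrier N" "y \<in> carrier Y" "y' \<in> carrier Y"
  shows "pure_tensor R N Y x (y \<oplus>\<^bsub>Y\<^esub> y') =
    pure_tensor R N Y x y \<oplus>\<^bsub>tensor R N Y\<^esub> pure_tensor R N Y x y'"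
  unfolding tensor_def pure_tensor_def
  by (rule generator_relation_sum[OF tensor_relations_closed])
     (use assms in \<open>auto simp: tensor_relations_def\<close>)

lemma pure_tensor_balanced:
  assumes "r \<in> carrier R" "x \<in> carrier N" "y \<in> carrier Y"
  shows "pure_tensor R N Y (r \<odot>\<^bsub>N\<^esub> x) y = pure_tensor R N Y x (r \<odot>\<^bsub>Y\<^esub> y)"
  unfolding pure_tensor_def
  by (rule generator_relation_eq[OF tensor_relations_closed])
     (use assms N_smult_closed smult_closed in \<open>auto simp: tensor_relations_def\<close>)

lemma induced_balanced:
  assumes G: "abelian_group G" and f: "\<And>x y. \<lbrakk>x \<in> carrier N; y \<in> carrier Y\<rbrakk> \<Longrightarrow> f x y \<in> carrier G"
    and addl: "\<And>x x' y. \<lbrakk>x \<in> carrier N; x' \<in> carrier N; y \<in> carrier Y\<rbrakk> \<Longrightarrow>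
      f (x \<oplus>\<^bsub>N\<^esub> x') y = f x y \<oplus>\<^bsub>G\<^esub> f x' y"
    and addr: "\<And>x y y'. \<lbrakk>x \<in> carrier N; y \<in> carrier Y; y' \<in> carrier Y\<rbrakk> \<Longrightarrow>
      f x (y \<oplus>\<^bsub>Y\<^esub> y') = f x y \<oplus>\<^bsub>G\<^esub> f x y'"
    and bal: "\<And>r x y. \<lbrakk>r \<in> carrier R; x \<in> carrier N; y \<in> carrier Y\<rbrakk> \<Longrightarrow>
      f (r \<odot>\<^bsub>N\<^esub> x) y = f x (r \<odot>\<^bsub>Y\<^esub> y)"
  shows "induced G (\<lambda>(x, y). f x y) \<in> hom (add_monoid (tensor R N Y)) (add_monoid G)"
    and "\<lbrakk>x \<in> carrier N; y \<in> carrier Y\<rbrakk> \<Longrightarrow>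
      induced G (\<lambda>(x, y). f x y) (pure_tensor R N Y x y) = f x y"
proof -
  interpret G: abelian_group G by fact
  let ?S = "carrier N \<times> carrier Y" and ?f = "\<lambda>(x, y). f x y"
  interpret F: comm_group "free_Abelian_group ?S" by (rule abelian_free_Abelian_group)
  have fS: "?f \<in> ?S \<rightarrow> carrier G" using f by auto
  have diff2: "linear_extension G ?f (frag_of a - frag_of b) = ?f a \<ominus>\<^bsub>G\<^esub> ?f b"
    if "a \<in> ?S" "b \<in> ?S" for a b
  proof -
    have "?f a \<in> carrier G" "?f b \<in> carrier G" using that fS by blast+
    then show ?thesis
      using that linear_extension_diff[OF G fS, of "frag_of a" "frag_of b"]
      by (simp add: linear_extension_frag_of[OF G])
  qed
  have diff3: "linear_extension G ?f (frag_of a - frag_of b - frag_of c) = ?f a \<ominus>\<^bsub>G\<^esub> ?f b \<ominus>\<^bsub>G\<^esub> ?f c"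
    if "a \<in> ?S" "b \<in> ?S" "c \<in> ?S" for a b c
  proof -
    have "frag_of a - frag_of b \<in> carrier (free_Abelian_group ?S)"
      using that keys_diff[of "frag_of a" "frag_of b"] by auto
    then have "linear_extension G ?f (frag_of a - frag_of b - frag_of c) =
        linear_extension G ?f (frag_of a - frag_of b) \<ominus>\<^bsub>G\<^esub> linear_extension G ?f (frag_of c)"
      using that(3) by (intro linear_extension_diff[OF G fS]) auto
    moreover have "linear_extension G ?f (frag_of c) = ?f c"
      by (rule linear_extension_frag_of[OF G]) (use that fS in blast)
    ultimately show ?thesis using diff2[OF that(1,2)] by simp
  qed
  have cancel: "(u \<oplus>\<^bsub>G\<^esub> v) \<ominus>\<^bsub>G\<^esub> u \<ominus>\<^bsub>G\<^esub> v = \<zero>\<^bsub>G\<^esub>" if "u \<in> carrier G" "v \<in> carrier G" for u v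
    using that by (metis G.a_comm G.a_inv_closed G.add.m_assoc G.add.m_closed G.minus_eq G.r_neg G.r_zero)
  have kill: "linear_extension G ?f r = \<zero>\<^bsub>G\<^esub>" if "r \<in> tensor_relations R N Y" for r
    using that unfolding tensor_relations_def
  proof (elim UnE CollectE exE conjE)
    fix x x' y assume "r = frag_of (x \<oplus>\<^bsub>N\<^esub> x', y) - frag_of (x, y) - frag_of (x', y)"
      "x \<in> carrier N" "x' \<in> carrier N" "y \<in> carrier Y"
    then show ?thesis using diff3 addl cancel f by simp
  next
    fix x y y' assume "r = frag_of (x, y \<oplus>\<^bsub>Y\<^esub> y') - frag_of (x, y) - frag_of (x, y')"
      "x \<in> carrier N" "y \<in> carrier Y" "y' \<in> carrier Y"
    then show ?thesis using diff3 addr cancel f by simp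
  next
    fix s x y assume "r = frag_of (s \<odot>\<^bsub>N\<^esub> x, y) - frag_of (x, s \<odot>\<^bsub>Y\<^esub> y)"
      "s \<in> carrier R" "x \<in> carrier N" "y \<in> carrier Y"
    then show ?thesis using diff2 bal f smult_closed N_smult_closed
      by (simp add: G.minus_eq G.r_neg)
  qed
  show "induced G ?f \<in> hom (add_monoid (tensor R N Y)) (add_monoid G)"
    unfolding tensor_def by (rule induced_add[OF G fS tensor_relations_closed kill])
  show "induced G ?f (pure_tensor R N Y x y) = f x y" if "x \<in> carrier N" "y \<in> carrier Y"
    unfolding pure_tensor_def
    using induced_generator[OF G fS tensor_relations_closed kill, of "(x, y)"] that by simp
qed

end

lemma tensor_map_pure_tensor:
  assumes "balanced_pair R Y N" "balanced_pair R Y' N" and f: "f \<in> linear_maps R Y Y'"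
    and "x \<in> carrier N" "y \<in> carrier Y"
  shows "tensor_map R N Y' f (pure_tensor R N Y x y) = pure_tensor R N Y' x (f y)"
proof -
  interpret Y: balanced_pair R Y N by fact
  interpret Y': balanced_pair R Y' N by fact
  have fc: "f u \<in> carrier Y'" if "u \<in> carrier Y" for u
    using f that by (auto simp: linear_maps_def)
  show ?thesis
    unfolding tensor_map_def
    by (rule Y.induced_balanced(2)[OF Y'.abelian_group_tensor])
       (use assms fc in \<open>auto simp: linear_maps_def Y'.pure_tensor_closed Y'.pure_tensor_add_left
          Y'.pure_tensor_add_right Y'.pure_tensor_balanced\<close>)
qed

lemma power_relations_closed:
  fixes A (structure)
  assumes "abelian_group A" and sm: "\<And>r x. r \<in> carrier k \<Longrightarrow> x \<in> carrier A \<Longrightarrow> r \<odot> x \<in> carrier A"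
  shows "power_relations k A N \<subseteq> carrier (free_Abelian_group (tuples A N))"
proof -
  interpret A: abelian_group A by fact
  have diff: "c - d \<in> carrier (free_Abelian_group (tuples A N))"
    if "c \<in> carrier (free_Abelian_group (tuples A N))"
       "d \<in> carrier (free_Abelian_group (tuples A N))" for c d
    using that keys_diff[of c d] by auto
  have upd: "xs[i := a] \<in> tuples A N" if "xs \<in> tuples A N" "a \<in> carrier A" for xs i a
    using that set_update_subset_insert[of xs i a] by (auto simp: tuples_def)
  have nth: "xs ! i \<in> carrier A" if "xs \<in> tuples A N" "i < N" for xs i
    using that by (auto simp: tuples_def)
  show ?thesis
    unfolding power_relations_def
    by (auto simp del: carrier_free_Abelian_group_iff intro!: diff upd sm nth
        simp: frag_of_in_free_Abelian_group)
qed

lemma induced_multilinear: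
  fixes A (structure)
  assumes A: "abelian_group A" and sm: "\<And>r x. r \<in> carrier k \<Longrightarrow> x \<in> carrier A \<Longrightarrow> r \<odot> x \<in> carrier A"
    and G: "abelian_group G" and f: "f \<in> tuples A N \<rightarrow> carrier G"
    and add: "\<And>xs i a b. \<lbrakk>xs \<in> tuples A N; i < N; a \<in> carrier A; b \<in> carrier A\<rbrakk> \<Longrightarrow>
      f (xs[i := a \<oplus> b]) = f (xs[i := a]) \<oplus>\<^bsub>G\<^esub> f (xs[i := b])"
    and bal: "\<And>xs i j r. \<lbrakk>xs \<in> tuples A N; i < N; j < N; r \<in> carrier k\<rbrakk> \<Longrightarrow>
      f (xs[i := r \<odot> xs ! i]) = f (xs[j := r \<odot> xs ! j])"
  shows "induced G f \<in> hom (add_monoid (tensor_power k A N)) (add_monoid G)"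
    and "xs \<in> tuples A N \<Longrightarrow> induced G f (pure_power k A xs) = f xs"
proof -
  interpret A: abelian_group A by fact
  interpret G: abelian_group G by fact
  let ?S = "tuples A N"
  interpret F: comm_group "free_Abelian_group ?S" by (rule abelian_free_Abelian_group)
  have upd: "xs[i := a] \<in> tuples A N" if "xs \<in> tuples A N" "a \<in> carrier A" for xs i a
    using that set_update_subset_insert[of xs i a] by (auto simp: tuples_def)
  have nth: "xs ! i \<in> carrier A" if "xs \<in> tuples A N" "i < N" for xs i
    using that by (auto simp: tuples_def)
  have diff2: "linear_extension G f (frag_of a - frag_of b) = f a \<ominus>\<^bsub>G\<^esub> f b"
    if "a \<in> ?S" "b \<in> ?S" for a b
  proof -
    have "f a \<in> carrier G" "f b \<in> carrier G" using that f by auto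
    then show ?thesis
      using that linear_extension_diff[OF G f, of "frag_of a" "frag_of b"]
      by (simp add: linear_extension_frag_of[OF G])
  qed
  have diff3: "linear_extension G f (frag_of a - frag_of b - frag_of c) = f a \<ominus>\<^bsub>G\<^esub> f b \<ominus>\<^bsub>G\<^esub> f c"
    if "a \<in> ?S" "b \<in> ?S" "c \<in> ?S" for a b c
  proof -
    have "frag_of a - frag_of b \<in> carrier (free_Abelian_group ?S)"
      using that keys_diff[of "frag_of a" "frag_of b"] by auto
    then have "linear_extension G f (frag_of a - frag_of b - frag_of c) =
        linear_extension G f (frag_of a - frag_of b) \<ominus>\<^bsub>G\<^esub> linear_extension G f (frag_of c)"
      using that(3) by (intro linear_extension_diff[OF G f]) auto
    moreover have "linear_extension G f (frag_of c) = f c"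
      by (rule linear_extension_frag_of[OF G]) (use that f in blast)
    ultimately show ?thesis using diff2[OF that(1,2)] by simp
  qed
  have cancel: "(u \<oplus>\<^bsub>G\<^esub> v) \<ominus>\<^bsub>G\<^esub> u \<ominus>\<^bsub>G\<^esub> v = \<zero>\<^bsub>G\<^esub>" if "u \<in> carrier G" "v \<in> carrier G" for u v
    using that by (metis G.a_comm G.a_inv_closed G.add.m_assoc G.add.m_closed G.minus_eq G.r_neg G.r_zero)
  have fc: "f xs \<in> carrier G" if "xs \<in> ?S" for xs using f that by auto
  have kill: "linear_extension G f r = \<zero>\<^bsub>G\<^esub>" if "r \<in> power_relations k A N" for r
    using that unfolding power_relations_def
  proof (elim UnE CollectE exE conjE)
    fix xs i a b assume *: "r = frag_of (xs[i := a \<oplus> b]) - frag_of (xs[i := a]) - frag_of (xs[i := b])"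
      "xs \<in> ?S" "i < N" "a \<in> carrier A" "b \<in> carrier A"
    show ?thesis
    proof -
      have in_S: "xs[i := a \<oplus> b] \<in> ?S" "xs[i := a] \<in> ?S" "xs[i := b] \<in> ?S"
        using * upd by auto
      show ?thesis
        unfolding *(1) diff3[OF in_S] add[OF *(2-5)] using cancel fc[OF in_S(2)] fc[OF in_S(3)] by simp
    qed
  next
    fix xs i j s assume *: "r = frag_of (xs[i := s \<odot> xs ! i]) - frag_of (xs[j := s \<odot> xs ! j])"
      "xs \<in> ?S" "i < N" "j < N" "s \<in> carrier k"
    show ?thesis
    proof -
      have in_S: "xs[i := s \<odot> xs ! i] \<in> ?S" "xs[j := s \<odot> xs ! j] \<in> ?S"
        using * upd sm nth by blast+
      show ?thesis
        unfolding *(1) diff2[OF in_S] bal[OF *(2-5)] using fc[OF in_S(2)]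
        by (simp add: G.minus_eq G.r_neg)
    qed
  qed
  show "induced G f \<in> hom (add_monoid (tensor_power k A N)) (add_monoid G)"
    unfolding tensor_power_def by (rule induced_add[OF G f power_relations_closed[OF A sm] kill])
  show "induced G f (pure_power k A xs) = f xs" if "xs \<in> tuples A N"
    unfolding pure_power_def
    using induced_generator[OF G f power_relations_closed[OF A sm] kill, where x = xs] that
    by (simp add: tuples_def)
qed

subsection \<open>The enveloping algebra and the bar complex\<close>

context assoc_algebra begin

lemma balanced_pair_self: "balanced_pair k A A"
  by (intro balanced_pair.intro left_module.intro left_module_axioms.intro balanced_pair_axioms.intro)
     (auto simp: smult_l_distr smult_r_distr smult_assoc1 intro: R.ring_axioms M.abelian_group_axioms)

sublocale B: balanced_pair k A A by (rule balanced_pair_self)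

lemma pure_tensor_mult:
  assumes "a \<in> carrier A" "b \<in> carrier A" "a' \<in> carrier A" "b' \<in> carrier A"
  shows "pure_tensor k A A a b \<otimes>\<^bsub>enveloping k A\<^esub> pure_tensor k A A a' b' =
    pure_tensor k A A (a \<otimes>\<^bsub>A\<^esub> a') (b' \<otimes>\<^bsub>A\<^esub> b)"
proof -
  let ?T = "tensor k A A" and ?p = "pure_tensor k A A"
  have inner: "induced ?T (\<lambda>(a', b'). ?p (x \<otimes>\<^bsub>A\<^esub> a') (b' \<otimes>\<^bsub>A\<^esub> y)) (?p a' b') =
      ?p (x \<otimes>\<^bsub>A\<^esub> a') (b' \<otimes>\<^bsub>A\<^esub> y)" if "x \<in> carrier A" "y \<in> carrier A" for x y
    by (rule B.induced_balanced(2)[OF B.abelian_group_tensor])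
       (use that assms in \<open>simp_all add: B.pure_tensor_closed A.r_distr A.l_distr B.pure_tensor_add_left
          B.pure_tensor_add_right smult_assoc_left smult_assoc_right B.pure_tensor_balanced\<close>)
  have "induced ?T (\<lambda>(x, y). induced ?T (\<lambda>(a', b'). ?p (x \<otimes>\<^bsub>A\<^esub> a') (b' \<otimes>\<^bsub>A\<^esub> y)) (?p a' b')) (?p a b) =
      induced ?T (\<lambda>(a', b'). ?p (a \<otimes>\<^bsub>A\<^esub> a') (b' \<otimes>\<^bsub>A\<^esub> b)) (?p a' b')"
    by (rule B.induced_balanced(2)[OF B.abelian_group_tensor])
       (use assms in \<open>simp_all add: inner B.pure_tensor_closed A.r_distr A.l_distr B.pure_tensor_add_left
          B.pure_tensor_add_right smult_assoc_left smult_assoc_right B.pure_tensor_balanced\<close>)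
  then show ?thesis using inner[of a b] assms by (simp add: enveloping_def)
qed

lemma left_regular_smult:
  assumes "a \<in> carrier A" "c \<in> carrier A" "y \<in> carrier A"
  shows "pure_tensor k A A a c \<odot>\<^bsub>left_regular k A\<^esub> y = a \<otimes>\<^bsub>A\<^esub> y \<otimes>\<^bsub>A\<^esub> c"
proof -
  have "induced A (\<lambda>(a, c). a \<otimes>\<^bsub>A\<^esub> y \<otimes>\<^bsub>A\<^esub> c) (pure_tensor k A A a c) = a \<otimes>\<^bsub>A\<^esub> y \<otimes>\<^bsub>A\<^esub> c"
    by (rule B.induced_balanced(2)[OF M.abelian_group_axioms])
       (use assms in \<open>simp_all add: A.l_distr A.r_distr smult_assoc_left smult_assoc_right\<close>)
  then show ?thesis by (simp add: left_regular_def)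
qed

lemma right_regular_smult:
  assumes "a \<in> carrier A" "c \<in> carrier A" "x \<in> carrier A"
  shows "pure_tensor k A A a c \<odot>\<^bsub>right_regular k A\<^esub> x = c \<otimes>\<^bsub>A\<^esub> x \<otimes>\<^bsub>A\<^esub> a"
proof -
  have "induced A (\<lambda>(a, c). c \<otimes>\<^bsub>A\<^esub> x \<otimes>\<^bsub>A\<^esub> a) (pure_tensor k A A a c) = c \<otimes>\<^bsub>A\<^esub> x \<otimes>\<^bsub>A\<^esub> a"
    by (rule B.induced_balanced(2)[OF M.abelian_group_axioms])
       (use assms in \<open>simp_all add: A.l_distr A.r_distr smult_assoc_left smult_assoc_right\<close>)
  then show ?thesis by (simp add: right_regular_def)
qed

end

context assoc_algebra begin

lemma abelian_group_tensor_power: "abelian_group (tensor_power k A N)"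
  unfolding tensor_power_def
  by (rule abelian_group_presented_group[OF power_relations_closed[OF M.abelian_group_axioms smult_closed]])

lemma pure_power_closed: "xs \<in> tuples A N \<Longrightarrow> pure_power k A xs \<in> carrier (tensor_power k A N)"
  unfolding tensor_power_def pure_power_def
  using generator_closed[of xs "tuples A N"] by (auto simp: tuples_def)

lemma tuples_update: "\<lbrakk>xs \<in> tuples A N; a \<in> carrier A\<rbrakk> \<Longrightarrow> xs[i := a] \<in> tuples A N"
  using set_update_subset_insert[of xs i a] by (auto simp: tuples_def)

lemma tuples_nth: "\<lbrakk>xs \<in> tuples A N; i < N\<rbrakk> \<Longrightarrow> xs ! i \<in> carrier A"
  by (auto simp: tuples_def)

lemma pure_power_add:
  assumes "xs \<in> tuples A N" "i < N" "a \<in> carrier A" "b \<in> carrier A"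
  shows "pure_power k A (xs[i := a \<oplus>\<^bsub>A\<^esub> b]) =
    pure_power k A (xs[i := a]) \<oplus>\<^bsub>tensor_power k A N\<^esub> pure_power k A (xs[i := b])"
proof -
  have len: "length xs = N" using assms(1) by (simp add: tuples_def)
  have "frag_of (xs[i := a \<oplus>\<^bsub>A\<^esub> b]) - frag_of (xs[i := a]) - frag_of (xs[i := b]) \<in> power_relations k A N"
    unfolding power_relations_def using assms by blast
  then show ?thesis
    unfolding tensor_power_def pure_power_def length_list_update len
    by (intro generator_relation_sum[OF power_relations_closed[OF M.abelian_group_axioms smult_closed]])
       (auto intro!: tuples_update assms M.a_closed)
qed

lemma pure_power_balanced:
  assumes "xs \<in> tuples A N" "i < N" "j < N" "r \<in> carrier k"
  shows "pure_power k A (xs[i := r \<odot>\<^bsub>A\<^esub> xs ! i]) = pure_power k A (xs[j := r \<odot>\<^bsub>A\<^esub> xs ! j])"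
proof -
  have len: "length xs = N" using assms(1) by (simp add: tuples_def)
  have "frag_of (xs[i := r \<odot>\<^bsub>A\<^esub> xs ! i]) - frag_of (xs[j := r \<odot>\<^bsub>A\<^esub> xs ! j]) \<in> power_relations k A N"
    unfolding power_relations_def using assms by blast
  then show ?thesis
    unfolding pure_power_def length_list_update len
    by (intro generator_relation_eq[OF power_relations_closed[OF M.abelian_group_axioms smult_closed]])
       (auto intro!: tuples_update tuples_nth assms smult_closed)
qed

text \<open>\<open>h\<close> turns a change in one slot into a linear change in one slot.\<close>

definition slotwise :: "nat \<Rightarrow> nat \<Rightarrow> ('a list \<Rightarrow> 'a list) \<Rightarrow> bool"
  where "slotwise N L h \<longleftrightarrow> h \<in> tuples A N \<rightarrow> tuples A L \<and>
    (\<forall>xs\<in>tuples A N. \<forall>i<N. \<exists>j<L. \<exists>\<phi>\<in>linear_maps k A A. \<forall>a\<in>carrier A. h (xs[i := a]) = (h xs)[j := \<phi> a])"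

lemma slotwise_multilinear:
  assumes h: "slotwise N L h" and xs: "xs \<in> tuples A N"
  shows "pure_power k A (h xs) \<in> carrier (tensor_power k A L)"
    and "\<lbrakk>i < N; a \<in> carrier A; b \<in> carrier A\<rbrakk> \<Longrightarrow> pure_power k A (h (xs[i := a \<oplus>\<^bsub>A\<^esub> b])) =
      pure_power k A (h (xs[i := a])) \<oplus>\<^bsub>tensor_power k A L\<^esub> pure_power k A (h (xs[i := b]))"
    and "\<lbrakk>i < N; j < N; r \<in> carrier k\<rbrakk> \<Longrightarrow>
      pure_power k A (h (xs[i := r \<odot>\<^bsub>A\<^esub> xs ! i])) = pure_power k A (h (xs[j := r \<odot>\<^bsub>A\<^esub> xs ! j]))"
proof -
  have hx: "h xs \<in> tuples A L" using h xs by (auto simp: slotwise_def)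
  have slotD: "\<exists>j<L. \<exists>\<phi>\<in>linear_maps k A A. \<forall>a\<in>carrier A. h (xs[i := a]) = (h xs)[j := \<phi> a]" if "i < N" for i
    using h xs that unfolding slotwise_def by blast
  show "pure_power k A (h xs) \<in> carrier (tensor_power k A L)" using hx by (rule pure_power_closed)
  show "pure_power k A (h (xs[i := a \<oplus>\<^bsub>A\<^esub> b])) =
      pure_power k A (h (xs[i := a])) \<oplus>\<^bsub>tensor_power k A L\<^esub> pure_power k A (h (xs[i := b]))"
    if iN: "i < N" and ab: "a \<in> carrier A" "b \<in> carrier A" for i a b
  proof -
    obtain j \<phi> where j: "j < L" and \<phi>: "\<phi> \<in> linear_maps k A A"
      and e0: "\<forall>a\<in>carrier A. h (xs[i := a]) = (h xs)[j := \<phi> a]"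
      using slotD[OF iN] by blast
    have e: "h (xs[i := a]) = (h xs)[j := \<phi> a]" if "a \<in> carrier A" for a
      using e0 that by blast
    show ?thesis
      unfolding e[OF ab(1)] e[OF ab(2)] e[OF M.a_closed[OF ab]] linear_maps_add[OF \<phi> ab]
      by (rule pure_power_add[OF hx j]) (use \<phi> ab in \<open>auto intro: linear_maps_closed\<close>)
  qed
  have scal: "\<exists>j<L. h (xs[i := r \<odot>\<^bsub>A\<^esub> xs ! i]) = (h xs)[j := r \<odot>\<^bsub>A\<^esub> h xs ! j]"
    if iN: "i < N" and r: "r \<in> carrier k" for i r
  proof -
    obtain j \<phi> where j: "j < L" and \<phi>: "\<phi> \<in> linear_maps k A A"
      and e0: "\<forall>a\<in>carrier A. h (xs[i := a]) = (h xs)[j := \<phi> a]"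
      using slotD[OF iN] by blast
    have e: "h (xs[i := a]) = (h xs)[j := \<phi> a]" if "a \<in> carrier A" for a
      using e0 that by blast
    have x: "xs ! i \<in> carrier A" using tuples_nth[OF xs iN] .
    have "h xs = (h xs)[j := \<phi> (xs ! i)]" using e[OF x] by simp
    moreover have "length (h xs) = L" using hx by (simp add: tuples_def)
    ultimately have "h xs ! j = \<phi> (xs ! i)" using j by (metis nth_list_update_eq)
    then show ?thesis using e[OF smult_closed[OF r x]] linear_maps_smult[OF \<phi> r x] j by auto
  qed
  show "pure_power k A (h (xs[i := r \<odot>\<^bsub>A\<^esub> xs ! i])) = pure_power k A (h (xs[j := r \<odot>\<^bsub>A\<^esub> xs ! j]))"
    if ijr: "i < N" "j < N" "r \<in> carrier k" for i j r
  proof -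
    obtain i' j' where l: "i' < L" "j' < L"
      and e1: "h (xs[i := r \<odot>\<^bsub>A\<^esub> xs ! i]) = (h xs)[i' := r \<odot>\<^bsub>A\<^esub> h xs ! i']"
      and e2: "h (xs[j := r \<odot>\<^bsub>A\<^esub> xs ! j]) = (h xs)[j' := r \<odot>\<^bsub>A\<^esub> h xs ! j']"
      using scal[OF ijr(1,3)] scal[OF ijr(2,3)] by blast
    show ?thesis unfolding e1 e2 by (rule pure_power_balanced[OF hx l ijr(3)])
  qed
qed

lemma linear_id: "(\<lambda>x. x) \<in> linear_maps k A A"
  by (simp add: linear_maps_def)

lemma linear_mult_left: "a \<in> carrier A \<Longrightarrow> (\<lambda>x. a \<otimes>\<^bsub>A\<^esub> x) \<in> linear_maps k A A"
  by (simp add: linear_maps_def A.r_distr smult_assoc_right)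

lemma linear_mult_right: "a \<in> carrier A \<Longrightarrow> (\<lambda>x. x \<otimes>\<^bsub>A\<^esub> a) \<in> linear_maps k A A"
  by (simp add: linear_maps_def A.l_distr smult_assoc_left)

lemma slotwise_contract:
  assumes "c < n + 1"
  shows "slotwise (n + 2) (n + 1) (contract A c)"
  unfolding slotwise_def
proof (intro conjI ballI allI impI funcsetI)
  fix xs assume xs: "xs \<in> tuples A (n + 2)"
  have len: "length xs = n + 2" using xs by (simp add: tuples_def)
  show "contract A c xs \<in> tuples A (n + 1)"
    using xs assms tuples_nth[OF xs]
    by (auto simp: contract_def tuples_def dest!: in_set_takeD in_set_dropD)
  fix i assume i: "i < n + 2"
  consider "i < c" | "i = c" | "i = c + 1" | "i > c + 1" by linarith
  then show "\<exists>j<n + 1. \<exists>\<phi>\<in>linear_maps k A A. \<forall>a\<in>carrier A.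
      contract A c (xs[i := a]) = (contract A c xs)[j := \<phi> a]"
  proof cases
    case 1
    have "contract A c (xs[i := a]) = (contract A c xs)[i := a]" for a
      using 1 len assms by (auto simp: contract_def take_update_swap list_update_append)
    then show ?thesis using 1 assms linear_id by (intro exI[of _ i]) auto
  next
    case 2
    have "contract A c (xs[i := a]) = (contract A c xs)[c := a \<otimes>\<^bsub>A\<^esub> xs ! (c + 1)]" for a
      using 2 len assms by (auto simp: contract_def list_update_append)
    then show ?thesis using assms linear_mult_right[of "xs ! (c + 1)"] tuples_nth[OF xs, of "c + 1"]
      by (intro exI[of _ c]) auto
  next
    case 3
    have "contract A c (xs[i := a]) = (contract A c xs)[c := xs ! c \<otimes>\<^bsub>A\<^esub> a]" for a
      using 3 len assms by (auto simp: contract_def list_update_append)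
    then show ?thesis using assms linear_mult_left[of "xs ! c"] tuples_nth[OF xs, of c]
      by (intro exI[of _ c]) auto
  next
    case 4
    have "contract A c (xs[i := a]) = (contract A c xs)[i - 1 := a]" for a
    proof (rule nth_equalityI)
      fix l assume "l < length (contract A c (xs[i := a]))"
      then show "contract A c (xs[i := a]) ! l = (contract A c xs)[i - 1 := a] ! l"
        using 4 len assms i by (auto simp: contract_def nth_append nth_list_update nth_Cons')
    qed (simp add: contract_def)
    then show ?thesis using 4 i linear_id by (intro exI[of _ "i - 1"]) auto
  qed
qed

lemma bar_diff_pure_power:
  assumes "xs \<in> tuples A (n + 2)"
  shows "bar_diff k A n (pure_power k A xs) =
    (\<Oplus>\<^bsub>tensor_power k A (n + 1)\<^esub>i\<in>{0..n}.
      [((- 1) ^ i :: int)] \<cdot>\<^bsub>tensor_power k A (n + 1)\<^esub> pure_power k A (contract A i xs))"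
proof -
  interpret G: abelian_group "tensor_power k A (n + 1)" by (rule abelian_group_tensor_power)
  have S: "slotwise (n + 2) (n + 1) (contract A c)" if "c \<le> n" for c
    using that by (intro slotwise_contract) simp
  note M1 = slotwise_multilinear(1)[OF S] and M2 = slotwise_multilinear(2)[OF S]
    and M3 = slotwise_multilinear(3)[OF S]
  show ?thesis
    unfolding bar_diff_def
  proof (rule induced_multilinear(2)[OF M.abelian_group_axioms smult_closed abelian_group_tensor_power _ _ _ assms])
    show "(\<lambda>xs. \<Oplus>\<^bsub>tensor_power k A (n + 1)\<^esub>i\<in>{0..n}.
      [((- 1) ^ i :: int)] \<cdot>\<^bsub>tensor_power k A (n + 1)\<^esub> pure_power k A (contract A i xs)) \<in>
        tuples A (n + 2) \<rightarrow> carrier (tensor_power k A (n + 1))"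
      by (intro funcsetI G.finsum_closed G.add.int_pow_closed M1) auto
  next
    fix xs i a b assume *: "xs \<in> tuples A (n + 2)" "i < n + 2" "a \<in> carrier A" "b \<in> carrier A"
    note u = tuples_update[OF *(1,3), of i] tuples_update[OF *(1,4), of i]
    have "(\<Oplus>\<^bsub>tensor_power k A (n + 1)\<^esub>c\<in>{0..n}. [((- 1) ^ c :: int)] \<cdot>\<^bsub>tensor_power k A (n + 1)\<^esub>
        pure_power k A (contract A c (xs[i := a \<oplus>\<^bsub>A\<^esub> b]))) =
      (\<Oplus>\<^bsub>tensor_power k A (n + 1)\<^esub>c\<in>{0..n}.
        [((- 1) ^ c :: int)] \<cdot>\<^bsub>tensor_power k A (n + 1)\<^esub> pure_power k A (contract A c (xs[i := a]))
        \<oplus>\<^bsub>tensor_power k A (n + 1)\<^esub>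
        [((- 1) ^ c :: int)] \<cdot>\<^bsub>tensor_power k A (n + 1)\<^esub> pure_power k A (contract A c (xs[i := b])))"
    proof (rule G.finsum_cong')
      show "(\<lambda>c. [((- 1) ^ c :: int)] \<cdot>\<^bsub>tensor_power k A (n + 1)\<^esub> pure_power k A (contract A c (xs[i := a]))
        \<oplus>\<^bsub>tensor_power k A (n + 1)\<^esub>
        [((- 1) ^ c :: int)] \<cdot>\<^bsub>tensor_power k A (n + 1)\<^esub> pure_power k A (contract A c (xs[i := b])))
        \<in> {0..n} \<rightarrow> carrier (tensor_power k A (n + 1))"
        by (intro funcsetI G.a_closed G.add.int_pow_closed M1 u) auto
    next
      fix c assume "c \<in> {0..n}"
      then have c: "c \<le> n" by simp
      show "[((- 1) ^ c :: int)] \<cdot>\<^bsub>tensor_power k A (n + 1)\<^esub> pure_power k A (contract A c (xs[i := a \<oplus>\<^bsub>A\<^esub> b])) =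
        [((- 1) ^ c :: int)] \<cdot>\<^bsub>tensor_power k A (n + 1)\<^esub> pure_power k A (contract A c (xs[i := a]))
        \<oplus>\<^bsub>tensor_power k A (n + 1)\<^esub>
        [((- 1) ^ c :: int)] \<cdot>\<^bsub>tensor_power k A (n + 1)\<^esub> pure_power k A (contract A c (xs[i := b]))"
        unfolding M2[OF c *] by (rule G.add.int_pow_distrib[OF M1[OF c u(1)] M1[OF c u(2)]])
    qed simp
    also have "\<dots> = (\<Oplus>\<^bsub>tensor_power k A (n + 1)\<^esub>c\<in>{0..n}.
        [((- 1) ^ c :: int)] \<cdot>\<^bsub>tensor_power k A (n + 1)\<^esub> pure_power k A (contract A c (xs[i := a])))
        \<oplus>\<^bsub>tensor_power k A (n + 1)\<^esub>
        (\<Oplus>\<^bsub>tensor_power k A (n + 1)\<^esub>c\<in>{0..n}.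
        [((- 1) ^ c :: int)] \<cdot>\<^bsub>tensor_power k A (n + 1)\<^esub> pure_power k A (contract A c (xs[i := b])))"
      by (rule G.finsum_addf) (intro funcsetI G.add.int_pow_closed M1 u, simp)+
    finally show "(\<Oplus>\<^bsub>tensor_power k A (n + 1)\<^esub>c\<in>{0..n}. [((- 1) ^ c :: int)] \<cdot>\<^bsub>tensor_power k A (n + 1)\<^esub>
        pure_power k A (contract A c (xs[i := a \<oplus>\<^bsub>A\<^esub> b]))) = \<dots>" .
  next
    fix xs i j r assume *: "xs \<in> tuples A (n + 2)" "i < n + 2" "j < n + 2" "r \<in> carrier k"
    note u = tuples_update[OF *(1) smult_closed[OF *(4) tuples_nth[OF *(1,3)]], of j]
    show "(\<Oplus>\<^bsub>tensor_power k A (n + 1)\<^esub>c\<in>{0..n}. [((- 1) ^ c :: int)] \<cdot>\<^bsub>tensor_power k A (n + 1)\<^esub>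
        pure_power k A (contract A c (xs[i := r \<odot>\<^bsub>A\<^esub> xs ! i]))) =
      (\<Oplus>\<^bsub>tensor_power k A (n + 1)\<^esub>c\<in>{0..n}. [((- 1) ^ c :: int)] \<cdot>\<^bsub>tensor_power k A (n + 1)\<^esub>
        pure_power k A (contract A c (xs[j := r \<odot>\<^bsub>A\<^esub> xs ! j])))"
    proof (rule G.finsum_cong')
      show "(\<lambda>c. [((- 1) ^ c :: int)] \<cdot>\<^bsub>tensor_power k A (n + 1)\<^esub>
        pure_power k A (contract A c (xs[j := r \<odot>\<^bsub>A\<^esub> xs ! j]))) \<in> {0..n} \<rightarrow> carrier (tensor_power k A (n + 1))"
        by (intro funcsetI G.add.int_pow_closed M1 u) auto
      fix c assume "c \<in> {0..n}"
      then have c: "c \<le> n" by simp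
      show "[((- 1) ^ c :: int)] \<cdot>\<^bsub>tensor_power k A (n + 1)\<^esub>
        pure_power k A (contract A c (xs[i := r \<odot>\<^bsub>A\<^esub> xs ! i])) = [((- 1) ^ c :: int)] \<cdot>\<^bsub>tensor_power k A (n + 1)\<^esub>
        pure_power k A (contract A c (xs[j := r \<odot>\<^bsub>A\<^esub> xs ! j]))"
        unfolding M3[OF c *] ..
    qed simp
  qed auto
qed

lemma bar_aug_pure_power:
  assumes "xs \<in> tuples A 2"
  shows "aug (bar k A) (pure_power k A xs) = xs ! 0 \<otimes>\<^bsub>A\<^esub> xs ! 1"
proof -
  have two: "i = 0 \<or> i = 1" if "i < 2" for i :: nat using that by auto
  have "induced A (\<lambda>xs. xs ! 0 \<otimes>\<^bsub>A\<^esub> xs ! 1) (pure_power k A xs) = xs ! 0 \<otimes>\<^bsub>A\<^esub> xs ! 1"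
  proof (rule induced_multilinear(2)[OF M.abelian_group_axioms smult_closed M.abelian_group_axioms _ _ _ assms])
    show "(\<lambda>xs. xs ! 0 \<otimes>\<^bsub>A\<^esub> xs ! 1) \<in> tuples A 2 \<rightarrow> carrier A"
      using tuples_nth by auto
    fix ys and i :: nat assume ys: "ys \<in> tuples A 2" and i: "i < 2"
    have y: "length ys = 2" "ys ! 0 \<in> carrier A" "ys ! Suc 0 \<in> carrier A"
      using ys tuples_nth by (auto simp: tuples_def)
    show "(ys[i := a \<oplus>\<^bsub>A\<^esub> b]) ! 0 \<otimes>\<^bsub>A\<^esub> (ys[i := a \<oplus>\<^bsub>A\<^esub> b]) ! 1 =
        (ys[i := a]) ! 0 \<otimes>\<^bsub>A\<^esub> (ys[i := a]) ! 1 \<oplus>\<^bsub>A\<^esub> (ys[i := b]) ! 0 \<otimes>\<^bsub>A\<^esub> (ys[i := b]) ! 1"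
      if "a \<in> carrier A" "b \<in> carrier A" for a b
      using two[OF i] y that by (auto simp: A.l_distr A.r_distr)
    show "(ys[i := r \<odot>\<^bsub>A\<^esub> ys ! i]) ! 0 \<otimes>\<^bsub>A\<^esub> (ys[i := r \<odot>\<^bsub>A\<^esub> ys ! i]) ! 1 =
        (ys[j := r \<odot>\<^bsub>A\<^esub> ys ! j]) ! 0 \<otimes>\<^bsub>A\<^esub> (ys[j := r \<odot>\<^bsub>A\<^esub> ys ! j]) ! 1"
      if "j < 2" "r \<in> carrier k" for j :: nat and r
      using two[OF i] two[OF that(1)] y that by (auto simp: smult_assoc_left smult_assoc_right)
  qed auto
  then show ?thesis by (simp add: bar_def)
qed

lemma slotwise_ends:
  assumes "a \<in> carrier A" "c \<in> carrier A"
  shows "slotwise (n + 2) (n + 2) (\<lambda>xs. xs[0 := a \<otimes>\<^bsub>A\<^esub> xs ! 0, n + 1 := xs ! (n + 1) \<otimes>\<^bsub>A\<^esub> c])"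
  unfolding slotwise_def
proof (intro conjI ballI allI impI funcsetI)
  fix xs assume xs: "xs \<in> tuples A (n + 2)"
  have len: "length xs = n + 2" using xs by (simp add: tuples_def)
  show "xs[0 := a \<otimes>\<^bsub>A\<^esub> xs ! 0, n + 1 := xs ! (n + 1) \<otimes>\<^bsub>A\<^esub> c] \<in> tuples A (n + 2)"
    using tuples_nth[OF xs] assms by (intro tuples_update xs) auto
  fix i assume i: "i < n + 2"
  consider "i = 0" | "i = n + 1" | "0 < i" "i < n + 1" using i by linarith
  then show "\<exists>j<n + 2. \<exists>\<phi>\<in>linear_maps k A A. \<forall>b\<in>carrier A.
      (xs[i := b])[0 := a \<otimes>\<^bsub>A\<^esub> (xs[i := b]) ! 0, n + 1 := (xs[i := b]) ! (n + 1) \<otimes>\<^bsub>A\<^esub> c] =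
      (xs[0 := a \<otimes>\<^bsub>A\<^esub> xs ! 0, n + 1 := xs ! (n + 1) \<otimes>\<^bsub>A\<^esub> c])[j := \<phi> b]"
  proof cases
    case 1
    show ?thesis
      by (rule exI[of _ 0], intro conjI bexI[OF _ linear_mult_left[OF assms(1)]])
         (use 1 len in \<open>auto simp: list_update_swap\<close>)
  next
    case 2
    show ?thesis
      by (rule exI[of _ "n + 1"], intro conjI bexI[OF _ linear_mult_right[OF assms(2)]])
         (use 2 len in \<open>auto simp: list_update_swap\<close>)
  next
    case 3
    show ?thesis
      by (rule exI[of _ i], intro conjI bexI[OF _ linear_id])
         (use 3 len in \<open>auto simp: list_update_swap\<close>)
  qed
qed

lemma bar_smult_pure_power:
  assumes "a \<in> carrier A" "c \<in> carrier A" and xs: "xs \<in> tuples A (n + 2)"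
  shows "pure_tensor k A A a c \<odot>\<^bsub>bar_module k A n\<^esub> pure_power k A xs =
    pure_power k A (xs[0 := a \<otimes>\<^bsub>A\<^esub> xs ! 0, n + 1 := xs ! (n + 1) \<otimes>\<^bsub>A\<^esub> c])"
proof -
  let ?T = "tensor_power k A (n + 2)"
  define h where "h a c xs = xs[0 := a \<otimes>\<^bsub>A\<^esub> xs ! 0, n + 1 := xs ! (n + 1) \<otimes>\<^bsub>A\<^esub> c]" for a c xs
  have slot: "slotwise (n + 2) (n + 2) (h a c)" if "a \<in> carrier A" "c \<in> carrier A" for a c
    unfolding h_def using slotwise_ends[OF that] .
  have inner: "induced ?T (\<lambda>xs. pure_power k A (h a c xs)) (pure_power k A xs) = pure_power k A (h a c xs)"
    if "a \<in> carrier A" "c \<in> carrier A" for a c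
    by (rule induced_multilinear(2)[OF M.abelian_group_axioms smult_closed abelian_group_tensor_power _ _ _ xs])
       (intro funcsetI slotwise_multilinear[OF slot[OF that]] | assumption)+
  have x: "xs ! 0 \<in> carrier A" "xs ! (n + 1) \<in> carrier A" using tuples_nth[OF xs] by auto
  have len: "length xs = n + 2" using xs by (simp add: tuples_def)
  have h': "h a c xs = (xs[n + 1 := xs ! (n + 1) \<otimes>\<^bsub>A\<^esub> c])[0 := a \<otimes>\<^bsub>A\<^esub> xs ! 0]" for a c
    unfolding h_def by (simp add: list_update_swap)
  have t1: "xs[n + 1 := xs ! (n + 1) \<otimes>\<^bsub>A\<^esub> c] \<in> tuples A (n + 2)" if "c \<in> carrier A" for c
    by (rule tuples_update[OF xs A.m_closed[OF x(2) that]])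
  have t2: "xs[0 := a \<otimes>\<^bsub>A\<^esub> xs ! 0] \<in> tuples A (n + 2)" if "a \<in> carrier A" for a
    by (rule tuples_update[OF xs A.m_closed[OF that x(1)]])
  have "induced ?T (\<lambda>(a, c). induced ?T (\<lambda>xs. pure_power k A (h a c xs)) (pure_power k A xs)) (pure_tensor k A A a c)
      = induced ?T (\<lambda>xs. pure_power k A (h a c xs)) (pure_power k A xs)"
  proof (rule B.induced_balanced(2)[OF abelian_group_tensor_power])
    fix a c assume ac: "a \<in> carrier A" "c \<in> carrier A"
    show "induced ?T (\<lambda>xs. pure_power k A (h a c xs)) (pure_power k A xs) \<in> carrier ?T"
      unfolding inner[OF ac] by (rule slotwise_multilinear(1)[OF slot[OF ac] xs])
  next
    fix a a' c assume ac: "a \<in> carrier A" "a' \<in> carrier A" "c \<in> carrier A"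
    show "induced ?T (\<lambda>xs. pure_power k A (h (a \<oplus>\<^bsub>A\<^esub> a') c xs)) (pure_power k A xs) =
      induced ?T (\<lambda>xs. pure_power k A (h a c xs)) (pure_power k A xs) \<oplus>\<^bsub>?T\<^esub>
      induced ?T (\<lambda>xs. pure_power k A (h a' c xs)) (pure_power k A xs)"
      unfolding inner[OF ac(1,3)] inner[OF ac(2,3)] inner[OF M.a_closed[OF ac(1,2)] ac(3)]
      unfolding h' A.l_distr[OF ac(1,2) x(1)]
      by (rule pure_power_add[OF t1[OF ac(3)]]) (use ac x in auto)
  next
    fix a c c' assume ac: "a \<in> carrier A" "c \<in> carrier A" "c' \<in> carrier A"
    show "induced ?T (\<lambda>xs. pure_power k A (h a (c \<oplus>\<^bsub>A\<^esub> c') xs)) (pure_power k A xs) =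
      induced ?T (\<lambda>xs. pure_power k A (h a c xs)) (pure_power k A xs) \<oplus>\<^bsub>?T\<^esub>
      induced ?T (\<lambda>xs. pure_power k A (h a c' xs)) (pure_power k A xs)"
      unfolding inner[OF ac(1,2)] inner[OF ac(1,3)] inner[OF ac(1) M.a_closed[OF ac(2,3)]]
      unfolding h_def A.r_distr[OF ac(2,3) x(2)]
      by (rule pure_power_add[OF t2[OF ac(1)]]) (use ac x in auto)
  next
    fix r a c assume rac: "r \<in> carrier k" "a \<in> carrier A" "c \<in> carrier A"
    let ?ys = "xs[0 := a \<otimes>\<^bsub>A\<^esub> xs ! 0, n + 1 := xs ! (n + 1) \<otimes>\<^bsub>A\<^esub> c]"
    have ys: "?ys \<in> tuples A (n + 2)" using slot[OF rac(2,3)] xs by (auto simp: slotwise_def h_def)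
    have "pure_power k A (?ys[0 := r \<odot>\<^bsub>A\<^esub> ?ys ! 0]) = pure_power k A (?ys[n + 1 := r \<odot>\<^bsub>A\<^esub> ?ys ! (n + 1)])"
      by (rule pure_power_balanced[OF ys _ _ rac(1)]) auto
    moreover have "?ys[0 := r \<odot>\<^bsub>A\<^esub> ?ys ! 0] = h (r \<odot>\<^bsub>A\<^esub> a) c xs"
      using len smult_assoc_left[OF rac(1,2) x(1)]
        list_update_swap[of 0 "Suc n" xs "a \<otimes>\<^bsub>A\<^esub> xs ! 0"] by (simp add: h')
    moreover have "?ys[n + 1 := r \<odot>\<^bsub>A\<^esub> ?ys ! (n + 1)] = h a (r \<odot>\<^bsub>A\<^esub> c) xs"
      using len smult_assoc_right[OF rac(1) x(2) rac(3)] by (simp add: h_def)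
    ultimately show "induced ?T (\<lambda>xs. pure_power k A (h (r \<odot>\<^bsub>A\<^esub> a) c xs)) (pure_power k A xs) =
      induced ?T (\<lambda>xs. pure_power k A (h a (r \<odot>\<^bsub>A\<^esub> c) xs)) (pure_power k A xs)"
      using inner[OF smult_closed[OF rac(1,2)] rac(3)] inner[OF rac(2) smult_closed[OF rac(1,3)]] by simp
  qed (fact assms)+
  then show ?thesis
    using inner[OF assms(1,2)] by (simp add: bar_module_def h_def)
qed

end

end

theory Submission
  imports Defs
begin

text \<open>
  Both products are computed by lifting a cocycle to a chain map, once the right chain map is found on
  the bar resolution. For a cocycle \<open>t\<close> of degree \<open>m\<close> on the bar resolution let \<open>\<rho>\<^sub>i\<close> map
  \<open>a\<^sub>0 \<otimes> \<dots> \<otimes> a\<^sub>m\<^sub>+\<^sub>i\<^sub>+\<^sub>1\<close> to \<open>t (a\<^sub>0 \<otimes> \<dots> \<otimes> a\<^sub>m \<otimes> 1) \<otimes> a\<^sub>m\<^sub>+\<^sub>1 \<otimes> \<dots> \<otimes> a\<^sub>m\<^sub>+\<^sub>i\<^sub>+\<^sub>1\<close> (\<open>front_eval\<close>). The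
  defining formula of the cap product is \<open>id\<^sub>A \<otimes> \<rho>\<^sub>i\<close> (\<open>bar_cap_chain_eq\<close>), because a factor can be moved
  across \<open>\<otimes>\<close> over \<open>A\<^sup>e\<close>. The maps \<open>\<rho>\<^sub>i\<close> almost form a chain map lifting \<open>t\<close>: the augmentation turns \<open>\<rho>\<^sub>0\<close>
  into \<open>t\<close>, but \<open>\<rho>\<^sub>i d = (-1)\<^sup>m d \<rho>\<^sub>i\<^sub>+\<^sub>1\<close> (\<open>front_eval_bar_diff\<close>), since \<open>t\<close> swallows the first \<open>m + 1\<close> places of
  the alternating sum and the cocycle condition trades the summands there for one with sign \<open>(-1)\<^sup>m\<close>. Hence
  \<open>\<sigma>\<^sub>i = (-1)\<^sup>m\<^sup>i \<rho>\<^sub>i\<close> is an honest lift of \<open>t\<close> (\<open>lift_over_signed_front\<close>), and the sign of the theorem is the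
  sign in its definition, with \<open>i = n - m\<close>.

  The rest is uniqueness of lifts up to homotopy. Two lifts of cohomologous cocycles induce the same map
  on homology (\<open>lift_over_homotopy\<close>, \<open>HH_class_lift_eq\<close>). With comparison maps \<open>\<phi>\<close> from \<open>P\<close> to the
  bar resolution and \<open>\<psi>\<close> back, the cap product of a class on \<open>P\<close> with \<open>[t]\<close> is up to the sign computed by
  \<open>\<psi> \<sigma> \<phi>\<close>, where \<open>\<sigma>\<close> lifts \<open>t \<psi>\<close>. This composite lifts \<open>t \<psi> \<phi>\<close>, which is cohomologous to \<open>t\<close> because
  \<open>\<psi> \<phi>\<close> is homotopic to the identity, so it induces the same map as any lift of \<open>t\<close> (\<open>cap_class\<close>).

  Two facts about the bar complex enter: it is exact, by the contraction that prefixes \<open>1\<close>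
  (\<open>resolves_bar\<close>), and linear maps out of it lift along linear maps whose image contains theirs
  (\<open>bar_module_lifts_along\<close>). The latter is where projectivity of \<open>A\<close> over \<open>k\<close> is used: an \<open>A\<^sup>e\<close>-linear map
  on \<open>A\<^sup>\<otimes>\<^sup>n\<^sup>+\<^sup>2\<close> is a \<open>k\<close>-multilinear map in the \<open>n\<close> inner factors, and multilinear maps lift one
  variable at a time (\<open>multilinear_lift\<close>).
\<close>


section \<open>Additive maps out of groups given by generators\<close>

lemma additiveI:
  assumes "abelian_group G" "abelian_group H"
    and "\<And>x. x \<in> carrier G \<Longrightarrow> f x \<in> carrier H"
    and "\<And>x y. \<lbrakk>x \<in> carrier G; y \<in> carrier G\<rbrakk> \<Longrightarrow> f (x \<oplus>\<^bsub>G\<^esub> y) = f x \<oplus>\<^bsub>H\<^esub> f y"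
  shows "abelian_group_hom G H f"
  using assms by (intro abelian_group_homI)
     (auto simp: group_hom_def group_hom_axioms_def hom_def abelian_group.a_group)

lemma additive_hom:
  assumes "abelian_group G" "abelian_group H" "f \<in> hom (add_monoid G) (add_monoid H)"
  shows "abelian_group_hom G H f"
  using assms by (intro additiveI) (auto simp: hom_def)

context abelian_group_hom
begin

lemma hom_diff: "\<lbrakk>x \<in> carrier G; y \<in> carrier G\<rbrakk> \<Longrightarrow> h (x \<ominus>\<^bsub>G\<^esub> y) = h x \<ominus>\<^bsub>H\<^esub> h y"
  by (simp add: a_minus_def)

lemma hom_add_pow: "x \<in> carrier G \<Longrightarrow> h ([n] \<cdot>\<^bsub>G\<^esub> x) = [(n::int)] \<cdot>\<^bsub>H\<^esub> h x"
  unfolding add_pow_def using group_hom.hom_int_pow[OF a_group_hom, of x n] by simp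

lemma hom_finsum_add:
  assumes "finite T" "f \<in> T \<rightarrow> carrier G"
  shows "h (\<Oplus>\<^bsub>G\<^esub>i\<in>T. f i) = (\<Oplus>\<^bsub>H\<^esub>i\<in>T. h (f i))"
  using assms by (induction T) (simp_all add: Pi_iff)

end

lemma additive_comp:
  assumes "abelian_group_hom G H f" "abelian_group_hom H K g"
  shows "abelian_group_hom G K (\<lambda>x. g (f x))"
proof -
  interpret f: abelian_group_hom G H f by fact
  interpret g: abelian_group_hom H K g by fact
  show ?thesis
    by (rule additiveI[OF f.G.abelian_group_axioms g.H.abelian_group_axioms]) auto
qed

lemma additive_add:
  assumes "abelian_group_hom G H f" "abelian_group_hom G H g"
  shows "abelian_group_hom G H (\<lambda>x. f x \<oplus>\<^bsub>H\<^esub> g x)"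
proof -
  interpret f: abelian_group_hom G H f by fact
  interpret g: abelian_group_hom G H g by fact
  show ?thesis
    by (rule additiveI[OF f.G.abelian_group_axioms f.H.abelian_group_axioms]) (auto simp: f.H.add.m_ac)
qed

lemma additive_add_pow:
  assumes "abelian_group_hom G H f"
  shows "abelian_group_hom G H (\<lambda>x. [(n::int)] \<cdot>\<^bsub>H\<^esub> f x)"
proof -
  interpret f: abelian_group_hom G H f by fact
  show ?thesis
    by (rule additiveI[OF f.G.abelian_group_axioms f.H.abelian_group_axioms])
       (auto simp: f.H.add.int_pow_distrib)
qed

lemma additive_uminus:
  assumes "abelian_group_hom G H f"
  shows "abelian_group_hom G H (\<lambda>x. \<ominus>\<^bsub>H\<^esub> f x)"
proof -
  interpret f: abelian_group_hom G H f by fact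
  show ?thesis
    by (rule additiveI[OF f.G.abelian_group_axioms f.H.abelian_group_axioms])
       (auto simp: f.H.minus_add)
qed

lemma additive_diff:
  assumes "abelian_group_hom G H f" "abelian_group_hom G H g"
  shows "abelian_group_hom G H (\<lambda>x. f x \<ominus>\<^bsub>H\<^esub> g x)"
  unfolding a_minus_def by (rule additive_add[OF assms(1) additive_uminus[OF assms(2)]])

lemma additive_id: "abelian_group G \<Longrightarrow> abelian_group_hom G G (\<lambda>x. x)"
  by (rule additiveI) auto

lemma additive_zero: 
  assumes "abelian_group G" "abelian_group H" shows "abelian_group_hom G H (\<lambda>x. \<zero>\<^bsub>H\<^esub>)"
proof -
  interpret H: abelian_group H by fact
  show ?thesis using assms by (intro additiveI) auto
qed

lemma additive_finsum:
  assumes "finite T" "abelian_group G" "abelian_group H" "\<And>i. i \<in> T \<Longrightarrow> abelian_group_hom G H (f i)"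
  shows "abelian_group_hom G H (\<lambda>x. \<Oplus>\<^bsub>H\<^esub>i\<in>T. f i x)"
proof -
  interpret H: abelian_group H by fact
  show ?thesis
  proof (rule additiveI[OF assms(2,3)])
    have closed: "f i x \<in> carrier H" if "i \<in> T" "x \<in> carrier G" for i x
      using abelian_group_hom.hom_closed[OF assms(4)] that by blast
    fix x assume x: "x \<in> carrier G"
    show "(\<Oplus>\<^bsub>H\<^esub>i\<in>T. f i x) \<in> carrier H" using x closed by (intro H.finsum_closed) auto
    fix y assume y: "y \<in> carrier G"
    have "(\<Oplus>\<^bsub>H\<^esub>i\<in>T. f i (x \<oplus>\<^bsub>G\<^esub> y)) = (\<Oplus>\<^bsub>H\<^esub>i\<in>T. f i x \<oplus>\<^bsub>H\<^esub> f i y)"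
      using x y closed abelian_group_hom.hom_add[OF assms(4)] by (intro H.finsum_cong') auto
    also have "\<dots> = (\<Oplus>\<^bsub>H\<^esub>i\<in>T. f i x) \<oplus>\<^bsub>H\<^esub> (\<Oplus>\<^bsub>H\<^esub>i\<in>T. f i y)"
      using x y closed by (intro H.finsum_addf) auto
    finally show "(\<Oplus>\<^bsub>H\<^esub>i\<in>T. f i (x \<oplus>\<^bsub>G\<^esub> y)) = (\<Oplus>\<^bsub>H\<^esub>i\<in>T. f i x) \<oplus>\<^bsub>H\<^esub> (\<Oplus>\<^bsub>H\<^esub>i\<in>T. f i y)" .
  qed
qed

lemma additive_cong:
  assumes "abelian_group_hom G H f" "\<And>x. x \<in> carrier G \<Longrightarrow> f x = g x"
  shows "abelian_group_hom G H g"
proof -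
  interpret f: abelian_group_hom G H f by fact
  show ?thesis
    using assms(2)[symmetric] by (intro additiveI f.G.abelian_group_axioms f.H.abelian_group_axioms) auto
qed

lemma presented_group_coset_hom:
  assumes "Rel \<subseteq> carrier (free_Abelian_group S)"
  shows "(\<lambda>c. relations_span S Rel #>\<^bsub>free_Abelian_group S\<^esub> c) \<in>
    hom (free_Abelian_group S) (add_monoid (presented_group S Rel))"
proof -
  interpret F: comm_group "free_Abelian_group S" by (rule abelian_free_Abelian_group)
  interpret N: normal "relations_span S Rel" "free_Abelian_group S"
    by (rule F.subgroup_imp_normal[OF subgroup_relations_span[OF assms]])
  show ?thesis
    using N.r_coset_hom_Mod by (simp add: hom_def presented_group_def additive_group_def)
qed

lemma hom_free_eqI:
  assumes "group G" and f: "f \<in> hom (free_Abelian_group S) G" and g: "g \<in> hom (free_Abelian_group S) G"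
    and eq: "\<And>x. x \<in> S \<Longrightarrow> f (frag_of x) = g (frag_of x)" and c: "c \<in> carrier (free_Abelian_group S)"
  shows "f c = g c"
proof -
  interpret f: group_hom "free_Abelian_group S" G f
    using assms by (simp add: group_hom_def group_hom_axioms_def)
  interpret g: group_hom "free_Abelian_group S" G g
    using assms by (simp add: group_hom_def group_hom_axioms_def)
  have "Poly_Mapping.keys c \<subseteq> S" using c by simp
  then show ?thesis
  proof (induction c rule: free_Abelian_group_induct[consumes 1])
    show "f 0 = g 0" using f.hom_one g.hom_one by simp
  next
    fix x y assume 2: "Poly_Mapping.keys x \<subseteq> S" "Poly_Mapping.keys y \<subseteq> S" "f x = g x" "f y = g y"
    have "f (x \<otimes>\<^bsub>free_Abelian_group S\<^esub> inv\<^bsub>free_Abelian_group S\<^esub> y) =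
        g (x \<otimes>\<^bsub>free_Abelian_group S\<^esub> inv\<^bsub>free_Abelian_group S\<^esub> y)"
    proof -
      have "x \<in> carrier (free_Abelian_group S)" "y \<in> carrier (free_Abelian_group S)" using 2 by simp_all
      then show ?thesis
        using 2(3,4) by (simp only: f.hom_mult g.hom_mult f.hom_inv g.hom_inv f.G.inv_closed)
    qed
    then show "f (x - y) = g (x - y)" using 2 by simp
  qed (rule eq)
qed

lemma presented_group_eqI:
  assumes Rel: "Rel \<subseteq> carrier (free_Abelian_group S)"
    and f: "abelian_group_hom (presented_group S Rel) G f"
    and g: "abelian_group_hom (presented_group S Rel) G g"
    and eq: "\<And>x. x \<in> S \<Longrightarrow> f (generator S Rel x) = g (generator S Rel x)"
    and X: "X \<in> carrier (presented_group S Rel)"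
  shows "f X = g X"
proof -
  interpret f: abelian_group_hom "presented_group S Rel" G f by fact
  interpret g: abelian_group_hom "presented_group S Rel" G g by fact
  obtain c where c: "c \<in> carrier (free_Abelian_group S)"
    and Xc: "X = relations_span S Rel #>\<^bsub>free_Abelian_group S\<^esub> c"
    using X by (auto simp: presented_group_def additive_group_def FactGroup_def RCOSETS_def)
  have hom: "(\<lambda>c. h (relations_span S Rel #>\<^bsub>free_Abelian_group S\<^esub> c)) \<in> hom (free_Abelian_group S) (add_monoid G)"
    if "abelian_group_hom (presented_group S Rel) G h" for h
    using hom_compose[OF presented_group_coset_hom[OF Rel] group_hom.homh[OF abelian_group_hom.a_group_hom[OF that]]]
    by (simp add: comp_def)
  show ?thesis
    unfolding Xc
    by (rule hom_free_eqI[OF f.H.a_group hom[OF f] hom[OF g] _ c])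
       (use eq in \<open>simp add: generator_def\<close>)
qed

text \<open>
  A map that is already known to be additive is recovered from its values on the generators, so the
  formulas that are given on generators only can be compared with additive maps built by other means.
\<close>

lemma induced_eq_additive:
  assumes Rel: "Rel \<subseteq> carrier (free_Abelian_group S)"
    and F: "abelian_group_hom (presented_group S Rel) G F"
    and f: "\<And>x. x \<in> S \<Longrightarrow> f x = F (generator S Rel x)"
    and X: "X \<in> carrier (presented_group S Rel)"
  shows "induced G f X = F X"
proof -
  interpret F: abelian_group_hom "presented_group S Rel" G F by fact
  interpret FA: comm_group "free_Abelian_group S" by (rule abelian_free_Abelian_group)
  have fS: "f \<in> S \<rightarrow> carrier G" using f generator_closed[of _ S Rel] by auto
  have lin: "linear_extension G f c = F (relations_span S Rel #>\<^bsub>free_Abelian_group S\<^esub> c)"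
    if "c \<in> carrier (free_Abelian_group S)" for c
  proof (rule hom_free_eqI[OF F.H.a_group linear_extension_hom[OF F.H.abelian_group_axioms fS] _ _ that])
    show "(\<lambda>c. F (relations_span S Rel #>\<^bsub>free_Abelian_group S\<^esub> c)) \<in> hom (free_Abelian_group S) (add_monoid G)"
      using hom_compose[OF presented_group_coset_hom[OF Rel] group_hom.homh[OF F.a_group_hom]]
      by (simp add: comp_def)
    show "linear_extension G f (frag_of x) = F (relations_span S Rel #>\<^bsub>free_Abelian_group S\<^esub> frag_of x)"
      if "x \<in> S" for x
      using linear_extension_frag_of[OF F.H.abelian_group_axioms, of f x] funcset_mem[OF fS that]
      by (simp add: f[OF that] generator_def)
  qed
  have kill: "linear_extension G f r = \<zero>\<^bsub>G\<^esub>" if "r \<in> Rel" for r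
  proof -
    have r: "r \<in> carrier (free_Abelian_group S)" using that Rel by (rule subsetD[rotated])
    have "r \<in> relations_span S Rel" using that by (simp add: relations_span_def generate.incl)
    then have "relations_span S Rel #>\<^bsub>free_Abelian_group S\<^esub> r = relations_span S Rel"
      by (rule FA.coset_join2[OF r subgroup_relations_span[OF Rel]])
    also have "\<dots> = \<zero>\<^bsub>presented_group S Rel\<^esub>"
      by (simp add: presented_group_def additive_group_def FactGroup_def)
    finally show ?thesis using lin[OF r] by simp
  qed
  obtain c where c: "c \<in> carrier (free_Abelian_group S)"
    and Xc: "X = relations_span S Rel #>\<^bsub>free_Abelian_group S\<^esub> c"
    using X by (auto simp: presented_group_def additive_group_def FactGroup_def RCOSETS_def)
  show ?thesis
    unfolding Xc using induced_coset[OF F.H.abelian_group_axioms fS Rel kill c] lin[OF c] by simp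
qed

context balanced_pair
begin

lemma tensor_eqI:
  assumes "abelian_group_hom (tensor R N Y) G f" "abelian_group_hom (tensor R N Y) G g"
    and "\<And>x y. \<lbrakk>x \<in> carrier N; y \<in> carrier Y\<rbrakk> \<Longrightarrow> f (pure_tensor R N Y x y) = g (pure_tensor R N Y x y)"
    and "X \<in> carrier (tensor R N Y)"
  shows "f X = g X"
proof -
  have eq: "f (generator (carrier N \<times> carrier Y) (tensor_relations R N Y) z) =
      g (generator (carrier N \<times> carrier Y) (tensor_relations R N Y) z)"
    if "z \<in> carrier N \<times> carrier Y" for z
    using assms(3)[of "fst z" "snd z"] that by (auto simp: pure_tensor_def)
  show ?thesis
    by (rule presented_group_eqI[OF tensor_relations_closed assms(1)[unfolded tensor_def]
          assms(2)[unfolded tensor_def] eq assms(4)[unfolded tensor_def]])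
qed

lemma induced_eq_tensor:
  assumes "abelian_group_hom (tensor R N Y) G F"
    and "\<And>x y. \<lbrakk>x \<in> carrier N; y \<in> carrier Y\<rbrakk> \<Longrightarrow> f x y = F (pure_tensor R N Y x y)"
    and "X \<in> carrier (tensor R N Y)"
  shows "induced G (\<lambda>(x, y). f x y) X = F X"
proof -
  have f: "(\<lambda>(x, y). f x y) z = F (generator (carrier N \<times> carrier Y) (tensor_relations R N Y) z)"
    if "z \<in> carrier N \<times> carrier Y" for z
    using assms(2)[of "fst z" "snd z"] that by (auto simp: pure_tensor_def case_prod_unfold)
  show ?thesis
    by (rule induced_eq_additive[OF tensor_relations_closed assms(1)[unfolded tensor_def] f
          assms(3)[unfolded tensor_def]])
qed

end

context assoc_algebra
begin

lemma tensor_power_eqI: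
  assumes "abelian_group_hom (tensor_power k A n) G f" "abelian_group_hom (tensor_power k A n) G g"
    and "\<And>xs. xs \<in> tuples A n \<Longrightarrow> f (pure_power k A xs) = g (pure_power k A xs)"
    and "X \<in> carrier (tensor_power k A n)"
  shows "f X = g X"
proof -
  have eq: "f (generator (tuples A n) (power_relations k A n) xs) =
      g (generator (tuples A n) (power_relations k A n) xs)" if "xs \<in> tuples A n" for xs
    using assms(3)[OF that] that by (simp add: pure_power_def tuples_def)
  show ?thesis
    by (rule presented_group_eqI[OF power_relations_closed[OF M.abelian_group_axioms smult_closed]
          assms(1)[unfolded tensor_power_def] assms(2)[unfolded tensor_power_def] eq
          assms(4)[unfolded tensor_power_def]])
qed

lemma induced_eq_tensor_power:
  assumes "abelian_group_hom (tensor_power k A n) G F"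
    and "\<And>xs. xs \<in> tuples A n \<Longrightarrow> f xs = F (pure_power k A xs)"
    and "X \<in> carrier (tensor_power k A n)"
  shows "induced G f X = F X"
proof -
  have f: "f xs = F (generator (tuples A n) (power_relations k A n) xs)" if "xs \<in> tuples A n" for xs
    using assms(2)[OF that] that by (simp add: pure_power_def tuples_def)
  show ?thesis
    by (rule induced_eq_additive[OF power_relations_closed[OF M.abelian_group_axioms smult_closed]
          assms(1)[unfolded tensor_power_def] f assms(3)[unfolded tensor_power_def]])
qed

end

section \<open>Linear maps and the functor \<open>N \<otimes> -\<close>\<close>

lemma linear_mapsI:
  assumes "\<And>x. x \<in> carrier M \<Longrightarrow> f x \<in> carrier N"
    and "\<And>x y. \<lbrakk>x \<in> carrier M; y \<in> carrier M\<rbrakk> \<Longrightarrow> f (x \<oplus>\<^bsub>M\<^esub> y) = f x \<oplus>\<^bsub>N\<^esub> f y"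
    and "\<And>r x. \<lbrakk>r \<in> carrier R; x \<in> carrier M\<rbrakk> \<Longrightarrow> f (r \<odot>\<^bsub>M\<^esub> x) = r \<odot>\<^bsub>N\<^esub> f x"
  shows "f \<in> linear_maps R M N"
  using assms by (simp add: linear_maps_def Pi_iff)

lemma linear_maps_additive:
  assumes "f \<in> linear_maps R M N" "left_module R M" "left_module R N"
  shows "abelian_group_hom M N f"
  using assms by (intro additiveI) (auto simp: left_module_def linear_maps_def)

lemma linear_maps_ident: "(\<lambda>x. x) \<in> linear_maps R M M"
  by (simp add: linear_maps_def)

lemma linear_maps_comp:
  "\<lbrakk>f \<in> linear_maps R L M; g \<in> linear_maps R M N\<rbrakk> \<Longrightarrow> (\<lambda>x. g (f x)) \<in> linear_maps R L N"
  by (simp add: linear_maps_def Pi_iff)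

lemma linear_maps_cong:
  assumes "f \<in> linear_maps R M N" "left_module R M" "\<And>x. x \<in> carrier M \<Longrightarrow> f x = g x"
  shows "g \<in> linear_maps R M N"
proof -
  interpret M: left_module R M by fact
  show ?thesis using assms(1,3) by (simp add: linear_maps_def Pi_iff M.smult_closed)
qed

lemma (in left_module) additive_smult: "a \<in> carrier R \<Longrightarrow> abelian_group_hom M M (\<lambda>x. a \<odot>\<^bsub>M\<^esub> x)"
  by (rule additiveI) (auto simp: smult_closed smult_r_distr M.abelian_group_axioms)

lemma linear_maps_plus:
  assumes "f \<in> linear_maps R M N" "g \<in> linear_maps R M N" "left_module R M" "left_module R N"
  shows "(\<lambda>x. f x \<oplus>\<^bsub>N\<^esub> g x) \<in> linear_maps R M N"
proof -
  interpret N: left_module R N by fact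
  interpret f: abelian_group_hom M N f by (rule linear_maps_additive[OF assms(1,3,4)])
  interpret g: abelian_group_hom M N g by (rule linear_maps_additive[OF assms(2-4)])
  show ?thesis
    by (rule linear_mapsI)
       (auto simp: N.M.add.m_ac N.smult_r_distr linear_maps_smult[OF assms(1)] linear_maps_smult[OF assms(2)])
qed

lemma linear_maps_int_multiple:
  assumes "f \<in> linear_maps R M N" "left_module R M" "left_module R N"
  shows "(\<lambda>x. [(n::int)] \<cdot>\<^bsub>N\<^esub> f x) \<in> linear_maps R M N"
proof -
  interpret N: left_module R N by fact
  interpret f: abelian_group_hom M N f by (rule linear_maps_additive[OF assms])
  show ?thesis
    by (rule linear_mapsI)
       (auto simp: N.M.add.int_pow_distrib linear_maps_smult[OF assms(1)]
          abelian_group_hom.hom_add_pow[OF N.additive_smult])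
qed

lemma linear_maps_minus:
  assumes "f \<in> linear_maps R M N" "g \<in> linear_maps R M N" "left_module R M" "left_module R N"
  shows "(\<lambda>x. f x \<ominus>\<^bsub>N\<^esub> g x) \<in> linear_maps R M N"
proof -
  interpret N: left_module R N by fact
  interpret g: abelian_group_hom M N g by (rule linear_maps_additive[OF assms(2-4)])
  have "(\<lambda>x. \<ominus>\<^bsub>N\<^esub> g x) \<in> linear_maps R M N"
    by (rule linear_mapsI)
       (auto simp: N.M.minus_add linear_maps_smult[OF assms(2)]
          abelian_group_hom.hom_a_inv[OF N.additive_smult])
  then show ?thesis unfolding a_minus_def using assms by (intro linear_maps_plus)
qed

lemma linear_maps_zero:
  assumes "left_module R M" "left_module R N"
  shows "(\<lambda>x. \<zero>\<^bsub>N\<^esub>) \<in> linear_maps R M N"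
proof -
  interpret N: left_module R N by fact
  show ?thesis by (rule linear_mapsI) (auto simp: N.smult_r_null)
qed

text \<open>
  The target only has to be an abelian group here, so that this also yields the module axioms of the
  image of a resolution under its augmentation.
\<close>

lemma left_module_image:
  assumes "left_module R M" "abelian_group N" and g: "g \<in> linear_maps R M N"
  shows "left_module R (N\<lparr>carrier := g ` carrier M\<rparr>)"
proof -
  interpret M: left_module R M by fact
  interpret N: abelian_group N by fact
  interpret g: abelian_group_hom M N g
    using g by (intro additiveI M.M.abelian_group_axioms N.abelian_group_axioms) (auto simp: linear_maps_def)
  note g_smult = linear_maps_smult[OF g, symmetric]
  show ?thesis
  proof (intro left_module.intro left_module_axioms.intro M.R.ring_axioms)
    show "abelian_group (N\<lparr>carrier := g ` carrier M\<rparr>)"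
    proof (rule abelian_groupI)
      show "x \<oplus>\<^bsub>N\<lparr>carrier := g ` carrier M\<rparr>\<^esub> y \<in> carrier (N\<lparr>carrier := g ` carrier M\<rparr>)"
        if "x \<in> carrier (N\<lparr>carrier := g ` carrier M\<rparr>)" "y \<in> carrier (N\<lparr>carrier := g ` carrier M\<rparr>)" for x y
        using that by (auto simp flip: g.hom_add)
      show "\<zero>\<^bsub>N\<lparr>carrier := g ` carrier M\<rparr>\<^esub> \<in> carrier (N\<lparr>carrier := g ` carrier M\<rparr>)"
        by (auto simp flip: g.hom_zero)
      show "\<exists>y\<in>carrier (N\<lparr>carrier := g ` carrier M\<rparr>).
          y \<oplus>\<^bsub>N\<lparr>carrier := g ` carrier M\<rparr>\<^esub> x = \<zero>\<^bsub>N\<lparr>carrier := g ` carrier M\<rparr>\<^esub>"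
        if x: "x \<in> carrier (N\<lparr>carrier := g ` carrier M\<rparr>)" for x
      proof -
        obtain y where y: "y \<in> carrier M" "x = g y" using x by auto
        then show ?thesis
          by (intro bexI[of _ "g (\<ominus>\<^bsub>M\<^esub> y)"]) (auto simp: N.l_neg simp del: g.hom_a_inv, simp add: N.l_neg)
      qed
    qed (auto simp: N.a_ac)
  qed (auto simp: g_smult M.smult_closed M.smult_one M.smult_assoc1 simp flip: g.hom_add
      simp: M.smult_l_distr M.smult_r_distr)
qed

lemma (in balanced_pair) pure_tensor_additive:
  "x \<in> carrier N \<Longrightarrow> abelian_group_hom Y (tensor R N Y) (pure_tensor R N Y x)"
  by (intro additiveI abelian_group_tensor)
     (auto simp: pure_tensor_closed pure_tensor_add_right M.abelian_group_axioms)

lemma tensor_map_additive: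
  assumes "balanced_pair R Y N" "balanced_pair R Y' N" and f: "f \<in> linear_maps R Y Y'"
  shows "abelian_group_hom (tensor R N Y) (tensor R N Y') (tensor_map R N Y' f)"
proof -
  interpret Y: balanced_pair R Y N by fact
  interpret Y': balanced_pair R Y' N by fact
  have fc: "f u \<in> carrier Y'" if "u \<in> carrier Y" for u
    using f that by (auto simp: linear_maps_def)
  show ?thesis
    unfolding tensor_map_def
    by (intro additive_hom Y.abelian_group_tensor Y'.abelian_group_tensor
          Y.induced_balanced(1)[OF Y'.abelian_group_tensor])
       (use f fc in \<open>auto simp: linear_maps_def Y'.pure_tensor_closed Y'.pure_tensor_add_left
          Y'.pure_tensor_add_right Y'.pure_tensor_balanced\<close>)
qed

lemma tensor_map_cong:
  assumes "balanced_pair R Y N" "balanced_pair R Y' N"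
    and f: "f \<in> linear_maps R Y Y'" and eq: "\<And>y. y \<in> carrier Y \<Longrightarrow> f y = g y"
    and X: "X \<in> carrier (tensor R N Y)"
  shows "tensor_map R N Y' f X = tensor_map R N Y' g X"
proof -
  interpret Y: balanced_pair R Y N by fact
  have g: "g \<in> linear_maps R Y Y'" by (rule linear_maps_cong[OF f Y.left_module_axioms eq])
  show ?thesis
    by (rule Y.tensor_eqI[OF tensor_map_additive[OF assms(1,2) f] tensor_map_additive[OF assms(1,2) g] _ X])
       (simp add: tensor_map_pure_tensor[OF assms(1,2)] f g eq)
qed

lemma tensor_map_comp:
  assumes "balanced_pair R Y N" "balanced_pair R Y' N" "balanced_pair R Y'' N"
    and f: "f \<in> linear_maps R Y Y'" and g: "g \<in> linear_maps R Y' Y''"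
    and X: "X \<in> carrier (tensor R N Y)"
  shows "tensor_map R N Y'' g (tensor_map R N Y' f X) = tensor_map R N Y'' (\<lambda>y. g (f y)) X"
proof -
  interpret Y: balanced_pair R Y N by fact
  note gf = linear_maps_comp[OF f g]
  show ?thesis
    by (rule Y.tensor_eqI[OF additive_comp[OF tensor_map_additive[OF assms(1,2) f]
            tensor_map_additive[OF assms(2,3) g]] tensor_map_additive[OF assms(1,3) gf] _ X])
       (simp add: tensor_map_pure_tensor[OF assms(1,2) f] tensor_map_pure_tensor[OF assms(2,3) g]
          tensor_map_pure_tensor[OF assms(1,3) gf] linear_maps_closed[OF f])
qed

lemma tensor_map_plus:
  assumes Y: "balanced_pair R Y N" and Y': "balanced_pair R Y' N"
    and f: "f \<in> linear_maps R Y Y'" and g: "g \<in> linear_maps R Y Y'"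
    and X: "X \<in> carrier (tensor R N Y)"
  shows "tensor_map R N Y' (\<lambda>y. f y \<oplus>\<^bsub>Y'\<^esub> g y) X =
    tensor_map R N Y' f X \<oplus>\<^bsub>tensor R N Y'\<^esub> tensor_map R N Y' g X"
proof -
  interpret Y: balanced_pair R Y N by fact
  interpret Y': balanced_pair R Y' N by fact
  note fg = linear_maps_plus[OF f g Y.left_module_axioms Y'.left_module_axioms]
  show ?thesis
    by (rule Y.tensor_eqI[OF tensor_map_additive[OF Y Y' fg] additive_add[OF tensor_map_additive[OF Y Y' f]
            tensor_map_additive[OF Y Y' g]] _ X])
       (simp add: tensor_map_pure_tensor[OF Y Y'] f g fg Y'.pure_tensor_add_right linear_maps_closed[OF f]
          linear_maps_closed[OF g])
qed

lemma tensor_map_int_multiple: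
  assumes Y: "balanced_pair R Y N" and Y': "balanced_pair R Y' N"
    and f: "f \<in> linear_maps R Y Y'" and X: "X \<in> carrier (tensor R N Y)"
  shows "tensor_map R N Y' (\<lambda>y. [(n::int)] \<cdot>\<^bsub>Y'\<^esub> f y) X = [n] \<cdot>\<^bsub>tensor R N Y'\<^esub> tensor_map R N Y' f X"
proof -
  interpret Y: balanced_pair R Y N by fact
  interpret Y': balanced_pair R Y' N by fact
  note nf = linear_maps_int_multiple[OF f Y.left_module_axioms Y'.left_module_axioms, of n]
  show ?thesis
    by (intro Y.tensor_eqI[OF tensor_map_additive[OF Y Y' nf] additive_add_pow[OF tensor_map_additive[OF Y Y' f]] _ X])
       (simp add: tensor_map_pure_tensor[OF Y Y' f] tensor_map_pure_tensor[OF Y Y' nf] linear_maps_closed[OF f]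
          abelian_group_hom.hom_add_pow[OF Y'.pure_tensor_additive])
qed

lemma tensor_map_eq_zero:
  assumes Y: "balanced_pair R Y N" and Y': "balanced_pair R Y' N"
    and f: "f \<in> linear_maps R Y Y'" and zero: "\<And>y. y \<in> carrier Y \<Longrightarrow> f y = \<zero>\<^bsub>Y'\<^esub>"
    and X: "X \<in> carrier (tensor R N Y)"
  shows "tensor_map R N Y' f X = \<zero>\<^bsub>tensor R N Y'\<^esub>"
proof -
  interpret Y: balanced_pair R Y N by fact
  interpret Y': balanced_pair R Y' N by fact
  show ?thesis
    by (rule Y.tensor_eqI[OF tensor_map_additive[OF Y Y' f]
          additive_zero[OF Y.abelian_group_tensor Y'.abelian_group_tensor] _ X])
       (simp add: tensor_map_pure_tensor[OF Y Y' f] zero abelian_group_hom.hom_zero[OF Y'.pure_tensor_additive])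
qed

section \<open>Lifting maps through exact complexes\<close>

text \<open>
  Lifts are asked for exactly the maps that can have one, those into the image of \<open>g\<close>. Projective
  modules have them along every \<open>g\<close>; for the modules of the bar resolution they come from the
  projectivity of \<open>A\<close> over \<open>k\<close>, which avoids presenting these modules as direct summands of free ones.
\<close>

definition lifts_along ::
    "('r, 'x) ring_scheme \<Rightarrow> ('r, 'q, 'u) module_scheme \<Rightarrow> ('r, 'n, 'y) module_scheme
      \<Rightarrow> ('r, 'l, 'z) module_scheme \<Rightarrow> ('n \<Rightarrow> 'l) \<Rightarrow> bool"
  where "lifts_along R X N L g \<longleftrightarrow>
    (\<forall>f\<in>linear_maps R X L. f ` carrier X \<subseteq> g ` carrier N \<longrightarrow>
       (\<exists>h\<in>linear_maps R X N. \<forall>x\<in>carrier X. g (h x) = f x))"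

lemma lifts_alongE:
  assumes "lifts_along R X N L g" "f \<in> linear_maps R X L" "\<And>x. x \<in> carrier X \<Longrightarrow> f x \<in> g ` carrier N"
  obtains h where "h \<in> linear_maps R X N" "\<And>x. x \<in> carrier X \<Longrightarrow> g (h x) = f x"
  using assms unfolding lifts_along_def by (metis image_subsetI)

lemma projective_lifts_along:
  assumes X: "projective_module R X" and N: "left_module R N" and L: "abelian_group L"
    and g: "g \<in> linear_maps R N L"
  shows "lifts_along R X N L g"
  unfolding lifts_along_def
proof (intro ballI impI)
  fix f assume f: "f \<in> linear_maps R X L" and im: "f ` carrier X \<subseteq> g ` carrier N"
  let ?I = "L\<lparr>carrier := g ` carrier N\<rparr>"
  obtain h where "h \<in> linear_maps R X N" "\<And>x. x \<in> carrier X \<Longrightarrow> g (h x) = f x"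
  proof (rule projective_module_lift[OF X N left_module_image[OF N L g]])
    show "g \<in> linear_maps R N ?I" "f \<in> linear_maps R X ?I"
      using f g im by (auto simp: linear_maps_def)
  qed auto
  then show "\<exists>h\<in>linear_maps R X N. \<forall>x\<in>carrier X. g (h x) = f x" by blast
qed

text \<open>
  The exactness half of being a projective resolution. It is separated from projectivity because
  on the bar resolution a lifting property takes the place of projectivity. For the enveloping
  algebra it also carries the ring axioms of \<open>A\<^sup>e\<close> and the module axioms of \<open>A\<close>, both inherited from the
  modules of any given resolution.
\<close>

locale exact_complex =
  fixes R :: "('r, 'x) ring_scheme" and M :: "('r, 'm, 'y) module_scheme"
    and P :: "('r, 'p, 'm) aug_complex"
  assumes M_module: "left_module R M"
    and Ch_module: "left_module R (Ch P i)"
    and bd_linear: "bd P (Suc i) \<in> linear_maps R (Ch P (Suc i)) (Ch P i)"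
    and aug_linear: "aug P \<in> linear_maps R (Ch P 0) M"
    and aug_surj: "aug P ` carrier (Ch P 0) = carrier M"
    and aug_kernel: "{x \<in> carrier (Ch P 0). aug P x = \<zero>\<^bsub>M\<^esub>} = bd P (Suc 0) ` carrier (Ch P (Suc 0))"
    and bd_kernel: "{x \<in> carrier (Ch P (Suc i)). bd P (Suc i) x = \<zero>\<^bsub>Ch P i\<^esub>} =
      bd P (Suc (Suc i)) ` carrier (Ch P (Suc (Suc i)))"
begin

sublocale M: left_module R M by (rule M_module)
sublocale Ch: left_module R "Ch P i" for i by (rule Ch_module)
sublocale bd: abelian_group_hom "Ch P (Suc i)" "Ch P i" "bd P (Suc i)" for i
  by (rule linear_maps_additive[OF bd_linear Ch_module Ch_module])
sublocale aug: abelian_group_hom "Ch P 0" M "aug P"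
  by (rule linear_maps_additive[OF aug_linear Ch_module M_module])

lemma bd_bd: "x \<in> carrier (Ch P (Suc (Suc i))) \<Longrightarrow> bd P (Suc i) (bd P (Suc (Suc i)) x) = \<zero>\<^bsub>Ch P i\<^esub>"
  using bd_kernel[of i] by blast

lemma aug_bd: "x \<in> carrier (Ch P (Suc 0)) \<Longrightarrow> aug P (bd P (Suc 0) x) = \<zero>\<^bsub>M\<^esub>"
  using aug_kernel by blast

end

lemma exact_complex_projective_resolution:
  assumes P: "projective_resolution R M P" and "abelian_group M"
  shows "exact_complex R M P"
proof (rule exact_complex.intro)
  have Ch: "left_module R (Ch P i)" for i
    using P by (auto simp: projective_resolution_def projective_module_def)
  have aug: "aug P \<in> linear_maps R (Ch P 0) M" "aug P ` carrier (Ch P 0) = carrier M"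
    using P by (auto simp: projective_resolution_def)
  show "left_module R (Ch P i)" for i by (rule Ch)
  show "left_module R M"
    using left_module_image[OF Ch assms(2) aug(1)] aug(2) by simp
  show "bd P (Suc i) \<in> linear_maps R (Ch P (Suc i)) (Ch P i)" for i
    using P by (auto simp: projective_resolution_def)
  show "{x \<in> carrier (Ch P (Suc i)). bd P (Suc i) x = \<zero>\<^bsub>Ch P i\<^esub>} =
      bd P (Suc (Suc i)) ` carrier (Ch P (Suc (Suc i)))" for i
  proof -
    have "\<forall>i\<ge>1. {x \<in> carrier (Ch P i). bd P i x = \<zero>\<^bsub>Ch P (i - 1)\<^esub>} = bd P (i + 1) ` carrier (Ch P (i + 1))"
      using P by (simp add: projective_resolution_def)
    from this[rule_format, of "Suc i"] show ?thesis by simp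
  qed
  show "{x \<in> carrier (Ch P 0). aug P x = \<zero>\<^bsub>M\<^esub>} = bd P (Suc 0) ` carrier (Ch P (Suc 0))"
    using P by (simp add: projective_resolution_def)
qed (use P in \<open>auto simp: projective_resolution_def\<close>)

definition lifts_through ::
    "('r, 'x) ring_scheme \<Rightarrow> ('r, 'm, 'y) module_scheme \<Rightarrow> ('r, 'q, 'm) aug_complex
      \<Rightarrow> ('r, 'p, 'u) module_scheme \<Rightarrow> bool"
  where "lifts_through R M Q Y \<longleftrightarrow> lifts_along R Y (Ch Q 0) M (aug Q) \<and>
    (\<forall>i. lifts_along R Y (Ch Q (Suc i)) (Ch Q i) (bd Q (Suc i)))"

lemma (in exact_complex) projective_lifts_through:
  "projective_module R Y \<Longrightarrow> lifts_through R M P Y"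
  unfolding lifts_through_def
  by (intro conjI allI projective_lifts_along Ch_module M.M.abelian_group_axioms Ch.M.abelian_group_axioms
      aug_linear bd_linear)

text \<open>
  Comparison maps and the chain maps lifting a cocycle are the instances \<open>m = 0\<close>, \<open>t = aug X\<close> and
  \<open>X = Q\<close> of one notion, so that one homotopy argument serves both.
\<close>

definition lift_over ::
    "('r, 'x) ring_scheme \<Rightarrow> ('r, 'p, 'm) aug_complex \<Rightarrow> ('r, 'q, 'm) aug_complex
      \<Rightarrow> nat \<Rightarrow> ('p \<Rightarrow> 'm) \<Rightarrow> (nat \<Rightarrow> 'p \<Rightarrow> 'q) \<Rightarrow> bool"
  where "lift_over R X Q m t \<tau> \<longleftrightarrow>
    (\<forall>i. \<tau> i \<in> linear_maps R (Ch X (m + i)) (Ch Q i)) \<and>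
    (\<forall>x\<in>carrier (Ch X m). aug Q (\<tau> 0 x) = t x) \<and>
    (\<forall>i. \<forall>x\<in>carrier (Ch X (Suc (m + i))). bd Q (Suc i) (\<tau> (Suc i) x) = \<tau> i (bd X (Suc (m + i)) x))"

lemma lift_overD:
  assumes "lift_over R X Q m t \<tau>"
  shows "\<tau> i \<in> linear_maps R (Ch X (m + i)) (Ch Q i)"
    and "x \<in> carrier (Ch X m) \<Longrightarrow> aug Q (\<tau> 0 x) = t x"
    and "x \<in> carrier (Ch X (Suc (m + i))) \<Longrightarrow> bd Q (Suc i) (\<tau> (Suc i) x) = \<tau> i (bd X (Suc (m + i)) x)"
  using assms by (auto simp: lift_over_def)

lemma all_ge_1_iff: "(\<forall>i\<ge>1. Q i) \<longleftrightarrow> (\<forall>i. Q (Suc i))"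
  by (auto dest: Suc_le_D)

lemma chain_lift_iff_lift_over: "chain_lift R P m t \<tau> \<longleftrightarrow> lift_over R P P m t \<tau>"
  unfolding chain_lift_def lift_over_def all_ge_1_iff by simp

lemma comparison_map_iff_lift_over: "comparison_map R P Q \<phi> \<longleftrightarrow> lift_over R P Q 0 (aug P) \<phi>"
  unfolding comparison_map_def lift_over_def all_ge_1_iff by simp

lemma lift_over_comp:
  assumes \<tau>: "lift_over R X Y m t \<tau>" and \<sigma>: "lift_over R Y Z l s \<sigma>" 
  shows "lift_over R X Z (m + l) (\<lambda>x. s (\<tau> l x)) (\<lambda>i x. \<sigma> i (\<tau> (l + i) x))"
  unfolding lift_over_def
proof (intro conjI allI ballI)
  show "(\<lambda>x. \<sigma> i (\<tau> (l + i) x)) \<in> linear_maps R (Ch X (m + l + i)) (Ch Z i)" for i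
    using linear_maps_comp[OF lift_overD(1)[OF \<tau>, of "l + i"] lift_overD(1)[OF \<sigma>, of i]] by (simp add: add.assoc)
  show "aug Z (\<sigma> 0 (\<tau> (l + 0) x)) = s (\<tau> l x)" if "x \<in> carrier (Ch X (m + l))" for x
    using lift_overD(2)[OF \<sigma>] linear_maps_closed[OF lift_overD(1)[OF \<tau>] that] by simp
  show "bd Z (Suc i) (\<sigma> (Suc i) (\<tau> (l + Suc i) x)) = \<sigma> i (\<tau> (l + i) (bd X (Suc (m + l + i)) x))"
    if x: "x \<in> carrier (Ch X (Suc (m + l + i)))" for i x
  proof -
    have x': "x \<in> carrier (Ch X (Suc (m + (l + i))))" using x by (simp add: add.assoc)
    have "\<tau> (Suc (l + i)) x \<in> carrier (Ch Y (Suc (l + i)))"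
      using linear_maps_closed[OF lift_overD(1)[OF \<tau>, of "Suc (l + i)"]] x' by simp
    then show ?thesis
      using lift_overD(3)[OF \<sigma>] lift_overD(3)[OF \<tau> x'] by (simp add: add.assoc)
  qed
qed

lemma lift_over_cong:
  assumes "lift_over R X Q m t \<tau>" "\<And>x. x \<in> carrier (Ch X m) \<Longrightarrow> t x = t' x"
  shows "lift_over R X Q m t' \<tau>"
  using assms by (simp add: lift_over_def)

lemma lift_over_exists:
  assumes X: "exact_complex R M X" and Q: "exact_complex R M Q"
    and lifts: "\<And>i. lifts_through R M Q (Ch X i)"
    and t: "t \<in> linear_maps R (Ch X m) M"
    and cocycle: "\<And>x. x \<in> carrier (Ch X (Suc m)) \<Longrightarrow> t (bd X (Suc m) x) = \<zero>\<^bsub>M\<^esub>"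
  obtains \<tau> where "lift_over R X Q m t \<tau>"
proof -
  interpret X: exact_complex R M X by fact
  interpret Q: exact_complex R M Q by fact
  have lift: "\<exists>h\<in>linear_maps R (Ch X j) (Ch Q (Suc i)). \<forall>x\<in>carrier (Ch X j). bd Q (Suc i) (h x) = f x"
    if "f \<in> linear_maps R (Ch X j) (Ch Q i)" "f ` carrier (Ch X j) \<subseteq> bd Q (Suc i) ` carrier (Ch Q (Suc i))"
    for f i j
    using lifts[of j] that unfolding lifts_through_def lifts_along_def by blast
  define good where "good i f \<longleftrightarrow> f \<in> linear_maps R (Ch X (m + i)) (Ch Q i) \<and>
    (i = 0 \<longrightarrow> (\<forall>x\<in>carrier (Ch X m). aug Q (f x) = t x)) \<and>
    (\<lambda>x. f (bd X (Suc (m + i)) x)) ` carrier (Ch X (Suc (m + i))) \<subseteq> bd Q (Suc i) ` carrier (Ch Q (Suc i))"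
    for i f
  have "\<exists>\<tau>. \<forall>i. good i (\<tau> i) \<and>
    (\<forall>x\<in>carrier (Ch X (Suc (m + i))). bd Q (Suc i) (\<tau> (Suc i) x) = \<tau> i (bd X (Suc (m + i)) x))"
  proof (rule dependent_nat_choice)
    have "t ` carrier (Ch X m) \<subseteq> aug Q ` carrier (Ch Q 0)"
      using Q.aug_surj linear_maps_closed[OF t] by auto
    then obtain f where f: "f \<in> linear_maps R (Ch X m) (Ch Q 0)"
      and ft: "\<forall>x\<in>carrier (Ch X m). aug Q (f x) = t x"
      using lifts[of m] t unfolding lifts_through_def lifts_along_def by blast
    have "f (bd X (Suc m) x) \<in> bd Q (Suc 0) ` carrier (Ch Q (Suc 0))" if "x \<in> carrier (Ch X (Suc m))" for x
      using ft that cocycle linear_maps_closed[OF f X.bd.hom_closed[OF that]]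
      by (simp flip: Q.aug_kernel)
    then show "\<exists>f. good 0 f" using f ft unfolding good_def by auto
  next
    fix f i assume "good i f"
    then have f: "f \<in> linear_maps R (Ch X (m + i)) (Ch Q i)"
      and im: "(\<lambda>x. f (bd X (Suc (m + i)) x)) ` carrier (Ch X (Suc (m + i))) \<subseteq> bd Q (Suc i) ` carrier (Ch Q (Suc i))"
      by (auto simp: good_def)
    interpret f: abelian_group_hom "Ch X (m + i)" "Ch Q i" f
      by (rule linear_maps_additive[OF f X.Ch_module Q.Ch_module])
    obtain h where h: "h \<in> linear_maps R (Ch X (Suc (m + i))) (Ch Q (Suc i))"
      and hf: "\<forall>x\<in>carrier (Ch X (Suc (m + i))). bd Q (Suc i) (h x) = f (bd X (Suc (m + i)) x)"
      using lift[OF linear_maps_comp[OF X.bd_linear f] im] by blast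
    have "h (bd X (Suc (Suc (m + i))) x) \<in> bd Q (Suc (Suc i)) ` carrier (Ch Q (Suc (Suc i)))"
      if "x \<in> carrier (Ch X (Suc (Suc (m + i))))" for x
      using hf that linear_maps_closed[OF h X.bd.hom_closed[OF that]] X.bd_bd[OF that]
      by (simp flip: Q.bd_kernel)
    then have "good (Suc i) h" using h unfolding good_def by auto
    then show "\<exists>h. good (Suc i) h \<and>
        (\<forall>x\<in>carrier (Ch X (Suc (m + i))). bd Q (Suc i) (h x) = f (bd X (Suc (m + i)) x))"
      using hf by blast
  qed
  then obtain \<tau> where \<tau>: "\<And>i. good i (\<tau> i)"
    "\<And>i x. x \<in> carrier (Ch X (Suc (m + i))) \<Longrightarrow> bd Q (Suc i) (\<tau> (Suc i) x) = \<tau> i (bd X (Suc (m + i)) x)"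
    by blast
  then have "lift_over R X Q m t \<tau>"
    unfolding lift_over_def using \<tau>(1)[of 0] by (auto simp: good_def)
  then show thesis by (rule that)
qed

definition cohomologous ::
    "('r, 'x) ring_scheme \<Rightarrow> ('r, 'm, 'y) module_scheme \<Rightarrow> ('r, 'p, 'm) aug_complex
      \<Rightarrow> nat \<Rightarrow> ('p \<Rightarrow> 'm) \<Rightarrow> ('p \<Rightarrow> 'm) \<Rightarrow> bool"
  where "cohomologous R M X m t t' \<longleftrightarrow> (\<exists>s\<in>linear_maps R (Ch X (m - 1)) M.
    \<forall>x\<in>carrier (Ch X m). t x = t' x \<oplus>\<^bsub>M\<^esub> (if m = 0 then \<zero>\<^bsub>M\<^esub> else s (bd X m x)))"

lemma (in abelian_group) diff_diff_cancel:
  assumes "a \<in> carrier G" "b \<in> carrier G" "c \<in> carrier G"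
  shows "a = b \<oplus> ((a \<ominus> b \<ominus> c) \<oplus> c)"
proof -
  have "(a \<ominus> b \<ominus> c) \<oplus> c = a \<oplus> \<ominus> b" using assms by (simp add: a_minus_def a_assoc l_neg)
  also have "b \<oplus> \<dots> = a \<oplus> (b \<oplus> \<ominus> b)" using assms by (simp add: a_lcomm)
  finally show ?thesis using assms by (simp add: r_neg)
qed

lemma (in abelian_group) plus_diff_diff:
  assumes "b \<in> carrier G" "c \<in> carrier G"
  shows "(b \<oplus> c) \<ominus> b \<ominus> c = \<zero>"
proof -
  have "(b \<oplus> c) \<ominus> b \<ominus> c = (b \<oplus> c) \<oplus> \<ominus> (b \<oplus> c)" using assms by (simp add: a_minus_def a_assoc minus_add)
  then show ?thesis using assms by (simp add: r_neg)
qed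

text \<open>
  The difference of two lifts is killed by the augmentation up to the coboundary \<open>s d\<close>, which is
  corrected by a lift \<open>w\<close> of \<open>s\<close>; from there on the usual null homotopy is built degree by degree,
  the map \<open>h\<close> of one degree being the map \<open>w\<close> of the next. Degree \<open>m + i = 0\<close> has no \<open>w\<close>.
\<close>

lemma lift_over_homotopy:
  assumes X: "exact_complex R M X" and Q: "exact_complex R M Q"
    and lifts: "\<And>i. lifts_through R M Q (Ch X i)"
    and f: "lift_over R X Q m t f" and g: "lift_over R X Q m t' g"
    and coh: "cohomologous R M X m t t'"
  shows "\<exists>h\<in>linear_maps R (Ch X (m + i)) (Ch Q (Suc i)). \<exists>w\<in>linear_maps R (Ch X (m + i - 1)) (Ch Q i).
    \<forall>x\<in>carrier (Ch X (m + i)). f i x = g i x \<oplus>\<^bsub>Ch Q i\<^esub>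
      (bd Q (Suc i) (h x) \<oplus>\<^bsub>Ch Q i\<^esub> (if m + i = 0 then \<zero>\<^bsub>Ch Q i\<^esub> else w (bd X (m + i) x)))"
proof -
  interpret X: exact_complex R M X by fact
  interpret Q: exact_complex R M Q by fact
  have fhom: "abelian_group_hom (Ch X (m + i)) (Ch Q i) (f i)" for i
    by (rule linear_maps_additive[OF lift_overD(1)[OF f] X.Ch_module Q.Ch_module])
  have ghom: "abelian_group_hom (Ch X (m + i)) (Ch Q i) (g i)" for i
    by (rule linear_maps_additive[OF lift_overD(1)[OF g] X.Ch_module Q.Ch_module])
  note fc = abelian_group_hom.hom_closed[OF fhom] and gc = abelian_group_hom.hom_closed[OF ghom]
  have step: "\<exists>h\<in>linear_maps R (Ch X (m + i)) (Ch Q (Suc i)). \<forall>x\<in>carrier (Ch X (m + i)).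
      f i x = g i x \<oplus>\<^bsub>Ch Q i\<^esub> (bd Q (Suc i) (h x) \<oplus>\<^bsub>Ch Q i\<^esub> W x)"
    if W: "W \<in> linear_maps R (Ch X (m + i)) (Ch Q i)"
      and im: "\<And>x. x \<in> carrier (Ch X (m + i)) \<Longrightarrow>
        f i x \<ominus>\<^bsub>Ch Q i\<^esub> g i x \<ominus>\<^bsub>Ch Q i\<^esub> W x \<in> bd Q (Suc i) ` carrier (Ch Q (Suc i))" for W i
  proof -
    have lin: "(\<lambda>x. f i x \<ominus>\<^bsub>Ch Q i\<^esub> g i x \<ominus>\<^bsub>Ch Q i\<^esub> W x) \<in> linear_maps R (Ch X (m + i)) (Ch Q i)"
      by (intro linear_maps_minus W lift_overD(1)[OF f] lift_overD(1)[OF g] X.Ch_module Q.Ch_module)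
    obtain h where h: "h \<in> linear_maps R (Ch X (m + i)) (Ch Q (Suc i))"
      and bh: "\<And>x. x \<in> carrier (Ch X (m + i)) \<Longrightarrow> bd Q (Suc i) (h x) = f i x \<ominus>\<^bsub>Ch Q i\<^esub> g i x \<ominus>\<^bsub>Ch Q i\<^esub> W x"
      using lifts_alongE[OF lifts[of "m + i", unfolded lifts_through_def, THEN conjunct2, rule_format, of i] lin im]
      by blast
    show ?thesis
    proof (intro bexI[OF _ h] ballI)
      fix x assume x: "x \<in> carrier (Ch X (m + i))"
      show "f i x = g i x \<oplus>\<^bsub>Ch Q i\<^esub> (bd Q (Suc i) (h x) \<oplus>\<^bsub>Ch Q i\<^esub> W x)"
        unfolding bh[OF x] by (rule Q.Ch.diff_diff_cancel[OF fc[OF x] gc[OF x] linear_maps_closed[OF W x]])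
    qed
  qed
  show ?thesis
  proof (induction i)
    case 0
    obtain s where s: "s \<in> linear_maps R (Ch X (m - 1)) M"
      and ts: "\<And>x. x \<in> carrier (Ch X m) \<Longrightarrow> t x = t' x \<oplus>\<^bsub>M\<^esub> (if m = 0 then \<zero>\<^bsub>M\<^esub> else s (bd X m x))"
      using coh unfolding cohomologous_def by blast
    have s_im: "s x \<in> aug Q ` carrier (Ch Q 0)" if "x \<in> carrier (Ch X (m - 1))" for x
      unfolding Q.aug_surj using linear_maps_closed[OF s that] .
    obtain w where w: "w \<in> linear_maps R (Ch X (m - 1)) (Ch Q 0)"
      and ws: "\<And>x. x \<in> carrier (Ch X (m - 1)) \<Longrightarrow> aug Q (w x) = s x"
      using lifts_alongE[OF lifts[of "m - 1", unfolded lifts_through_def, THEN conjunct1] s s_im] by blast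
    define W where "W x = (if m = 0 then \<zero>\<^bsub>Ch Q 0\<^esub> else w (bd X m x))" for x
    have W: "W \<in> linear_maps R (Ch X (m + 0)) (Ch Q 0)"
      and Ws: "\<And>x. x \<in> carrier (Ch X m) \<Longrightarrow> aug Q (W x) = (if m = 0 then \<zero>\<^bsub>M\<^esub> else s (bd X m x))"
    proof -
      show "W \<in> linear_maps R (Ch X (m + 0)) (Ch Q 0)"
      proof (cases m)
        case 0
        then show ?thesis using linear_maps_zero[OF X.Ch_module Q.Ch_module] by (simp add: W_def[abs_def])
      next
        case (Suc j)
        then show ?thesis using linear_maps_comp[OF X.bd_linear, of w j] w by (simp add: W_def[abs_def])
      qed
      show "aug Q (W x) = (if m = 0 then \<zero>\<^bsub>M\<^esub> else s (bd X m x))" if "x \<in> carrier (Ch X m)" for x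
        using ws[of "bd X m x"] X.bd.hom_closed[of x "m - 1"] that by (cases m) (simp_all add: W_def)
    qed
    have "f 0 x \<ominus>\<^bsub>Ch Q 0\<^esub> g 0 x \<ominus>\<^bsub>Ch Q 0\<^esub> W x \<in> bd Q (Suc 0) ` carrier (Ch Q (Suc 0))"
      if x: "x \<in> carrier (Ch X (m + 0))" for x
    proof -
      note c = fc[OF x] gc[OF x] linear_maps_closed[OF W x]
      have "t' x \<in> carrier M" using x lift_overD(2)[OF g, of x] Q.aug.hom_closed[OF c(2)] by simp
      moreover have "aug Q (W x) \<in> carrier M" using Q.aug.hom_closed[OF c(3)] .
      moreover have "aug Q (f 0 x) = t' x \<oplus>\<^bsub>M\<^esub> aug Q (W x)"
        using x lift_overD(2)[OF f, of x] ts[of x] Ws[of x] by simp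
      ultimately have "aug Q (f 0 x \<ominus>\<^bsub>Ch Q 0\<^esub> g 0 x \<ominus>\<^bsub>Ch Q 0\<^esub> W x) = \<zero>\<^bsub>M\<^esub>"
        using x c lift_overD(2)[OF g, of x] X.M.M.plus_diff_diff[of "t' x" "aug Q (W x)"]
        by (simp add: Q.aug.hom_diff)
      then show ?thesis using c by (simp flip: Q.aug_kernel)
    qed
    from step[OF W this] show ?case using w unfolding W_def by fastforce
  next
    case (Suc i)
    obtain h w where h: "h \<in> linear_maps R (Ch X (m + i)) (Ch Q (Suc i))"
      and w: "w \<in> linear_maps R (Ch X (m + i - 1)) (Ch Q i)"
      and fg: "\<And>x. x \<in> carrier (Ch X (m + i)) \<Longrightarrow> f i x = g i x \<oplus>\<^bsub>Ch Q i\<^esub>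
        (bd Q (Suc i) (h x) \<oplus>\<^bsub>Ch Q i\<^esub> (if m + i = 0 then \<zero>\<^bsub>Ch Q i\<^esub> else w (bd X (m + i) x)))"
      using Suc by blast
    define W where "W x = h (bd X (Suc (m + i)) x)" for x
    have W: "W \<in> linear_maps R (Ch X (m + Suc i)) (Ch Q (Suc i))"
      unfolding W_def using linear_maps_comp[OF X.bd_linear h] by simp
    have "f (Suc i) x \<ominus>\<^bsub>Ch Q (Suc i)\<^esub> g (Suc i) x \<ominus>\<^bsub>Ch Q (Suc i)\<^esub> W x \<in> bd Q (Suc (Suc i)) ` carrier (Ch Q (Suc (Suc i)))"
      if x: "x \<in> carrier (Ch X (m + Suc i))" for x
    proof -
      note c = fc[OF x] gc[OF x] linear_maps_closed[OF W x]
      have x': "x \<in> carrier (Ch X (Suc (m + i)))" using x by simp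
      define y where "y = bd X (Suc (m + i)) x"
      have y: "y \<in> carrier (Ch X (m + i))" unfolding y_def using x' by simp
      have "(if m + i = 0 then \<zero>\<^bsub>Ch Q i\<^esub> else w (bd X (m + i) y)) = \<zero>\<^bsub>Ch Q i\<^esub>"
      proof (cases "m + i")
        case (Suc j)
        interpret w: abelian_group_hom "Ch X j" "Ch Q i" w
          using linear_maps_additive[OF w X.Ch_module Q.Ch_module] Suc by simp
        show ?thesis using X.bd_bd[of x j] x' Suc by (simp add: y_def)
      qed simp
      then have fy: "f i y = g i y \<oplus>\<^bsub>Ch Q i\<^esub> bd Q (Suc i) (h y)"
        using fg[OF y] linear_maps_closed[OF h y] by simp
      have "bd Q (Suc i) (f (Suc i) x \<ominus>\<^bsub>Ch Q (Suc i)\<^esub> g (Suc i) x \<ominus>\<^bsub>Ch Q (Suc i)\<^esub> W x) =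
          f i y \<ominus>\<^bsub>Ch Q i\<^esub> g i y \<ominus>\<^bsub>Ch Q i\<^esub> bd Q (Suc i) (h y)"
        using c lift_overD(3)[OF f x'] lift_overD(3)[OF g x'] by (simp add: Q.bd.hom_diff W_def y_def)
      also have "\<dots> = \<zero>\<^bsub>Ch Q i\<^esub>"
        unfolding fy by (rule Q.Ch.plus_diff_diff) (use gc[OF y] linear_maps_closed[OF h y] in auto)
      finally show ?thesis using c by (simp flip: Q.bd_kernel)
    qed
    from step[OF W this] show ?case using h unfolding W_def by fastforce
  qed
qed

section \<open>Homology and cohomology classes\<close>

lemma abelian_group_subgroup:
  assumes "abelian_group G" and Z: "subgroup Z (add_monoid G)"
  shows "abelian_group (G\<lparr>carrier := Z\<rparr>)"
proof -
  interpret G: abelian_group G by fact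
  note Zc = subgroup.mem_carrier[OF Z, simplified]
  show ?thesis
  proof (rule abelian_groupI)
    fix x assume x: "x \<in> carrier (G\<lparr>carrier := Z\<rparr>)"
    then show "\<exists>y\<in>carrier (G\<lparr>carrier := Z\<rparr>). y \<oplus>\<^bsub>G\<lparr>carrier := Z\<rparr>\<^esub> x = \<zero>\<^bsub>G\<lparr>carrier := Z\<rparr>\<^esub>"
      using subgroup.m_inv_closed[OF Z, of x] Zc[of x]
      by (intro bexI[of _ "\<ominus>\<^bsub>G\<^esub> x"]) (auto simp: G.l_neg a_inv_def)
  qed (use subgroup.m_closed[OF Z] subgroup.one_closed[OF Z] Zc in \<open>auto simp: G.a_ac\<close>)
qed

lemma carrier_quotient:
  "carrier (additive_group (G\<lparr>carrier := Z\<rparr> A_Mod B)) = (\<lambda>z. B +>\<^bsub>G\<^esub> z) ` Z"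
  by (auto simp: additive_group_def A_FactGroup_def FactGroup_def RCOSETS_def a_r_coset_def r_coset_def)

lemma coset_additive:
  assumes G: "abelian_group G" and Z: "subgroup Z (add_monoid G)" and B: "subgroup B (add_monoid G)" "B \<subseteq> Z"
  shows "abelian_group_hom (G\<lparr>carrier := Z\<rparr>) (additive_group (G\<lparr>carrier := Z\<rparr> A_Mod B)) (\<lambda>z. B +>\<^bsub>G\<^esub> z)"
proof -
  interpret G: abelian_group G by fact
  interpret GZ: abelian_group "G\<lparr>carrier := Z\<rparr>" by (rule abelian_group_subgroup[OF G Z])
  have "subgroup B (add_monoid (G\<lparr>carrier := Z\<rparr>))"
  proof (rule GZ.add.subgroupI)
    show "B \<noteq> {}" using subgroup.one_closed[OF B(1)] by auto
    fix a assume a: "a \<in> B"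
    then have "a \<in> Z" using B(2) by auto
    then have "\<ominus>\<^bsub>G\<lparr>carrier := Z\<rparr>\<^esub> a = \<ominus>\<^bsub>G\<^esub> a"
      using subgroup.m_inv_closed[OF Z] subgroup.mem_carrier[OF Z]
      by (intro GZ.minus_equality) (auto simp: G.l_neg a_inv_def)
    then show "\<ominus>\<^bsub>G\<lparr>carrier := Z\<rparr>\<^esub> a \<in> B" using subgroup.m_inv_closed[OF B(1) a] by (simp add: a_inv_def)
  next
    fix a b assume "a \<in> B" "b \<in> B"
    then show "a \<oplus>\<^bsub>G\<lparr>carrier := Z\<rparr>\<^esub> b \<in> B" using subgroup.m_closed[OF B(1)] by simp
  qed (use B(2) in simp)
  then have sub: "abelian_subgroup B (G\<lparr>carrier := Z\<rparr>)"
    by (intro abelian_subgroupI3 additive_subgroupI GZ.abelian_group_axioms)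
  have coset: "B +>\<^bsub>G\<lparr>carrier := Z\<rparr>\<^esub> z = B +>\<^bsub>G\<^esub> z" for z
    by (simp add: a_r_coset_def r_coset_def)
  have "(\<lambda>z. B +>\<^bsub>G\<^esub> z) \<in> hom (add_monoid (G\<lparr>carrier := Z\<rparr>)) (G\<lparr>carrier := Z\<rparr> A_Mod B)"
    using abelian_subgroup.a_r_coset_hom_A_Mod[OF sub] by (simp add: coset)
  then have "(\<lambda>z. B +>\<^bsub>G\<^esub> z) \<in> hom (add_monoid (G\<lparr>carrier := Z\<rparr>)) (add_monoid (additive_group (G\<lparr>carrier := Z\<rparr> A_Mod B)))"
    by (simp add: additive_group_def hom_def)
  then show ?thesis
    by (intro additive_hom GZ.abelian_group_axioms abelian_group_additive_group
          abelian_subgroup.a_factorgroup_is_comm_group[OF sub])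
qed

lemma add_pow_subgroup:
  assumes G: "abelian_group G" and Z: "subgroup Z (add_monoid G)" and z: "z \<in> Z"
  shows "[(n::int)] \<cdot>\<^bsub>G\<lparr>carrier := Z\<rparr>\<^esub> z = [n] \<cdot>\<^bsub>G\<^esub> z"
proof -
  interpret inc: abelian_group_hom "G\<lparr>carrier := Z\<rparr>" G "\<lambda>x. x"
    using subgroup.mem_carrier[OF Z] by (intro additiveI abelian_group_subgroup[OF G Z] G) auto
  show ?thesis using inc.hom_add_pow[of z n] z by simp
qed

context assoc_algebra
begin

abbreviation "env \<equiv> enveloping k A"
abbreviation "resolves P \<equiv> exact_complex (enveloping k A) (left_regular k A) P"

lemma abelian_group_left_regular: "abelian_group (left_regular k A)"
  by (rule abelian_groupI)
     (auto simp: left_regular_def M.a_ac intro: M.add.l_inv_ex)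

lemma abelian_group_right_regular: "abelian_group (right_regular k A)"
  by (rule abelian_groupI)
     (auto simp: right_regular_def M.a_ac intro: M.add.l_inv_ex)

lemma right_regular_smult_closed:
  assumes "r \<in> carrier env" "x \<in> carrier A"
  shows "r \<odot>\<^bsub>right_regular k A\<^esub> x \<in> carrier A"
proof -
  have "induced A (\<lambda>(a, c). c \<otimes>\<^bsub>A\<^esub> x \<otimes>\<^bsub>A\<^esub> a) \<in> hom (add_monoid (tensor k A A)) (add_monoid A)"
    by (rule B.induced_balanced(1)[OF M.abelian_group_axioms])
       (use assms(2) in \<open>simp_all add: A.l_distr A.r_distr smult_assoc_left smult_assoc_right\<close>)
  then show ?thesis using assms(1) by (simp add: right_regular_def enveloping_def hom_def Pi_iff)
qed

lemma balanced_pair_right_regular: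
  "left_module env Y \<Longrightarrow> balanced_pair env Y (right_regular k A)"
  using right_regular_smult_closed abelian_group_right_regular
  by (intro balanced_pair.intro balanced_pair_axioms.intro) (auto simp: right_regular_def)

lemma balanced_pair_chains: "resolves P \<Longrightarrow> balanced_pair env (Ch P n) (right_regular k A)"
  by (intro balanced_pair_right_regular exact_complex.Ch_module)

lemma abelian_group_chains: "resolves P \<Longrightarrow> abelian_group (chains k A P n)"
  unfolding chains_def by (rule balanced_pair.abelian_group_tensor[OF balanced_pair_chains])

lemma chain_map_additive:
  assumes "resolves X" "resolves Q" "f \<in> linear_maps env (Ch X j) (Ch Q n)"
  shows "abelian_group_hom (chains k A X j) (chains k A Q n) (chain_map k A Q n f)"
  unfolding chains_def chain_map_def
  by (rule tensor_map_additive[OF balanced_pair_chains[OF assms(1)] balanced_pair_chains[OF assms(2)] assms(3)])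

lemma chain_map_comp:
  assumes "resolves X" "resolves Y" "resolves Z" "f \<in> linear_maps env (Ch X i) (Ch Y j)"
    "g \<in> linear_maps env (Ch Y j) (Ch Z n)" "z \<in> carrier (chains k A X i)"
  shows "chain_map k A Z n g (chain_map k A Y j f z) = chain_map k A Z n (\<lambda>x. g (f x)) z"
  unfolding chain_map_def
  by (rule tensor_map_comp[OF balanced_pair_chains[OF assms(1)] balanced_pair_chains[OF assms(2)]
        balanced_pair_chains[OF assms(3)] assms(4,5) assms(6)[unfolded chains_def]])

lemma chain_map_cong:
  assumes "resolves X" "resolves Y" "f \<in> linear_maps env (Ch X i) (Ch Y j)"
    "\<And>x. x \<in> carrier (Ch X i) \<Longrightarrow> f x = g x" "z \<in> carrier (chains k A X i)"
  shows "chain_map k A Y j f z = chain_map k A Y j g z"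
  unfolding chain_map_def
  by (rule tensor_map_cong[OF balanced_pair_chains[OF assms(1)] balanced_pair_chains[OF assms(2)]
        assms(3,4) assms(5)[unfolded chains_def]])

lemma chain_map_plus:
  assumes "resolves X" "resolves Y" "f \<in> linear_maps env (Ch X i) (Ch Y j)" "g \<in> linear_maps env (Ch X i) (Ch Y j)"
    "z \<in> carrier (chains k A X i)"
  shows "chain_map k A Y j (\<lambda>x. f x \<oplus>\<^bsub>Ch Y j\<^esub> g x) z = chain_map k A Y j f z \<oplus>\<^bsub>chains k A Y j\<^esub> chain_map k A Y j g z"
  unfolding chain_map_def chains_def
  by (rule tensor_map_plus[OF balanced_pair_chains[OF assms(1)] balanced_pair_chains[OF assms(2)]
        assms(3,4) assms(5)[unfolded chains_def]])

lemma chain_map_int_multiple: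
  assumes "resolves X" "resolves Y" "f \<in> linear_maps env (Ch X i) (Ch Y j)" "z \<in> carrier (chains k A X i)"
  shows "chain_map k A Y j (\<lambda>x. [(n::int)] \<cdot>\<^bsub>Ch Y j\<^esub> f x) z = [n] \<cdot>\<^bsub>chains k A Y j\<^esub> chain_map k A Y j f z"
  unfolding chain_map_def chains_def
  by (rule tensor_map_int_multiple[OF balanced_pair_chains[OF assms(1)] balanced_pair_chains[OF assms(2)]
        assms(3) assms(4)[unfolded chains_def]])

lemma chain_map_eq_zero:
  assumes "resolves X" "resolves Y" "f \<in> linear_maps env (Ch X i) (Ch Y j)"
    "\<And>x. x \<in> carrier (Ch X i) \<Longrightarrow> f x = \<zero>\<^bsub>Ch Y j\<^esub>" "z \<in> carrier (chains k A X i)"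
  shows "chain_map k A Y j f z = \<zero>\<^bsub>chains k A Y j\<^esub>"
  unfolding chain_map_def chains_def
  by (rule tensor_map_eq_zero[OF balanced_pair_chains[OF assms(1)] balanced_pair_chains[OF assms(2)]
        assms(3,4) assms(5)[unfolded chains_def]])

lemma chain_diff_Suc: "chain_diff k A P (Suc n) = chain_map k A P n (bd P (Suc n))"
  by (simp add: chain_diff_def)

lemma chain_diff_additive:
  "resolves P \<Longrightarrow> abelian_group_hom (chains k A P (Suc n)) (chains k A P n) (chain_diff k A P (Suc n))"
  unfolding chain_diff_Suc by (intro chain_map_additive exact_complex.bd_linear)

lemma chain_diff_diff:
  assumes P: "resolves P" and z: "z \<in> carrier (chains k A P (Suc (Suc n)))"
  shows "chain_diff k A P (Suc n) (chain_diff k A P (Suc (Suc n)) z) = \<zero>\<^bsub>chains k A P n\<^esub>"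
proof -
  interpret P: exact_complex "enveloping k A" "left_regular k A" P by fact
  show ?thesis
    unfolding chain_diff_Suc chain_map_comp[OF P P P P.bd_linear P.bd_linear z]
    by (rule chain_map_eq_zero[OF P P linear_maps_comp[OF P.bd_linear P.bd_linear] P.bd_bd z])
qed

lemma HH_cycles_iff:
  "z \<in> HH_cycles k A P n \<longleftrightarrow> z \<in> carrier (chains k A P n) \<and>
    (\<forall>j. n = Suc j \<longrightarrow> chain_diff k A P n z = \<zero>\<^bsub>chains k A P j\<^esub>)"
  by (cases n) (auto simp: HH_cycles_def cycles_def)

lemma subgroup_HH_cycles:
  assumes P: "resolves P"
  shows "subgroup (HH_cycles k A P n) (add_monoid (chains k A P n))"
proof (cases n)
  case 0
  interpret C: abelian_group "chains k A P n" by (rule abelian_group_chains[OF P])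
  have "HH_cycles k A P n = carrier (chains k A P n)" using 0 by (auto simp: HH_cycles_iff)
  then show ?thesis using C.add.subgroup_self by simp
next
  case (Suc j)
  interpret d: abelian_group_hom "chains k A P n" "chains k A P j" "chain_diff k A P n"
    unfolding Suc by (rule chain_diff_additive[OF P])
  have "HH_cycles k A P n = a_kernel (chains k A P n) (chains k A P j) (chain_diff k A P n)"
    using Suc by (auto simp: HH_cycles_iff a_kernel_def')
  then show ?thesis using additive_subgroup.a_subgroup[OF d.additive_subgroup_a_kernel] by simp
qed

abbreviation "HH_boundaries P n \<equiv> boundaries (chains k A P) (chain_diff k A P) n"

lemma subgroup_HH_boundaries:
  assumes P: "resolves P"
  shows "subgroup (HH_boundaries P n) (add_monoid (chains k A P n))"
  unfolding boundaries_def
  using group_hom.img_is_subgroup[OF abelian_group_hom.a_group_hom[OF chain_diff_additive[OF P]], of n] by simp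

lemma HH_boundaries_cycles:
  assumes P: "resolves P"
  shows "HH_boundaries P n \<subseteq> HH_cycles k A P n"
proof
  fix b assume "b \<in> HH_boundaries P n"
  then obtain y where y: "y \<in> carrier (chains k A P (Suc n))" "b = chain_diff k A P (Suc n) y"
    by (auto simp: boundaries_def)
  then show "b \<in> HH_cycles k A P n"
    using abelian_group_hom.hom_closed[OF chain_diff_additive[OF P] y(1)] chain_diff_diff[OF P, of y]
    by (auto simp: HH_cycles_iff)
qed

lemma HH_class_additive:
  "resolves P \<Longrightarrow>
    abelian_group_hom ((chains k A P n)\<lparr>carrier := HH_cycles k A P n\<rparr>) (HH k A P n) (HH_class k A P n)"
  using coset_additive[OF abelian_group_chains subgroup_HH_cycles subgroup_HH_boundaries HH_boundaries_cycles]
  unfolding HH_def homology_def HH_class_def HH_cycles_def by blast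

lemma carrier_HH: "carrier (HH k A P n) = HH_class k A P n ` HH_cycles k A P n"
  unfolding HH_def homology_def carrier_quotient HH_class_def HH_cycles_def ..

lemma abelian_group_HH: "resolves P \<Longrightarrow> abelian_group (HH k A P n)"
  using HH_class_additive abelian_group_hom.axioms(2) by blast

lemma HH_class_int_multiple:
  assumes P: "resolves P" and z: "z \<in> HH_cycles k A P n"
  shows "[(j::int)] \<cdot>\<^bsub>HH k A P n\<^esub> HH_class k A P n z = HH_class k A P n ([j] \<cdot>\<^bsub>chains k A P n\<^esub> z)"
proof -
  interpret c: abelian_group_hom "(chains k A P n)\<lparr>carrier := HH_cycles k A P n\<rparr>" "HH k A P n" "HH_class k A P n"
    by (rule HH_class_additive[OF P])
  show ?thesis
    using c.hom_add_pow[of z j] z add_pow_subgroup[OF abelian_group_chains[OF P] subgroup_HH_cycles[OF P] z] by simp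
qed

lemma HH_cycles_int_multiple:
  assumes P: "resolves P" and z: "z \<in> HH_cycles k A P n"
  shows "[(j::int)] \<cdot>\<^bsub>chains k A P n\<^esub> z \<in> HH_cycles k A P n"
proof -
  interpret c: abelian_group "(chains k A P n)\<lparr>carrier := HH_cycles k A P n\<rparr>"
    by (rule abelian_group_subgroup[OF abelian_group_chains[OF P] subgroup_HH_cycles[OF P]])
  show ?thesis
    using c.add.int_pow_closed[of z j] z add_pow_subgroup[OF abelian_group_chains[OF P] subgroup_HH_cycles[OF P] z] by simp
qed

lemma HH_class_eqI:
  assumes P: "resolves P" and "z \<in> carrier (chains k A P n)" "b \<in> HH_boundaries P n"
  shows "HH_class k A P n (b \<oplus>\<^bsub>chains k A P n\<^esub> z) = HH_class k A P n z"
proof -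
  interpret C: abelian_group "chains k A P n" by (rule abelian_group_chains[OF P])
  show ?thesis
    unfolding HH_class_def
    using assms subgroup.subset[OF subgroup_HH_boundaries[OF P]]
    by (intro C.a_repr_independence[symmetric] subgroup_HH_boundaries[OF P] C.a_rcosI) auto
qed

lemma mem_HH_class:
  "z' \<in> HH_class k A P n z \<longleftrightarrow> (\<exists>b\<in>HH_boundaries P n. z' = b \<oplus>\<^bsub>chains k A P n\<^esub> z)"
  by (auto simp: HH_class_def a_r_coset_def r_coset_def)

lemma HH_class_self:
  assumes P: "resolves P" and z: "z \<in> carrier (chains k A P n)"
  shows "z \<in> HH_class k A P n z"
  using subgroup.one_closed[OF subgroup_HH_boundaries[OF P]] abelian_group.axioms(1)[OF abelian_group_chains[OF P]] z
  unfolding mem_HH_class by (intro bexI[of _ "\<zero>\<^bsub>chains k A P n\<^esub>"]) (auto simp: abelian_monoid.l_zero)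

lemma chain_map_lift_boundary:
  assumes X: "resolves X" and Q: "resolves Q" and f: "lift_over env X Q m t f"
    and y: "y \<in> carrier (chains k A X (Suc (m + i)))"
  shows "chain_map k A Q i (f i) (chain_diff k A X (Suc (m + i)) y) =
    chain_diff k A Q (Suc i) (chain_map k A Q (Suc i) (f (Suc i)) y)"
proof -
  have f': "f (Suc i) \<in> linear_maps env (Ch X (Suc (m + i))) (Ch Q (Suc i))"
    using lift_overD(1)[OF f, of "Suc i"] by simp
  note bX = exact_complex.bd_linear[OF X, of "m + i"] and bQ = exact_complex.bd_linear[OF Q, of i]
  show ?thesis
    unfolding chain_diff_Suc chain_map_comp[OF X X Q bX lift_overD(1)[OF f] y] chain_map_comp[OF X Q Q f' bQ y]
    by (rule chain_map_cong[OF X Q linear_maps_comp[OF bX lift_overD(1)[OF f]] _ y]) (simp add: lift_overD(3)[OF f])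
qed

lemma chain_map_lift_cycle:
  assumes X: "resolves X" and Q: "resolves Q" and f: "lift_over env X Q m t f"
    and z: "z \<in> HH_cycles k A X (m + i)"
  shows "chain_map k A Q i (f i) z \<in> HH_cycles k A Q i"
  unfolding HH_cycles_iff
proof (intro conjI allI impI)
  have zc: "z \<in> carrier (chains k A X (m + i))" using z by (simp add: HH_cycles_iff)
  show "chain_map k A Q i (f i) z \<in> carrier (chains k A Q i)"
    by (rule abelian_group_hom.hom_closed[OF chain_map_additive[OF X Q lift_overD(1)[OF f]] zc])
  fix j assume i: "i = Suc j"
  have "chain_diff k A Q (Suc j) (chain_map k A Q (Suc j) (f (Suc j)) z) =
      chain_map k A Q j (f j) (chain_diff k A X (Suc (m + j)) z)"
    using chain_map_lift_boundary[OF X Q f, of z j] zc i by simp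
  also have "chain_diff k A X (Suc (m + j)) z = \<zero>\<^bsub>chains k A X (m + j)\<^esub>"
    using z i by (simp add: HH_cycles_iff)
  also have "chain_map k A Q j (f j) \<dots> = \<zero>\<^bsub>chains k A Q j\<^esub>"
    by (rule abelian_group_hom.hom_zero[OF chain_map_additive[OF X Q lift_overD(1)[OF f]]])
  finally show "chain_diff k A Q i (chain_map k A Q i (f i) z) = \<zero>\<^bsub>chains k A Q j\<^esub>" using i by simp
qed

text \<open>
  All the well-definedness statements below, those of the identification of the homologies of two
  resolutions and of the two products, are instances of this one.
\<close>

lemma HH_class_lift_eq:
  assumes X: "resolves X" and Q: "resolves Q"
    and lifts: "\<And>i. lifts_through env (left_regular k A) Q (Ch X i)"
    and f: "lift_over env X Q m t f" and g: "lift_over env X Q m t' g"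
    and coh: "cohomologous env (left_regular k A) X m t t'"
    and z: "z \<in> HH_cycles k A X (m + i)" and z': "z' \<in> HH_class k A X (m + i) z"
  shows "HH_class k A Q i (chain_map k A Q i (f i) z') = HH_class k A Q i (chain_map k A Q i (g i) z)"
proof -
  interpret X: exact_complex "enveloping k A" "left_regular k A" X by fact
  interpret Q: exact_complex "enveloping k A" "left_regular k A" Q by fact
  interpret CQ: abelian_group "chains k A Q i" by (rule abelian_group_chains[OF Q])
  let ?fi = "chain_map k A Q i (f i)" and ?gi = "chain_map k A Q i (g i)"
  interpret f: abelian_group_hom "chains k A X (m + i)" "chains k A Q i" ?fi
    by (rule chain_map_additive[OF X Q lift_overD(1)[OF f]])
  interpret g: abelian_group_hom "chains k A X (m + i)" "chains k A Q i" ?gi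
    by (rule chain_map_additive[OF X Q lift_overD(1)[OF g]])
  have zc: "z \<in> carrier (chains k A X (m + i))" using z by (simp add: HH_cycles_iff)
  have dc: "chain_diff k A Q (Suc i) y \<in> HH_boundaries Q i" if "y \<in> carrier (chains k A Q (Suc i))" for y
    using that by (auto simp: boundaries_def)
  obtain y where y: "y \<in> carrier (chains k A X (Suc (m + i)))"
    and z'y: "z' = chain_diff k A X (Suc (m + i)) y \<oplus>\<^bsub>chains k A X (m + i)\<^esub> z"
    using z' by (auto simp: mem_HH_class boundaries_def)
  have "?fi z' = ?fi (chain_diff k A X (Suc (m + i)) y) \<oplus>\<^bsub>chains k A Q i\<^esub> ?fi z"
    unfolding z'y using zc abelian_group_hom.hom_closed[OF chain_diff_additive[OF X] y] by simp
  moreover have "?fi (chain_diff k A X (Suc (m + i)) y) \<in> HH_boundaries Q i"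
    unfolding chain_map_lift_boundary[OF X Q f y]
    using lift_overD(1)[OF f, of "Suc i"]
    by (intro dc abelian_group_hom.hom_closed[OF chain_map_additive[OF X Q] y]) simp
  ultimately have 1: "HH_class k A Q i (?fi z') = HH_class k A Q i (?fi z)"
    using HH_class_eqI[OF Q, of "?fi z"] zc by simp
  obtain h w where h: "h \<in> linear_maps env (Ch X (m + i)) (Ch Q (Suc i))"
    and w: "w \<in> linear_maps env (Ch X (m + i - 1)) (Ch Q i)"
    and fg: "\<And>x. x \<in> carrier (Ch X (m + i)) \<Longrightarrow> f i x = g i x \<oplus>\<^bsub>Ch Q i\<^esub>
      (bd Q (Suc i) (h x) \<oplus>\<^bsub>Ch Q i\<^esub> (if m + i = 0 then \<zero>\<^bsub>Ch Q i\<^esub> else w (bd X (m + i) x)))"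
    using lift_over_homotopy[OF X Q lifts f g coh, of i] by blast
  define W where "W x = (if m + i = 0 then \<zero>\<^bsub>Ch Q i\<^esub> else w (bd X (m + i) x))" for x
  have W: "W \<in> linear_maps env (Ch X (m + i)) (Ch Q i)" and Wz: "chain_map k A Q i W z = \<zero>\<^bsub>chains k A Q i\<^esub>"
  proof -
    show W: "W \<in> linear_maps env (Ch X (m + i)) (Ch Q i)"
    proof (cases "m + i")
      case 0
      then show ?thesis using linear_maps_zero[OF X.Ch_module Q.Ch_module] by (simp add: W_def[abs_def])
    next
      case (Suc j)
      then show ?thesis using linear_maps_comp[OF X.bd_linear, of w j] w by (simp add: W_def[abs_def])
    qed
    show "chain_map k A Q i W z = \<zero>\<^bsub>chains k A Q i\<^esub>"
    proof (cases "m + i")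
      case 0
      then show ?thesis by (intro chain_map_eq_zero[OF X Q W _ zc]) (simp add: W_def)
    next
      case (Suc j)
      have w': "w \<in> linear_maps env (Ch X j) (Ch Q i)" using w Suc by simp
      have zc': "z \<in> carrier (chains k A X (Suc j))" using zc Suc by simp
      have "chain_map k A Q i W z = chain_map k A Q i w (chain_diff k A X (Suc j) z)"
        unfolding chain_diff_Suc chain_map_comp[OF X X Q X.bd_linear w' zc']
        by (rule chain_map_cong[OF X Q W _ zc]) (simp add: W_def Suc)
      also have "chain_diff k A X (Suc j) z = \<zero>\<^bsub>chains k A X j\<^esub>" using z Suc by (simp add: HH_cycles_iff)
      finally show ?thesis using abelian_group_hom.hom_zero[OF chain_map_additive[OF X Q w']] by simp
    qed
  qed
  have bh: "(\<lambda>x. bd Q (Suc i) (h x)) \<in> linear_maps env (Ch X (m + i)) (Ch Q i)"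
    by (rule linear_maps_comp[OF h Q.bd_linear])
  have hz: "chain_map k A Q (Suc i) h z \<in> carrier (chains k A Q (Suc i))"
    by (rule abelian_group_hom.hom_closed[OF chain_map_additive[OF X Q h] zc])
  have "?fi z = chain_map k A Q i (\<lambda>x. g i x \<oplus>\<^bsub>Ch Q i\<^esub> (bd Q (Suc i) (h x) \<oplus>\<^bsub>Ch Q i\<^esub> W x)) z"
    by (rule chain_map_cong[OF X Q lift_overD(1)[OF f] _ zc]) (simp add: fg W_def)
  also have "\<dots> = ?gi z \<oplus>\<^bsub>chains k A Q i\<^esub> (chain_diff k A Q (Suc i) (chain_map k A Q (Suc i) h z)
      \<oplus>\<^bsub>chains k A Q i\<^esub> \<zero>\<^bsub>chains k A Q i\<^esub>)"
    unfolding chain_map_plus[OF X Q lift_overD(1)[OF g] linear_maps_plus[OF bh W X.Ch_module Q.Ch_module] zc]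
      chain_map_plus[OF X Q bh W zc] Wz chain_diff_Suc chain_map_comp[OF X Q Q h Q.bd_linear zc] ..
  also have "\<dots> = chain_diff k A Q (Suc i) (chain_map k A Q (Suc i) h z) \<oplus>\<^bsub>chains k A Q i\<^esub> ?gi z"
    using zc abelian_group_hom.hom_closed[OF chain_diff_additive[OF Q] hz] by (simp add: CQ.a_comm)
  finally have "HH_class k A Q i (?fi z) = HH_class k A Q i (?gi z)"
    using HH_class_eqI[OF Q g.hom_closed[OF zc] dc[OF hz]] by simp
  with 1 show ?thesis by simp
qed

lemma cohomologous_refl:
  assumes X: "resolves X" and t: "t \<in> linear_maps env (Ch X m) (left_regular k A)"
  shows "cohomologous env (left_regular k A) X m t t"
proof -
  interpret X: exact_complex "enveloping k A" "left_regular k A" X by fact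
  show ?thesis
    unfolding cohomologous_def using linear_maps_closed[OF t]
    by (intro bexI[OF _ linear_maps_zero[OF X.Ch_module X.M_module]]) (auto simp: X.M.M.r_zero)
qed

lemma HH_ident_class:
  assumes P: "resolves P" and Q: "resolves Q"
    and lifts: "\<And>i. lifts_through env (left_regular k A) Q (Ch P i)"
    and \<phi>: "comparison_map env P Q \<phi>" and z: "z \<in> HH_cycles k A P n"
  shows "HH_ident k A P Q n (HH_class k A P n z) = HH_class k A Q n (chain_map k A Q n (\<phi> n) z)"
  unfolding HH_ident_def
proof (rule the_equality)
  have zc: "z \<in> carrier (chains k A P n)" using z by (simp add: HH_cycles_iff)
  show "\<exists>\<phi>' z'. comparison_map env P Q \<phi>' \<and> z' \<in> HH_class k A P n z \<and>
      HH_class k A Q n (chain_map k A Q n (\<phi> n) z) = HH_class k A Q n (chain_map k A Q n (\<phi>' n) z')"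
    using \<phi> HH_class_self[OF P zc] by blast
next
  fix w assume "\<exists>\<phi> z'. comparison_map env P Q \<phi> \<and> z' \<in> HH_class k A P n z \<and>
      w = HH_class k A Q n (chain_map k A Q n (\<phi> n) z')"
  then obtain \<phi>' z' where \<phi>': "comparison_map env P Q \<phi>'" and z': "z' \<in> HH_class k A P n z"
    and w: "w = HH_class k A Q n (chain_map k A Q n (\<phi>' n) z')" by blast
  show "w = HH_class k A Q n (chain_map k A Q n (\<phi> n) z)"
    using HH_class_lift_eq[OF P Q lifts \<phi>'[unfolded comparison_map_iff_lift_over]
        \<phi>[unfolded comparison_map_iff_lift_over] cohomologous_refl[OF P], of z n z'] z z'
      exact_complex.aug_linear[OF P]
    unfolding w by simp
qed


abbreviation "HHco_boundaries P m \<equiv> coboundaries (cochains k A P) (cochain_diff P) m"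

lemma left_regular_simps:
  "carrier (left_regular k A) = carrier A" "\<zero>\<^bsub>left_regular k A\<^esub> = \<zero>\<^bsub>A\<^esub>"
  "x \<oplus>\<^bsub>left_regular k A\<^esub> y = x \<oplus>\<^bsub>A\<^esub> y"
  by (simp_all add: left_regular_def)

lemma mem_cochains:
  "t \<in> carrier (cochains k A P m) \<longleftrightarrow>
    t \<in> linear_maps env (Ch P m) (left_regular k A) \<and> t \<in> extensional (carrier (Ch P m))"
  by (simp add: cochains_def)

lemma restrict_cochain:
  assumes "resolves P" "t \<in> linear_maps env (Ch P m) (left_regular k A)"
  shows "restrict t (carrier (Ch P m)) \<in> carrier (cochains k A P m)"
  unfolding mem_cochains
  using linear_maps_cong[OF assms(2) exact_complex.Ch_module[OF assms(1)], of "restrict t (carrier (Ch P m))"] by simp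

lemma abelian_group_cochains:
  assumes P: "resolves P"
  shows "abelian_group (cochains k A P m)"
proof -
  interpret P: exact_complex "enveloping k A" "left_regular k A" P by fact
  note lc = linear_maps_closed[where M = "Ch P m" and N = "left_regular k A", unfolded left_regular_simps]
  have add: "f \<oplus>\<^bsub>cochains k A P m\<^esub> g = (\<lambda>x\<in>carrier (Ch P m). f x \<oplus>\<^bsub>A\<^esub> g x)" for f g
    by (simp add: cochains_def)
  have zero: "\<zero>\<^bsub>cochains k A P m\<^esub> = (\<lambda>x\<in>carrier (Ch P m). \<zero>\<^bsub>A\<^esub>)"
    by (simp add: cochains_def)
  show ?thesis
  proof (rule abelian_groupI)
    fix f g assume fg: "f \<in> carrier (cochains k A P m)" "g \<in> carrier (cochains k A P m)"
    then show "f \<oplus>\<^bsub>cochains k A P m\<^esub> g \<in> carrier (cochains k A P m)"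
      using restrict_cochain[OF P linear_maps_plus[OF _ _ P.Ch_module P.M_module]]
      by (simp add: add mem_cochains left_regular_simps)
    show "f \<oplus>\<^bsub>cochains k A P m\<^esub> g = g \<oplus>\<^bsub>cochains k A P m\<^esub> f"
      using fg by (auto simp: add mem_cochains intro!: ext M.a_comm lc)
    fix h assume h: "h \<in> carrier (cochains k A P m)"
    show "f \<oplus>\<^bsub>cochains k A P m\<^esub> g \<oplus>\<^bsub>cochains k A P m\<^esub> h = f \<oplus>\<^bsub>cochains k A P m\<^esub> (g \<oplus>\<^bsub>cochains k A P m\<^esub> h)"
      using fg h by (auto simp: add mem_cochains intro!: ext M.a_assoc lc)
  next
    show "\<zero>\<^bsub>cochains k A P m\<^esub> \<in> carrier (cochains k A P m)"
      using restrict_cochain[OF P linear_maps_zero[OF P.Ch_module P.M_module]] by (simp add: zero left_regular_simps)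
    fix f assume f: "f \<in> carrier (cochains k A P m)"
    then have fl: "f \<in> linear_maps env (Ch P m) (left_regular k A)" by (simp add: mem_cochains)
    show "\<zero>\<^bsub>cochains k A P m\<^esub> \<oplus>\<^bsub>cochains k A P m\<^esub> f = f"
      using f by (auto simp: add zero mem_cochains extensional_def intro!: ext M.l_zero lc)
    have "(\<lambda>x. \<zero>\<^bsub>A\<^esub> \<ominus>\<^bsub>left_regular k A\<^esub> f x) \<in> linear_maps env (Ch P m) (left_regular k A)"
      using linear_maps_minus[OF linear_maps_zero[OF P.Ch_module P.M_module] fl P.Ch_module P.M_module]
      by (simp add: left_regular_simps)
    note neg = restrict_cochain[OF P this]
    have "\<zero>\<^bsub>A\<^esub> \<ominus>\<^bsub>left_regular k A\<^esub> f x \<oplus>\<^bsub>A\<^esub> f x = \<zero>\<^bsub>A\<^esub>" if "x \<in> carrier (Ch P m)" for x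
      using P.M.M.add.inv_closed[of "f x"] P.M.M.l_neg[of "f x"] P.M.M.l_zero[of "\<ominus>\<^bsub>left_regular k A\<^esub> f x"] lc[OF fl that]
      by (simp add: a_minus_def left_regular_simps)
    then show "\<exists>g\<in>carrier (cochains k A P m). g \<oplus>\<^bsub>cochains k A P m\<^esub> f = \<zero>\<^bsub>cochains k A P m\<^esub>"
      by (intro bexI[OF _ neg]) (auto simp: add zero)
  qed
qed

lemma cochain_diff_additive:
  assumes P: "resolves P"
  shows "abelian_group_hom (cochains k A P m) (cochains k A P (Suc m)) (cochain_diff P m)"
proof -
  interpret P: exact_complex "enveloping k A" "left_regular k A" P by fact
  show ?thesis
  proof (rule additiveI[OF abelian_group_cochains[OF P] abelian_group_cochains[OF P]])
    fix t assume "t \<in> carrier (cochains k A P m)"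
    then show "cochain_diff P m t \<in> carrier (cochains k A P (Suc m))"
      using restrict_cochain[OF P linear_maps_comp[OF P.bd_linear]]
      by (simp add: cochain_diff_def mem_cochains)
  qed (auto simp: cochain_diff_def cochains_def)
qed

lemma subgroup_coboundaries:
  assumes P: "resolves P"
  shows "subgroup (HHco_boundaries P m) (add_monoid (cochains k A P m))"
proof (cases m)
  case 0
  then show ?thesis
    using group.triv_subgroup[OF abelian_group.a_group[OF abelian_group_cochains[OF P]]]
    by (simp add: coboundaries_def)
next
  case (Suc j)
  show ?thesis
    using group_hom.img_is_subgroup[OF abelian_group_hom.a_group_hom[OF cochain_diff_additive[OF P, of j]]]
    by (simp add: coboundaries_def Suc)
qed

lemma HHco_cocycles_iff:
  "t \<in> HHco_cocycles k A P m \<longleftrightarrow> t \<in> linear_maps env (Ch P m) (left_regular k A) \<and>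
    t \<in> extensional (carrier (Ch P m)) \<and> (\<forall>x\<in>carrier (Ch P (Suc m)). t (bd P (Suc m) x) = \<zero>\<^bsub>A\<^esub>)"
  by (auto simp: HHco_cocycles_def cocycles_def mem_cochains cochain_diff_def cochains_def fun_eq_iff restrict_def)

lemma carrier_HHco: "carrier (HHco k A P m) = HHco_class k A P m ` HHco_cocycles k A P m"
  unfolding HHco_def cohomology_def carrier_quotient HHco_class_def HHco_cocycles_def ..

lemma mem_HHco_class:
  "t' \<in> HHco_class k A P m t \<longleftrightarrow> (\<exists>b\<in>HHco_boundaries P m. t' = b \<oplus>\<^bsub>cochains k A P m\<^esub> t)"
  by (auto simp: HHco_class_def a_r_coset_def r_coset_def)

lemma HHco_class_self:
  assumes P: "resolves P" and t: "t \<in> HHco_cocycles k A P m"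
  shows "t \<in> HHco_class k A P m t"
  using subgroup.one_closed[OF subgroup_coboundaries[OF P]] abelian_group.axioms(1)[OF abelian_group_cochains[OF P]] t
  unfolding mem_HHco_class by (intro bexI[of _ "\<zero>\<^bsub>cochains k A P m\<^esub>"])
    (auto simp: abelian_monoid.l_zero HHco_cocycles_def cocycles_def)

lemma mem_HHco_class_iff_cohomologous:
  assumes P: "resolves P" and t: "t \<in> HHco_cocycles k A P m" and t': "t' \<in> extensional (carrier (Ch P m))"
  shows "t' \<in> HHco_class k A P m t \<longleftrightarrow> cohomologous env (left_regular k A) P m t' t"
proof -
  interpret P: exact_complex "enveloping k A" "left_regular k A" P by fact
  have tl: "t \<in> linear_maps env (Ch P m) (left_regular k A)" using t by (simp add: HHco_cocycles_iff)
  note tc = linear_maps_closed[OF tl, unfolded left_regular_simps]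
  have add: "f \<oplus>\<^bsub>cochains k A P n\<^esub> g = (\<lambda>x\<in>carrier (Ch P n). f x \<oplus>\<^bsub>A\<^esub> g x)" for f g n
    by (simp add: cochains_def)
  show ?thesis
  proof (cases m)
    case 0
    have "t' \<in> HHco_class k A P m t \<longleftrightarrow> (\<forall>x\<in>carrier (Ch P m). t' x = t x)"
      using t' tc unfolding mem_HHco_class
      by (auto simp: coboundaries_def 0 add cochains_def extensional_def fun_eq_iff restrict_def)
    also have "\<dots> \<longleftrightarrow> cohomologous env (left_regular k A) P m t' t"
      using linear_maps_zero[OF P.Ch_module P.M_module] tc
      by (auto simp: cohomologous_def 0 left_regular_simps)
    finally show ?thesis .
  next
    case (Suc j)
    have bdc: "bd P (Suc j) x \<in> carrier (Ch P j)" if "x \<in> carrier (Ch P m)" for x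
      using that Suc by simp
    show ?thesis
    proof
      assume "t' \<in> HHco_class k A P m t"
      then obtain s where s: "s \<in> carrier (cochains k A P j)"
        and eq: "t' = cochain_diff P j s \<oplus>\<^bsub>cochains k A P m\<^esub> t"
        by (auto simp: mem_HHco_class coboundaries_def Suc)
      have sl: "s \<in> linear_maps env (Ch P (m - 1)) (left_regular k A)" using s Suc by (simp add: mem_cochains)
      show "cohomologous env (left_regular k A) P m t' t"
        unfolding cohomologous_def
      proof (intro bexI[OF _ sl] ballI)
        fix x assume x: "x \<in> carrier (Ch P m)"
        have "s (bd P (Suc j) x) \<in> carrier A"
          using linear_maps_closed[OF sl] bdc[OF x] Suc by (simp add: left_regular_simps)
        then show "t' x = t x \<oplus>\<^bsub>left_regular k A\<^esub> (if m = 0 then \<zero>\<^bsub>left_regular k A\<^esub> else s (bd P m x))"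
          using x tc[OF x] by (simp add: eq add Suc cochain_diff_def left_regular_simps M.a_comm)
      qed
    next
      assume "cohomologous env (left_regular k A) P m t' t"
      then obtain s where s: "s \<in> linear_maps env (Ch P j) (left_regular k A)"
        and eq: "\<And>x. x \<in> carrier (Ch P m) \<Longrightarrow> t' x = t x \<oplus>\<^bsub>A\<^esub> s (bd P (Suc j) x)"
        by (auto simp: cohomologous_def Suc left_regular_simps)
      have sc: "s (bd P (Suc j) x) \<in> carrier A" if "x \<in> carrier (Ch P m)" for x
        using linear_maps_closed[OF s bdc[OF that]] by (simp add: left_regular_simps)
      have "t' = cochain_diff P j (restrict s (carrier (Ch P j))) \<oplus>\<^bsub>cochains k A P m\<^esub> t"
      proof (rule extensionalityI[OF t'])
        fix x assume x: "x \<in> carrier (Ch P m)"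
        then show "t' x = (cochain_diff P j (restrict s (carrier (Ch P j))) \<oplus>\<^bsub>cochains k A P m\<^esub> t) x"
          using eq[OF x] bdc[OF x] sc[OF x] tc[OF x] Suc by (simp add: add cochain_diff_def M.a_comm)
      qed (simp add: add)
      then show "t' \<in> HHco_class k A P m t"
        using restrict_cochain[OF P s] by (auto simp: mem_HHco_class coboundaries_def Suc)
    qed
  qed
qed

lemma HHco_class_eqI:
  assumes P: "resolves P" and t: "t \<in> HHco_cocycles k A P m" and t': "t' \<in> HHco_class k A P m t"
  shows "HHco_class k A P m t' = HHco_class k A P m t"
proof -
  interpret C: abelian_group "cochains k A P m" by (rule abelian_group_cochains[OF P])
  have "t \<in> carrier (cochains k A P m)" using t by (simp add: HHco_cocycles_def cocycles_def)
  then show ?thesis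
    using t' unfolding HHco_class_def by (intro C.a_repr_independence[symmetric] subgroup_coboundaries[OF P])
qed

lemma HHco_class_extensional:
  assumes "t' \<in> HHco_class k A P m t"
  shows "t' \<in> extensional (carrier (Ch P m))"
  using assms by (auto simp: mem_HHco_class cochains_def)

lemma cohomologous_cocycle:
  assumes P: "resolves P" and t: "t \<in> HHco_cocycles k A P m" and t': "t' \<in> extensional (carrier (Ch P m))"
    and coh: "cohomologous env (left_regular k A) P m t' t"
  shows "t' \<in> HHco_cocycles k A P m"
proof -
  interpret P: exact_complex "enveloping k A" "left_regular k A" P by fact
  have tl: "t \<in> linear_maps env (Ch P m) (left_regular k A)"
    and tz: "\<And>x. x \<in> carrier (Ch P (Suc m)) \<Longrightarrow> t (bd P (Suc m) x) = \<zero>\<^bsub>A\<^esub>"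
    using t by (auto simp: HHco_cocycles_iff)
  obtain s where s: "s \<in> linear_maps env (Ch P (m - 1)) (left_regular k A)"
    and ts: "\<And>x. x \<in> carrier (Ch P m) \<Longrightarrow> t' x = t x \<oplus>\<^bsub>left_regular k A\<^esub>
      (if m = 0 then \<zero>\<^bsub>left_regular k A\<^esub> else s (bd P m x))"
    using coh unfolding cohomologous_def by blast
  define S where "S x = (if m = 0 then \<zero>\<^bsub>left_regular k A\<^esub> else s (bd P m x))" for x
  have S: "S \<in> linear_maps env (Ch P m) (left_regular k A)"
    and Sz: "\<And>x. x \<in> carrier (Ch P (Suc m)) \<Longrightarrow> S (bd P (Suc m) x) = \<zero>\<^bsub>left_regular k A\<^esub>"
  proof -
    show "S \<in> linear_maps env (Ch P m) (left_regular k A)"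
    proof (cases m)
      case 0
      then show ?thesis using linear_maps_zero[OF P.Ch_module P.M_module] by (simp add: S_def[abs_def])
    next
      case (Suc j)
      then show ?thesis using linear_maps_comp[OF P.bd_linear, of s j] s by (simp add: S_def[abs_def])
    qed
    show "S (bd P (Suc m) x) = \<zero>\<^bsub>left_regular k A\<^esub>" if "x \<in> carrier (Ch P (Suc m))" for x
    proof (cases m)
      case (Suc j)
      then show ?thesis
        using P.bd_bd[of x j] that s abelian_group_hom.hom_zero[OF linear_maps_additive[OF s P.Ch_module P.M_module]]
        by (simp add: S_def)
    qed (simp add: S_def)
  qed
  have "t' \<in> linear_maps env (Ch P m) (left_regular k A)"
    by (rule linear_maps_cong[OF linear_maps_plus[OF tl S P.Ch_module P.M_module] P.Ch_module]) (simp add: ts S_def)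
  then show ?thesis
    using t' tz Sz ts by (simp add: HHco_cocycles_iff S_def left_regular_simps)
qed

lemma cocycle_pullback:
  assumes P: "resolves P" and Q: "resolves Q" and \<psi>: "comparison_map env Q P \<psi>"
    and t: "t \<in> HHco_cocycles k A P m"
  shows "(\<lambda>x\<in>carrier (Ch Q m). t (\<psi> m x)) \<in> HHco_cocycles k A Q m"
proof -
  interpret P: exact_complex "enveloping k A" "left_regular k A" P by fact
  interpret Q: exact_complex "enveloping k A" "left_regular k A" Q by fact
  note l = \<psi>[unfolded comparison_map_iff_lift_over]
  have \<psi>l: "\<psi> i \<in> linear_maps env (Ch Q i) (Ch P i)" for i using lift_overD(1)[OF l, of i] by simp
  have "t (\<psi> m (bd Q (Suc m) x)) = \<zero>\<^bsub>A\<^esub>" if x: "x \<in> carrier (Ch Q (Suc m))" for x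
  proof -
    have "t (bd P (Suc m) (\<psi> (Suc m) x)) = \<zero>\<^bsub>A\<^esub>"
      using t linear_maps_closed[OF \<psi>l x] by (simp add: HHco_cocycles_iff)
    then show ?thesis using lift_overD(3)[OF l, of x m] x by simp
  qed
  then show ?thesis
    using restrict_cochain[OF Q linear_maps_comp[OF \<psi>l, of t m]] t
    by (auto simp: HHco_cocycles_iff mem_cochains)
qed

lemma cohomologous_pullback:
  assumes P: "resolves P" and Q: "resolves Q"
    and lifts: "\<And>i. lifts_through env (left_regular k A) P (Ch Q i)"
    and \<psi>: "comparison_map env Q P \<psi>" and \<psi>': "comparison_map env Q P \<psi>'"
    and t: "t \<in> HHco_cocycles k A P m" and coh: "cohomologous env (left_regular k A) P m t' t"
  shows "cohomologous env (left_regular k A) Q m (\<lambda>x. t' (\<psi>' m x)) (\<lambda>x. t (\<psi> m x))"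
proof -
  interpret P: exact_complex "enveloping k A" "left_regular k A" P by fact
  interpret Q: exact_complex "enveloping k A" "left_regular k A" Q by fact
  note l = \<psi>[unfolded comparison_map_iff_lift_over] and l' = \<psi>'[unfolded comparison_map_iff_lift_over]
  have \<psi>l: "\<psi> i \<in> linear_maps env (Ch Q i) (Ch P i)" for i using lift_overD(1)[OF l, of i] by simp
  have \<psi>'l: "\<psi>' i \<in> linear_maps env (Ch Q i) (Ch P i)" for i using lift_overD(1)[OF l', of i] by simp
  have tl: "t \<in> linear_maps env (Ch P m) (left_regular k A)"
    and tz: "\<And>x. x \<in> carrier (Ch P (Suc m)) \<Longrightarrow> t (bd P (Suc m) x) = \<zero>\<^bsub>left_regular k A\<^esub>"
    using t by (auto simp: HHco_cocycles_iff left_regular_simps)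
  interpret t: abelian_group_hom "Ch P m" "left_regular k A" t
    by (rule linear_maps_additive[OF tl P.Ch_module P.M_module])
  obtain s where s: "s \<in> linear_maps env (Ch P (m - 1)) (left_regular k A)"
    and ts: "\<And>x. x \<in> carrier (Ch P m) \<Longrightarrow> t' x = t x \<oplus>\<^bsub>left_regular k A\<^esub>
      (if m = 0 then \<zero>\<^bsub>left_regular k A\<^esub> else s (bd P m x))"
    using coh unfolding cohomologous_def by blast
  obtain h w where h: "h \<in> linear_maps env (Ch Q m) (Ch P (Suc m))"
    and w: "w \<in> linear_maps env (Ch Q (m - 1)) (Ch P m)"
    and hw: "\<And>x. x \<in> carrier (Ch Q m) \<Longrightarrow> \<psi>' m x = \<psi> m x \<oplus>\<^bsub>Ch P m\<^esub>
      (bd P (Suc m) (h x) \<oplus>\<^bsub>Ch P m\<^esub> (if m = 0 then \<zero>\<^bsub>Ch P m\<^esub> else w (bd Q m x)))"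
    using lift_over_homotopy[OF Q P lifts l' l cohomologous_refl[OF Q Q.aug_linear], of m] by auto
  define s' where "s' x = t (w x) \<oplus>\<^bsub>left_regular k A\<^esub> s (\<psi>' (m - 1) x)" for x
  have s': "s' \<in> linear_maps env (Ch Q (m - 1)) (left_regular k A)"
    unfolding s'_def
    by (intro linear_maps_plus linear_maps_comp[OF w tl] linear_maps_comp[OF \<psi>'l s] Q.Ch_module P.M_module)
  show ?thesis
    unfolding cohomologous_def
  proof (intro bexI[OF _ s'] ballI)
    fix x assume x: "x \<in> carrier (Ch Q m)"
    note \<psi>x = linear_maps_closed[OF \<psi>l x] and \<psi>'x = linear_maps_closed[OF \<psi>'l x]
      and hx = linear_maps_closed[OF h x]
    show "t' (\<psi>' m x) = t (\<psi> m x) \<oplus>\<^bsub>left_regular k A\<^esub>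
        (if m = 0 then \<zero>\<^bsub>left_regular k A\<^esub> else s' (bd Q m x))"
    proof (cases m)
      case 0
      have "\<psi>' m x = \<psi> m x \<oplus>\<^bsub>Ch P m\<^esub> bd P (Suc m) (h x)"
        using hw[OF x] 0 hx P.bd.hom_closed[OF hx] by simp
      then have "t (\<psi>' m x) = t (\<psi> m x)"
        using \<psi>x P.bd.hom_closed[OF hx] tz[OF hx] by simp
      then show ?thesis using ts[OF \<psi>'x] 0 \<psi>'x \<psi>x by simp
    next
      case (Suc j)
      have bx: "bd Q (Suc j) x \<in> carrier (Ch Q j)" using x Suc by simp
      have wb: "w (bd Q m x) \<in> carrier (Ch P m)" using linear_maps_closed[OF w] bx Suc by simp
      have sb: "s (\<psi>' j (bd Q m x)) \<in> carrier (left_regular k A)"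
        using linear_maps_closed[OF s] linear_maps_closed[OF \<psi>'l bx] Suc by simp
      have "\<psi>' m x = \<psi> m x \<oplus>\<^bsub>Ch P m\<^esub> (bd P (Suc m) (h x) \<oplus>\<^bsub>Ch P m\<^esub> w (bd Q m x))"
        using hw[OF x] Suc by simp
      then have "t (\<psi>' m x) = t (\<psi> m x) \<oplus>\<^bsub>left_regular k A\<^esub> t (w (bd Q m x))"
        using \<psi>x wb P.bd.hom_closed[OF hx] tz[OF hx] by simp
      moreover have "bd P m (\<psi>' m x) = \<psi>' j (bd Q m x)"
        using lift_overD(3)[OF l', of x j] x Suc by simp
      ultimately show ?thesis
        using ts[OF \<psi>'x] Suc \<psi>x wb sb by (simp add: s'_def P.M.M.a_assoc)
    qed
  qed
qed

lemma HHco_ident_class: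
  assumes P: "resolves P" and Q: "resolves Q"
    and lifts: "\<And>i. lifts_through env (left_regular k A) P (Ch Q i)"
    and \<psi>: "comparison_map env Q P \<psi>" and t: "t \<in> HHco_cocycles k A P m"
  shows "HHco_ident k A P Q m (HHco_class k A P m t) =
    HHco_class k A Q m (\<lambda>x\<in>carrier (Ch Q m). t (\<psi> m x))"
  unfolding HHco_ident_def
proof (rule the_equality)
  show "\<exists>\<psi>' t'. comparison_map env Q P \<psi>' \<and> t' \<in> HHco_class k A P m t \<and>
      HHco_class k A Q m (\<lambda>x\<in>carrier (Ch Q m). t (\<psi> m x)) =
      HHco_class k A Q m (\<lambda>x\<in>carrier (Ch Q m). t' (\<psi>' m x))"
    using \<psi> HHco_class_self[OF P t] by blast
next
  fix w assume "\<exists>\<psi>' t'. comparison_map env Q P \<psi>' \<and> t' \<in> HHco_class k A P m t \<and>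
      w = HHco_class k A Q m (\<lambda>x\<in>carrier (Ch Q m). t' (\<psi>' m x))"
  then obtain \<psi>' t' where \<psi>': "comparison_map env Q P \<psi>'" and t': "t' \<in> HHco_class k A P m t"
    and w: "w = HHco_class k A Q m (\<lambda>x\<in>carrier (Ch Q m). t' (\<psi>' m x))" by blast
  have coh: "cohomologous env (left_regular k A) P m t' t"
    using mem_HHco_class_iff_cohomologous[OF P t HHco_class_extensional[OF t']] t' by simp
  have "cohomologous env (left_regular k A) Q m (\<lambda>x\<in>carrier (Ch Q m). t' (\<psi>' m x))
      (\<lambda>x\<in>carrier (Ch Q m). t (\<psi> m x))"
    using cohomologous_pullback[OF P Q lifts \<psi> \<psi>' t coh] by (simp add: cohomologous_def)
  then have "(\<lambda>x\<in>carrier (Ch Q m). t' (\<psi>' m x)) \<in> HHco_class k A Q m (\<lambda>x\<in>carrier (Ch Q m). t (\<psi> m x))"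
    using mem_HHco_class_iff_cohomologous[OF Q cocycle_pullback[OF P Q \<psi> t]] by simp
  then show "w = HHco_class k A Q m (\<lambda>x\<in>carrier (Ch Q m). t (\<psi> m x))"
    unfolding w by (rule HHco_class_eqI[OF Q cocycle_pullback[OF P Q \<psi> t]])
qed

end

section \<open>The bar resolution\<close>

context assoc_algebra
begin

abbreviation "TP \<equiv> tensor_power k A"

definition slot_map :: "nat \<Rightarrow> ('a list \<Rightarrow> 'a list) \<Rightarrow> ('a list \<Rightarrow>\<^sub>0 int) set \<Rightarrow> ('a list \<Rightarrow>\<^sub>0 int) set"
  where "slot_map L h = induced (TP L) (\<lambda>xs. pure_power k A (h xs))"

lemma slot_map_additive:
  assumes "slotwise N L h"
  shows "abelian_group_hom (TP N) (TP L) (slot_map L h)"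
  unfolding slot_map_def
proof (intro additive_hom abelian_group_tensor_power)
  show "induced (TP L) (\<lambda>xs. pure_power k A (h xs)) \<in>
      hom (add_monoid (TP N)) (add_monoid (TP L))"
    by (rule induced_multilinear(1)[OF M.abelian_group_axioms smult_closed abelian_group_tensor_power])
       (intro funcsetI slotwise_multilinear[OF assms] | assumption)+
qed

lemma slot_map_pure_power:
  assumes "slotwise N L h" "xs \<in> tuples A N"
  shows "slot_map L h (pure_power k A xs) = pure_power k A (h xs)"
  unfolding slot_map_def
  by (rule induced_multilinear(2)[OF M.abelian_group_axioms smult_closed abelian_group_tensor_power _ _ _ assms(2)])
     (intro funcsetI slotwise_multilinear[OF assms(1)] | assumption)+

lemma slotwise_append:
  assumes u: "u \<in> tuples A p" and v: "v \<in> tuples A q"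
  shows "slotwise N (p + N + q) (\<lambda>xs. u @ xs @ v)"
  unfolding slotwise_def
proof (intro conjI ballI allI impI funcsetI)
  fix xs assume xs: "xs \<in> tuples A N"
  show "u @ xs @ v \<in> tuples A (p + N + q)" using u v xs by (auto simp: tuples_def)
  fix i assume i: "i < N"
  show "\<exists>j<p + N + q. \<exists>\<phi>\<in>linear_maps k A A. \<forall>a\<in>carrier A. u @ xs[i := a] @ v = (u @ xs @ v)[j := \<phi> a]"
    by (rule exI[of _ "p + i"], intro conjI bexI[OF _ linear_id])
       (use u xs i in \<open>auto simp: tuples_def list_update_append\<close>)
qed

text \<open>The action of \<open>a \<otimes> c\<close> on \<open>A\<^sup>\<otimes>\<^sup>n\<^sup>+\<^sup>2\<close> as an additive map; the module structure is built from it.\<close>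

definition ends :: "nat \<Rightarrow> 'a \<Rightarrow> 'a \<Rightarrow> ('a list \<Rightarrow>\<^sub>0 int) set \<Rightarrow> ('a list \<Rightarrow>\<^sub>0 int) set"
  where "ends n a c = slot_map (n + 2) (\<lambda>xs. xs[0 := a \<otimes>\<^bsub>A\<^esub> xs ! 0, n + 1 := xs ! (n + 1) \<otimes>\<^bsub>A\<^esub> c])"

lemma ends_additive:
  "\<lbrakk>a \<in> carrier A; c \<in> carrier A\<rbrakk> \<Longrightarrow>
    abelian_group_hom (TP (n + 2)) (TP (n + 2)) (ends n a c)"
  unfolding ends_def by (intro slot_map_additive slotwise_ends)

lemma tuples_ends_iff: "xs \<in> tuples A (n + 2) \<longleftrightarrow>
    (\<exists>x ys z. xs = x # ys @ [z] \<and> x \<in> carrier A \<and> z \<in> carrier A \<and> ys \<in> tuples A n)"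
proof
  assume xs: "xs \<in> tuples A (n + 2)"
  then obtain x ws where 1: "xs = x # ws" "length ws = Suc n" by (cases xs) (auto simp: tuples_def)
  then obtain ys z where "ws = ys @ [z]" by (metis length_Suc_conv_rev)
  then show "\<exists>x ys z. xs = x # ys @ [z] \<and> x \<in> carrier A \<and> z \<in> carrier A \<and> ys \<in> tuples A n"
    using 1 xs by (auto simp: tuples_def)
qed (auto simp: tuples_def)

lemma update_ends:
  assumes "ys \<in> tuples A n"
  shows "(x # ys @ [z])[0 := a \<otimes>\<^bsub>A\<^esub> (x # ys @ [z]) ! 0, n + 1 := (x # ys @ [z]) ! (n + 1) \<otimes>\<^bsub>A\<^esub> c] =
    (a \<otimes>\<^bsub>A\<^esub> x) # ys @ [z \<otimes>\<^bsub>A\<^esub> c]"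
  using assms by (auto simp: tuples_def nth_append)

lemma ends_pure_power:
  assumes "a \<in> carrier A" "c \<in> carrier A" "x \<in> carrier A" "z \<in> carrier A" "ys \<in> tuples A n"
  shows "ends n a c (pure_power k A (x # ys @ [z])) = pure_power k A ((a \<otimes>\<^bsub>A\<^esub> x) # ys @ [z \<otimes>\<^bsub>A\<^esub> c])"
proof -
  have "x # ys @ [z] \<in> tuples A (n + 2)" using assms by (simp add: tuples_def)
  from slot_map_pure_power[OF slotwise_ends[OF assms(1,2)] this] show ?thesis
    unfolding ends_def update_ends[OF assms(5)] .
qed

lemma pure_power_add_at:
  assumes "u \<in> tuples A p" "v \<in> tuples A q" "a \<in> carrier A" "b \<in> carrier A" "N = p + q + 1"
  shows "pure_power k A (u @ (a \<oplus>\<^bsub>A\<^esub> b) # v) =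
    pure_power k A (u @ a # v) \<oplus>\<^bsub>TP N\<^esub> pure_power k A (u @ b # v)"
proof -
  have "u @ a # v \<in> tuples A N" "length u < N" using assms by (auto simp: tuples_def)
  from pure_power_add[OF this assms(3,4)] show ?thesis by simp
qed

lemma pure_power_ends_balanced:
  assumes "x \<in> carrier A" "z \<in> carrier A" "ys \<in> tuples A n" "r \<in> carrier k"
  shows "pure_power k A ((r \<odot>\<^bsub>A\<^esub> x) # ys @ [z]) = pure_power k A (x # ys @ [r \<odot>\<^bsub>A\<^esub> z])"
proof -
  have "x # ys @ [z] \<in> tuples A (n + 2)" "0 < n + 2" "Suc (length ys) < n + 2"
    using assms by (auto simp: tuples_def)
  from pure_power_balanced[OF this assms(4)] show ?thesis by simp
qed

lemma ends_bilinear: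
  assumes \<beta>: "\<beta> \<in> carrier (TP (n + 2))"
  shows "\<lbrakk>a \<in> carrier A; a' \<in> carrier A; c \<in> carrier A\<rbrakk> \<Longrightarrow>
      ends n (a \<oplus>\<^bsub>A\<^esub> a') c \<beta> = ends n a c \<beta> \<oplus>\<^bsub>TP (n + 2)\<^esub> ends n a' c \<beta>"
    and "\<lbrakk>a \<in> carrier A; c \<in> carrier A; c' \<in> carrier A\<rbrakk> \<Longrightarrow>
      ends n a (c \<oplus>\<^bsub>A\<^esub> c') \<beta> = ends n a c \<beta> \<oplus>\<^bsub>TP (n + 2)\<^esub> ends n a c' \<beta>"
    and "\<lbrakk>r \<in> carrier k; a \<in> carrier A; c \<in> carrier A\<rbrakk> \<Longrightarrow>
      ends n (r \<odot>\<^bsub>A\<^esub> a) c \<beta> = ends n a (r \<odot>\<^bsub>A\<^esub> c) \<beta>"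
proof -
  show "ends n (a \<oplus>\<^bsub>A\<^esub> a') c \<beta> = ends n a c \<beta> \<oplus>\<^bsub>TP (n + 2)\<^esub> ends n a' c \<beta>"
    if a: "a \<in> carrier A" "a' \<in> carrier A" "c \<in> carrier A"
  proof (rule tensor_power_eqI[OF ends_additive additive_add[OF ends_additive ends_additive] _ \<beta>])
    fix xs assume "xs \<in> tuples A (n + 2)"
    then obtain x ys z where xs: "xs = x # ys @ [z]" "x \<in> carrier A" "z \<in> carrier A" "ys \<in> tuples A n"
      unfolding tuples_ends_iff by blast
    show "ends n (a \<oplus>\<^bsub>A\<^esub> a') c (pure_power k A xs) =
        ends n a c (pure_power k A xs) \<oplus>\<^bsub>TP (n + 2)\<^esub> ends n a' c (pure_power k A xs)"
      using a xs pure_power_add_at[of "[]" 0 "ys @ [z \<otimes>\<^bsub>A\<^esub> c]" "n + 1" "a \<otimes>\<^bsub>A\<^esub> x" "a' \<otimes>\<^bsub>A\<^esub> x" "n + 2"]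
      by (simp add: ends_pure_power A.l_distr tuples_def)
  qed (use a in simp_all)
  show "ends n a (c \<oplus>\<^bsub>A\<^esub> c') \<beta> = ends n a c \<beta> \<oplus>\<^bsub>TP (n + 2)\<^esub> ends n a c' \<beta>"
    if a: "a \<in> carrier A" "c \<in> carrier A" "c' \<in> carrier A"
  proof (rule tensor_power_eqI[OF ends_additive additive_add[OF ends_additive ends_additive] _ \<beta>])
    fix xs assume "xs \<in> tuples A (n + 2)"
    then obtain x ys z where xs: "xs = x # ys @ [z]" "x \<in> carrier A" "z \<in> carrier A" "ys \<in> tuples A n"
      unfolding tuples_ends_iff by blast
    show "ends n a (c \<oplus>\<^bsub>A\<^esub> c') (pure_power k A xs) =
        ends n a c (pure_power k A xs) \<oplus>\<^bsub>TP (n + 2)\<^esub> ends n a c' (pure_power k A xs)"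
      using a xs pure_power_add_at[of "(a \<otimes>\<^bsub>A\<^esub> x) # ys" "n + 1" "[]" 0 "z \<otimes>\<^bsub>A\<^esub> c" "z \<otimes>\<^bsub>A\<^esub> c'" "n + 2"]
      by (simp add: ends_pure_power A.r_distr tuples_def)
  qed (use a in simp_all)
  show "ends n (r \<odot>\<^bsub>A\<^esub> a) c \<beta> = ends n a (r \<odot>\<^bsub>A\<^esub> c) \<beta>"
    if a: "r \<in> carrier k" "a \<in> carrier A" "c \<in> carrier A"
  proof (rule tensor_power_eqI[OF ends_additive ends_additive _ \<beta>])
    fix xs assume "xs \<in> tuples A (n + 2)"
    then obtain x ys z where xs: "xs = x # ys @ [z]" "x \<in> carrier A" "z \<in> carrier A" "ys \<in> tuples A n"
      unfolding tuples_ends_iff by blast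
    show "ends n (r \<odot>\<^bsub>A\<^esub> a) c (pure_power k A xs) = ends n a (r \<odot>\<^bsub>A\<^esub> c) (pure_power k A xs)"
      using a xs pure_power_ends_balanced[of "a \<otimes>\<^bsub>A\<^esub> x" "z \<otimes>\<^bsub>A\<^esub> c" ys n r]
      by (simp add: ends_pure_power smult_assoc_left smult_assoc_right)
  qed (use a in simp_all)
qed

lemma bar_module_simps:
  "carrier (bar_module k A n) = carrier (TP (n + 2))"
  "\<zero>\<^bsub>bar_module k A n\<^esub> = \<zero>\<^bsub>TP (n + 2)\<^esub>"
  "x \<oplus>\<^bsub>bar_module k A n\<^esub> y = x \<oplus>\<^bsub>TP (n + 2)\<^esub> y"
  by (simp_all add: bar_module_def)

lemma abelian_group_bar_module: "abelian_group (bar_module k A n)"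
proof -
  interpret T: abelian_group "TP (n + 2)" by (rule abelian_group_tensor_power)
  show ?thesis
    using T.add.l_inv_ex by (intro abelian_groupI) (auto simp: bar_module_simps T.a_ac simp del: add_2_eq_Suc')
qed

lemma additive_into_bar_module:
  assumes "abelian_group_hom G (TP (n + 2)) f"
  shows "abelian_group_hom G (bar_module k A n) f"
proof -
  interpret f: abelian_group_hom G "TP (n + 2)" f by fact
  show ?thesis
    by (intro additiveI abelian_group_bar_module f.G.abelian_group_axioms) (simp_all add: bar_module_simps del: add_2_eq_Suc')
qed

lemma bar_smult:
  assumes \<beta>: "\<beta> \<in> carrier (TP (n + 2))"
  shows "abelian_group_hom (tensor k A A) (TP (n + 2)) (\<lambda>X. X \<odot>\<^bsub>bar_module k A n\<^esub> \<beta>)"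
    and "\<lbrakk>a \<in> carrier A; c \<in> carrier A\<rbrakk> \<Longrightarrow> pure_tensor k A A a c \<odot>\<^bsub>bar_module k A n\<^esub> \<beta> = ends n a c \<beta>"
proof -
  have eq: "X \<odot>\<^bsub>bar_module k A n\<^esub> \<beta> = induced (TP (n + 2)) (\<lambda>(a, c). ends n a c \<beta>) X" for X
    by (simp add: bar_module_def ends_def slot_map_def)
  note bal = abelian_group_tensor_power abelian_group_hom.hom_closed[OF ends_additive \<beta>] ends_bilinear[OF \<beta>]
  show "abelian_group_hom (tensor k A A) (TP (n + 2)) (\<lambda>X. X \<odot>\<^bsub>bar_module k A n\<^esub> \<beta>)"
    unfolding eq
    by (intro additive_hom B.abelian_group_tensor abelian_group_tensor_power B.induced_balanced(1)) (rule bal; assumption)+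
  show "pure_tensor k A A a c \<odot>\<^bsub>bar_module k A n\<^esub> \<beta> = ends n a c \<beta>" if "a \<in> carrier A" "c \<in> carrier A"
    unfolding eq by (rule B.induced_balanced(2)[OF abelian_group_tensor_power]) (rule bal that; assumption?)+
qed

lemma env_simps:
  "carrier env = carrier (tensor k A A)" "X \<oplus>\<^bsub>env\<^esub> Y = X \<oplus>\<^bsub>tensor k A A\<^esub> Y" "\<one>\<^bsub>env\<^esub> = pure_tensor k A A \<one>\<^bsub>A\<^esub> \<one>\<^bsub>A\<^esub>"
  by (simp_all add: enveloping_def)

lemma ends_one:
  assumes "\<beta> \<in> carrier (TP (n + 2))"
  shows "ends n \<one>\<^bsub>A\<^esub> \<one>\<^bsub>A\<^esub> \<beta> = \<beta>"
proof (rule tensor_power_eqI[OF ends_additive additive_id _ assms])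
  fix xs assume "xs \<in> tuples A (n + 2)"
  then show "ends n \<one>\<^bsub>A\<^esub> \<one>\<^bsub>A\<^esub> (pure_power k A xs) = pure_power k A xs"
    unfolding tuples_ends_iff by (auto simp: ends_pure_power)
qed (simp_all add: abelian_group_tensor_power)

lemma ends_ends:
  assumes a: "a \<in> carrier A" "c \<in> carrier A" "a' \<in> carrier A" "c' \<in> carrier A"
    and \<beta>: "\<beta> \<in> carrier (TP (n + 2))"
  shows "ends n a c (ends n a' c' \<beta>) = ends n (a \<otimes>\<^bsub>A\<^esub> a') (c' \<otimes>\<^bsub>A\<^esub> c) \<beta>"
proof (rule tensor_power_eqI[OF additive_comp[OF ends_additive ends_additive] ends_additive _ \<beta>])
  fix xs assume "xs \<in> tuples A (n + 2)"
  then show "ends n a c (ends n a' c' (pure_power k A xs)) =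
      ends n (a \<otimes>\<^bsub>A\<^esub> a') (c' \<otimes>\<^bsub>A\<^esub> c) (pure_power k A xs)"
    unfolding tuples_ends_iff using a by (auto simp: ends_pure_power A.m_assoc)
qed (use a in simp_all)

lemma left_module_bar_module:
  assumes "ring env"
  shows "left_module env (bar_module k A n)"
proof -
  interpret E: ring "enveloping k A" by fact
  let ?T = "TP (n + 2)"
  interpret T: abelian_group ?T by (rule abelian_group_tensor_power)
  have mult_hom: "abelian_group_hom (tensor k A A) (tensor k A A) (\<lambda>X. X \<otimes>\<^bsub>env\<^esub> Y)"
    "abelian_group_hom (tensor k A A) (tensor k A A) (\<lambda>X. Y \<otimes>\<^bsub>env\<^esub> X)"
    if "Y \<in> carrier env" for Y
    using that by (intro additiveI B.abelian_group_tensor; simp add: E.l_distr E.r_distr flip: env_simps)+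
  have closed: "X \<odot>\<^bsub>bar_module k A n\<^esub> \<beta> \<in> carrier ?T" if "X \<in> carrier env" "\<beta> \<in> carrier ?T" for X \<beta>
    using abelian_group_hom.hom_closed[OF bar_smult(1)[OF that(2)]] that(1) by (simp add: env_simps)
  have assoc1: "(pure_tensor k A A a c \<otimes>\<^bsub>env\<^esub> Y) \<odot>\<^bsub>bar_module k A n\<^esub> \<beta> = ends n a c (Y \<odot>\<^bsub>bar_module k A n\<^esub> \<beta>)"
    if ac: "a \<in> carrier A" "c \<in> carrier A" and Y: "Y \<in> carrier env" and \<beta>: "\<beta> \<in> carrier ?T" for a c Y \<beta>
  proof (rule B.tensor_eqI[OF additive_comp[OF mult_hom(2) bar_smult(1)[OF \<beta>]] additive_comp[OF bar_smult(1)[OF \<beta>] ends_additive]])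
    show "Y \<in> carrier (tensor k A A)" using Y by (simp add: env_simps)
    show "pure_tensor k A A a c \<in> carrier env" using ac by (simp add: env_simps B.pure_tensor_closed)
    fix x y assume "x \<in> carrier A" "y \<in> carrier A"
    then show "(pure_tensor k A A a c \<otimes>\<^bsub>env\<^esub> pure_tensor k A A x y) \<odot>\<^bsub>bar_module k A n\<^esub> \<beta> =
        ends n a c (pure_tensor k A A x y \<odot>\<^bsub>bar_module k A n\<^esub> \<beta>)"
      using ac \<beta> by (simp add: pure_tensor_mult bar_smult(2) ends_ends)
  qed (use ac in auto)
  show ?thesis
  proof (intro left_module.intro left_module_axioms.intro assms)
    show "abelian_group (bar_module k A n)"
      by (rule abelian_group_bar_module)
  next
    fix X \<beta> \<gamma> assume X: "X \<in> carrier env" and \<beta>: "\<beta> \<in> carrier (bar_module k A n)" and \<gamma>: "\<gamma> \<in> carrier (bar_module k A n)"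
    note \<beta>' = \<beta>[unfolded bar_module_simps] and \<gamma>' = \<gamma>[unfolded bar_module_simps]
    have "X \<odot>\<^bsub>bar_module k A n\<^esub> (\<beta> \<oplus>\<^bsub>?T\<^esub> \<gamma>) = X \<odot>\<^bsub>bar_module k A n\<^esub> \<beta> \<oplus>\<^bsub>?T\<^esub> X \<odot>\<^bsub>bar_module k A n\<^esub> \<gamma>"
    proof (rule B.tensor_eqI[OF bar_smult(1) additive_add[OF bar_smult(1)[OF \<beta>'] bar_smult(1)[OF \<gamma>']]])
      show "X \<in> carrier (tensor k A A)" using X by (simp add: env_simps)
      show sum: "\<beta> \<oplus>\<^bsub>?T\<^esub> \<gamma> \<in> carrier ?T" using \<beta>' \<gamma>' by (rule T.a_closed)
      fix a c assume ac: "a \<in> carrier A" "c \<in> carrier A"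
      interpret e: abelian_group_hom ?T ?T "ends n a c" by (rule ends_additive[OF ac])
      show "pure_tensor k A A a c \<odot>\<^bsub>bar_module k A n\<^esub> (\<beta> \<oplus>\<^bsub>?T\<^esub> \<gamma>) =
          pure_tensor k A A a c \<odot>\<^bsub>bar_module k A n\<^esub> \<beta> \<oplus>\<^bsub>?T\<^esub> pure_tensor k A A a c \<odot>\<^bsub>bar_module k A n\<^esub> \<gamma>"
        unfolding bar_smult(2)[OF sum ac] bar_smult(2)[OF \<beta>' ac] bar_smult(2)[OF \<gamma>' ac]
        by (rule e.hom_add[OF \<beta>' \<gamma>'])
    qed
    then show "X \<odot>\<^bsub>bar_module k A n\<^esub> (\<beta> \<oplus>\<^bsub>bar_module k A n\<^esub> \<gamma>) =
        X \<odot>\<^bsub>bar_module k A n\<^esub> \<beta> \<oplus>\<^bsub>bar_module k A n\<^esub> X \<odot>\<^bsub>bar_module k A n\<^esub> \<gamma>"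
      by (simp add: bar_module_simps)
  next
    fix X Y \<beta> assume X: "X \<in> carrier env" and Y: "Y \<in> carrier env" and \<beta>: "\<beta> \<in> carrier (bar_module k A n)"
    note \<beta>' = \<beta>[unfolded bar_module_simps]
    show "(X \<oplus>\<^bsub>env\<^esub> Y) \<odot>\<^bsub>bar_module k A n\<^esub> \<beta> =
        X \<odot>\<^bsub>bar_module k A n\<^esub> \<beta> \<oplus>\<^bsub>bar_module k A n\<^esub> Y \<odot>\<^bsub>bar_module k A n\<^esub> \<beta>"
      using abelian_group_hom.hom_add[OF bar_smult(1)[OF \<beta>'], of X Y] X Y by (simp add: env_simps bar_module_simps)
    show "(X \<otimes>\<^bsub>env\<^esub> Y) \<odot>\<^bsub>bar_module k A n\<^esub> \<beta> = X \<odot>\<^bsub>bar_module k A n\<^esub> (Y \<odot>\<^bsub>bar_module k A n\<^esub> \<beta>)"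
    proof (rule B.tensor_eqI[OF additive_comp[OF mult_hom(1)[OF Y] bar_smult(1)[OF \<beta>']] bar_smult(1)[OF closed[OF Y \<beta>']]])
      show "X \<in> carrier (tensor k A A)" using X by (simp add: env_simps)
      show "(pure_tensor k A A a c \<otimes>\<^bsub>env\<^esub> Y) \<odot>\<^bsub>bar_module k A n\<^esub> \<beta> =
          pure_tensor k A A a c \<odot>\<^bsub>bar_module k A n\<^esub> (Y \<odot>\<^bsub>bar_module k A n\<^esub> \<beta>)"
        if "a \<in> carrier A" "c \<in> carrier A" for a c
        unfolding assoc1[OF that Y \<beta>'] bar_smult(2)[OF closed[OF Y \<beta>'] that] ..
    qed
  next
    fix X \<beta> assume X: "X \<in> carrier env" and \<beta>: "\<beta> \<in> carrier (bar_module k A n)"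
    show "X \<odot>\<^bsub>bar_module k A n\<^esub> \<beta> \<in> carrier (bar_module k A n)"
      using closed X \<beta> by (simp add: bar_module_simps)
  next
    fix \<beta> assume \<beta>: "\<beta> \<in> carrier (bar_module k A n)"
    then show "\<one>\<^bsub>env\<^esub> \<odot>\<^bsub>bar_module k A n\<^esub> \<beta> = \<beta>"
      by (simp add: bar_module_simps env_simps bar_smult(2) ends_one)
  qed
qed

lemma smult_additive_env:
  assumes "left_module env Y" "y \<in> carrier Y"
  shows "abelian_group_hom (tensor k A A) Y (\<lambda>X. X \<odot>\<^bsub>Y\<^esub> y)"
proof -
  interpret Y: left_module env Y by fact
  show ?thesis
    by (intro additiveI B.abelian_group_tensor Y.M.abelian_group_axioms)
       (use assms(2) Y.smult_closed Y.smult_l_distr in \<open>simp_all add: env_simps\<close>)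
qed

lemma linear_on_bar_moduleI:
  assumes Y: "left_module env Y" and f: "abelian_group_hom (TP (n + 2)) Y f"
    and act: "\<And>a c x ys z. \<lbrakk>a \<in> carrier A; c \<in> carrier A; x \<in> carrier A; ys \<in> tuples A n; z \<in> carrier A\<rbrakk> \<Longrightarrow>
      f (pure_power k A ((a \<otimes>\<^bsub>A\<^esub> x) # ys @ [z \<otimes>\<^bsub>A\<^esub> c])) =
      pure_tensor k A A a c \<odot>\<^bsub>Y\<^esub> f (pure_power k A (x # ys @ [z]))"
  shows "f \<in> linear_maps env (bar_module k A n) Y"
proof -
  interpret Y: left_module env Y by fact
  interpret f: abelian_group_hom "TP (n + 2)" Y f by fact
  have act': "f (ends n a c \<beta>) = pure_tensor k A A a c \<odot>\<^bsub>Y\<^esub> f \<beta>"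
    if ac: "a \<in> carrier A" "c \<in> carrier A" and \<beta>: "\<beta> \<in> carrier (TP (n + 2))" for a c \<beta>
  proof (rule tensor_power_eqI[OF additive_comp[OF ends_additive f] additive_comp[OF f Y.additive_smult] _ \<beta>])
    show "pure_tensor k A A a c \<in> carrier env" using ac by (simp add: env_simps B.pure_tensor_closed)
    fix xs assume "xs \<in> tuples A (n + 2)"
    then show "f (ends n a c (pure_power k A xs)) = pure_tensor k A A a c \<odot>\<^bsub>Y\<^esub> f (pure_power k A xs)"
      unfolding tuples_ends_iff using ac act by (auto simp: ends_pure_power)
  qed (use ac in auto)
  show ?thesis
  proof (rule linear_mapsI)
    fix X \<beta> assume X: "X \<in> carrier env" and "\<beta> \<in> carrier (bar_module k A n)"
    then have \<beta>: "\<beta> \<in> carrier (TP (n + 2))" by (simp add: bar_module_simps)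
    show "f (X \<odot>\<^bsub>bar_module k A n\<^esub> \<beta>) = X \<odot>\<^bsub>Y\<^esub> f \<beta>"
    proof (rule B.tensor_eqI[OF additive_comp[OF bar_smult(1)[OF \<beta>] f] smult_additive_env[OF Y f.hom_closed[OF \<beta>]]])
      show "X \<in> carrier (tensor k A A)" using X by (simp add: env_simps)
      show "f (pure_tensor k A A a c \<odot>\<^bsub>bar_module k A n\<^esub> \<beta>) = pure_tensor k A A a c \<odot>\<^bsub>Y\<^esub> f \<beta>"
        if "a \<in> carrier A" "c \<in> carrier A" for a c
        unfolding bar_smult(2)[OF \<beta> that] by (rule act'[OF that \<beta>])
    qed
  qed (simp_all add: bar_module_simps del: add_2_eq_Suc')
qed

end

lemma contract_Cons:
  "contract A 0 (a # b # ys) = (a \<otimes>\<^bsub>A\<^esub> b) # ys" "contract A (Suc i) (a # ys) = a # contract A i ys"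
  by (simp_all add: contract_def)

context assoc_algebra
begin

lemma bar_diff_additive: "abelian_group_hom (TP (n + 2)) (TP (n + 1)) (bar_diff k A n)"
proof -
  have S: "slotwise (n + 2) (n + 1) (contract A i)" if "i \<in> {0..n}" for i
    using that by (intro slotwise_contract) auto
  have hom: "abelian_group_hom (TP (n + 2)) (TP (n + 1))
      (\<lambda>\<beta>. \<Oplus>\<^bsub>TP (n + 1)\<^esub>i\<in>{0..n}. [((- 1) ^ i :: int)] \<cdot>\<^bsub>TP (n + 1)\<^esub> slot_map (n + 1) (contract A i) \<beta>)"
    by (intro additive_finsum additive_add_pow slot_map_additive S abelian_group_tensor_power) auto
  interpret G: abelian_group "TP (n + 1)" by (rule abelian_group_tensor_power)
  show ?thesis
  proof (rule additive_cong[OF hom])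
    fix \<beta> assume \<beta>: "\<beta> \<in> carrier (TP (n + 2))"
    show "(\<Oplus>\<^bsub>TP (n + 1)\<^esub>i\<in>{0..n}. [((- 1) ^ i :: int)] \<cdot>\<^bsub>TP (n + 1)\<^esub> slot_map (n + 1) (contract A i) \<beta>) = bar_diff k A n \<beta>"
      unfolding bar_diff_def
    proof (rule induced_eq_tensor_power[OF hom _ \<beta>, symmetric])
      fix xs assume xs: "xs \<in> tuples A (n + 2)"
      show "(\<Oplus>\<^bsub>TP (n + 1)\<^esub>i\<in>{0..n}. [((- 1) ^ i :: int)] \<cdot>\<^bsub>TP (n + 1)\<^esub> pure_power k A (contract A i xs)) =
        (\<Oplus>\<^bsub>TP (n + 1)\<^esub>i\<in>{0..n}. [((- 1) ^ i :: int)] \<cdot>\<^bsub>TP (n + 1)\<^esub> slot_map (n + 1) (contract A i) (pure_power k A xs))"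
      proof (rule G.finsum_cong'[OF _ funcsetI])
        fix i assume i: "i \<in> {0..n}"
        show "[((- 1) ^ i :: int)] \<cdot>\<^bsub>TP (n + 1)\<^esub> pure_power k A (contract A i xs) =
            [((- 1) ^ i :: int)] \<cdot>\<^bsub>TP (n + 1)\<^esub> slot_map (n + 1) (contract A i) (pure_power k A xs)"
          unfolding slot_map_pure_power[OF S[OF i] xs] ..
        show "[((- 1) ^ i :: int)] \<cdot>\<^bsub>TP (n + 1)\<^esub> slot_map (n + 1) (contract A i) (pure_power k A xs) \<in> carrier (TP (n + 1))" 
          by (intro G.add.int_pow_closed abelian_group_hom.hom_closed[OF slot_map_additive[OF S[OF i]]] pure_power_closed[OF xs])
      qed simp
    qed
  qed
qed

lemma slotwise_Cons: "a \<in> carrier A \<Longrightarrow> slotwise N (N + 1) ((#) a)"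
  using slotwise_append[of "[a]" 1 "[]" 0 N] by (simp add: tuples_def)

definition cons :: "nat \<Rightarrow> 'a \<Rightarrow> ('a list \<Rightarrow>\<^sub>0 int) set \<Rightarrow> ('a list \<Rightarrow>\<^sub>0 int) set"
  where "cons N a = slot_map (N + 1) ((#) a)"

lemma cons_additive: "a \<in> carrier A \<Longrightarrow> abelian_group_hom (TP N) (TP (N + 1)) (cons N a)"
  unfolding cons_def by (intro slot_map_additive slotwise_Cons)

lemma cons_pure_power:
  "\<lbrakk>a \<in> carrier A; xs \<in> tuples A N\<rbrakk> \<Longrightarrow> cons N a (pure_power k A xs) = pure_power k A (a # xs)"
  unfolding cons_def by (rule slot_map_pure_power[OF slotwise_Cons])

text \<open>
  Splitting off the first summand of the differential. The remaining ones are again a bar differential,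
  so identities for the bar complex can be proved by induction instead of by rearranging sums.
\<close>

lemma bar_diff_Cons_pure_power:
  assumes a: "a \<in> carrier A" "b \<in> carrier A" and ys: "ys \<in> tuples A (n + 1)"
  shows "bar_diff k A (n + 1) (pure_power k A (a # b # ys)) =
    pure_power k A ((a \<otimes>\<^bsub>A\<^esub> b) # ys) \<ominus>\<^bsub>TP (n + 2)\<^esub> cons (n + 1) a (bar_diff k A n (pure_power k A (b # ys)))"
proof -
  interpret G: abelian_group "TP (n + 2)" by (rule abelian_group_tensor_power)
  interpret c: abelian_group_hom "TP (n + 1)" "TP (n + 2)" "cons (n + 1) a"
    using cons_additive[OF a(1), of "n + 1"] by simp
  have t: "a # b # ys \<in> tuples A (n + 1 + 2)" "b # ys \<in> tuples A (n + 2)" "(a \<otimes>\<^bsub>A\<^esub> b) # ys \<in> tuples A (n + 2)"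
    using assms by (auto simp: tuples_def)
  have t': "contract A i (b # ys) \<in> tuples A (n + 1)" if "i \<le> n" for i
    using slotwise_contract[of i n] t(2) that by (auto simp: slotwise_def)
  have p: "pure_power k A (contract A i (b # ys)) \<in> carrier (TP (n + 1))" if "i \<le> n" for i
    using pure_power_closed[OF t'[OF that]] .
  have p': "pure_power k A (a # contract A i (b # ys)) \<in> carrier (TP (n + 2))" if "i \<le> n" for i
    using pure_power_closed[of "a # contract A i (b # ys)" "n + 2"] t'[OF that] a by (simp add: tuples_def)
  define F where "F i = [((- 1) ^ i :: int)] \<cdot>\<^bsub>TP (n + 2)\<^esub> pure_power k A (contract A i (a # b # ys))" for i
  have F0: "F 0 = pure_power k A ((a \<otimes>\<^bsub>A\<^esub> b) # ys)"
    using G.add.int_pow_1[OF pure_power_closed[OF t(3)]] by (simp add: F_def contract_Cons del: add_2_eq_Suc')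
  have FSuc: "F (Suc i) = \<ominus>\<^bsub>TP (n + 2)\<^esub> ([((- 1) ^ i :: int)] \<cdot>\<^bsub>TP (n + 2)\<^esub> pure_power k A (a # contract A i (b # ys)))"
    if "i \<le> n" for i
    using G.add.int_pow_neg[OF p'[OF that], of "(- 1) ^ i"] by (simp add: F_def contract_Cons del: add_2_eq_Suc')
  have Fc: "F \<in> {..Suc n} \<rightarrow> carrier (TP (n + 2))"
  proof
    fix i assume "i \<in> {..Suc n}"
    then show "F i \<in> carrier (TP (n + 2))"
      using F0 FSuc pure_power_closed[OF t(3)] p' by (cases i) (auto simp del: add_2_eq_Suc')
  qed
  have "bar_diff k A (n + 1) (pure_power k A (a # b # ys)) = (\<Oplus>\<^bsub>TP (n + 2)\<^esub>i\<in>{..Suc n}. F i)"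
    using bar_diff_pure_power[OF t(1)] by (simp add: F_def atMost_atLeast0)
  also have "\<dots> = (\<Oplus>\<^bsub>TP (n + 2)\<^esub>i\<in>{..n}. F (Suc i)) \<oplus>\<^bsub>TP (n + 2)\<^esub> F 0"
    by (rule G.finsum_Suc2[OF Fc])
  also have "(\<Oplus>\<^bsub>TP (n + 2)\<^esub>i\<in>{..n}. F (Suc i)) = \<ominus>\<^bsub>TP (n + 2)\<^esub> cons (n + 1) a (bar_diff k A n (pure_power k A (b # ys)))"
  proof -
    interpret neg: abelian_group_hom "TP (n + 1)" "TP (n + 2)" "\<lambda>\<beta>. \<ominus>\<^bsub>TP (n + 2)\<^esub> cons (n + 1) a \<beta>"
      by (rule additive_uminus[OF c.abelian_group_hom_axioms])
    have "\<ominus>\<^bsub>TP (n + 2)\<^esub> cons (n + 1) a (bar_diff k A n (pure_power k A (b # ys))) =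
      (\<Oplus>\<^bsub>TP (n + 2)\<^esub>i\<in>{0..n}. \<ominus>\<^bsub>TP (n + 2)\<^esub> cons (n + 1) a
        ([((- 1) ^ i :: int)] \<cdot>\<^bsub>TP (n + 1)\<^esub> pure_power k A (contract A i (b # ys))))"
      unfolding bar_diff_pure_power[OF t(2)]
      by (rule neg.hom_finsum_add) (intro funcsetI c.G.add.int_pow_closed p | simp)+
    also have "\<dots> = (\<Oplus>\<^bsub>TP (n + 2)\<^esub>i\<in>{..n}. F (Suc i))"
    proof (rule G.finsum_cong')
      fix i assume "i \<in> {..n}"
      then have i: "i \<le> n" by simp
      show "\<ominus>\<^bsub>TP (n + 2)\<^esub> cons (n + 1) a ([((- 1) ^ i :: int)] \<cdot>\<^bsub>TP (n + 1)\<^esub> pure_power k A (contract A i (b # ys))) = F (Suc i)"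
        unfolding FSuc[OF i] c.hom_add_pow[OF p[OF i]] cons_pure_power[OF a(1) t'[OF i]] ..
    qed (use Fc in \<open>auto simp: atMost_atLeast0\<close>)
    finally show ?thesis by simp
  qed
  also have "\<dots> \<oplus>\<^bsub>TP (n + 2)\<^esub> F 0 = F 0 \<ominus>\<^bsub>TP (n + 2)\<^esub> cons (n + 1) a (bar_diff k A n (pure_power k A (b # ys)))"
    unfolding a_minus_def F0
    by (intro G.a_comm pure_power_closed[OF t(3)] G.a_inv_closed c.hom_closed
          abelian_group_hom.hom_closed[OF bar_diff_additive] pure_power_closed[OF t(2)])
  finally show ?thesis unfolding F0 .
qed

lemma bar_diff_cons:
  assumes a: "a \<in> carrier A" and \<beta>: "\<beta> \<in> carrier (TP (n + 2))"
  shows "bar_diff k A (n + 1) (cons (n + 2) a \<beta>) = ends n a \<one>\<^bsub>A\<^esub> \<beta> \<ominus>\<^bsub>TP (n + 2)\<^esub> cons (n + 1) a (bar_diff k A n \<beta>)"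
proof -
  have d: "abelian_group_hom (TP (n + 2 + 1)) (TP (n + 2)) (bar_diff k A (n + 1))"
    using bar_diff_additive[of "n + 1"] by (simp add: numeral_2_eq_2 numeral_3_eq_3)
  have c: "abelian_group_hom (TP (n + 1)) (TP (n + 2)) (cons (n + 1) a)"
    using cons_additive[OF a, of "n + 1"] by simp
  show ?thesis
  proof (rule tensor_power_eqI[OF additive_comp[OF cons_additive[OF a] d]
        additive_diff[OF ends_additive[OF a A.one_closed] additive_comp[OF bar_diff_additive c]] _ \<beta>])
    fix xs assume xs: "xs \<in> tuples A (n + 2)"
    then obtain x ys z where eq: "xs = x # ys @ [z]" "x \<in> carrier A" "z \<in> carrier A" "ys \<in> tuples A n"
      unfolding tuples_ends_iff by blast
    have "ys @ [z] \<in> tuples A (n + 1)" using eq by (simp add: tuples_def)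
    from bar_diff_Cons_pure_power[OF a eq(2) this]
    show "bar_diff k A (n + 1) (cons (n + 2) a (pure_power k A xs)) =
        ends n a \<one>\<^bsub>A\<^esub> (pure_power k A xs) \<ominus>\<^bsub>TP (n + 2)\<^esub> cons (n + 1) a (bar_diff k A n (pure_power k A xs))"
      using eq a by (simp add: cons_pure_power[OF a xs, unfolded eq(1)] ends_pure_power del: add_2_eq_Suc')
  qed
qed

lemma contract_ends:
  assumes "a \<in> carrier A" "c \<in> carrier A" "x \<in> carrier A" "z \<in> carrier A" "ys \<in> tuples A (n + 1)" "i \<le> n + 1"
  shows "\<exists>x' ys' z'. x' \<in> carrier A \<and> z' \<in> carrier A \<and> ys' \<in> tuples A n \<and>
    contract A i (x # ys @ [z]) = x' # ys' @ [z'] \<and>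
    contract A i ((a \<otimes>\<^bsub>A\<^esub> x) # ys @ [z \<otimes>\<^bsub>A\<^esub> c]) = (a \<otimes>\<^bsub>A\<^esub> x') # ys' @ [z' \<otimes>\<^bsub>A\<^esub> c]"
proof (cases i)
  case 0
  obtain y ws where ys: "ys = y # ws" using assms(5) by (cases ys) (auto simp: tuples_def)
  then show ?thesis
    using assms 0 by (intro exI[of _ "x \<otimes>\<^bsub>A\<^esub> y"] exI[of _ ws] exI[of _ z])
      (auto simp: contract_Cons tuples_def A.m_assoc)
next
  case (Suc j)
  have len: "length ys = n + 1" using assms(5) by (simp add: tuples_def)
  show ?thesis
  proof (cases "j = n")
    case True
    obtain ws y where ys: "ys = ws @ [y]" using len by (cases ys rule: rev_cases) auto
    have lw: "length ws = n" using len ys by simp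
    have "contract A n (ws @ [y, z']) = ws @ [y \<otimes>\<^bsub>A\<^esub> z']" for z'
      using lw by (simp add: contract_def nth_append)
    then show ?thesis
      using assms Suc True ys by (intro exI[of _ x] exI[of _ ws] exI[of _ "y \<otimes>\<^bsub>A\<^esub> z"])
        (auto simp: contract_Cons tuples_def A.m_assoc)
  next
    case False
    then have j: "j < n" using assms(6) Suc by simp
    have "contract A j (ys @ [z']) = contract A j ys @ [z']" for z'
      using len j by (simp add: contract_def nth_append)
    moreover have "contract A j ys \<in> tuples A n"
      using slotwise_contract[of j "n - 1"] j assms(5) by (auto simp: slotwise_def Pi_iff numeral_2_eq_2)
    ultimately show ?thesis
      using assms Suc by (intro exI[of _ x] exI[of _ "contract A j ys"] exI[of _ z]) (simp add: contract_Cons)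
  qed
qed

lemma bar_diff_linear:
  assumes "ring env"
  shows "bar_diff k A (n + 1) \<in> linear_maps env (bar_module k A (n + 1)) (bar_module k A n)"
proof (rule linear_on_bar_moduleI[OF left_module_bar_module[OF assms]])
  have dd: "abelian_group_hom (TP (n + 1 + 2)) (TP (n + 2)) (bar_diff k A (n + 1))"
    using bar_diff_additive[of "n + 1"] by simp
  then show "abelian_group_hom (TP (n + 1 + 2)) (bar_module k A n) (bar_diff k A (n + 1))"
    by (rule additive_into_bar_module)
  interpret G: abelian_group "TP (n + 2)" by (rule abelian_group_tensor_power)
  fix a c x ys z
  assume *: "a \<in> carrier A" "c \<in> carrier A" "x \<in> carrier A" "ys \<in> tuples A (n + 1)" "z \<in> carrier A"
  interpret e: abelian_group_hom "TP (n + 2)" "TP (n + 2)" "ends n a c" by (rule ends_additive[OF *(1,2)])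
  have t: "x # ys @ [z] \<in> tuples A (n + 1 + 2)" "(a \<otimes>\<^bsub>A\<^esub> x) # ys @ [z \<otimes>\<^bsub>A\<^esub> c] \<in> tuples A (n + 1 + 2)"
    using * by (auto simp: tuples_def)
  have con: "contract A i (x # ys @ [z]) \<in> tuples A (n + 2) \<and>
      pure_power k A (contract A i ((a \<otimes>\<^bsub>A\<^esub> x) # ys @ [z \<otimes>\<^bsub>A\<^esub> c])) = ends n a c (pure_power k A (contract A i (x # ys @ [z])))"
    if i: "i \<le> n + 1" for i
  proof -
    obtain x' ys' z' where w: "x' \<in> carrier A" "z' \<in> carrier A" "ys' \<in> tuples A n"
      "contract A i (x # ys @ [z]) = x' # ys' @ [z']"
      "contract A i ((a \<otimes>\<^bsub>A\<^esub> x) # ys @ [z \<otimes>\<^bsub>A\<^esub> c]) = (a \<otimes>\<^bsub>A\<^esub> x') # ys' @ [z' \<otimes>\<^bsub>A\<^esub> c]"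
      using contract_ends[OF *(1,2,3,5,4) i] by blast
    then show ?thesis using ends_pure_power[OF *(1,2) w(1,2,3)] by (simp add: tuples_def)
  qed
  note pc = pure_power_closed[OF conjunct1[OF con]]
  have d: "bar_diff k A (n + 1) (pure_power k A xs) =
      (\<Oplus>\<^bsub>TP (n + 2)\<^esub>i\<in>{0..n + 1}. [((- 1) ^ i :: int)] \<cdot>\<^bsub>TP (n + 2)\<^esub> pure_power k A (contract A i xs))"
    if "xs \<in> tuples A (n + 1 + 2)" for xs
    using bar_diff_pure_power[OF that] by simp
  have "bar_diff k A (n + 1) (pure_power k A ((a \<otimes>\<^bsub>A\<^esub> x) # ys @ [z \<otimes>\<^bsub>A\<^esub> c])) =
      (\<Oplus>\<^bsub>TP (n + 2)\<^esub>i\<in>{0..n + 1}. ends n a c ([((- 1) ^ i :: int)] \<cdot>\<^bsub>TP (n + 2)\<^esub> pure_power k A (contract A i (x # ys @ [z]))))"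
    unfolding d[OF t(2)]
  proof (rule G.finsum_cong'[OF _ funcsetI])
    fix i assume "i \<in> {0..n + 1}"
    then have i: "i \<le> n + 1" by simp
    show "[((- 1) ^ i :: int)] \<cdot>\<^bsub>TP (n + 2)\<^esub> pure_power k A (contract A i ((a \<otimes>\<^bsub>A\<^esub> x) # ys @ [z \<otimes>\<^bsub>A\<^esub> c])) =
        ends n a c ([((- 1) ^ i :: int)] \<cdot>\<^bsub>TP (n + 2)\<^esub> pure_power k A (contract A i (x # ys @ [z])))"
      unfolding e.hom_add_pow[OF pc[OF i]] using con[OF i] by simp
    show "ends n a c ([((- 1) ^ i :: int)] \<cdot>\<^bsub>TP (n + 2)\<^esub> pure_power k A (contract A i (x # ys @ [z]))) \<in> carrier (TP (n + 2))"
      by (intro e.hom_closed G.add.int_pow_closed pc i)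
  qed simp
  also have "\<dots> = ends n a c (bar_diff k A (n + 1) (pure_power k A (x # ys @ [z])))"
    unfolding d[OF t(1)] by (rule e.hom_finsum_add[symmetric]) (intro funcsetI G.add.int_pow_closed pc | simp)+
  also have "\<dots> = pure_tensor k A A a c \<odot>\<^bsub>bar_module k A n\<^esub> bar_diff k A (n + 1) (pure_power k A (x # ys @ [z]))"
    by (rule bar_smult(2)[symmetric, OF _ *(1,2)])
       (rule abelian_group_hom.hom_closed[OF dd pure_power_closed[OF t(1)]])
  finally show "bar_diff k A (n + 1) (pure_power k A ((a \<otimes>\<^bsub>A\<^esub> x) # ys @ [z \<otimes>\<^bsub>A\<^esub> c])) = \<dots>" .
qed

end

lemma (in abelian_group) diff_zero: "x \<in> carrier G \<Longrightarrow> x \<ominus> \<zero> = x"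
  using minus_equality[of \<zero> \<zero>] by (simp add: a_minus_def)

context assoc_algebra
begin

lemma bar_diff_0_pure_power:
  assumes "x \<in> carrier A" "y \<in> carrier A"
  shows "bar_diff k A 0 (pure_power k A [x, y]) = pure_power k A [x \<otimes>\<^bsub>A\<^esub> y]"
proof -
  interpret T: abelian_group "TP 1" by (rule abelian_group_tensor_power)
  define F where "F i = [((- 1) ^ i :: int)] \<cdot>\<^bsub>TP 1\<^esub> pure_power k A (contract A i [x, y])" for i
  have t: "[x \<otimes>\<^bsub>A\<^esub> y] \<in> tuples A 1" "[x, y] \<in> tuples A (0 + 2)" using assms by (simp_all add: tuples_def)
  have F0: "F 0 = pure_power k A [x \<otimes>\<^bsub>A\<^esub> y]"
    using T.add.int_pow_1[OF pure_power_closed[OF t(1)]] by (simp add: F_def contract_Cons)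
  have "bar_diff k A 0 (pure_power k A [x, y]) = (\<Oplus>\<^bsub>TP 1\<^esub>i\<in>{0}. F i)"
    using bar_diff_pure_power[OF t(2)] by (simp add: F_def)
  also have "\<dots> = F 0"
    using T.finsum_insert[of "{}" 0 F] F0 pure_power_closed[OF t(1)] by (simp add: T.finsum_empty del: One_nat_def)
  finally show ?thesis unfolding F0 .
qed

text \<open>
  From \<open>d (a \<otimes> \<gamma>) = a \<gamma> - a \<otimes> d \<gamma>\<close> one gets \<open>d d (a \<otimes> \<gamma>) = d (a \<gamma>) - a d \<gamma> + a \<otimes> d d \<gamma>\<close>. The first two
  terms cancel by linearity and the last one vanishes by induction. The induction starts
  with \<open>A\<^sup>\<otimes>\<^sup>3 \<rightarrow> A\<^sup>\<otimes>\<^sup>2 \<rightarrow> A\<close>, where the statement is associativity.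
\<close>

lemma bar_diff_diff:
  assumes E: "ring env" and \<beta>: "\<beta> \<in> carrier (TP (n + 3))"
  shows "bar_diff k A n (bar_diff k A (n + 1) \<beta>) = \<zero>\<^bsub>TP (n + 1)\<^esub>"
  using \<beta>
proof (induction n arbitrary: \<beta>)
  have d: "abelian_group_hom (TP (n + 3)) (TP (n + 2)) (bar_diff k A (n + 1))" for n
    using bar_diff_additive[of "n + 1"] by (simp add: numeral_2_eq_2 numeral_3_eq_3)
  have dd: "abelian_group_hom (TP (n + 3)) (TP (n + 1)) (\<lambda>\<beta>. bar_diff k A n (bar_diff k A (n + 1) \<beta>))" for n
    by (rule additive_comp[OF d bar_diff_additive])
  have zero: "abelian_group_hom (TP (n + 3)) (TP (n + 1)) (\<lambda>\<beta>. \<zero>\<^bsub>TP (n + 1)\<^esub>)" for n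
    by (intro additive_zero abelian_group_tensor_power)
  {
    case 0
    show ?case
    proof (rule tensor_power_eqI[OF dd[of 0] zero[of 0] _ 0])
      fix xs assume "xs \<in> tuples A (0 + 3)"
      then obtain a b c where xs: "xs = [a, b, c]" and abc: "a \<in> carrier A" "b \<in> carrier A" "c \<in> carrier A"
        by (auto simp: tuples_def numeral_3_eq_3 length_Suc_conv)
      interpret T: abelian_group "TP 1" by (rule abelian_group_tensor_power)
      interpret d0: abelian_group_hom "TP 2" "TP 1" "bar_diff k A 0"
        using bar_diff_additive[of 0] by (simp add: numeral_2_eq_2)
      note d0 = bar_diff_0_pure_power
      have c: "[c] \<in> tuples A (0 + 1)" using abc by (simp add: tuples_def)
      have "bar_diff k A 1 (pure_power k A xs) = pure_power k A [a \<otimes>\<^bsub>A\<^esub> b, c] \<ominus>\<^bsub>TP 2\<^esub> pure_power k A [a, b \<otimes>\<^bsub>A\<^esub> c]"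
        using bar_diff_Cons_pure_power[OF abc(1,2) c] abc cons_pure_power[of a "[b \<otimes>\<^bsub>A\<^esub> c]" 1]
        by (simp add: xs d0 tuples_def numeral_2_eq_2)
      moreover have "[a \<otimes>\<^bsub>A\<^esub> b, c] \<in> tuples A 2" "[a, b \<otimes>\<^bsub>A\<^esub> c] \<in> tuples A 2" "[a \<otimes>\<^bsub>A\<^esub> b \<otimes>\<^bsub>A\<^esub> c] \<in> tuples A 1"
        using abc by (auto simp: tuples_def)
      ultimately show "bar_diff k A 0 (bar_diff k A (0 + 1) (pure_power k A xs)) = \<zero>\<^bsub>TP (0 + 1)\<^esub>"
        using abc d0.hom_diff[OF pure_power_closed pure_power_closed] T.r_neg[OF pure_power_closed]
        by (simp add: d0 A.m_assoc a_minus_def)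
    qed
  next
    case (Suc n)
    show ?case
    proof (rule tensor_power_eqI[OF dd[of "Suc n"] zero[of "Suc n"] _ Suc.prems])
      interpret T: abelian_group "TP (n + 2)" by (rule abelian_group_tensor_power)
      interpret d1: abelian_group_hom "TP (n + 3)" "TP (n + 2)" "bar_diff k A (n + 1)" by (rule d)
      fix xs assume xs: "xs \<in> tuples A (Suc n + 3)"
      then obtain a b ws z where w: "xs = a # b # ws @ [z]" "a \<in> carrier A" "b \<in> carrier A" "z \<in> carrier A" "ws \<in> tuples A (n + 1)"
        using tuples_ends_iff[of "tl xs" "n + 1"] by (cases xs) (auto simp: tuples_def)
      let ?ys = "ws @ [z]" and ?\<gamma> = "bar_diff k A (n + 1) (pure_power k A (b # ws @ [z]))"
      have ys: "?ys \<in> tuples A (n + 1 + 1)" and t: "b # ?ys \<in> tuples A (n + 3)" "(a \<otimes>\<^bsub>A\<^esub> b) # ?ys \<in> tuples A (n + 3)"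
        using w by (auto simp: tuples_def)
      note p = pure_power_closed[OF t(1)] and p' = pure_power_closed[OF t(2)]
      have \<gamma>: "?\<gamma> \<in> carrier (TP (n + 2))" by (rule d1.hom_closed[OF p])
      interpret c: abelian_group_hom "TP (n + 2)" "TP (n + 3)" "cons (n + 2) a"
        using cons_additive[OF w(2), of "n + 2"] by (simp add: numeral_2_eq_2 numeral_3_eq_3)
      have "bar_diff k A (Suc n + 1) (pure_power k A xs) =
          pure_power k A ((a \<otimes>\<^bsub>A\<^esub> b) # ?ys) \<ominus>\<^bsub>TP (n + 3)\<^esub> cons (n + 2) a ?\<gamma>"
        using bar_diff_Cons_pure_power[OF w(2,3) ys] w(1) by (simp add: numeral_2_eq_2 numeral_3_eq_3)
      then have "bar_diff k A (n + 1) (bar_diff k A (Suc n + 1) (pure_power k A xs)) =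
          bar_diff k A (n + 1) (pure_power k A ((a \<otimes>\<^bsub>A\<^esub> b) # ?ys)) \<ominus>\<^bsub>TP (n + 2)\<^esub> bar_diff k A (n + 1) (cons (n + 2) a ?\<gamma>)"
        using d1.hom_diff[OF p' c.hom_closed[OF \<gamma>]] by (simp del: Suc_eq_plus1 add_Suc)
      moreover have "bar_diff k A (n + 1) (cons (n + 2) a ?\<gamma>) = ends n a \<one>\<^bsub>A\<^esub> ?\<gamma>"
      proof -
        have "cons (n + 1) a (bar_diff k A n ?\<gamma>) = \<zero>\<^bsub>TP (n + 2)\<^esub>"
          unfolding Suc.IH[OF p]
          using abelian_group_hom.hom_zero[OF cons_additive[OF w(2), of "n + 1"]] by simp
        moreover have "ends n a \<one>\<^bsub>A\<^esub> ?\<gamma> \<in> carrier (TP (n + 2))"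
          by (rule abelian_group_hom.hom_closed[OF ends_additive[OF w(2) A.one_closed] \<gamma>])
        ultimately show ?thesis
          unfolding bar_diff_cons[OF w(2) \<gamma>] by (simp add: T.diff_zero del: add_2_eq_Suc')
      qed
      moreover have "bar_diff k A (n + 1) (pure_power k A ((a \<otimes>\<^bsub>A\<^esub> b) # ?ys)) = ends n a \<one>\<^bsub>A\<^esub> ?\<gamma>"
      proof -
        have one: "pure_tensor k A A a \<one>\<^bsub>A\<^esub> \<in> carrier env" using w(2) by (simp add: env_simps B.pure_tensor_closed)
        have p2: "pure_power k A (b # ?ys) \<in> carrier (TP (n + 1 + 2))" using p by (simp add: numeral_2_eq_2 numeral_3_eq_3)
        have "bar_diff k A (n + 1) (pure_tensor k A A a \<one>\<^bsub>A\<^esub> \<odot>\<^bsub>bar_module k A (n + 1)\<^esub> pure_power k A (b # ?ys)) =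
            pure_tensor k A A a \<one>\<^bsub>A\<^esub> \<odot>\<^bsub>bar_module k A n\<^esub> ?\<gamma>"
          by (rule linear_maps_smult[OF bar_diff_linear[OF E] one]) (unfold bar_module_simps, rule p2)
        then show ?thesis
          unfolding bar_smult(2)[OF p2 w(2) A.one_closed] bar_smult(2)[OF \<gamma> w(2) A.one_closed]
            ends_pure_power[OF w(2) A.one_closed w(3,4,5)] using w(4) by simp
      qed
      ultimately have "bar_diff k A (n + 1) (bar_diff k A (Suc n + 1) (pure_power k A xs)) =
          ends n a \<one>\<^bsub>A\<^esub> ?\<gamma> \<ominus>\<^bsub>TP (n + 2)\<^esub> ends n a \<one>\<^bsub>A\<^esub> ?\<gamma>" by simp
      also have "\<dots> = \<zero>\<^bsub>TP (n + 2)\<^esub>"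
        unfolding a_minus_def
        by (rule T.r_neg[OF abelian_group_hom.hom_closed[OF ends_additive[OF w(2) A.one_closed] \<gamma>]])
      finally show "bar_diff k A (Suc n) (bar_diff k A (Suc n + 1) (pure_power k A xs)) = \<zero>\<^bsub>TP (Suc n + 1)\<^esub>"
        by simp
    qed
  }
qed

lemma bar_aug_additive: "abelian_group_hom (TP 2) A (aug (bar k A))"
proof -
  have two: "i = 0 \<or> i = 1" if "i < 2" for i :: nat using that by auto
  have "induced A (\<lambda>xs. xs ! 0 \<otimes>\<^bsub>A\<^esub> xs ! 1) \<in> hom (add_monoid (TP 2)) (add_monoid A)"
  proof (rule induced_multilinear(1)[OF M.abelian_group_axioms smult_closed M.abelian_group_axioms])
    show "(\<lambda>xs. xs ! 0 \<otimes>\<^bsub>A\<^esub> xs ! 1) \<in> tuples A 2 \<rightarrow> carrier A" using tuples_nth by auto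
    fix ys and i :: nat assume ys: "ys \<in> tuples A 2" and i: "i < 2"
    have y: "length ys = 2" "ys ! 0 \<in> carrier A" "ys ! Suc 0 \<in> carrier A"
      using ys tuples_nth by (auto simp: tuples_def)
    show "(ys[i := a \<oplus>\<^bsub>A\<^esub> b]) ! 0 \<otimes>\<^bsub>A\<^esub> (ys[i := a \<oplus>\<^bsub>A\<^esub> b]) ! 1 =
        (ys[i := a]) ! 0 \<otimes>\<^bsub>A\<^esub> (ys[i := a]) ! 1 \<oplus>\<^bsub>A\<^esub> (ys[i := b]) ! 0 \<otimes>\<^bsub>A\<^esub> (ys[i := b]) ! 1"
      if "a \<in> carrier A" "b \<in> carrier A" for a b
      using two[OF i] y that by (auto simp: A.l_distr A.r_distr)
    show "(ys[i := r \<odot>\<^bsub>A\<^esub> ys ! i]) ! 0 \<otimes>\<^bsub>A\<^esub> (ys[i := r \<odot>\<^bsub>A\<^esub> ys ! i]) ! 1 =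
        (ys[j := r \<odot>\<^bsub>A\<^esub> ys ! j]) ! 0 \<otimes>\<^bsub>A\<^esub> (ys[j := r \<odot>\<^bsub>A\<^esub> ys ! j]) ! 1"
      if "j < 2" "r \<in> carrier k" for j :: nat and r
      using two[OF i] two[OF that(1)] y that by (auto simp: smult_assoc_left smult_assoc_right)
  qed auto
  then show ?thesis
    by (intro additive_hom abelian_group_tensor_power M.abelian_group_axioms) (simp add: bar_def)
qed

lemma additive_into_left_regular:
  assumes "abelian_group_hom G A f" shows "abelian_group_hom G (left_regular k A) f"
proof -
  interpret f: abelian_group_hom G A f by fact
  show ?thesis
    by (intro additiveI abelian_group_left_regular f.G.abelian_group_axioms) (simp_all add: left_regular_simps)
qed

lemma singleton_additive: "abelian_group_hom A (TP 1) (\<lambda>a. pure_power k A [a])"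
proof (rule additiveI[OF M.abelian_group_axioms abelian_group_tensor_power])
  show "pure_power k A [x] \<in> carrier (TP 1)" if "x \<in> carrier A" for x
    using that by (intro pure_power_closed) (simp add: tuples_def)
  show "pure_power k A [x \<oplus>\<^bsub>A\<^esub> y] = pure_power k A [x] \<oplus>\<^bsub>TP 1\<^esub> pure_power k A [y]"
    if "x \<in> carrier A" "y \<in> carrier A" for x y
    using pure_power_add_at[of "[]" 0 "[]" 0 x y 1] that by (simp add: tuples_def)
qed

lemma bar_diff_0:
  assumes "\<beta> \<in> carrier (TP 2)"
  shows "bar_diff k A 0 \<beta> = pure_power k A [aug (bar k A) \<beta>]"
proof -
  have d: "abelian_group_hom (TP 2) (TP 1) (bar_diff k A 0)" using bar_diff_additive[of 0] by (simp add: numeral_2_eq_2)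
  show ?thesis
  proof (rule tensor_power_eqI[OF d additive_comp[OF bar_aug_additive singleton_additive] _ assms])
    fix xs assume xs: "xs \<in> tuples A 2"
    then obtain x y where "xs = [x, y]" "x \<in> carrier A" "y \<in> carrier A"
      by (auto simp: tuples_def numeral_2_eq_2 length_Suc_conv)
    then show "bar_diff k A 0 (pure_power k A xs) = pure_power k A [aug (bar k A) (pure_power k A xs)]"
      using xs by (simp add: bar_diff_0_pure_power bar_aug_pure_power)
  qed
qed

lemma bar_simps: "Ch (bar k A) = bar_module k A" "bd (bar k A) = bar_diff k A"
  by (simp_all add: bar_def)

text \<open>
  Prefixing \<open>1\<close> is a contracting homotopy of the augmented complex: \<open>d (1 \<otimes> \<beta>) = \<beta> - 1 \<otimes> d \<beta>\<close>.
  It is additive, not left linear.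
\<close>

lemma bar_diff_cons_one:
  assumes "\<beta> \<in> carrier (TP (n + 2))" and cycle: "bar_diff k A n \<beta> = \<zero>\<^bsub>TP (n + 1)\<^esub>"
  shows "bar_diff k A (n + 1) (cons (n + 2) \<one>\<^bsub>A\<^esub> \<beta>) = \<beta>"
proof -
  interpret T: abelian_group "TP (n + 2)" by (rule abelian_group_tensor_power)
  have "cons (n + 1) \<one>\<^bsub>A\<^esub> \<zero>\<^bsub>TP (n + 1)\<^esub> = \<zero>\<^bsub>TP (n + 2)\<^esub>"
    using abelian_group_hom.hom_zero[OF cons_additive[OF A.one_closed, of "n + 1"]] by simp
  then show ?thesis
    unfolding bar_diff_cons[OF A.one_closed assms(1)] ends_one[OF assms(1)] cycle
    using T.diff_zero[OF assms(1)] by simp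
qed

text \<open>
  The hypothesis is supplied by any resolution of \<open>A\<close>, see \<open>exact_complex_projective_resolution\<close>.
\<close>

lemma resolves_bar:
  assumes M: "left_module env (left_regular k A)"
  shows "resolves (bar k A)"
proof -
  interpret L: left_module "enveloping k A" "left_regular k A" by fact
  have E: "ring env" by (rule L.R.ring_axioms)
  note M_mod = left_module_bar_module[OF E]
  interpret \<epsilon>: abelian_group_hom "TP 2" A "aug (bar k A)" by (rule bar_aug_additive)
  have d1: "abelian_group_hom (TP 3) (TP 2) (bar_diff k A 1)"
    using bar_diff_additive[of 1] by (simp add: numeral_2_eq_2 numeral_3_eq_3)
  have cons_closed: "cons (n + 2) \<one>\<^bsub>A\<^esub> \<beta> \<in> carrier (TP (n + 3))" if "\<beta> \<in> carrier (TP (n + 2))" for n \<beta>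
    using abelian_group_hom.hom_closed[OF cons_additive[OF A.one_closed] that] by (simp add: numeral_2_eq_2 numeral_3_eq_3)
  have aug_d1: "aug (bar k A) (bar_diff k A 1 \<beta>) = \<zero>\<^bsub>A\<^esub>" if "\<beta> \<in> carrier (TP 3)" for \<beta>
  proof (rule tensor_power_eqI[OF additive_comp[OF d1 bar_aug_additive] additive_zero[OF abelian_group_tensor_power M.abelian_group_axioms] _ that])
    fix xs assume "xs \<in> tuples A 3"
    then obtain a b c where xs: "xs = [a, b, c]" and abc: "a \<in> carrier A" "b \<in> carrier A" "c \<in> carrier A"
      by (auto simp: tuples_def numeral_3_eq_3 length_Suc_conv)
    have t: "[a \<otimes>\<^bsub>A\<^esub> b, c] \<in> tuples A 2" "[a, b \<otimes>\<^bsub>A\<^esub> c] \<in> tuples A 2" "[c] \<in> tuples A (0 + 1)" "[b, c] \<in> tuples A 2"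
      using abc by (auto simp: tuples_def)
    have "bar_diff k A 1 (pure_power k A xs) = pure_power k A [a \<otimes>\<^bsub>A\<^esub> b, c] \<ominus>\<^bsub>TP 2\<^esub> pure_power k A [a, b \<otimes>\<^bsub>A\<^esub> c]"
      using bar_diff_Cons_pure_power[OF abc(1,2) t(3)] abc cons_pure_power[of a "[b \<otimes>\<^bsub>A\<^esub> c]" 1]
      by (simp add: xs bar_diff_0 pure_power_closed t bar_aug_pure_power tuples_def numeral_2_eq_2)
    then show "aug (bar k A) (bar_diff k A 1 (pure_power k A xs)) = \<zero>\<^bsub>A\<^esub>"
      using abc by (simp add: \<epsilon>.hom_diff pure_power_closed t bar_aug_pure_power A.m_assoc a_minus_def M.r_neg)
  qed
  show ?thesis
  proof (rule exact_complex.intro)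
    show "left_module env (left_regular k A)" by fact
    show "left_module env (Ch (bar k A) i)" for i unfolding bar_simps by (rule M_mod)
    show "bd (bar k A) (Suc i) \<in> linear_maps env (Ch (bar k A) (Suc i)) (Ch (bar k A) i)" for i
      unfolding bar_simps using bar_diff_linear[OF E, of i] by simp
    show "aug (bar k A) \<in> linear_maps env (Ch (bar k A) 0) (left_regular k A)"
      unfolding bar_simps
    proof (rule linear_on_bar_moduleI[OF M])
      show "abelian_group_hom (TP (0 + 2)) (left_regular k A) (aug (bar k A))"
        using additive_into_left_regular[OF bar_aug_additive] by (simp add: numeral_2_eq_2)
      fix a c x ys z assume "a \<in> carrier A" "c \<in> carrier A" "x \<in> carrier A" "ys \<in> tuples A 0" "z \<in> carrier A"
      moreover from this have "[x, z] \<in> tuples A 2" "[a \<otimes>\<^bsub>A\<^esub> x, z \<otimes>\<^bsub>A\<^esub> c] \<in> tuples A 2" "ys = []"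
        by (auto simp: tuples_def)
      ultimately show "aug (bar k A) (pure_power k A ((a \<otimes>\<^bsub>A\<^esub> x) # ys @ [z \<otimes>\<^bsub>A\<^esub> c])) =
          pure_tensor k A A a c \<odot>\<^bsub>left_regular k A\<^esub> aug (bar k A) (pure_power k A (x # ys @ [z]))"
        by (simp add: bar_aug_pure_power left_regular_smult A.m_assoc)
    qed
    show "aug (bar k A) ` carrier (Ch (bar k A) 0) = carrier (left_regular k A)"
    proof
      show "aug (bar k A) ` carrier (Ch (bar k A) 0) \<subseteq> carrier (left_regular k A)"
        using \<epsilon>.hom_closed by (auto simp: bar_simps bar_module_simps left_regular_simps numeral_2_eq_2)
      show "carrier (left_regular k A) \<subseteq> aug (bar k A) ` carrier (Ch (bar k A) 0)"
      proof
        fix x assume "x \<in> carrier (left_regular k A)"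
        then have x: "x \<in> carrier A" by (simp add: left_regular_simps)
        then have t: "[\<one>\<^bsub>A\<^esub>, x] \<in> tuples A 2" by (simp add: tuples_def)
        show "x \<in> aug (bar k A) ` carrier (Ch (bar k A) 0)"
          using x pure_power_closed[OF t] bar_aug_pure_power[OF t]
          by (intro image_eqI[of _ _ "pure_power k A [\<one>\<^bsub>A\<^esub>, x]"]) (simp_all add: bar_simps bar_module_simps numeral_2_eq_2)
      qed
    qed
    show "{x \<in> carrier (Ch (bar k A) 0). aug (bar k A) x = \<zero>\<^bsub>left_regular k A\<^esub>} =
        bd (bar k A) (Suc 0) ` carrier (Ch (bar k A) (Suc 0))"
    proof (rule equalityI; rule subsetI)
      fix \<beta> assume "\<beta> \<in> {x \<in> carrier (Ch (bar k A) 0). aug (bar k A) x = \<zero>\<^bsub>left_regular k A\<^esub>}"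
      then have \<beta>: "\<beta> \<in> carrier (TP (0 + 2))" "aug (bar k A) \<beta> = \<zero>\<^bsub>A\<^esub>"
        by (auto simp: bar_simps bar_module_simps left_regular_simps)
      then have "bar_diff k A 0 \<beta> = \<zero>\<^bsub>TP (0 + 1)\<^esub>"
        using abelian_group_hom.hom_zero[OF singleton_additive] by (simp add: bar_diff_0 numeral_2_eq_2)
      from bar_diff_cons_one[OF \<beta>(1) this] cons_closed[OF \<beta>(1)]
      show "\<beta> \<in> bd (bar k A) (Suc 0) ` carrier (Ch (bar k A) (Suc 0))"
        by (intro image_eqI[of _ _ "cons 2 \<one>\<^bsub>A\<^esub> \<beta>"]) (simp_all add: bar_simps bar_module_simps numeral_2_eq_2 numeral_3_eq_3)
    next
      fix \<beta> assume "\<beta> \<in> bd (bar k A) (Suc 0) ` carrier (Ch (bar k A) (Suc 0))"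
      then obtain \<gamma> where \<gamma>: "\<gamma> \<in> carrier (TP 3)" "\<beta> = bar_diff k A 1 \<gamma>"
        by (auto simp: bar_simps bar_module_simps numeral_2_eq_2 numeral_3_eq_3)
      then show "\<beta> \<in> {x \<in> carrier (Ch (bar k A) 0). aug (bar k A) x = \<zero>\<^bsub>left_regular k A\<^esub>}"
        using abelian_group_hom.hom_closed[OF d1 \<gamma>(1)] aug_d1[OF \<gamma>(1)]
        by (simp add: bar_simps bar_module_simps left_regular_simps numeral_2_eq_2)
    qed
    show "{x \<in> carrier (Ch (bar k A) (Suc i)). bd (bar k A) (Suc i) x = \<zero>\<^bsub>Ch (bar k A) i\<^esub>} =
        bd (bar k A) (Suc (Suc i)) ` carrier (Ch (bar k A) (Suc (Suc i)))" for i
    proof (rule equalityI; rule subsetI)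
      fix \<beta> assume "\<beta> \<in> {x \<in> carrier (Ch (bar k A) (Suc i)). bd (bar k A) (Suc i) x = \<zero>\<^bsub>Ch (bar k A) i\<^esub>}"
      then have \<beta>: "\<beta> \<in> carrier (TP (Suc i + 2))" "bar_diff k A (Suc i) \<beta> = \<zero>\<^bsub>TP (Suc i + 1)\<^esub>"
        by (auto simp: bar_simps bar_module_simps)
      from bar_diff_cons_one[OF \<beta>] cons_closed[OF \<beta>(1)]
      show "\<beta> \<in> bd (bar k A) (Suc (Suc i)) ` carrier (Ch (bar k A) (Suc (Suc i)))"
        by (intro image_eqI[of _ _ "cons (Suc i + 2) \<one>\<^bsub>A\<^esub> \<beta>"]) (simp_all add: bar_simps bar_module_simps numeral_2_eq_2 numeral_3_eq_3)
    next
      fix \<beta> assume "\<beta> \<in> bd (bar k A) (Suc (Suc i)) ` carrier (Ch (bar k A) (Suc (Suc i)))"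
      then obtain \<gamma> where \<gamma>: "\<gamma> \<in> carrier (TP (Suc i + 3))" "\<beta> = bar_diff k A (Suc i + 1) \<gamma>"
        by (auto simp: bar_simps bar_module_simps numeral_2_eq_2 numeral_3_eq_3)
      have "abelian_group_hom (TP (Suc i + 3)) (TP (Suc i + 2)) (bar_diff k A (Suc i + 1))"
        using bar_diff_additive[of "Suc i + 1"] by (simp add: numeral_2_eq_2 numeral_3_eq_3)
      from abelian_group_hom.hom_closed[OF this \<gamma>(1)] bar_diff_diff[OF E \<gamma>(1)]
      show "\<beta> \<in> {x \<in> carrier (Ch (bar k A) (Suc i)). bd (bar k A) (Suc i) x = \<zero>\<^bsub>Ch (bar k A) i\<^esub>}"
        by (simp add: \<gamma>(2) bar_simps bar_module_simps)
    qed
  qed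
qed

end

section \<open>Multilinear maps and lifting maps out of the bar resolution\<close>

context assoc_algebra
begin

definition multilinear_maps :: "nat \<Rightarrow> ('k, 'n, 'w) module_scheme \<Rightarrow> ('k, 'a list \<Rightarrow> 'n) module"
  where "multilinear_maps n V =
    \<lparr>carrier = {f \<in> tuples A n \<rightarrow>\<^sub>E carrier V. \<forall>xs\<in>tuples A n. \<forall>i<n.
       (\<forall>a\<in>carrier A. \<forall>b\<in>carrier A. f (xs[i := a \<oplus>\<^bsub>A\<^esub> b]) = f (xs[i := a]) \<oplus>\<^bsub>V\<^esub> f (xs[i := b])) \<and>
       (\<forall>r\<in>carrier k. f (xs[i := r \<odot>\<^bsub>A\<^esub> xs ! i]) = r \<odot>\<^bsub>V\<^esub> f xs)},
     mult = undefined, one = undefined,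
     ring.zero = (\<lambda>xs\<in>tuples A n. \<zero>\<^bsub>V\<^esub>), ring.add = (\<lambda>f g. \<lambda>xs\<in>tuples A n. f xs \<oplus>\<^bsub>V\<^esub> g xs),
     smult = (\<lambda>r f. \<lambda>xs\<in>tuples A n. r \<odot>\<^bsub>V\<^esub> f xs)\<rparr>"

lemma multilinear_mapsI:
  assumes "\<And>xs. xs \<in> tuples A n \<Longrightarrow> f xs \<in> carrier V"
    and "\<And>xs i a b. \<lbrakk>xs \<in> tuples A n; i < n; a \<in> carrier A; b \<in> carrier A\<rbrakk> \<Longrightarrow>
      f (xs[i := a \<oplus>\<^bsub>A\<^esub> b]) = f (xs[i := a]) \<oplus>\<^bsub>V\<^esub> f (xs[i := b])"
    and "\<And>xs i r. \<lbrakk>xs \<in> tuples A n; i < n; r \<in> carrier k\<rbrakk> \<Longrightarrow> f (xs[i := r \<odot>\<^bsub>A\<^esub> xs ! i]) = r \<odot>\<^bsub>V\<^esub> f xs"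
  shows "restrict f (tuples A n) \<in> carrier (multilinear_maps n V)"
  using assms by (simp add: multilinear_maps_def tuples_update tuples_nth)

lemma multilinear_mapsD:
  assumes "f \<in> carrier (multilinear_maps n V)" "xs \<in> tuples A n"
  shows "f xs \<in> carrier V"
    and "\<lbrakk>i < n; a \<in> carrier A; b \<in> carrier A\<rbrakk> \<Longrightarrow> f (xs[i := a \<oplus>\<^bsub>A\<^esub> b]) = f (xs[i := a]) \<oplus>\<^bsub>V\<^esub> f (xs[i := b])"
    and "\<lbrakk>i < n; r \<in> carrier k\<rbrakk> \<Longrightarrow> f (xs[i := r \<odot>\<^bsub>A\<^esub> xs ! i]) = r \<odot>\<^bsub>V\<^esub> f xs"
  using assms by (auto simp: multilinear_maps_def)

lemma multilinear_maps_eqI: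
  assumes "f \<in> carrier (multilinear_maps n V)" "g \<in> carrier (multilinear_maps n V)"
    and "\<And>xs. xs \<in> tuples A n \<Longrightarrow> f xs = g xs"
  shows "f = g"
  using assms by (intro extensionalityI[of f "tuples A n" g]) (auto simp: multilinear_maps_def PiE_def)

lemma left_module_multilinear_maps:
  assumes "left_module k V"
  shows "left_module k (multilinear_maps n V)"
proof -
  interpret V: left_module k V by fact
  let ?M = "multilinear_maps n V"
  have ops: "f \<oplus>\<^bsub>?M\<^esub> g = (\<lambda>xs\<in>tuples A n. f xs \<oplus>\<^bsub>V\<^esub> g xs)" "\<zero>\<^bsub>?M\<^esub> = (\<lambda>xs\<in>tuples A n. \<zero>\<^bsub>V\<^esub>)"
    "r \<odot>\<^bsub>?M\<^esub> f = (\<lambda>xs\<in>tuples A n. r \<odot>\<^bsub>V\<^esub> f xs)" for f g r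
    by (simp_all add: multilinear_maps_def)
  note D = multilinear_mapsD[where V = V]
  have upd: "xs[i := c] \<in> tuples A n" if "xs \<in> tuples A n" "c \<in> carrier A" for xs i c
    using that by (rule tuples_update)
  have add: "f \<oplus>\<^bsub>?M\<^esub> g \<in> carrier ?M" if f: "f \<in> carrier ?M" and g: "g \<in> carrier ?M" for f g
    unfolding ops
  proof (rule multilinear_mapsI)
    fix xs i a b assume x: "xs \<in> tuples A n" and *: "i < n" "a \<in> carrier A" "b \<in> carrier A"
    show "f (xs[i := a \<oplus>\<^bsub>A\<^esub> b]) \<oplus>\<^bsub>V\<^esub> g (xs[i := a \<oplus>\<^bsub>A\<^esub> b]) =
        f (xs[i := a]) \<oplus>\<^bsub>V\<^esub> g (xs[i := a]) \<oplus>\<^bsub>V\<^esub> (f (xs[i := b]) \<oplus>\<^bsub>V\<^esub> g (xs[i := b]))"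
      unfolding D(2)[OF f x *] D(2)[OF g x *]
      using D(1)[OF f upd[OF x]] D(1)[OF g upd[OF x]] * by (simp add: V.M.a_ac)
  next
    fix xs i r assume x: "xs \<in> tuples A n" and *: "i < n" "r \<in> carrier k"
    show "f (xs[i := r \<odot>\<^bsub>A\<^esub> xs ! i]) \<oplus>\<^bsub>V\<^esub> g (xs[i := r \<odot>\<^bsub>A\<^esub> xs ! i]) = r \<odot>\<^bsub>V\<^esub> (f xs \<oplus>\<^bsub>V\<^esub> g xs)"
      unfolding D(3)[OF f x *] D(3)[OF g x *] V.smult_r_distr[OF *(2) D(1)[OF f x] D(1)[OF g x]] ..
  qed (use D(1)[OF f] D(1)[OF g] in simp)
  have smult: "r \<odot>\<^bsub>?M\<^esub> f \<in> carrier ?M" if r: "r \<in> carrier k" and f: "f \<in> carrier ?M" for r f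
    unfolding ops
  proof (rule multilinear_mapsI)
    fix xs i a b assume x: "xs \<in> tuples A n" and *: "i < n" "a \<in> carrier A" "b \<in> carrier A"
    show "r \<odot>\<^bsub>V\<^esub> f (xs[i := a \<oplus>\<^bsub>A\<^esub> b]) = r \<odot>\<^bsub>V\<^esub> f (xs[i := a]) \<oplus>\<^bsub>V\<^esub> r \<odot>\<^bsub>V\<^esub> f (xs[i := b])"
      unfolding D(2)[OF f x *] using D(1)[OF f upd[OF x]] * r by (simp add: V.smult_r_distr)
  next
    fix xs i s assume x: "xs \<in> tuples A n" and *: "i < n" "s \<in> carrier k"
    show "r \<odot>\<^bsub>V\<^esub> f (xs[i := s \<odot>\<^bsub>A\<^esub> xs ! i]) = s \<odot>\<^bsub>V\<^esub> (r \<odot>\<^bsub>V\<^esub> f xs)"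
      unfolding D(3)[OF f x *] using D(1)[OF f x] r *
      by (simp add: R.m_comm flip: V.smult_assoc1)
  qed (use D(1)[OF f] r in \<open>simp add: V.smult_closed\<close>)
  have zero: "\<zero>\<^bsub>?M\<^esub> \<in> carrier ?M"
    unfolding ops by (rule multilinear_mapsI) (auto simp: V.smult_r_null)
  have neg: "\<exists>g\<in>carrier ?M. g \<oplus>\<^bsub>?M\<^esub> f = \<zero>\<^bsub>?M\<^esub>" if f: "f \<in> carrier ?M" for f
  proof (intro bexI[of _ "(\<ominus>\<^bsub>k\<^esub> \<one>\<^bsub>k\<^esub>) \<odot>\<^bsub>?M\<^esub> f"] multilinear_maps_eqI[OF add[OF smult[OF _ f] f] zero] smult f)
    fix xs assume x: "xs \<in> tuples A n"
    have "(\<ominus>\<^bsub>k\<^esub> \<one>\<^bsub>k\<^esub>) \<odot>\<^bsub>V\<^esub> f xs \<oplus>\<^bsub>V\<^esub> f xs = ((\<ominus>\<^bsub>k\<^esub> \<one>\<^bsub>k\<^esub>) \<oplus>\<^bsub>k\<^esub> \<one>\<^bsub>k\<^esub>) \<odot>\<^bsub>V\<^esub> f xs"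
      using D(1)[OF f x] by (simp only: V.smult_l_distr V.smult_one R.a_inv_closed R.one_closed)
    then show "((\<ominus>\<^bsub>k\<^esub> \<one>\<^bsub>k\<^esub>) \<odot>\<^bsub>?M\<^esub> f \<oplus>\<^bsub>?M\<^esub> f) xs = \<zero>\<^bsub>?M\<^esub> xs"
      using x D(1)[OF f x] by (simp add: ops R.l_neg V.smult_l_null)
  qed auto
  show ?thesis
  proof (intro left_module.intro left_module_axioms.intro abelian_groupI R.ring_axioms add zero neg smult)
    fix f g h assume fgh: "f \<in> carrier ?M" "g \<in> carrier ?M" "h \<in> carrier ?M"
    show "f \<oplus>\<^bsub>?M\<^esub> g \<oplus>\<^bsub>?M\<^esub> h = f \<oplus>\<^bsub>?M\<^esub> (g \<oplus>\<^bsub>?M\<^esub> h)"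
      using fgh D(1) by (auto simp: ops V.M.a_assoc restrict_def fun_eq_iff)
    show "f \<oplus>\<^bsub>?M\<^esub> g = g \<oplus>\<^bsub>?M\<^esub> f"
      using fgh D(1) by (auto simp: ops V.M.a_comm restrict_def fun_eq_iff)
  next
    fix f assume f: "f \<in> carrier ?M"
    show "\<zero>\<^bsub>?M\<^esub> \<oplus>\<^bsub>?M\<^esub> f = f"
      by (rule multilinear_maps_eqI[OF add[OF zero f] f]) (simp add: ops D(1)[OF f])
    show "\<one>\<^bsub>k\<^esub> \<odot>\<^bsub>?M\<^esub> f = f"
      by (rule multilinear_maps_eqI[OF smult[OF R.one_closed f] f]) (simp add: ops D(1)[OF f] V.smult_one)
  next
    fix r s f assume "r \<in> carrier k" "s \<in> carrier k" "f \<in> carrier ?M"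
    then show "(r \<oplus>\<^bsub>k\<^esub> s) \<odot>\<^bsub>?M\<^esub> f = r \<odot>\<^bsub>?M\<^esub> f \<oplus>\<^bsub>?M\<^esub> s \<odot>\<^bsub>?M\<^esub> f"
      "(r \<otimes>\<^bsub>k\<^esub> s) \<odot>\<^bsub>?M\<^esub> f = r \<odot>\<^bsub>?M\<^esub> (s \<odot>\<^bsub>?M\<^esub> f)"
      using D(1) by (auto simp: ops V.smult_l_distr V.smult_assoc1 restrict_def fun_eq_iff)
  next
    fix r f g assume "r \<in> carrier k" "f \<in> carrier ?M" "g \<in> carrier ?M"
    then show "r \<odot>\<^bsub>?M\<^esub> (f \<oplus>\<^bsub>?M\<^esub> g) = r \<odot>\<^bsub>?M\<^esub> f \<oplus>\<^bsub>?M\<^esub> r \<odot>\<^bsub>?M\<^esub> g"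
      using D(1) by (auto simp: ops V.smult_r_distr restrict_def fun_eq_iff)
  qed
qed

lemma tuples_Suc: "xs \<in> tuples A (Suc n) \<longleftrightarrow> (\<exists>x ys. xs = x # ys \<and> x \<in> carrier A \<and> ys \<in> tuples A n)"
  by (cases xs) (auto simp: tuples_def)

text \<open>
  A multilinear map in \<open>n + 1\<close> variables is a linear map from \<open>A\<close> to multilinear maps in \<open>n\<close>
  variables, so projectivity of \<open>A\<close> lifts one variable at a time.
\<close>

lemma multilinear_lift:
  assumes proj: "projective_module k A" and V: "left_module k V" and W: "left_module k W"
    and g: "g \<in> linear_maps k V W" and surj: "g ` carrier V = carrier W"
    and f: "f \<in> carrier (multilinear_maps n W)"
  shows "\<exists>h\<in>carrier (multilinear_maps n V). \<forall>xs\<in>tuples A n. g (h xs) = f xs"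
  using f
proof (induction n arbitrary: f)
  case 0
  have "[] \<in> tuples A 0" by (simp add: tuples_def)
  then have "f [] \<in> carrier W" using multilinear_mapsD(1)[OF 0] by blast
  then obtain v where v: "v \<in> carrier V" "g v = f []" using surj by (metis imageE)
  then have "restrict (\<lambda>xs. v) (tuples A 0) \<in> carrier (multilinear_maps 0 V)"
    by (intro multilinear_mapsI) auto
  then show ?case using v by (intro bexI[of _ "restrict (\<lambda>xs. v) (tuples A 0)"]) (auto simp: tuples_def)
next
  case (Suc n)
  interpret V: left_module k V by (rule V)
  interpret W: left_module k W by (rule W)
  note D = multilinear_mapsD
  have opsW: "f \<oplus>\<^bsub>multilinear_maps n W\<^esub> g = (\<lambda>xs\<in>tuples A n. f xs \<oplus>\<^bsub>W\<^esub> g xs)"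
    "r \<odot>\<^bsub>multilinear_maps n W\<^esub> f = (\<lambda>xs\<in>tuples A n. r \<odot>\<^bsub>W\<^esub> f xs)" for f g r
    by (simp_all add: multilinear_maps_def)
  have opsV: "f \<oplus>\<^bsub>multilinear_maps n V\<^esub> g = (\<lambda>xs\<in>tuples A n. f xs \<oplus>\<^bsub>V\<^esub> g xs)"
    "r \<odot>\<^bsub>multilinear_maps n V\<^esub> f = (\<lambda>xs\<in>tuples A n. r \<odot>\<^bsub>V\<^esub> f xs)" for f g r
    by (simp_all add: multilinear_maps_def)
  have cons: "x # xs \<in> tuples A (Suc n)" if "x \<in> carrier A" "xs \<in> tuples A n" for x xs
    using that by (auto simp: tuples_Suc)
  define \<Phi> where "\<Phi> x = (\<lambda>xs\<in>tuples A n. f (x # xs))" for x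
  have \<Phi>: "\<Phi> x \<in> carrier (multilinear_maps n W)" if x: "x \<in> carrier A" for x
    unfolding \<Phi>_def
  proof (rule multilinear_mapsI)
    fix xs i assume xs: "xs \<in> tuples A n" "i < n"
    show "f (x # xs[i := a \<oplus>\<^bsub>A\<^esub> b]) = f (x # xs[i := a]) \<oplus>\<^bsub>W\<^esub> f (x # xs[i := b])"
      if "a \<in> carrier A" "b \<in> carrier A" for a b
      using D(2)[OF Suc.prems cons[OF x xs(1)], of "Suc i" a b] xs that by simp
    show "f (x # xs[i := r \<odot>\<^bsub>A\<^esub> xs ! i]) = r \<odot>\<^bsub>W\<^esub> f (x # xs)" if "r \<in> carrier k" for r
      using D(3)[OF Suc.prems cons[OF x xs(1)], of "Suc i" r] xs that by simp
  qed (use D(1)[OF Suc.prems cons[OF x]] in simp)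
  have \<Phi>_linear: "\<Phi> \<in> linear_maps k A (multilinear_maps n W)"
  proof (rule linear_mapsI[OF \<Phi>])
    show "\<Phi> (x \<oplus>\<^bsub>A\<^esub> y) = \<Phi> x \<oplus>\<^bsub>multilinear_maps n W\<^esub> \<Phi> y" if "x \<in> carrier A" "y \<in> carrier A" for x y
      unfolding opsW
      using D(2)[OF Suc.prems cons[OF that(1)], of _ 0 x y] that by (auto simp: \<Phi>_def restrict_def fun_eq_iff)
    show "\<Phi> (r \<odot>\<^bsub>A\<^esub> x) = r \<odot>\<^bsub>multilinear_maps n W\<^esub> \<Phi> x" if "r \<in> carrier k" "x \<in> carrier A" for r x
      unfolding opsW
      using D(3)[OF Suc.prems cons[OF that(2)], of _ 0 r] that by (auto simp: \<Phi>_def restrict_def fun_eq_iff)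
  qed
  define G where "G h = (\<lambda>xs\<in>tuples A n. g (h xs))" for h :: "'a list \<Rightarrow> 'b"
  have G: "G h \<in> carrier (multilinear_maps n W)" if h: "h \<in> carrier (multilinear_maps n V)" for h
    unfolding G_def
  proof (rule multilinear_mapsI)
    fix xs i assume xs: "xs \<in> tuples A n" "i < n"
    show "g (h (xs[i := a \<oplus>\<^bsub>A\<^esub> b])) = g (h (xs[i := a])) \<oplus>\<^bsub>W\<^esub> g (h (xs[i := b]))"
      if "a \<in> carrier A" "b \<in> carrier A" for a b
      using D(2)[OF h xs that] linear_maps_add[OF g D(1)[OF h] D(1)[OF h]] tuples_update[OF xs(1)] that by simp
    show "g (h (xs[i := r \<odot>\<^bsub>A\<^esub> xs ! i])) = r \<odot>\<^bsub>W\<^esub> g (h xs)" if "r \<in> carrier k" for r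
      using D(3)[OF h xs that] linear_maps_smult[OF g that D(1)[OF h xs(1)]] by simp
  qed (use linear_maps_closed[OF g D(1)[OF h]] in simp)
  have G_linear: "G \<in> linear_maps k (multilinear_maps n V) (multilinear_maps n W)"
  proof (rule linear_mapsI[OF G])
    show "G (p \<oplus>\<^bsub>multilinear_maps n V\<^esub> q) = G p \<oplus>\<^bsub>multilinear_maps n W\<^esub> G q"
      if "p \<in> carrier (multilinear_maps n V)" "q \<in> carrier (multilinear_maps n V)" for p q
      unfolding opsV opsW using linear_maps_add[OF g D(1)[OF that(1)] D(1)[OF that(2)]]
      by (auto simp: G_def restrict_def fun_eq_iff)
    show "G (r \<odot>\<^bsub>multilinear_maps n V\<^esub> p) = r \<odot>\<^bsub>multilinear_maps n W\<^esub> G p"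
      if "r \<in> carrier k" "p \<in> carrier (multilinear_maps n V)" for r p
      unfolding opsV opsW using linear_maps_smult[OF g that(1) D(1)[OF that(2)]]
      by (auto simp: G_def restrict_def fun_eq_iff)
  qed
  have G_surj: "G ` carrier (multilinear_maps n V) = carrier (multilinear_maps n W)"
  proof
    show "carrier (multilinear_maps n W) \<subseteq> G ` carrier (multilinear_maps n V)"
    proof
      fix p assume p: "p \<in> carrier (multilinear_maps n W)"
      obtain h where h: "h \<in> carrier (multilinear_maps n V)" "\<forall>xs\<in>tuples A n. g (h xs) = p xs"
        using Suc.IH[OF p] by blast
      have "p = G h" by (rule multilinear_maps_eqI[OF p G[OF h(1)]]) (simp add: G_def h(2))
      then show "p \<in> G ` carrier (multilinear_maps n V)" using h(1) by (rule image_eqI)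
    qed
  qed (use G in blast)
  obtain H where H: "H \<in> linear_maps k A (multilinear_maps n V)" and GH: "\<And>x. x \<in> carrier A \<Longrightarrow> G (H x) = \<Phi> x"
    using projective_module_lift[OF proj left_module_multilinear_maps[OF V] left_module_multilinear_maps[OF W]
        G_linear G_surj \<Phi>_linear] by blast
  note Hc = linear_maps_closed[OF H]
  define h where "h xs = H (hd xs) (tl xs)" for xs
  have "restrict h (tuples A (Suc n)) \<in> carrier (multilinear_maps (Suc n) V)"
  proof (rule multilinear_mapsI)
    fix xs assume "xs \<in> tuples A (Suc n)"
    then show "h xs \<in> carrier V" using D(1)[OF Hc] by (auto simp: tuples_Suc h_def)
  next
    fix xs i a b assume "xs \<in> tuples A (Suc n)" and i: "i < Suc n" and ab: "a \<in> carrier A" "b \<in> carrier A"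
    then obtain x ys where xs: "xs = x # ys" "x \<in> carrier A" "ys \<in> tuples A n" by (auto simp: tuples_Suc)
    show "h (xs[i := a \<oplus>\<^bsub>A\<^esub> b]) = h (xs[i := a]) \<oplus>\<^bsub>V\<^esub> h (xs[i := b])"
    proof (cases i)
      case 0
      then show ?thesis using linear_maps_add[OF H ab] xs by (simp add: h_def opsV)
    next
      case (Suc j)
      then show ?thesis using D(2)[OF Hc[OF xs(2)] xs(3) _ ab, of j] i xs by (simp add: h_def)
    qed
  next
    fix xs i r assume "xs \<in> tuples A (Suc n)" and i: "i < Suc n" and r: "r \<in> carrier k"
    then obtain x ys where xs: "xs = x # ys" "x \<in> carrier A" "ys \<in> tuples A n" by (auto simp: tuples_Suc)
    show "h (xs[i := r \<odot>\<^bsub>A\<^esub> xs ! i]) = r \<odot>\<^bsub>V\<^esub> h xs"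
    proof (cases i)
      case 0
      then show ?thesis using linear_maps_smult[OF H r xs(2)] xs by (simp add: h_def opsV)
    next
      case (Suc j)
      then show ?thesis using D(3)[OF Hc[OF xs(2)] xs(3) _ r, of j] i xs by (simp add: h_def)
    qed
  qed
  moreover have "g (restrict h (tuples A (Suc n)) xs) = f xs" if t: "xs \<in> tuples A (Suc n)" for xs
  proof -
    obtain x ys where xs: "xs = x # ys" "x \<in> carrier A" "ys \<in> tuples A n" using t by (auto simp: tuples_Suc)
    from fun_cong[OF GH[OF xs(2)], of ys] show ?thesis using t xs by (simp add: G_def \<Phi>_def h_def)
  qed
  ultimately show ?case by blast
qed

text \<open>The \<open>k\<close>-module underlying an \<open>A\<^sup>e\<close>-module, along \<open>r \<mapsto> r 1 \<otimes> 1\<close>.\<close>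

definition scalars :: "('a env, 'n, 'w) module_scheme \<Rightarrow> ('k, 'n) module"
  where "scalars N =
    \<lparr>carrier = carrier N, mult = undefined, one = undefined, ring.zero = \<zero>\<^bsub>N\<^esub>, ring.add = ring.add N,
     smult = (\<lambda>r x. pure_tensor k A A (r \<odot>\<^bsub>A\<^esub> \<one>\<^bsub>A\<^esub>) \<one>\<^bsub>A\<^esub> \<odot>\<^bsub>N\<^esub> x)\<rparr>"

lemma pure_tensor_env: "\<lbrakk>a \<in> carrier A; c \<in> carrier A\<rbrakk> \<Longrightarrow> pure_tensor k A A a c \<in> carrier env"
  by (simp add: env_simps B.pure_tensor_closed)

lemma left_module_scalars:
  assumes "left_module env N"
  shows "left_module k (scalars N)"
proof -
  interpret N: left_module "enveloping k A" N by fact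
  have one: "r \<odot>\<^bsub>A\<^esub> \<one>\<^bsub>A\<^esub> \<in> carrier A" if "r \<in> carrier k" for r using that by (simp add: smult_closed)
  have "abelian_group (scalars N)"
    using N.M.add.l_inv_ex by (intro abelian_groupI) (auto simp: scalars_def N.M.a_ac)
  then show ?thesis
  proof (intro left_module.intro left_module_axioms.intro R.ring_axioms)
    fix r s x assume rs: "r \<in> carrier k" "s \<in> carrier k" and "x \<in> carrier (scalars N)"
    then have x: "x \<in> carrier N" by (simp add: scalars_def)
    have "pure_tensor k A A ((r \<oplus>\<^bsub>k\<^esub> s) \<odot>\<^bsub>A\<^esub> \<one>\<^bsub>A\<^esub>) \<one>\<^bsub>A\<^esub> =
        pure_tensor k A A (r \<odot>\<^bsub>A\<^esub> \<one>\<^bsub>A\<^esub>) \<one>\<^bsub>A\<^esub> \<oplus>\<^bsub>env\<^esub> pure_tensor k A A (s \<odot>\<^bsub>A\<^esub> \<one>\<^bsub>A\<^esub>) \<one>\<^bsub>A\<^esub>"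
      using rs one by (simp add: env_simps smult_l_distr B.pure_tensor_add_left)
    then show "(r \<oplus>\<^bsub>k\<^esub> s) \<odot>\<^bsub>scalars N\<^esub> x = r \<odot>\<^bsub>scalars N\<^esub> x \<oplus>\<^bsub>scalars N\<^esub> s \<odot>\<^bsub>scalars N\<^esub> x"
      using N.smult_l_distr[OF pure_tensor_env[OF one[OF rs(1)] A.one_closed] pure_tensor_env[OF one[OF rs(2)] A.one_closed] x]
      by (simp add: scalars_def)
    have "pure_tensor k A A (r \<odot>\<^bsub>A\<^esub> \<one>\<^bsub>A\<^esub>) \<one>\<^bsub>A\<^esub> \<otimes>\<^bsub>env\<^esub> pure_tensor k A A (s \<odot>\<^bsub>A\<^esub> \<one>\<^bsub>A\<^esub>) \<one>\<^bsub>A\<^esub> =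
        pure_tensor k A A ((r \<otimes>\<^bsub>k\<^esub> s) \<odot>\<^bsub>A\<^esub> \<one>\<^bsub>A\<^esub>) \<one>\<^bsub>A\<^esub>"
      using rs one by (simp add: pure_tensor_mult smult_assoc_left smult_assoc1)
    then show "(r \<otimes>\<^bsub>k\<^esub> s) \<odot>\<^bsub>scalars N\<^esub> x = r \<odot>\<^bsub>scalars N\<^esub> (s \<odot>\<^bsub>scalars N\<^esub> x)"
      using N.smult_assoc1[OF pure_tensor_env[OF one[OF rs(1)] A.one_closed] pure_tensor_env[OF one[OF rs(2)] A.one_closed] x]
      by (simp add: scalars_def)
  next
    fix r x assume r: "r \<in> carrier k" and "x \<in> carrier (scalars N)"
    then have x: "x \<in> carrier N" by (simp add: scalars_def)
    note R = pure_tensor_env[OF one[OF r] A.one_closed]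
    show "r \<odot>\<^bsub>scalars N\<^esub> x \<in> carrier (scalars N)"
      using N.smult_closed[OF R x] by (simp add: scalars_def)
    fix y assume "y \<in> carrier (scalars N)"
    then show "r \<odot>\<^bsub>scalars N\<^esub> (x \<oplus>\<^bsub>scalars N\<^esub> y) = r \<odot>\<^bsub>scalars N\<^esub> x \<oplus>\<^bsub>scalars N\<^esub> r \<odot>\<^bsub>scalars N\<^esub> y"
      using N.smult_r_distr[OF R x] by (simp add: scalars_def)
  next
    fix x assume "x \<in> carrier (scalars N)"
    then show "\<one>\<^bsub>k\<^esub> \<odot>\<^bsub>scalars N\<^esub> x = x"
      using N.smult_one[of x] by (simp add: scalars_def smult_one env_simps)
  qed
qed

text \<open>
  An \<open>A\<^sup>e\<close>-linear map on the bar module is determined by its values at \<open>1 \<otimes> ys \<otimes> 1\<close>, which are \<open>k\<close>-multilinear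
  in \<open>ys\<close>. A multilinear lift \<open>h\<close> of these values extends back by \<open>x \<otimes> ys \<otimes> z \<mapsto> (x \<otimes> z) h(ys)\<close>.
\<close>

lemma bar_module_lifts_along:
  assumes proj: "projective_module k A" and N: "left_module env N" and L: "abelian_group L"
    and g: "g \<in> linear_maps env N L"
  shows "lifts_along env (bar_module k A n) N L g"
  unfolding lifts_along_def
proof (intro ballI impI)
  fix f assume f: "f \<in> linear_maps env (bar_module k A n) L" and im: "f ` carrier (bar_module k A n) \<subseteq> g ` carrier N"
  interpret N: left_module "enveloping k A" N by (rule N)
  define I where "I = L\<lparr>carrier := g ` carrier N\<rparr>"
  have I: "left_module env I" unfolding I_def by (rule left_module_image[OF N L g])
  interpret I: left_module "enveloping k A" I by (rule I)
  have I_simps: "carrier I = g ` carrier N" "x \<oplus>\<^bsub>I\<^esub> y = x \<oplus>\<^bsub>L\<^esub> y" "X \<odot>\<^bsub>I\<^esub> x = X \<odot>\<^bsub>L\<^esub> x" for x y X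
    by (simp_all add: I_def)
  have gI: "g \<in> linear_maps env N I" and fI: "f \<in> linear_maps env (bar_module k A n) I"
    using f g im by (auto simp: linear_maps_def I_simps)
  have fadd: "abelian_group_hom (TP (n + 2)) I f"
    using linear_maps_closed[OF fI] linear_maps_add[OF fI]
    by (intro additiveI abelian_group_tensor_power I.M.abelian_group_axioms) (simp_all add: bar_module_simps)
  have act: "f (pure_power k A ((a \<otimes>\<^bsub>A\<^esub> x) # ys @ [z \<otimes>\<^bsub>A\<^esub> c])) = pure_tensor k A A a c \<odot>\<^bsub>I\<^esub> f (pure_power k A (x # ys @ [z]))"
    if *: "a \<in> carrier A" "c \<in> carrier A" "x \<in> carrier A" "z \<in> carrier A" "ys \<in> tuples A n" for a c x ys z
  proof -
    have t: "x # ys @ [z] \<in> tuples A (n + 2)" using * by (simp add: tuples_def)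
    then have "pure_power k A (x # ys @ [z]) \<in> carrier (bar_module k A n)"
      using pure_power_closed[OF t] by (simp add: bar_module_simps)
    from linear_maps_smult[OF fI pure_tensor_env[OF *(1,2)] this]
    show ?thesis by (simp add: bar_smult(2)[OF pure_power_closed[OF t] *(1,2)] ends_pure_power *)
  qed
  have one_t: "\<one>\<^bsub>A\<^esub> # ys @ [\<one>\<^bsub>A\<^esub>] \<in> tuples A (n + 2)" if "ys \<in> tuples A n" for ys
    using that by (simp add: tuples_def)
  define f0 where "f0 ys = f (pure_power k A (\<one>\<^bsub>A\<^esub> # ys @ [\<one>\<^bsub>A\<^esub>]))" for ys
  have f0: "restrict f0 (tuples A n) \<in> carrier (multilinear_maps n (scalars I))"
  proof (rule multilinear_mapsI)
    fix ys assume ys: "ys \<in> tuples A n"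
    show "f0 ys \<in> carrier (scalars I)"
      using abelian_group_hom.hom_closed[OF fadd pure_power_closed[OF one_t[OF ys]]] by (simp add: f0_def scalars_def)
    fix i assume i: "i < n"
    have len: "length ys = n" using ys by (simp add: tuples_def)
    have upd: "(\<one>\<^bsub>A\<^esub> # ys @ [\<one>\<^bsub>A\<^esub>])[Suc i := a] = \<one>\<^bsub>A\<^esub> # ys[i := a] @ [\<one>\<^bsub>A\<^esub>]" for a
      using i len by (simp add: list_update_append)
    {
      fix a b assume ab: "a \<in> carrier A" "b \<in> carrier A"
      have "pure_power k A (\<one>\<^bsub>A\<^esub> # ys[i := a \<oplus>\<^bsub>A\<^esub> b] @ [\<one>\<^bsub>A\<^esub>]) =
          pure_power k A (\<one>\<^bsub>A\<^esub> # ys[i := a] @ [\<one>\<^bsub>A\<^esub>]) \<oplus>\<^bsub>TP (n + 2)\<^esub> pure_power k A (\<one>\<^bsub>A\<^esub> # ys[i := b] @ [\<one>\<^bsub>A\<^esub>])"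
        using pure_power_add[OF one_t[OF ys], of "Suc i" a b] ab i unfolding upd by simp
      then show "f0 (ys[i := a \<oplus>\<^bsub>A\<^esub> b]) = f0 (ys[i := a]) \<oplus>\<^bsub>scalars I\<^esub> f0 (ys[i := b])"
        using abelian_group_hom.hom_add[OF fadd pure_power_closed[OF one_t[OF tuples_update[OF ys ab(1)]]]
            pure_power_closed[OF one_t[OF tuples_update[OF ys ab(2)]]]]
        by (simp add: f0_def scalars_def)
    }
    fix r assume r: "r \<in> carrier k"
    have nth: "(\<one>\<^bsub>A\<^esub> # ys @ [\<one>\<^bsub>A\<^esub>]) ! Suc i = ys ! i" using i len by (simp add: nth_append)
    have "pure_power k A (\<one>\<^bsub>A\<^esub> # ys[i := r \<odot>\<^bsub>A\<^esub> ys ! i] @ [\<one>\<^bsub>A\<^esub>]) = pure_power k A ((r \<odot>\<^bsub>A\<^esub> \<one>\<^bsub>A\<^esub>) # ys @ [\<one>\<^bsub>A\<^esub>])"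
      using pure_power_balanced[OF one_t[OF ys], of "Suc i" 0 r] r i unfolding nth upd by simp
    then show "f0 (ys[i := r \<odot>\<^bsub>A\<^esub> ys ! i]) = r \<odot>\<^bsub>scalars I\<^esub> f0 ys"
      using act[of "r \<odot>\<^bsub>A\<^esub> \<one>\<^bsub>A\<^esub>" "\<one>\<^bsub>A\<^esub>" "\<one>\<^bsub>A\<^esub>" "\<one>\<^bsub>A\<^esub>" ys] ys r
      by (simp add: f0_def scalars_def smult_closed)
  qed
  have gk: "g \<in> linear_maps k (scalars N) (scalars I)"
    using linear_maps_add[OF gI] linear_maps_smult[OF gI] linear_maps_closed[OF gI]
    by (intro linear_mapsI) (auto simp: scalars_def pure_tensor_env smult_closed)
  have g_surj: "g ` carrier (scalars N) = carrier (scalars I)" by (simp add: scalars_def I_simps)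
  obtain h where h: "h \<in> carrier (multilinear_maps n (scalars N))"
    and gh0: "\<forall>ys\<in>tuples A n. g (h ys) = restrict f0 (tuples A n) ys"
    using multilinear_lift[OF proj left_module_scalars[OF N] left_module_scalars[OF I] gk g_surj f0] by blast
  have gh: "g (h ys) = f0 ys" if "ys \<in> tuples A n" for ys
    using gh0 that by simp
  have hc: "h ys \<in> carrier N" if "ys \<in> tuples A n" for ys
    using multilinear_mapsD(1)[OF h that] by (simp add: scalars_def)
  define F where "F xs = pure_tensor k A A (hd xs) (last xs) \<odot>\<^bsub>N\<^esub> h (butlast (tl xs))" for xs
  have F: "F (x # ys @ [z]) = pure_tensor k A A x z \<odot>\<^bsub>N\<^esub> h ys" for x ys z by (simp add: F_def)
  have Fc: "F (x # ys @ [z]) \<in> carrier N" if "x \<in> carrier A" "z \<in> carrier A" "ys \<in> tuples A n" for x ys z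
    unfolding F using that by (intro N.smult_closed pure_tensor_env hc)
  have upd: "(x # ys @ [z])[i := a] =
      (if i = 0 then a # ys @ [z] else if i = n + 1 then x # ys @ [a] else x # ys[i - 1 := a] @ [z])"
    if "ys \<in> tuples A n" "i < n + 2" for x ys z i a
    using that by (cases i) (auto simp: tuples_def list_update_append)
  have Fadd: "F (xs[i := a \<oplus>\<^bsub>A\<^esub> b]) = F (xs[i := a]) \<oplus>\<^bsub>N\<^esub> F (xs[i := b])"
    if xs: "xs \<in> tuples A (n + 2)" and i: "i < n + 2" and ab: "a \<in> carrier A" "b \<in> carrier A" for xs i a b
  proof -
    obtain x ys z where e: "xs = x # ys @ [z]" "x \<in> carrier A" "z \<in> carrier A" "ys \<in> tuples A n"
      using xs unfolding tuples_ends_iff by blast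
    consider "i = 0" | "i = n + 1" | "0 < i" "i - 1 < n" using i by linarith
    then show ?thesis
    proof cases
      case 1
      show ?thesis unfolding e(1) upd[OF e(4) i] using 1 ab e
        by (simp add: F B.pure_tensor_add_left N.smult_l_distr[unfolded env_simps] B.pure_tensor_closed hc)
    next
      case 2
      show ?thesis unfolding e(1) upd[OF e(4) i] using 2 ab e
        by (simp add: F B.pure_tensor_add_right N.smult_l_distr[unfolded env_simps] B.pure_tensor_closed hc)
    next
      case 3
      have "h (ys[i - 1 := a \<oplus>\<^bsub>A\<^esub> b]) = h (ys[i - 1 := a]) \<oplus>\<^bsub>N\<^esub> h (ys[i - 1 := b])"
        using multilinear_mapsD(2)[OF h e(4) 3(2) ab] by (simp add: scalars_def)
      then show ?thesis unfolding e(1) upd[OF e(4) i] using 3 ab e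
        by (auto simp: F N.smult_r_distr pure_tensor_env hc tuples_update)
    qed
  qed
  have Fsmult: "F (xs[i := r \<odot>\<^bsub>A\<^esub> xs ! i]) = pure_tensor k A A (r \<odot>\<^bsub>A\<^esub> hd xs) (last xs) \<odot>\<^bsub>N\<^esub> h (butlast (tl xs))"
    if xs: "xs \<in> tuples A (n + 2)" and i: "i < n + 2" and r: "r \<in> carrier k" for xs i r
  proof -
    obtain x ys z where e: "xs = x # ys @ [z]" "x \<in> carrier A" "z \<in> carrier A" "ys \<in> tuples A n"
      using xs unfolding tuples_ends_iff by blast
    have len: "length ys = n" using e(4) by (simp add: tuples_def)
    consider "i = 0" | "i = n + 1" | "0 < i" "i - 1 < n" using i by linarith
    then show ?thesis
    proof cases
      case 1
      show ?thesis unfolding e(1) upd[OF e(4) i] using 1 by (simp add: F)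
    next
      case 2
      have "(x # ys @ [z]) ! i = z" using 2 len by (simp add: nth_append)
      then show ?thesis unfolding e(1) upd[OF e(4) i] using 2 e r B.pure_tensor_balanced[of r x z] by (simp add: F)
    next
      case 3
      have "(x # ys @ [z]) ! i = ys ! (i - 1)" using 3 len by (cases i) (auto simp: nth_append)
      then have "F ((x # ys @ [z])[i := r \<odot>\<^bsub>A\<^esub> (x # ys @ [z]) ! i]) =
          pure_tensor k A A x z \<odot>\<^bsub>N\<^esub> (pure_tensor k A A (r \<odot>\<^bsub>A\<^esub> \<one>\<^bsub>A\<^esub>) \<one>\<^bsub>A\<^esub> \<odot>\<^bsub>N\<^esub> h ys)"
        unfolding upd[OF e(4) i] using 3 multilinear_mapsD(3)[OF h e(4) 3(2) r] by (auto simp: F scalars_def)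
      also have "\<dots> = (pure_tensor k A A x z \<otimes>\<^bsub>env\<^esub> pure_tensor k A A (r \<odot>\<^bsub>A\<^esub> \<one>\<^bsub>A\<^esub>) \<one>\<^bsub>A\<^esub>) \<odot>\<^bsub>N\<^esub> h ys"
        using e r by (intro N.smult_assoc1[symmetric] pure_tensor_env hc smult_closed) auto
      finally show ?thesis unfolding e(1) using e r by (simp add: pure_tensor_mult smult_assoc_right smult_closed)
    qed
  qed
  define \<Psi> where "\<Psi> = induced N F"
  note ml = M.abelian_group_axioms smult_closed N.M.abelian_group_axioms
  have F_fun: "F \<in> tuples A (n + 2) \<rightarrow> carrier N" 
  proof
    fix xs assume "xs \<in> tuples A (n + 2)"
    then show "F xs \<in> carrier N" unfolding tuples_ends_iff using Fc by blast
  qed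
  have \<Psi>_add: "abelian_group_hom (TP (n + 2)) N \<Psi>"
    unfolding \<Psi>_def
    by (intro additive_hom abelian_group_tensor_power N.M.abelian_group_axioms
          induced_multilinear(1)[OF ml F_fun Fadd]) (simp_all add: Fsmult)
  have \<Psi>_pure: "\<Psi> (pure_power k A (x # ys @ [z])) = pure_tensor k A A x z \<odot>\<^bsub>N\<^esub> h ys"
    if "x \<in> carrier A" "z \<in> carrier A" "ys \<in> tuples A n" for x ys z
  proof -
    have t: "x # ys @ [z] \<in> tuples A (n + 2)" using that by (simp add: tuples_def)
    have "induced N F (pure_power k A (x # ys @ [z])) = F (x # ys @ [z])"
      by (rule induced_multilinear(2)[OF ml F_fun Fadd _ t]) (simp_all add: Fsmult)
    then show ?thesis by (simp add: \<Psi>_def F)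
  qed
  have \<Psi>: "\<Psi> \<in> linear_maps env (bar_module k A n) N"
  proof (rule linear_on_bar_moduleI[OF N \<Psi>_add])
    fix a c x ys z assume *: "a \<in> carrier A" "c \<in> carrier A" "x \<in> carrier A" "ys \<in> tuples A n" "z \<in> carrier A"
    then show "\<Psi> (pure_power k A ((a \<otimes>\<^bsub>A\<^esub> x) # ys @ [z \<otimes>\<^bsub>A\<^esub> c])) =
        pure_tensor k A A a c \<odot>\<^bsub>N\<^esub> \<Psi> (pure_power k A (x # ys @ [z]))"
      using N.smult_assoc1[OF pure_tensor_env[OF *(1,2)] pure_tensor_env[OF *(3,5)] hc[OF *(4)]]
      by (simp add: \<Psi>_pure pure_tensor_mult)
  qed
  show "\<exists>h\<in>linear_maps env (bar_module k A n) N. \<forall>x\<in>carrier (bar_module k A n). g (h x) = f x"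
  proof (intro bexI[OF _ \<Psi>] ballI)
    fix \<beta> assume "\<beta> \<in> carrier (bar_module k A n)"
    then have \<beta>: "\<beta> \<in> carrier (TP (n + 2))" by (simp add: bar_module_simps)
    have g_add: "abelian_group_hom N I g" by (rule linear_maps_additive[OF gI N I])
    show "g (\<Psi> \<beta>) = f \<beta>"
    proof (rule tensor_power_eqI[OF additive_comp[OF \<Psi>_add g_add] fadd _ \<beta>])
      fix xs assume "xs \<in> tuples A (n + 2)"
      then obtain x ys z where e: "xs = x # ys @ [z]" "x \<in> carrier A" "z \<in> carrier A" "ys \<in> tuples A n"
        unfolding tuples_ends_iff by blast
      then show "g (\<Psi> (pure_power k A xs)) = f (pure_power k A xs)"
        using linear_maps_smult[OF gI pure_tensor_env[OF e(2,3)] hc[OF e(4)]]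
          act[of x z "\<one>\<^bsub>A\<^esub>" "\<one>\<^bsub>A\<^esub>" ys] gh[OF e(4)]
        by (simp add: \<Psi>_pure f0_def)
    qed
  qed
qed

end

section \<open>The cap product on the bar resolution as a lift\<close>

lemma (in abelian_group) finsum_split:
  fixes f :: "nat \<Rightarrow> 'a"
  assumes "\<And>j. f j \<in> carrier G"
  shows "(\<Oplus>j\<in>{0..m + 1 + i}. f j) = (\<Oplus>j\<in>{0..m}. f j) \<oplus> (\<Oplus>l\<in>{0..i}. f (m + 1 + l))"
proof (induction i)
  case 0
  show ?case using assms by (simp add: atLeast0AtMost finsum_Suc a_comm Pi_iff)
next
  case (Suc i)
  have "(\<Oplus>j\<in>{0..m + 1 + Suc i}. f j) = f (m + 1 + Suc i) \<oplus> (\<Oplus>j\<in>{0..m + 1 + i}. f j)"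
    using finsum_Suc[of f "m + 1 + i"] assms by (simp add: atLeast0AtMost)
  moreover have "(\<Oplus>l\<in>{0..Suc i}. f (m + 1 + l)) = f (m + 1 + Suc i) \<oplus> (\<Oplus>l\<in>{0..i}. f (m + 1 + l))"
    using finsum_Suc[of "\<lambda>l. f (m + 1 + l)" i] assms by (simp add: atLeast0AtMost)
  ultimately show ?case using Suc assms by (simp add: a_lcomm)
qed

context assoc_algebra
begin

text \<open>
  The map \<open>a\<^sub>0 \<otimes> \<dots> \<otimes> a\<^sub>n\<^sub>+\<^sub>1 \<mapsto> t (a\<^sub>0 \<otimes> \<dots> \<otimes> a\<^sub>m \<otimes> 1) \<otimes> a\<^sub>m\<^sub>+\<^sub>1 \<otimes> \<dots> \<otimes> a\<^sub>n\<^sub>+\<^sub>1\<close>, where \<open>n = m + i\<close>. The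
  cap product on the bar resolution is \<open>id \<otimes> front_eval m i t\<close>.
\<close>

definition front_eval ::
    "nat \<Rightarrow> nat \<Rightarrow> (('a list \<Rightarrow>\<^sub>0 int) set \<Rightarrow> 'a) \<Rightarrow> ('a list \<Rightarrow>\<^sub>0 int) set \<Rightarrow> ('a list \<Rightarrow>\<^sub>0 int) set"
  where "front_eval m i t = induced (TP (i + 2))
    (\<lambda>xs. pure_power k A (t (pure_power k A (take (m + 1) xs @ [\<one>\<^bsub>A\<^esub>])) # drop (m + 1) xs))"

lemma tuples_split: "xs \<in> tuples A (p + q) \<longleftrightarrow> (\<exists>u w. xs = u @ w \<and> u \<in> tuples A p \<and> w \<in> tuples A q)"
proof
  assume "xs \<in> tuples A (p + q)"
  then show "\<exists>u w. xs = u @ w \<and> u \<in> tuples A p \<and> w \<in> tuples A q"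
    by (intro exI[of _ "take p xs"] exI[of _ "drop p xs"])
       (auto simp: tuples_def dest: in_set_takeD in_set_dropD)
qed (auto simp: tuples_def)

lemma cochain_act:
  assumes t: "t \<in> linear_maps env (bar_module k A m) (left_regular k A)"
    and *: "a \<in> carrier A" "c \<in> carrier A" "x \<in> carrier A" "z \<in> carrier A" "ys \<in> tuples A m"
  shows "t (pure_power k A ((a \<otimes>\<^bsub>A\<^esub> x) # ys @ [z \<otimes>\<^bsub>A\<^esub> c])) = a \<otimes>\<^bsub>A\<^esub> t (pure_power k A (x # ys @ [z])) \<otimes>\<^bsub>A\<^esub> c"
proof -
  have xs: "x # ys @ [z] \<in> tuples A (m + 2)" using * by (simp add: tuples_def)
  note p = pure_power_closed[OF xs]
  then have p': "pure_power k A (x # ys @ [z]) \<in> carrier (bar_module k A m)" by (simp add: bar_module_simps)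
  have "t (pure_power k A (x # ys @ [z])) \<in> carrier A"
    using linear_maps_closed[OF t p'] by (simp add: left_regular_simps)
  then show ?thesis
    using linear_maps_smult[OF t pure_tensor_env[OF *(1,2)] p']
    by (simp add: bar_smult(2)[OF p *(1,2)] ends_pure_power * left_regular_smult)
qed

lemma cochain_additive:
  assumes t: "t \<in> linear_maps env (bar_module k A m) (left_regular k A)"
  shows "abelian_group_hom (TP (m + 2)) A t"
  using linear_maps_closed[OF t] linear_maps_add[OF t]
  by (intro additiveI abelian_group_tensor_power M.abelian_group_axioms)
     (simp_all add: bar_module_simps left_regular_simps)

lemma cochain_front:
  assumes t: "t \<in> linear_maps env (bar_module k A m) (left_regular k A)" and u: "u \<in> tuples A (m + 1)"
  shows "u @ [\<one>\<^bsub>A\<^esub>] \<in> tuples A (m + 2)"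
    and "t (pure_power k A (u @ [\<one>\<^bsub>A\<^esub>])) \<in> carrier A"
    and "b \<in> carrier A \<Longrightarrow> t (pure_power k A (u @ [b])) = t (pure_power k A (u @ [\<one>\<^bsub>A\<^esub>])) \<otimes>\<^bsub>A\<^esub> b"
    and "\<lbrakk>j < m + 1; a \<in> carrier A; b \<in> carrier A\<rbrakk> \<Longrightarrow> t (pure_power k A (u[j := a \<oplus>\<^bsub>A\<^esub> b] @ [\<one>\<^bsub>A\<^esub>])) =
      t (pure_power k A (u[j := a] @ [\<one>\<^bsub>A\<^esub>])) \<oplus>\<^bsub>A\<^esub> t (pure_power k A (u[j := b] @ [\<one>\<^bsub>A\<^esub>]))"
    and "\<lbrakk>j < m + 1; r \<in> carrier k\<rbrakk> \<Longrightarrow> t (pure_power k A (u[j := r \<odot>\<^bsub>A\<^esub> u ! j] @ [\<one>\<^bsub>A\<^esub>])) =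
      r \<odot>\<^bsub>A\<^esub> t (pure_power k A (u @ [\<one>\<^bsub>A\<^esub>]))"
proof -
  interpret t: abelian_group_hom "TP (m + 2)" A t by (rule cochain_additive[OF t])
  show one: "u @ [\<one>\<^bsub>A\<^esub>] \<in> tuples A (m + 2)" using u by (auto simp: tuples_def)
  show tc: "t (pure_power k A (u @ [\<one>\<^bsub>A\<^esub>])) \<in> carrier A" by (rule t.hom_closed[OF pure_power_closed[OF one]])
  obtain x ys where xu: "u = x # ys" "x \<in> carrier A" "ys \<in> tuples A m" using u tuples_Suc[of u m] by auto
  show right: "t (pure_power k A (u @ [b])) = t (pure_power k A (u @ [\<one>\<^bsub>A\<^esub>])) \<otimes>\<^bsub>A\<^esub> b" if b: "b \<in> carrier A" for b
    using cochain_act[OF t A.one_closed b xu(2) A.one_closed xu(3)] b xu tc by simp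
  have len: "length u = m + 1" using u by (simp add: tuples_def)
  have upd: "(u @ [\<one>\<^bsub>A\<^esub>])[j := c] = u[j := c] @ [\<one>\<^bsub>A\<^esub>]" if "j < m + 1" for j c
    using that len by (simp add: list_update_append)
  show "t (pure_power k A (u[j := a \<oplus>\<^bsub>A\<^esub> b] @ [\<one>\<^bsub>A\<^esub>])) =
      t (pure_power k A (u[j := a] @ [\<one>\<^bsub>A\<^esub>])) \<oplus>\<^bsub>A\<^esub> t (pure_power k A (u[j := b] @ [\<one>\<^bsub>A\<^esub>]))"
    if j: "j < m + 1" and ab: "a \<in> carrier A" "b \<in> carrier A" for j a b
  proof -
    have j': "j < m + 2" using j by simp
    show ?thesis
      unfolding upd[OF j, symmetric] pure_power_add[OF one j' ab]
      by (intro t.hom_add pure_power_closed tuples_update[OF one] ab)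
  qed
  show "t (pure_power k A (u[j := r \<odot>\<^bsub>A\<^esub> u ! j] @ [\<one>\<^bsub>A\<^esub>])) = r \<odot>\<^bsub>A\<^esub> t (pure_power k A (u @ [\<one>\<^bsub>A\<^esub>]))"
    if j: "j < m + 1" and r: "r \<in> carrier k" for j r
  proof -
    have "(u @ [\<one>\<^bsub>A\<^esub>]) ! j = u ! j" "(u @ [\<one>\<^bsub>A\<^esub>])[m + 1 := r \<odot>\<^bsub>A\<^esub> (u @ [\<one>\<^bsub>A\<^esub>]) ! (m + 1)] = u @ [r \<odot>\<^bsub>A\<^esub> \<one>\<^bsub>A\<^esub>]"
      using j len by (auto simp: nth_append list_update_append)
    then have "pure_power k A (u[j := r \<odot>\<^bsub>A\<^esub> u ! j] @ [\<one>\<^bsub>A\<^esub>]) = pure_power k A (u @ [r \<odot>\<^bsub>A\<^esub> \<one>\<^bsub>A\<^esub>])"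
      using pure_power_balanced[OF one, of j "m + 1" r] upd[OF j, of "r \<odot>\<^bsub>A\<^esub> u ! j"] j r by simp
    then show ?thesis using right[of "r \<odot>\<^bsub>A\<^esub> \<one>\<^bsub>A\<^esub>"] r tc by (simp add: smult_closed smult_assoc_right)
  qed
qed

lemma front_eval_multilinear:
  assumes t: "t \<in> linear_maps env (bar_module k A m) (left_regular k A)"
  shows "abelian_group_hom (TP (m + i + 2)) (TP (i + 2)) (front_eval m i t)"
    and "\<lbrakk>u \<in> tuples A (m + 1); w \<in> tuples A (i + 1)\<rbrakk> \<Longrightarrow>
      front_eval m i t (pure_power k A (u @ w)) = pure_power k A (t (pure_power k A (u @ [\<one>\<^bsub>A\<^esub>])) # w)"
proof -
  define \<theta> where "\<theta> u = t (pure_power k A (u @ [\<one>\<^bsub>A\<^esub>]))" for u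
  note \<theta> = cochain_front(2)[OF t, folded \<theta>_def]
  define f where "f xs = pure_power k A (\<theta> (take (m + 1) xs) # drop (m + 1) xs)" for xs
  have f: "f (u @ w) = pure_power k A (\<theta> u # w)" if "u \<in> tuples A (m + 1)" for u w
    using that by (simp add: f_def tuples_def)
  have split: "xs \<in> tuples A (m + i + 2) \<longleftrightarrow> (\<exists>u w. xs = u @ w \<and> u \<in> tuples A (m + 1) \<and> w \<in> tuples A (i + 1))" for xs
    using tuples_split[of xs "m + 1" "i + 1"] by (simp add: numeral_2_eq_2)
  have t2: "\<theta> u # w \<in> tuples A (i + 2)" if "u \<in> tuples A (m + 1)" "w \<in> tuples A (i + 1)" for u w
    using \<theta>[OF that(1)] that(2) by (simp add: tuples_def)
  have f_fun: "f \<in> tuples A (m + i + 2) \<rightarrow> carrier (TP (i + 2))"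
  proof
    fix xs assume "xs \<in> tuples A (m + i + 2)"
    then obtain u w where xs: "xs = u @ w" "u \<in> tuples A (m + 1)" "w \<in> tuples A (i + 1)" unfolding split by blast
    show "f xs \<in> carrier (TP (i + 2))" unfolding xs(1) f[OF xs(2)] by (rule pure_power_closed[OF t2[OF xs(2,3)]])
  qed
  have upd: "(u @ w)[j := c] = (if j < m + 1 then u[j := c] @ w else u @ w[j - (m + 1) := c])"
    if "u \<in> tuples A (m + 1)" for u w j c
    using that by (simp add: tuples_def list_update_append)
  have f_add: "f (xs[j := a \<oplus>\<^bsub>A\<^esub> b]) = f (xs[j := a]) \<oplus>\<^bsub>TP (i + 2)\<^esub> f (xs[j := b])"
    if x: "xs \<in> tuples A (m + i + 2)" and j: "j < m + i + 2" and ab: "a \<in> carrier A" "b \<in> carrier A" for xs j a b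
  proof -
    obtain u w where xs: "xs = u @ w" "u \<in> tuples A (m + 1)" "w \<in> tuples A (i + 1)" using x unfolding split by blast
    show ?thesis
    proof (cases "j < m + 1")
      case True
      have "\<theta> (u[j := a \<oplus>\<^bsub>A\<^esub> b]) = \<theta> (u[j := a]) \<oplus>\<^bsub>A\<^esub> \<theta> (u[j := b])"
        unfolding \<theta>_def by (rule cochain_front(4)[OF t xs(2) True ab])
      moreover have "u[j := c] \<in> tuples A (m + 1)" if "c \<in> carrier A" for c by (rule tuples_update[OF xs(2) that])
      ultimately show ?thesis
        unfolding xs(1) upd[OF xs(2)]
        using True ab xs(3) \<theta> pure_power_add_at[of "[]" 0 w "i + 1" "\<theta> (u[j := a])" "\<theta> (u[j := b])" "i + 2"]
        by (simp add: f tuples_def)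
    next
      case False
      define l where "l = j - (m + 1)"
      have l: "Suc l < i + 2" using False j by (simp add: l_def)
      have "pure_power k A (\<theta> u # w[l := a \<oplus>\<^bsub>A\<^esub> b]) =
          pure_power k A (\<theta> u # w[l := a]) \<oplus>\<^bsub>TP (i + 2)\<^esub> pure_power k A (\<theta> u # w[l := b])"
        using pure_power_add[OF t2[OF xs(2,3)] l ab] by simp
      then show ?thesis unfolding xs(1) upd[OF xs(2)] using False by (simp add: f[OF xs(2)] l_def)
    qed
  qed
  have f_smult: "f (xs[j := r \<odot>\<^bsub>A\<^esub> xs ! j]) = pure_power k A ((r \<odot>\<^bsub>A\<^esub> \<theta> (take (m + 1) xs)) # drop (m + 1) xs)"
    if x: "xs \<in> tuples A (m + i + 2)" and j: "j < m + i + 2" and r: "r \<in> carrier k" for xs j r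
  proof -
    obtain u w where xs: "xs = u @ w" "u \<in> tuples A (m + 1)" "w \<in> tuples A (i + 1)" using x unfolding split by blast
    have len: "length u = m + 1" using xs by (simp add: tuples_def)
    show ?thesis
    proof (cases "j < m + 1")
      case True
      have "xs ! j = u ! j" using True len xs(1) by (simp add: nth_append)
      moreover have "\<theta> (u[j := r \<odot>\<^bsub>A\<^esub> u ! j]) = r \<odot>\<^bsub>A\<^esub> \<theta> u"
        unfolding \<theta>_def by (rule cochain_front(5)[OF t xs(2) True r])
      moreover have "u[j := r \<odot>\<^bsub>A\<^esub> u ! j] \<in> tuples A (m + 1)"
        by (intro tuples_update xs(2) smult_closed r tuples_nth[OF xs(2) True])
      ultimately show ?thesis using True len by (simp add: xs(1) upd[OF xs(2)] f)
    next
      case False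
      define l where "l = j - (m + 1)"
      have l: "Suc l < i + 2" using False j by (simp add: l_def)
      have "xs ! j = w ! l" using False len xs(1) by (simp add: nth_append l_def)
      moreover have "pure_power k A (\<theta> u # w[l := r \<odot>\<^bsub>A\<^esub> w ! l]) = pure_power k A ((r \<odot>\<^bsub>A\<^esub> \<theta> u) # w)"
        using pure_power_balanced[OF t2[OF xs(2,3)] l _ r, of 0] by simp
      ultimately show ?thesis using False len by (simp add: xs(1) upd[OF xs(2)] f[OF xs(2)] l_def)
    qed
  qed
  note ml = M.abelian_group_axioms smult_closed abelian_group_tensor_power
  have eq: "front_eval m i t = induced (TP (i + 2)) f" by (simp add: front_eval_def f_def[abs_def] \<theta>_def)
  show "abelian_group_hom (TP (m + i + 2)) (TP (i + 2)) (front_eval m i t)"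
    unfolding eq
    by (intro additive_hom abelian_group_tensor_power induced_multilinear(1)[OF ml f_fun f_add]) (simp_all add: f_smult)
  show "front_eval m i t (pure_power k A (u @ w)) = pure_power k A (t (pure_power k A (u @ [\<one>\<^bsub>A\<^esub>])) # w)"
    if "u \<in> tuples A (m + 1)" "w \<in> tuples A (i + 1)"
  proof -
    have "u @ w \<in> tuples A (m + i + 2)" unfolding split using that by blast
    then have "induced (TP (i + 2)) f (pure_power k A (u @ w)) = f (u @ w)"
      by (intro induced_multilinear(2)[OF ml f_fun f_add]) (simp_all add: f_smult)
    then show ?thesis unfolding eq f[OF that(1)] by (simp add: \<theta>_def)
  qed
qed

lemma front_eval_linear:
  assumes E: "ring env" and t: "t \<in> linear_maps env (bar_module k A m) (left_regular k A)"
  shows "front_eval m i t \<in> linear_maps env (bar_module k A (m + i)) (bar_module k A i)"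
proof (rule linear_on_bar_moduleI[OF left_module_bar_module[OF E]
      additive_into_bar_module[OF front_eval_multilinear(1)[OF t]]])
  fix a c x ys z
  assume *: "a \<in> carrier A" "c \<in> carrier A" "x \<in> carrier A" "ys \<in> tuples A (m + i)" "z \<in> carrier A"
  obtain us ws where ys: "ys = us @ ws" "us \<in> tuples A m" "ws \<in> tuples A i" using *(4) unfolding tuples_split by blast
  have u: "x # us \<in> tuples A (m + 1)" "(a \<otimes>\<^bsub>A\<^esub> x) # us \<in> tuples A (m + 1)" and w: "ws @ [z] \<in> tuples A (i + 1)" "ws @ [z \<otimes>\<^bsub>A\<^esub> c] \<in> tuples A (i + 1)"
    using * ys by (auto simp: tuples_def)
  have \<theta>: "t (pure_power k A ((a \<otimes>\<^bsub>A\<^esub> x) # us @ [\<one>\<^bsub>A\<^esub>])) = a \<otimes>\<^bsub>A\<^esub> t (pure_power k A (x # us @ [\<one>\<^bsub>A\<^esub>]))"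
    using cochain_act[OF t *(1) A.one_closed *(3) A.one_closed ys(2)] cochain_front(2)[OF t u(1)] * by simp
  let ?s = "t (pure_power k A (x # us @ [\<one>\<^bsub>A\<^esub>]))"
  have s: "?s \<in> carrier A" using cochain_front(2)[OF t u(1)] by simp
  have t2: "?s # ws @ [z] \<in> tuples A (i + 2)" using s w by (auto simp: tuples_def)
  show "front_eval m i t (pure_power k A ((a \<otimes>\<^bsub>A\<^esub> x) # ys @ [z \<otimes>\<^bsub>A\<^esub> c])) =
      pure_tensor k A A a c \<odot>\<^bsub>bar_module k A i\<^esub> front_eval m i t (pure_power k A (x # ys @ [z]))"
    using front_eval_multilinear(2)[OF t u(1) w(1)] front_eval_multilinear(2)[OF t u(2) w(2)]
      bar_smult(2)[OF pure_power_closed[OF t2] *(1,2)] ends_pure_power[OF *(1,2) s *(5) ys(3)]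
    by (simp add: ys(1) \<theta>)
qed

lemma contract_append:
  assumes "length u = m + 1"
  shows "j \<le> m \<Longrightarrow> contract A j (u @ b # v) = contract A j (u @ [b]) @ v"
    and "contract A (m + 1 + l) (u @ w) = u @ contract A l w"
  using assms by (auto simp: contract_def nth_append)

text \<open>
  The first \<open>m + 1\<close> summands of \<open>d (u \<otimes> b \<otimes> v)\<close> contract inside \<open>u \<otimes> b\<close>; as \<open>t\<close> kills the
  boundary of \<open>u \<otimes> b \<otimes> 1\<close>, they add up, with the sign \<open>(-1)\<^sup>m\<close>, to the
  single summand that multiplies the value of \<open>t\<close> by \<open>b\<close>.
  The remaining summands are those of \<open>d (b \<otimes> v)\<close>, moved by \<open>m + 1\<close> places in the alternating sum.
\<close>

lemma front_eval_bar_diff: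
  assumes t: "t \<in> linear_maps env (bar_module k A m) (left_regular k A)"
    and cocycle: "\<And>\<beta>. \<beta> \<in> carrier (TP (m + 3)) \<Longrightarrow> t (bar_diff k A (m + 1) \<beta>) = \<zero>\<^bsub>A\<^esub>"
    and \<beta>: "\<beta> \<in> carrier (TP (m + i + 3))"
  shows "front_eval m i t (bar_diff k A (m + i + 1) \<beta>) =
    [((- 1) ^ m :: int)] \<cdot>\<^bsub>TP (i + 2)\<^esub> bar_diff k A (i + 1) (front_eval m (i + 1) t \<beta>)"
proof -
  interpret G: abelian_group "TP (i + 2)" by (rule abelian_group_tensor_power)
  interpret t: abelian_group_hom "TP (m + 2)" A t by (rule cochain_additive[OF t])
  interpret r: abelian_group_hom "TP (m + i + 2)" "TP (i + 2)" "front_eval m i t" by (rule front_eval_multilinear(1)[OF t])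
  have r1: "abelian_group_hom (TP (m + i + 3)) (TP (i + 3)) (front_eval m (i + 1) t)"
    using front_eval_multilinear(1)[OF t, of "i + 1"] by (simp add: numeral_2_eq_2 numeral_3_eq_3)
  have d1: "abelian_group_hom (TP (n + 3)) (TP (n + 2)) (bar_diff k A (n + 1))" for n
    using bar_diff_additive[of "n + 1"] by (simp add: numeral_2_eq_2 numeral_3_eq_3)
  show ?thesis
  proof (rule tensor_power_eqI[OF additive_comp[OF d1 r.abelian_group_hom_axioms]
        additive_add_pow[OF additive_comp[OF r1 d1]] _ \<beta>])
    fix xs assume xs: "xs \<in> tuples A (m + i + 3)"
    then obtain u bv where 1: "xs = u @ bv" "u \<in> tuples A (m + 1)" "bv \<in> tuples A (i + 2)"
      using tuples_split[of xs "m + 1" "i + 2"] by (auto simp: numeral_2_eq_2 numeral_3_eq_3)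
    then obtain b v where 2: "bv = b # v" "b \<in> carrier A" "v \<in> tuples A (i + 1)"
      using tuples_Suc[of bv "i + 1"] by auto
    note u = 1(2) and b = 2(2) and v = 2(3)
    have len: "length u = m + 1" using u by (simp add: tuples_def)
    let ?\<theta> = "\<lambda>u. t (pure_power k A (u @ [\<one>\<^bsub>A\<^esub>]))"
    note \<theta>u = cochain_front(2)[OF t u]
    have ub: "u @ [b] \<in> tuples A (m + 2)" and ub1: "u @ [b, \<one>\<^bsub>A\<^esub>] \<in> tuples A (m + 1 + 2)"
      and bv: "b # v \<in> tuples A (i + 2)" and x: "u @ b # v \<in> tuples A (m + i + 1 + 2)"
      using u b v by (auto simp: tuples_def)
    have cf: "contract A j (u @ [b]) \<in> tuples A (m + 1)" if "j \<le> m" for j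
      using slotwise_contract[of j m] that ub by (auto simp: slotwise_def)
    have cb: "contract A l (b # v) \<in> tuples A (i + 1)" if "l \<le> i" for l
      using slotwise_contract[of l i] that bv by (auto simp: slotwise_def)
    interpret \<kappa>: abelian_group_hom A "TP (i + 2)" "\<lambda>a. pure_power k A (a # v)"
    proof (rule additiveI[OF M.abelian_group_axioms abelian_group_tensor_power])
      show "pure_power k A (a # v) \<in> carrier (TP (i + 2))" if "a \<in> carrier A" for a
        using that v by (intro pure_power_closed) (simp add: tuples_def)
      show "pure_power k A ((a \<oplus>\<^bsub>A\<^esub> a') # v) = pure_power k A (a # v) \<oplus>\<^bsub>TP (i + 2)\<^esub> pure_power k A (a' # v)"
        if "a \<in> carrier A" "a' \<in> carrier A" for a a'
        using pure_power_add_at[of "[]" 0 v "i + 1" a a' "i + 2"] that v by (simp add: tuples_def)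
    qed
    interpret c: abelian_group_hom "TP (i + 1)" "TP (i + 2)" "cons (i + 1) (?\<theta> u)"
      using cons_additive[OF \<theta>u, of "i + 1"] by simp
    \<comment> \<open>all but the last summand of the cocycle condition at \<open>u \<otimes> b \<otimes> 1\<close>\<close>
    define S where "S = (\<Oplus>\<^bsub>A\<^esub>j\<in>{0..m}. [((- 1) ^ j :: int)] \<cdot>\<^bsub>A\<^esub> ?\<theta> (contract A j (u @ [b])))"
    have Sc: "S \<in> carrier A" unfolding S_def by (intro M.finsum_closed funcsetI M.add.int_pow_closed cochain_front(2)[OF t cf]) simp
    have S: "S = [((- 1) ^ m :: int)] \<cdot>\<^bsub>A\<^esub> (?\<theta> u \<otimes>\<^bsub>A\<^esub> b)"
    proof -
      have con: "contract A (m + 1) (u @ [b, \<one>\<^bsub>A\<^esub>]) = u @ [b]"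
        using contract_append(2)[OF len, of 0 "[b, \<one>\<^bsub>A\<^esub>]"] b by (simp add: contract_Cons)
      have cj: "contract A j (u @ [b, \<one>\<^bsub>A\<^esub>]) = contract A j (u @ [b]) @ [\<one>\<^bsub>A\<^esub>]" if "j \<le> m" for j
        using contract_append(1)[OF len that, of b "[\<one>\<^bsub>A\<^esub>]"] by simp
      define F where "F j = [((- 1) ^ j :: int)] \<cdot>\<^bsub>A\<^esub> t (pure_power k A (contract A j (u @ [b, \<one>\<^bsub>A\<^esub>])))" for j
      have cc: "contract A j (u @ [b, \<one>\<^bsub>A\<^esub>]) \<in> tuples A (m + 2)" if "j \<le> m + 1" for j
        using slotwise_contract[of j "m + 1"] that ub1 by (auto simp: slotwise_def)
      have Fc: "F j \<in> carrier A" if "j \<le> m + 1" for j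
        unfolding F_def by (intro M.add.int_pow_closed t.hom_closed pure_power_closed cc that)
      have "bar_diff k A (m + 1) (pure_power k A (u @ [b, \<one>\<^bsub>A\<^esub>])) =
          (\<Oplus>\<^bsub>TP (m + 2)\<^esub>j\<in>{0..m + 1}. [((- 1) ^ j :: int)] \<cdot>\<^bsub>TP (m + 2)\<^esub> pure_power k A (contract A j (u @ [b, \<one>\<^bsub>A\<^esub>])))"
        using bar_diff_pure_power[OF ub1] by simp
      then have "t (bar_diff k A (m + 1) (pure_power k A (u @ [b, \<one>\<^bsub>A\<^esub>]))) =
          (\<Oplus>\<^bsub>A\<^esub>j\<in>{0..m + 1}. t ([((- 1) ^ j :: int)] \<cdot>\<^bsub>TP (m + 2)\<^esub> pure_power k A (contract A j (u @ [b, \<one>\<^bsub>A\<^esub>]))))"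
        using t.hom_finsum_add[of "{0..m + 1}" "\<lambda>j. [((- 1) ^ j :: int)] \<cdot>\<^bsub>TP (m + 2)\<^esub> pure_power k A (contract A j (u @ [b, \<one>\<^bsub>A\<^esub>]))"]
          t.G.add.int_pow_closed[OF pure_power_closed[OF cc]] by (simp add: Pi_iff del: add_2_eq_Suc')
      also have "\<dots> = (\<Oplus>\<^bsub>A\<^esub>j\<in>{0..m + 1}. F j)"
        using Fc t.hom_add_pow[OF pure_power_closed[OF cc]] by (intro M.finsum_cong') (auto simp: F_def simp del: add_2_eq_Suc')
      also have "\<dots> = F (m + 1) \<oplus>\<^bsub>A\<^esub> (\<Oplus>\<^bsub>A\<^esub>j\<in>{0..m}. F j)"
        using M.finsum_Suc[of F m] Fc by (simp add: atLeast0AtMost Pi_iff)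
      also have "(\<Oplus>\<^bsub>A\<^esub>j\<in>{0..m}. F j) = S"
        unfolding S_def using cochain_front(2)[OF t cf] by (intro M.finsum_cong') (auto simp: F_def cj)
      also have "F (m + 1) = \<ominus>\<^bsub>A\<^esub> ([((- 1) ^ m :: int)] \<cdot>\<^bsub>A\<^esub> (?\<theta> u \<otimes>\<^bsub>A\<^esub> b))"
        unfolding F_def con cochain_front(3)[OF t u b]
        using M.add.int_pow_neg[of "?\<theta> u \<otimes>\<^bsub>A\<^esub> b" "(- 1) ^ m"] \<theta>u b by simp
      finally have "\<ominus>\<^bsub>A\<^esub> ([((- 1) ^ m :: int)] \<cdot>\<^bsub>A\<^esub> (?\<theta> u \<otimes>\<^bsub>A\<^esub> b)) \<oplus>\<^bsub>A\<^esub> S = \<zero>\<^bsub>A\<^esub>"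
        using cocycle[of "pure_power k A (u @ [b, \<one>\<^bsub>A\<^esub>])"] pure_power_closed[OF ub1]
        by (simp add: numeral_2_eq_2 numeral_3_eq_3)
      then show ?thesis
        using M.r_neg2[of "[((- 1) ^ m :: int)] \<cdot>\<^bsub>A\<^esub> (?\<theta> u \<otimes>\<^bsub>A\<^esub> b)" S] \<theta>u b Sc by simp
    qed
    define H where "H j = (if j \<le> m + 1 + i then [((- 1) ^ j :: int)] \<cdot>\<^bsub>TP (i + 2)\<^esub>
        front_eval m i t (pure_power k A (contract A j (u @ b # v))) else \<zero>\<^bsub>TP (i + 2)\<^esub>)" for j
    have cx: "contract A j (u @ b # v) \<in> tuples A (m + i + 2)" if "j \<le> m + 1 + i" for j
      using slotwise_contract[of j "m + i + 1"] that x by (auto simp: slotwise_def)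
    have Hc: "H j \<in> carrier (TP (i + 2))" for j
      unfolding H_def using G.add.int_pow_closed[OF r.hom_closed[OF pure_power_closed[OF cx]]] G.zero_closed by auto
    have "bar_diff k A (m + i + 1) (pure_power k A xs) =
        (\<Oplus>\<^bsub>TP (m + i + 2)\<^esub>j\<in>{0..m + 1 + i}. [((- 1) ^ j :: int)] \<cdot>\<^bsub>TP (m + i + 2)\<^esub> pure_power k A (contract A j (u @ b # v)))"
      using bar_diff_pure_power[OF x] 1 2 by simp
    then have "front_eval m i t (bar_diff k A (m + i + 1) (pure_power k A xs)) =
        (\<Oplus>\<^bsub>TP (i + 2)\<^esub>j\<in>{0..m + 1 + i}. front_eval m i t
          ([((- 1) ^ j :: int)] \<cdot>\<^bsub>TP (m + i + 2)\<^esub> pure_power k A (contract A j (u @ b # v))))"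
      using r.hom_finsum_add[of "{0..m + 1 + i}" "\<lambda>j. [((- 1) ^ j :: int)] \<cdot>\<^bsub>TP (m + i + 2)\<^esub> pure_power k A (contract A j (u @ b # v))"]
        r.G.add.int_pow_closed[OF pure_power_closed[OF cx]] by (simp add: Pi_iff del: add_2_eq_Suc')
    also have "\<dots> = (\<Oplus>\<^bsub>TP (i + 2)\<^esub>j\<in>{0..m + 1 + i}. H j)"
      using Hc r.hom_add_pow[OF pure_power_closed[OF cx]] by (intro G.finsum_cong') (auto simp: H_def simp del: add_2_eq_Suc')
    also have "\<dots> = (\<Oplus>\<^bsub>TP (i + 2)\<^esub>j\<in>{0..m}. H j) \<oplus>\<^bsub>TP (i + 2)\<^esub> (\<Oplus>\<^bsub>TP (i + 2)\<^esub>l\<in>{0..i}. H (m + 1 + l))"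
      by (rule G.finsum_split[OF Hc])
    also have "(\<Oplus>\<^bsub>TP (i + 2)\<^esub>j\<in>{0..m}. H j) = pure_power k A (S # v)"
    proof -
      have "pure_power k A (S # v) =
          (\<Oplus>\<^bsub>TP (i + 2)\<^esub>j\<in>{0..m}. pure_power k A (([((- 1) ^ j :: int)] \<cdot>\<^bsub>A\<^esub> ?\<theta> (contract A j (u @ [b]))) # v))"
        unfolding S_def by (rule \<kappa>.hom_finsum_add) (auto intro!: M.add.int_pow_closed cochain_front(2)[OF t cf])
      also have "\<dots> = (\<Oplus>\<^bsub>TP (i + 2)\<^esub>j\<in>{0..m}. H j)"
      proof (rule G.finsum_cong')
        fix j assume "j \<in> {0..m}"
        then have j: "j \<le> m" by simp
        show "pure_power k A (([((- 1) ^ j :: int)] \<cdot>\<^bsub>A\<^esub> ?\<theta> (contract A j (u @ [b]))) # v) = H j"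
        proof -
          have "j \<le> m + 1 + i" using j by simp
          then have Hj: "H j = [((- 1) ^ j :: int)] \<cdot>\<^bsub>TP (i + 2)\<^esub> front_eval m i t (pure_power k A (contract A j (u @ [b]) @ v))"
            unfolding H_def contract_append(1)[OF len j, of b v] by (rule if_P)
          show ?thesis
            unfolding Hj front_eval_multilinear(2)[OF t cf[OF j] v]
            by (rule \<kappa>.hom_add_pow[OF cochain_front(2)[OF t cf[OF j]]])
        qed
      qed (use Hc in auto)
      finally show ?thesis by simp
    qed
    also have "(\<Oplus>\<^bsub>TP (i + 2)\<^esub>l\<in>{0..i}. H (m + 1 + l)) =
        \<ominus>\<^bsub>TP (i + 2)\<^esub> ([((- 1) ^ m :: int)] \<cdot>\<^bsub>TP (i + 2)\<^esub> cons (i + 1) (?\<theta> u) (bar_diff k A i (pure_power k A (b # v))))"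
    proof -
      interpret N: abelian_group_hom "TP (i + 1)" "TP (i + 2)"
        "\<lambda>\<gamma>. \<ominus>\<^bsub>TP (i + 2)\<^esub> ([((- 1) ^ m :: int)] \<cdot>\<^bsub>TP (i + 2)\<^esub> cons (i + 1) (?\<theta> u) \<gamma>)"
        by (rule additive_uminus[OF additive_add_pow[OF c.abelian_group_hom_axioms]])
      note pc = pure_power_closed[OF cb]
      have "\<ominus>\<^bsub>TP (i + 2)\<^esub> ([((- 1) ^ m :: int)] \<cdot>\<^bsub>TP (i + 2)\<^esub> cons (i + 1) (?\<theta> u) (bar_diff k A i (pure_power k A (b # v)))) =
        (\<Oplus>\<^bsub>TP (i + 2)\<^esub>l\<in>{0..i}. \<ominus>\<^bsub>TP (i + 2)\<^esub> ([((- 1) ^ m :: int)] \<cdot>\<^bsub>TP (i + 2)\<^esub> cons (i + 1) (?\<theta> u)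
          ([((- 1) ^ l :: int)] \<cdot>\<^bsub>TP (i + 1)\<^esub> pure_power k A (contract A l (b # v)))))"
        unfolding bar_diff_pure_power[OF bv]
        by (rule N.hom_finsum_add) (intro funcsetI c.G.add.int_pow_closed pc | simp)+
      also have "\<dots> = (\<Oplus>\<^bsub>TP (i + 2)\<^esub>l\<in>{0..i}. H (m + 1 + l))"
      proof (rule G.finsum_cong')
        fix l assume "l \<in> {0..i}"
        then have l: "l \<le> i" by simp
        have cl: "cons (i + 1) (?\<theta> u) (pure_power k A (contract A l (b # v))) = front_eval m i t (pure_power k A (contract A (m + 1 + l) (u @ b # v)))"
          unfolding contract_append(2)[OF len] front_eval_multilinear(2)[OF t u cb[OF l]] by (rule cons_pure_power[OF \<theta>u cb[OF l]])
        let ?q = "cons (i + 1) (?\<theta> u) (pure_power k A (contract A l (b # v)))"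
        have q: "?q \<in> carrier (TP (i + 2))" by (rule c.hom_closed[OF pc[OF l]])
        have "\<ominus>\<^bsub>TP (i + 2)\<^esub> ([((- 1) ^ m :: int)] \<cdot>\<^bsub>TP (i + 2)\<^esub> ([((- 1) ^ l :: int)] \<cdot>\<^bsub>TP (i + 2)\<^esub> ?q)) =
            [((- 1) ^ (m + 1 + l) :: int)] \<cdot>\<^bsub>TP (i + 2)\<^esub> ?q"
        proof -
          have "[((- 1) ^ m :: int)] \<cdot>\<^bsub>TP (i + 2)\<^esub> ([((- 1) ^ l :: int)] \<cdot>\<^bsub>TP (i + 2)\<^esub> ?q) =
              [((- 1) ^ l * (- 1) ^ m :: int)] \<cdot>\<^bsub>TP (i + 2)\<^esub> ?q"
            by (rule G.add.int_pow_pow[OF q])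
          also have "((- 1) ^ l * (- 1) ^ m :: int) = (- 1) ^ (m + l)" by (simp add: power_add)
          finally have "\<ominus>\<^bsub>TP (i + 2)\<^esub> ([((- 1) ^ m :: int)] \<cdot>\<^bsub>TP (i + 2)\<^esub> ([((- 1) ^ l :: int)] \<cdot>\<^bsub>TP (i + 2)\<^esub> ?q)) =
              [(- ((- 1) ^ (m + l)) :: int)] \<cdot>\<^bsub>TP (i + 2)\<^esub> ?q"
            using G.add.int_pow_neg[OF q, of "(- 1) ^ (m + l)"] by metis
          then show ?thesis by simp
        qed
        then show "\<ominus>\<^bsub>TP (i + 2)\<^esub> ([((- 1) ^ m :: int)] \<cdot>\<^bsub>TP (i + 2)\<^esub> cons (i + 1) (?\<theta> u)
            ([((- 1) ^ l :: int)] \<cdot>\<^bsub>TP (i + 1)\<^esub> pure_power k A (contract A l (b # v)))) = H (m + 1 + l)"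
          unfolding c.hom_add_pow[OF pc[OF l]] using l cl by (simp add: H_def del: add_2_eq_Suc')
      qed (use Hc in auto)
      finally show ?thesis by simp
    qed
    also have "pure_power k A (S # v) = [((- 1) ^ m :: int)] \<cdot>\<^bsub>TP (i + 2)\<^esub> pure_power k A ((?\<theta> u \<otimes>\<^bsub>A\<^esub> b) # v)"
      unfolding S using \<theta>u b by (intro \<kappa>.hom_add_pow) simp
    finally have lhs: "front_eval m i t (bar_diff k A (m + i + 1) (pure_power k A xs)) =
        [((- 1) ^ m :: int)] \<cdot>\<^bsub>TP (i + 2)\<^esub> pure_power k A ((?\<theta> u \<otimes>\<^bsub>A\<^esub> b) # v) \<oplus>\<^bsub>TP (i + 2)\<^esub>
        \<ominus>\<^bsub>TP (i + 2)\<^esub> ([((- 1) ^ m :: int)] \<cdot>\<^bsub>TP (i + 2)\<^esub> cons (i + 1) (?\<theta> u) (bar_diff k A i (pure_power k A (b # v))))" .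
    have "front_eval m (i + 1) t (pure_power k A xs) = pure_power k A (?\<theta> u # b # v)"
      using front_eval_multilinear(2)[OF t u, of "b # v" "i + 1"] bv 1 2 by simp
    then have rhs: "bar_diff k A (i + 1) (front_eval m (i + 1) t (pure_power k A xs)) =
        pure_power k A ((?\<theta> u \<otimes>\<^bsub>A\<^esub> b) # v) \<ominus>\<^bsub>TP (i + 2)\<^esub> cons (i + 1) (?\<theta> u) (bar_diff k A i (pure_power k A (b # v)))"
      using bar_diff_Cons_pure_power[OF \<theta>u b v] by simp
    interpret pw: abelian_group_hom "TP (i + 2)" "TP (i + 2)" "\<lambda>\<gamma>. [((- 1) ^ m :: int)] \<cdot>\<^bsub>TP (i + 2)\<^esub> \<gamma>"
      by (rule additive_add_pow[OF additive_id[OF G.abelian_group_axioms]])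
    have "cons (i + 1) (?\<theta> u) (bar_diff k A i (pure_power k A (b # v))) \<in> carrier (TP (i + 2))"
      by (intro c.hom_closed abelian_group_hom.hom_closed[OF bar_diff_additive] pure_power_closed[OF bv])
    moreover have "pure_power k A ((?\<theta> u \<otimes>\<^bsub>A\<^esub> b) # v) \<in> carrier (TP (i + 2))"
      using \<theta>u b by (intro \<kappa>.hom_closed) simp
    ultimately show "front_eval m i t (bar_diff k A (m + i + 1) (pure_power k A xs)) =
        [((- 1) ^ m :: int)] \<cdot>\<^bsub>TP (i + 2)\<^esub> bar_diff k A (i + 1) (front_eval m (i + 1) t (pure_power k A xs))"
      unfolding lhs rhs a_minus_def[symmetric] by (rule pw.hom_diff[symmetric, rotated])
  qed
qed


text \<open>
  The sign accumulates one factor \<open>(-1)\<^sup>m\<close> per degree, which is what \<open>front_eval\<close> needs to commute with the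
  differentials.
\<close>

definition signed_front ::
    "nat \<Rightarrow> (('a list \<Rightarrow>\<^sub>0 int) set \<Rightarrow> 'a) \<Rightarrow> nat \<Rightarrow> ('a list \<Rightarrow>\<^sub>0 int) set \<Rightarrow> ('a list \<Rightarrow>\<^sub>0 int) set"
  where "signed_front m t i \<beta> = [((- 1) ^ (m * i) :: int)] \<cdot>\<^bsub>bar_module k A i\<^esub> front_eval m i t \<beta>"

lemma bar_module_add_pow:
  assumes "\<beta> \<in> carrier (TP (n + 2))"
  shows "[(j::int)] \<cdot>\<^bsub>bar_module k A n\<^esub> \<beta> = [j] \<cdot>\<^bsub>TP (n + 2)\<^esub> \<beta>"
  using abelian_group_hom.hom_add_pow[OF additive_into_bar_module[OF additive_id[OF abelian_group_tensor_power]] assms, of j]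
  by simp

lemma bar_cocycleD:
  assumes "t \<in> HHco_cocycles k A (bar k A) m"
  shows "t \<in> linear_maps env (bar_module k A m) (left_regular k A)"
    and "\<beta> \<in> carrier (TP (m + 3)) \<Longrightarrow> t (bar_diff k A (m + 1) \<beta>) = \<zero>\<^bsub>A\<^esub>"
  using assms by (auto simp: HHco_cocycles_iff bar_simps bar_module_simps numeral_2_eq_2 numeral_3_eq_3)

lemma lift_over_signed_front:
  assumes bar: "resolves (bar k A)" and t: "t \<in> HHco_cocycles k A (bar k A) m"
  shows "lift_over env (bar k A) (bar k A) m t (signed_front m t)"
  unfolding lift_over_def
proof (intro conjI allI ballI)
  interpret bar: exact_complex "enveloping k A" "left_regular k A" "bar k A" by fact
  have E: "ring env" by (rule bar.M.R.ring_axioms)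
  note tl = bar_cocycleD(1)[OF t] and tz = bar_cocycleD(2)[OF t]
  interpret t: abelian_group_hom "TP (m + 2)" A t by (rule cochain_additive[OF tl])
  note fr = front_eval_multilinear(1)[OF tl]
  show "signed_front m t i \<in> linear_maps env (Ch (bar k A) (m + i)) (Ch (bar k A) i)" for i
    unfolding signed_front_def[abs_def] bar_simps
    by (intro linear_maps_int_multiple front_eval_linear[OF E tl] left_module_bar_module[OF E])
  show "aug (bar k A) (signed_front m t 0 \<beta>) = t \<beta>" if "\<beta> \<in> carrier (Ch (bar k A) m)" for \<beta>
  proof -
    have \<beta>: "\<beta> \<in> carrier (TP (m + 2))" using that by (simp add: bar_simps bar_module_simps)
    have f0: "abelian_group_hom (TP (m + 2)) (TP 2) (front_eval m 0 t)" using fr[of 0] by (simp add: numeral_2_eq_2)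
    interpret T: abelian_group "TP 2" by (rule abelian_group_tensor_power)
    have "aug (bar k A) (front_eval m 0 t \<beta>) = t \<beta>"
    proof (rule tensor_power_eqI[OF additive_comp[OF f0 bar_aug_additive] t.abelian_group_hom_axioms _ \<beta>])
      fix xs assume "xs \<in> tuples A (m + 2)"
      then obtain u w where 1: "xs = u @ w" "u \<in> tuples A (m + 1)" "w \<in> tuples A (0 + 1)"
        using tuples_split[of xs "m + 1" 1] by (auto simp: numeral_2_eq_2)
      then obtain z where 2: "w = [z]" "z \<in> carrier A" by (auto simp: tuples_def length_Suc_conv)
      note c = cochain_front(2)[OF tl 1(2)]
      have "[t (pure_power k A (u @ [\<one>\<^bsub>A\<^esub>])), z] \<in> tuples A 2" using c 2 by (simp add: tuples_def)
      then show "aug (bar k A) (front_eval m 0 t (pure_power k A xs)) = t (pure_power k A xs)"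
        using front_eval_multilinear(2)[OF tl 1(2,3)] cochain_front(3)[OF tl 1(2) 2(2)] 1(1) 2(1)
        by (simp add: bar_aug_pure_power)
    qed
    then show ?thesis
      using T.add.int_pow_1[OF abelian_group_hom.hom_closed[OF f0 \<beta>]] abelian_group_hom.hom_closed[OF fr[of 0]] \<beta>
      by (simp add: signed_front_def bar_module_add_pow numeral_2_eq_2)
  qed
  show "bd (bar k A) (Suc i) (signed_front m t (Suc i) \<beta>) = signed_front m t i (bd (bar k A) (Suc (m + i)) \<beta>)"
    if "\<beta> \<in> carrier (Ch (bar k A) (Suc (m + i)))" for i \<beta>
  proof -
    have \<beta>: "\<beta> \<in> carrier (TP (m + i + 3))" and \<beta>': "\<beta> \<in> carrier (TP (m + (i + 1) + 2))" and \<beta>'': "\<beta> \<in> carrier (TP (m + i + 1 + 2))"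
      using that by (simp_all add: bar_simps bar_module_simps numeral_2_eq_2 numeral_3_eq_3)
    interpret d: abelian_group_hom "TP (i + 1 + 2)" "TP (i + 2)" "bar_diff k A (i + 1)"
      using bar_diff_additive[of "i + 1"] by simp
    have d\<beta>: "bar_diff k A (m + i + 1) \<beta> \<in> carrier (TP (m + i + 2))"
      using abelian_group_hom.hom_closed[OF bar_diff_additive \<beta>''] by simp
    let ?y = "front_eval m (i + 1) t \<beta>"
    have y: "?y \<in> carrier (TP (i + 1 + 2))" by (rule abelian_group_hom.hom_closed[OF fr \<beta>'])
    note dy = d.hom_closed[OF y]
    have fd: "front_eval m i t (bar_diff k A (m + i + 1) \<beta>) \<in> carrier (TP (i + 2))"
      by (rule abelian_group_hom.hom_closed[OF fr d\<beta>])
    have fe: "front_eval m i t (bar_diff k A (m + i + 1) \<beta>) = [((- 1) ^ m :: int)] \<cdot>\<^bsub>TP (i + 2)\<^esub> bar_diff k A (i + 1) ?y"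
      by (rule front_eval_bar_diff[OF tl _ \<beta>]) (rule tz)
    have sign: "((- 1) ^ m * (- 1) ^ (m * i) :: int) = (- 1) ^ (m * (i + 1))"
      by (simp add: power_add)
    have "signed_front m t i (bar_diff k A (m + i + 1) \<beta>) =
        [((- 1) ^ (m * i) :: int)] \<cdot>\<^bsub>TP (i + 2)\<^esub> ([((- 1) ^ m :: int)] \<cdot>\<^bsub>TP (i + 2)\<^esub> bar_diff k A (i + 1) ?y)"
      unfolding signed_front_def bar_module_add_pow[OF fd] by (simp only: fe)
    also have "\<dots> = [((- 1) ^ (m * (i + 1)) :: int)] \<cdot>\<^bsub>TP (i + 2)\<^esub> bar_diff k A (i + 1) ?y"
      unfolding d.H.add.int_pow_pow[OF dy] sign ..
    also have "\<dots> = bar_diff k A (i + 1) (signed_front m t (i + 1) \<beta>)"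
      unfolding signed_front_def bar_module_add_pow[OF y] d.hom_add_pow[OF y] ..
    finally show ?thesis by (simp add: bar_simps)
  qed
qed

lemma bar_cap_chain_eq:
  assumes bar: "resolves (bar k A)" and t: "t \<in> linear_maps env (bar_module k A m) (left_regular k A)"
    and z: "z \<in> carrier (chains k A (bar k A) (m + i))"
  shows "bar_cap_chain k A (m + i) m t z = chain_map k A (bar k A) i (front_eval m i t) z"
proof -
  interpret bar: exact_complex "enveloping k A" "left_regular k A" "bar k A" by fact
  have E: "ring env" by (rule bar.M.R.ring_axioms)
  let ?C = "chains k A (bar k A) i" and ?N = "right_regular k A"
  interpret B1: balanced_pair "enveloping k A" "bar_module k A (m + i)" ?N
    using balanced_pair_chains[OF bar, of "m + i"] by (simp add: bar_simps)
  interpret B2: balanced_pair "enveloping k A" "bar_module k A i" ?N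
    using balanced_pair_chains[OF bar, of i] by (simp add: bar_simps)
  note fl = front_eval_linear[OF E t, of i]
  have Cm: "abelian_group_hom (tensor env ?N (bar_module k A (m + i))) ?C (chain_map k A (bar k A) i (front_eval m i t))"
    using chain_map_additive[OF bar bar, of "front_eval m i t" "m + i" i] fl by (simp add: chains_def bar_simps)
  have C: "?C = tensor env ?N (bar_module k A i)" by (simp add: chains_def bar_simps)
  have pure: "chain_map k A (bar k A) i (front_eval m i t) (pure_tensor env ?N (bar_module k A (m + i)) x \<beta>) =
      pure_tensor env ?N (bar_module k A i) x (front_eval m i t \<beta>)"
    if "x \<in> carrier A" "\<beta> \<in> carrier (TP (m + i + 2))" for x \<beta>
    unfolding chain_map_def bar_simps
    by (rule tensor_map_pure_tensor[OF B1.balanced_pair_axioms B2.balanced_pair_axioms fl])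
       (use that in \<open>simp_all add: right_regular_def bar_module_simps\<close>)
  have inner: "induced ?C (\<lambda>xs. pure_tensor env ?N (bar_module k A i)
        (x \<otimes>\<^bsub>A\<^esub> t (pure_power k A (take (m + 1) xs @ [\<one>\<^bsub>A\<^esub>]))) (pure_power k A (\<one>\<^bsub>A\<^esub> # drop (m + 1) xs))) \<beta> =
      pure_tensor env ?N (bar_module k A i) x (front_eval m i t \<beta>)"
    if x: "x \<in> carrier A" and \<beta>: "\<beta> \<in> carrier (TP (m + i + 2))" for x \<beta>
  proof (rule induced_eq_tensor_power[OF _ _ \<beta>])
    have "abelian_group_hom (bar_module k A i) ?C (pure_tensor env ?N (bar_module k A i) x)"
      unfolding C using x by (intro B2.pure_tensor_additive) (simp add: right_regular_def)
    from additive_comp[OF additive_into_bar_module[OF front_eval_multilinear(1)[OF t]] this]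
    show "abelian_group_hom (TP (m + i + 2)) ?C (\<lambda>\<beta>. pure_tensor env ?N (bar_module k A i) x (front_eval m i t \<beta>))" .
    fix xs assume "xs \<in> tuples A (m + i + 2)"
    then obtain u w where xs: "xs = u @ w" "u \<in> tuples A (m + 1)" "w \<in> tuples A (i + 1)"
      using tuples_split[of xs "m + 1" "i + 1"] by (auto simp: numeral_2_eq_2)
    let ?s = "t (pure_power k A (u @ [\<one>\<^bsub>A\<^esub>]))"
    have s: "?s \<in> carrier A" by (rule cochain_front(2)[OF t xs(2)])
    obtain ws zs where w': "w = ws @ zs" "ws \<in> tuples A i" "zs \<in> tuples A 1"
      using xs(3) unfolding tuples_split by blast
    then obtain z where w: "w = ws @ [z]" "ws \<in> tuples A i" "z \<in> carrier A"
      by (auto simp: tuples_def length_Suc_conv)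
    have t2: "\<one>\<^bsub>A\<^esub> # w \<in> tuples A (i + 2)" using xs(3) by (simp add: tuples_def)
    have "pure_tensor env ?N (bar_module k A i) (x \<otimes>\<^bsub>A\<^esub> ?s) (pure_power k A (\<one>\<^bsub>A\<^esub> # w)) =
        pure_tensor env ?N (bar_module k A i) (pure_tensor k A A ?s \<one>\<^bsub>A\<^esub> \<odot>\<^bsub>?N\<^esub> x) (pure_power k A (\<one>\<^bsub>A\<^esub> # w))"
      using x s by (simp add: right_regular_smult)
    also have "\<dots> = pure_tensor env ?N (bar_module k A i) x (pure_tensor k A A ?s \<one>\<^bsub>A\<^esub> \<odot>\<^bsub>bar_module k A i\<^esub> pure_power k A (\<one>\<^bsub>A\<^esub> # w))"
      using x pure_power_closed[OF t2]
      by (intro B2.pure_tensor_balanced pure_tensor_env s) (simp_all add: right_regular_def bar_module_simps)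
    also have "pure_tensor k A A ?s \<one>\<^bsub>A\<^esub> \<odot>\<^bsub>bar_module k A i\<^esub> pure_power k A (\<one>\<^bsub>A\<^esub> # w) = pure_power k A (?s # w)"
      using bar_smult(2)[OF pure_power_closed[OF t2] s A.one_closed] ends_pure_power[OF s A.one_closed A.one_closed w(3,2)] s w(3)
      by (simp add: w(1))
    finally show "pure_tensor env ?N (bar_module k A i)
        (x \<otimes>\<^bsub>A\<^esub> t (pure_power k A (take (m + 1) xs @ [\<one>\<^bsub>A\<^esub>]))) (pure_power k A (\<one>\<^bsub>A\<^esub> # drop (m + 1) xs)) =
      pure_tensor env ?N (bar_module k A i) x (front_eval m i t (pure_power k A xs))"
      using front_eval_multilinear(2)[OF t xs(2,3)] xs by (simp add: tuples_def)
  qed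
  have z': "z \<in> carrier (tensor env ?N (bar_module k A (m + i)))" using z by (simp add: chains_def bar_simps)
  have "bar_cap_chain k A (m + i) m t z = induced ?C (\<lambda>(x, \<beta>).
      induced ?C (\<lambda>xs. pure_tensor env ?N (bar_module k A i)
        (x \<otimes>\<^bsub>A\<^esub> t (pure_power k A (take (m + 1) xs @ [\<one>\<^bsub>A\<^esub>]))) (pure_power k A (\<one>\<^bsub>A\<^esub> # drop (m + 1) xs))) \<beta>) z"
    by (simp add: bar_cap_chain_def)
  also have "\<dots> = chain_map k A (bar k A) i (front_eval m i t) z"
  proof (rule B1.induced_eq_tensor[OF Cm _ z'])
    fix x \<beta> assume "x \<in> carrier ?N" "\<beta> \<in> carrier (bar_module k A (m + i))"
    then have "x \<in> carrier A" "\<beta> \<in> carrier (TP (m + i + 2))" by (simp_all add: right_regular_def bar_module_simps)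
    then show "induced ?C (\<lambda>xs. pure_tensor env ?N (bar_module k A i)
        (x \<otimes>\<^bsub>A\<^esub> t (pure_power k A (take (m + 1) xs @ [\<one>\<^bsub>A\<^esub>]))) (pure_power k A (\<one>\<^bsub>A\<^esub> # drop (m + 1) xs))) \<beta> =
      chain_map k A (bar k A) i (front_eval m i t) (pure_tensor env ?N (bar_module k A (m + i)) x \<beta>)"
      using inner pure by simp
  qed
  finally show ?thesis .
qed

lemma int_sign_twice:
  assumes "abelian_group G" "x \<in> carrier G"
  shows "[((- 1) ^ j :: int)] \<cdot>\<^bsub>G\<^esub> ([((- 1) ^ j :: int)] \<cdot>\<^bsub>G\<^esub> x) = x"
proof -
  interpret G: abelian_group G by fact
  have "((- 1) ^ j * (- 1) ^ j :: int) = 1" by (simp flip: power_add mult_2)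
  then show ?thesis
    unfolding G.add.int_pow_pow[OF assms(2)] using G.add.int_pow_1[OF assms(2)] by simp
qed

lemma HH_class_bar_cap_chain:
  assumes bar: "resolves (bar k A)" and t: "t \<in> HHco_cocycles k A (bar k A) m"
    and z: "z \<in> HH_cycles k A (bar k A) (m + i)"
  shows "HH_class k A (bar k A) i (bar_cap_chain k A (m + i) m t z) =
    HH_class k A (bar k A) i ([((- 1) ^ (m * i) :: int)] \<cdot>\<^bsub>chains k A (bar k A) i\<^esub> chain_map k A (bar k A) i (signed_front m t i) z)"
proof -
  interpret bar: exact_complex "enveloping k A" "left_regular k A" "bar k A" by fact
  have E: "ring env" by (rule bar.M.R.ring_axioms)
  have zc: "z \<in> carrier (chains k A (bar k A) (m + i))" using z by (simp add: HH_cycles_iff)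
  have fl: "front_eval m i t \<in> linear_maps env (Ch (bar k A) (m + i)) (Ch (bar k A) i)"
    unfolding bar_simps by (rule front_eval_linear[OF E bar_cocycleD(1)[OF t]])
  have "chain_map k A (bar k A) i (signed_front m t i) z =
      [((- 1) ^ (m * i) :: int)] \<cdot>\<^bsub>chains k A (bar k A) i\<^esub> chain_map k A (bar k A) i (front_eval m i t) z"
    using chain_map_int_multiple[OF bar bar fl zc, of "(- 1) ^ (m * i)"]
    by (simp add: signed_front_def[abs_def] bar_simps)
  then have "[((- 1) ^ (m * i) :: int)] \<cdot>\<^bsub>chains k A (bar k A) i\<^esub> chain_map k A (bar k A) i (signed_front m t i) z =
      chain_map k A (bar k A) i (front_eval m i t) z"
    using int_sign_twice[OF abelian_group_chains[OF bar] abelian_group_hom.hom_closed[OF chain_map_additive[OF bar bar fl] zc]]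
    by simp
  then show ?thesis using bar_cap_chain_eq[OF bar bar_cocycleD(1)[OF t] zc] by simp
qed

lemma bar_cap_class:
  assumes bar: "resolves (bar k A)" and lifts: "\<And>i. lifts_through env (left_regular k A) (bar k A) (Ch (bar k A) i)"
    and t: "t \<in> HHco_cocycles k A (bar k A) m" and z: "z \<in> HH_cycles k A (bar k A) (m + i)"
  shows "bar_cap k A (m + i) m (HH_class k A (bar k A) (m + i) z) (HHco_class k A (bar k A) m t) =
    HH_class k A (bar k A) i ([((- 1) ^ (m * i) :: int)] \<cdot>\<^bsub>chains k A (bar k A) i\<^esub> chain_map k A (bar k A) i (signed_front m t i) z)"
  unfolding bar_cap_def
proof (rule the_equality)
  have zc: "z \<in> carrier (chains k A (bar k A) (m + i))" using z by (simp add: HH_cycles_iff)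
  show "\<exists>z'\<in>HH_class k A (bar k A) (m + i) z. \<exists>t'\<in>HHco_class k A (bar k A) m t.
      HH_class k A (bar k A) i ([((- 1) ^ (m * i) :: int)] \<cdot>\<^bsub>chains k A (bar k A) i\<^esub> chain_map k A (bar k A) i (signed_front m t i) z) =
      HH_class k A (bar k A) (m + i - m) (bar_cap_chain k A (m + i) m t' z')"
    using HH_class_self[OF bar zc] HHco_class_self[OF bar t] HH_class_bar_cap_chain[OF bar t z] by auto
next
  fix w assume "\<exists>z'\<in>HH_class k A (bar k A) (m + i) z. \<exists>t'\<in>HHco_class k A (bar k A) m t.
      w = HH_class k A (bar k A) (m + i - m) (bar_cap_chain k A (m + i) m t' z')"
  then obtain z' t' where z': "z' \<in> HH_class k A (bar k A) (m + i) z" and t': "t' \<in> HHco_class k A (bar k A) m t"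
    and w: "w = HH_class k A (bar k A) i (bar_cap_chain k A (m + i) m t' z')" by auto
  have coh: "cohomologous env (left_regular k A) (bar k A) m t' t"
    using mem_HHco_class_iff_cohomologous[OF bar t HHco_class_extensional[OF t']] t' by simp
  have t'c: "t' \<in> HHco_cocycles k A (bar k A) m"
    by (rule cohomologous_cocycle[OF bar t HHco_class_extensional[OF t'] coh])
  have z'c: "z' \<in> HH_cycles k A (bar k A) (m + i)" 
    using z' HH_boundaries_cycles[OF bar, of "m + i"] subgroup.m_closed[OF subgroup_HH_cycles[OF bar], of _ "m + i" z] z
    by (auto simp: mem_HH_class)
  note L = lift_over_signed_front[OF bar t] and L' = lift_over_signed_front[OF bar t'c]
  have "w = [((- 1) ^ (m * i) :: int)] \<cdot>\<^bsub>HH k A (bar k A) i\<^esub> HH_class k A (bar k A) i (chain_map k A (bar k A) i (signed_front m t' i) z')"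
    unfolding w HH_class_bar_cap_chain[OF bar t'c z'c] HH_class_int_multiple[OF bar chain_map_lift_cycle[OF bar bar L' z'c]] ..
  also have "HH_class k A (bar k A) i (chain_map k A (bar k A) i (signed_front m t' i) z') =
      HH_class k A (bar k A) i (chain_map k A (bar k A) i (signed_front m t i) z)"
    by (rule HH_class_lift_eq[OF bar bar lifts L' L coh z z'])
  finally show "w = HH_class k A (bar k A) i ([((- 1) ^ (m * i) :: int)] \<cdot>\<^bsub>chains k A (bar k A) i\<^esub> chain_map k A (bar k A) i (signed_front m t i) z)"
    unfolding HH_class_int_multiple[OF bar chain_map_lift_cycle[OF bar bar L z]] .
qed

end

section \<open>Comparison of the two products\<close>

context assoc_algebra
begin

lemma cap_class:
  assumes P: "resolves P" and bar: "resolves (bar k A)"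
    and P_P: "\<And>i. lifts_through env (left_regular k A) P (Ch P i)"
    and P_bar: "\<And>i. lifts_through env (left_regular k A) (bar k A) (Ch P i)"
    and bar_P: "\<And>i. lifts_through env (left_regular k A) P (Ch (bar k A) i)"
    and bar_bar: "\<And>i. lifts_through env (left_regular k A) (bar k A) (Ch (bar k A) i)"
    and t: "t \<in> HHco_cocycles k A P m" and \<tau>: "chain_lift env P m t \<tau>"
    and z: "z \<in> HH_cycles k A P (m + i)"
  shows "cap k A P (m + i) m (HH_class k A P (m + i) z) (HHco_class k A P m t) =
    [((- 1) ^ (m * i) :: int)] \<cdot>\<^bsub>HH k A P i\<^esub> HH_class k A P i (chain_map k A P i (\<tau> i) z)"
proof -
  interpret P: exact_complex "enveloping k A" "left_regular k A" P by fact
  interpret bar: exact_complex "enveloping k A" "left_regular k A" "bar k A" by fact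
  let ?s = "(- 1) ^ (m * i) :: int"
  obtain \<phi> where \<phi>: "lift_over env P (bar k A) 0 (aug P) \<phi>"
    by (rule lift_over_exists[OF P bar P_bar P.aug_linear]) (use P.aug_bd in auto)
  obtain \<psi> where \<psi>: "lift_over env (bar k A) P 0 (aug (bar k A)) \<psi>"
    by (rule lift_over_exists[OF bar P bar_P bar.aug_linear]) (use bar.aug_bd in auto)
  note \<phi>c = \<phi>[folded comparison_map_iff_lift_over] and \<psi>c = \<psi>[folded comparison_map_iff_lift_over]
  define T where "T = (\<lambda>x\<in>carrier (Ch (bar k A) m). t (\<psi> m x))"
  have T: "T \<in> HHco_cocycles k A (bar k A) m"
    unfolding T_def by (rule cocycle_pullback[OF P bar \<psi>c t])
  define \<sigma> where "\<sigma> = signed_front m T"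
  have \<sigma>: "lift_over env (bar k A) (bar k A) m T \<sigma>" unfolding \<sigma>_def by (rule lift_over_signed_front[OF bar T])
  have \<phi>l: "\<phi> j \<in> linear_maps env (Ch P j) (Ch (bar k A) j)" for j using lift_overD(1)[OF \<phi>, of j] by simp
  have \<psi>l: "\<psi> j \<in> linear_maps env (Ch (bar k A) j) (Ch P j)" for j using lift_overD(1)[OF \<psi>, of j] by simp
  have zc: "z \<in> carrier (chains k A P (m + i))" using z by (simp add: HH_cycles_iff)
  let ?z1 = "chain_map k A (bar k A) (m + i) (\<phi> (m + i)) z"
  have z1: "?z1 \<in> HH_cycles k A (bar k A) (m + i)"
    using chain_map_lift_cycle[OF P bar \<phi>, of z "m + i"] z by simp
  let ?z2 = "chain_map k A (bar k A) i (\<sigma> i) ?z1"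
  have z2: "?z2 \<in> HH_cycles k A (bar k A) i" by (rule chain_map_lift_cycle[OF bar bar \<sigma> z1])
  have "cap k A P (m + i) m (HH_class k A P (m + i) z) (HHco_class k A P m t) =
      HH_ident k A (bar k A) P i (HH_class k A (bar k A) i ([?s] \<cdot>\<^bsub>chains k A (bar k A) i\<^esub> ?z2))"
    unfolding cap_def HH_ident_class[OF P bar P_bar \<phi>c z] HHco_ident_class[OF P bar bar_P \<psi>c t] T_def[symmetric]
      bar_cap_class[OF bar bar_bar T z1] \<sigma>_def by simp
  also have "\<dots> = HH_class k A P i (chain_map k A P i (\<psi> i) ([?s] \<cdot>\<^bsub>chains k A (bar k A) i\<^esub> ?z2))"
    by (rule HH_ident_class[OF bar P bar_P \<psi>c HH_cycles_int_multiple[OF bar z2]])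
  also have "chain_map k A P i (\<psi> i) ([?s] \<cdot>\<^bsub>chains k A (bar k A) i\<^esub> ?z2) =
      [?s] \<cdot>\<^bsub>chains k A P i\<^esub> chain_map k A P i (\<psi> i) ?z2"
    using z2 by (intro abelian_group_hom.hom_add_pow[OF chain_map_additive[OF bar P \<psi>l]]) (simp add: HH_cycles_iff)
  also have "chain_map k A P i (\<psi> i) ?z2 = chain_map k A P i (\<lambda>x. \<psi> i (\<sigma> i (\<phi> (m + i) x))) z"
    using chain_map_comp[OF bar bar P lift_overD(1)[OF \<sigma>] \<psi>l, of ?z1] z1
      chain_map_comp[OF P bar P \<phi>l linear_maps_comp[OF lift_overD(1)[OF \<sigma>] \<psi>l] zc]
    by (simp add: HH_cycles_iff)
  also have "HH_class k A P i ([?s] \<cdot>\<^bsub>chains k A P i\<^esub> chain_map k A P i (\<lambda>x. \<psi> i (\<sigma> i (\<phi> (m + i) x))) z) =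
      [?s] \<cdot>\<^bsub>HH k A P i\<^esub> HH_class k A P i (chain_map k A P i (\<lambda>x. \<psi> i (\<sigma> i (\<phi> (m + i) x))) z)"
  proof (rule HH_class_int_multiple[OF P, symmetric])
    have "lift_over env P P (0 + m + 0) (\<lambda>x. aug (bar k A) (\<sigma> 0 (\<phi> (m + 0) x))) (\<lambda>i x. \<psi> i (\<sigma> (0 + i) (\<phi> (m + (0 + i)) x)))"
      by (rule lift_over_comp[OF lift_over_comp[OF \<phi> \<sigma>] \<psi>])
    from chain_map_lift_cycle[OF P P this, of z i] z
    show "chain_map k A P i (\<lambda>x. \<psi> i (\<sigma> i (\<phi> (m + i) x))) z \<in> HH_cycles k A P i" by simp
  qed
  also have "HH_class k A P i (chain_map k A P i (\<lambda>x. \<psi> i (\<sigma> i (\<phi> (m + i) x))) z) =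
      HH_class k A P i (chain_map k A P i (\<tau> i) z)"
  proof -
    \<comment> \<open>\<open>\<psi> \<sigma> \<phi>\<close> lifts \<open>t \<psi> \<phi>\<close>, which is cohomologous to \<open>t\<close> because \<open>\<psi> \<phi>\<close> is homotopic to the identity\<close>
    have "lift_over env P P (0 + m + 0) (\<lambda>x. aug (bar k A) (\<sigma> 0 (\<phi> (m + 0) x))) (\<lambda>i x. \<psi> i (\<sigma> (0 + i) (\<phi> (m + (0 + i)) x)))"
      by (rule lift_over_comp[OF lift_over_comp[OF \<phi> \<sigma>] \<psi>])
    then have "lift_over env P P m (\<lambda>x. aug (bar k A) (\<sigma> 0 (\<phi> m x))) (\<lambda>i x. \<psi> i (\<sigma> i (\<phi> (m + i) x)))" by simp
    then have f: "lift_over env P P m (\<lambda>x. t (\<psi> m (\<phi> m x))) (\<lambda>i x. \<psi> i (\<sigma> i (\<phi> (m + i) x)))"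
      by (rule lift_over_cong) (use lift_overD(2)[OF \<sigma>] linear_maps_closed[OF \<phi>l] in \<open>simp add: T_def\<close>)
    have "lift_over env P P (0 + 0) (\<lambda>x. aug (bar k A) (\<phi> 0 x)) (\<lambda>i x. \<psi> i (\<phi> (0 + i) x))"
      by (rule lift_over_comp[OF \<phi> \<psi>])
    then have "lift_over env P P 0 (\<lambda>x. aug (bar k A) (\<phi> 0 x)) (\<lambda>i x. \<psi> i (\<phi> i x))" by simp
    then have "lift_over env P P 0 (aug P) (\<lambda>i x. \<psi> i (\<phi> i x))"
      by (rule lift_over_cong) (rule lift_overD(2)[OF \<phi>])
    then have \<psi>\<phi>: "comparison_map env P P (\<lambda>i x. \<psi> i (\<phi> i x))" by (simp add: comparison_map_iff_lift_over)
    have id: "comparison_map env P P (\<lambda>i x. x)"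
      by (simp add: comparison_map_def linear_maps_ident)
    have tl: "t \<in> linear_maps env (Ch P m) (left_regular k A)" using t by (simp add: HHco_cocycles_iff)
    have coh: "cohomologous env (left_regular k A) P m (\<lambda>x. t (\<psi> m (\<phi> m x))) t"
      using cohomologous_pullback[OF P P P_P id \<psi>\<phi> t cohomologous_refl[OF P tl]] by simp
    show ?thesis
      by (rule HH_class_lift_eq[OF P P P_P f \<tau>[unfolded chain_lift_iff_lift_over] coh z HH_class_self[OF P zc]])
  qed
  finally show ?thesis .
qed

lemma cap_tilde_class:
  assumes P: "resolves P" and P_P: "\<And>i. lifts_through env (left_regular k A) P (Ch P i)"
    and t: "t \<in> HHco_cocycles k A P m" and \<tau>: "chain_lift env P m t \<tau>"
    and z: "z \<in> HH_cycles k A P (m + i)"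
  shows "cap_tilde k A P (m + i) m (HH_class k A P (m + i) z) (HHco_class k A P m t) =
    HH_class k A P i (chain_map k A P i (\<tau> i) z)"
  unfolding cap_tilde_def
proof (rule the_equality)
  have zc: "z \<in> carrier (chains k A P (m + i))" using z by (simp add: HH_cycles_iff)
  show "\<exists>z'\<in>HH_class k A P (m + i) z. \<exists>t'\<in>HHco_class k A P m t. \<exists>\<tau>'. chain_lift env P m t' \<tau>' \<and>
      HH_class k A P i (chain_map k A P i (\<tau> i) z) =
      HH_class k A P (m + i - m) (chain_map k A P (m + i - m) (\<tau>' (m + i - m)) z')"
    using HH_class_self[OF P zc] HHco_class_self[OF P t] \<tau> by auto
next
  fix w assume "\<exists>z'\<in>HH_class k A P (m + i) z. \<exists>t'\<in>HHco_class k A P m t. \<exists>\<tau>'. chain_lift env P m t' \<tau>' \<and>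
      w = HH_class k A P (m + i - m) (chain_map k A P (m + i - m) (\<tau>' (m + i - m)) z')"
  then obtain z' t' \<tau>' where z': "z' \<in> HH_class k A P (m + i) z" and t': "t' \<in> HHco_class k A P m t"
    and \<tau>': "chain_lift env P m t' \<tau>'" and w: "w = HH_class k A P i (chain_map k A P i (\<tau>' i) z')" by auto
  have coh: "cohomologous env (left_regular k A) P m t' t"
    using mem_HHco_class_iff_cohomologous[OF P t HHco_class_extensional[OF t']] t' by simp
  show "w = HH_class k A P i (chain_map k A P i (\<tau> i) z)"
    unfolding w
    by (rule HH_class_lift_eq[OF P P P_P \<tau>'[unfolded chain_lift_iff_lift_over] \<tau>[unfolded chain_lift_iff_lift_over] coh z z'])
qed

end

theorem theorem4p2:
  fixes k :: "('k, 'u) ring_scheme"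
    and A :: "('k, 'a, 'v) module_scheme"
    and P :: "('a env, 'p, 'a) aug_complex"
  assumes "assoc_algebra k A"
    and "projective_module k A"
    and "projective_resolution (enveloping k A) (left_regular k A) P"
  shows "(\<forall>m t \<tau> n z.
            t \<in> HHco_cocycles k A P m \<and> chain_lift (enveloping k A) P m t \<tau> \<and>
            m \<le> n \<and> z \<in> HH_cycles k A P n \<longrightarrow>
            cap k A P n m (HH_class k A P n z) (HHco_class k A P m t) =
              [((- 1) ^ (m * (n - m)) :: int)] \<cdot>\<^bsub>HH k A P (n - m)\<^esub>
                HH_class k A P (n - m) (chain_map k A P (n - m) (\<tau> (n - m)) z)) \<and>
         (\<forall>m n. m \<le> n \<longrightarrow>
            (\<forall>\<xi> \<in> carrier (HH k A P n). \<forall>\<eta> \<in> carrier (HHco k A P m).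
               cap_tilde k A P n m \<xi> \<eta> =
                 [((- 1) ^ (m * (n - m)) :: int)] \<cdot>\<^bsub>HH k A P (n - m)\<^esub> cap k A P n m \<xi> \<eta>)) \<and>
         (\<forall>m n. m \<le> n \<and> (even m \<or> even (n - m)) \<longrightarrow>
            (\<forall>\<xi> \<in> carrier (HH k A P n). \<forall>\<eta> \<in> carrier (HHco k A P m).
               cap_tilde k A P n m \<xi> \<eta> = cap k A P n m \<xi> \<eta>))"
proof -
  interpret assoc_algebra k A by fact
  have P: "resolves P"
    by (rule exact_complex_projective_resolution[OF assms(3) abelian_group_left_regular])
  interpret P: exact_complex "enveloping k A" "left_regular k A" P by (rule P)
  have bar: "resolves (bar k A)" by (rule resolves_bar[OF P.M_module])
  interpret bar: exact_complex "enveloping k A" "left_regular k A" "bar k A" by (rule bar)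
  have proj: "projective_module env (Ch P i)" for i
    using assms(3) by (simp add: projective_resolution_def)
  have P_P: "lifts_through env (left_regular k A) P (Ch P i)" for i
    by (rule P.projective_lifts_through[OF proj])
  have P_bar: "lifts_through env (left_regular k A) (bar k A) (Ch P i)" for i
    by (rule bar.projective_lifts_through[OF proj])
  have from_bar: "lifts_through env (left_regular k A) Q (Ch (bar k A) i)" if "resolves Q"
    for Q :: "('a env, 'q, 'a) aug_complex" and i
    using that unfolding lifts_through_def bar_simps
    by (intro conjI allI bar_module_lifts_along[OF assms(2)] abelian_group_left_regular
        exact_complex.Ch_module exact_complex.aug_linear exact_complex.bd_linear
        left_module.axioms(2)[OF exact_complex.Ch_module])
  note cap = cap_class[OF P bar P_P P_bar from_bar[OF P] from_bar[OF bar]]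
  have lift: "\<exists>\<tau>. chain_lift env P m t \<tau>" if t: "t \<in> HHco_cocycles k A P m" for m t
  proof -
    have "t \<in> linear_maps env (Ch P m) (left_regular k A)"
      "\<And>x. x \<in> carrier (Ch P (Suc m)) \<Longrightarrow> t (bd P (Suc m) x) = \<zero>\<^bsub>left_regular k A\<^esub>"
      using t by (auto simp: HHco_cocycles_iff left_regular_simps)
    from lift_over_exists[OF P P P_P this] show ?thesis
      unfolding chain_lift_iff_lift_over by blast
  qed
  have first: "cap k A P n m (HH_class k A P n z) (HHco_class k A P m t) =
      [((- 1) ^ (m * (n - m)) :: int)] \<cdot>\<^bsub>HH k A P (n - m)\<^esub>
        HH_class k A P (n - m) (chain_map k A P (n - m) (\<tau> (n - m)) z)"
    if "t \<in> HHco_cocycles k A P m" "chain_lift env P m t \<tau>" "m \<le> n" "z \<in> HH_cycles k A P n" for m t \<tau> n z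
    using cap[OF that(1,2), of z "n - m"] that(3,4) by simp
  have tilde: "cap_tilde k A P n m \<xi> \<eta> \<in> carrier (HH k A P (n - m)) \<and>
      cap k A P n m \<xi> \<eta> = [((- 1) ^ (m * (n - m)) :: int)] \<cdot>\<^bsub>HH k A P (n - m)\<^esub> cap_tilde k A P n m \<xi> \<eta>"
    if mn: "m \<le> n" and \<xi>: "\<xi> \<in> carrier (HH k A P n)" and \<eta>: "\<eta> \<in> carrier (HHco k A P m)" for m n \<xi> \<eta>
  proof -
    obtain z where z: "z \<in> HH_cycles k A P n" "\<xi> = HH_class k A P n z" using \<xi> unfolding carrier_HH by blast
    obtain t where t: "t \<in> HHco_cocycles k A P m" "\<eta> = HHco_class k A P m t" using \<eta> unfolding carrier_HHco by blast
    obtain \<tau> where \<tau>: "chain_lift env P m t \<tau>" using lift[OF t(1)] by blast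
    have "cap_tilde k A P n m \<xi> \<eta> = HH_class k A P (n - m) (chain_map k A P (n - m) (\<tau> (n - m)) z)"
      using cap_tilde_class[OF P P_P t(1) \<tau>, of z "n - m"] z t(2) mn by simp
    moreover have "chain_map k A P (n - m) (\<tau> (n - m)) z \<in> HH_cycles k A P (n - m)"
      using chain_map_lift_cycle[OF P P \<tau>[unfolded chain_lift_iff_lift_over], of z "n - m"] z(1) mn by simp
    ultimately show ?thesis
      using first[OF t(1) \<tau> mn z(1)] z(2) t(2) by (simp add: carrier_HH)
  qed
  have second: "cap_tilde k A P n m \<xi> \<eta> = [((- 1) ^ (m * (n - m)) :: int)] \<cdot>\<^bsub>HH k A P (n - m)\<^esub> cap k A P n m \<xi> \<eta>"
    if "m \<le> n" "\<xi> \<in> carrier (HH k A P n)" "\<eta> \<in> carrier (HHco k A P m)" for m n \<xi> \<eta>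
    using tilde[OF that] int_sign_twice[OF abelian_group_HH[OF P]] by simp
  have third: "cap_tilde k A P n m \<xi> \<eta> = cap k A P n m \<xi> \<eta>"
    if "m \<le> n" "even m \<or> even (n - m)" "\<xi> \<in> carrier (HH k A P n)" "\<eta> \<in> carrier (HHco k A P m)" for m n \<xi> \<eta>
  proof -
    interpret H: abelian_group "HH k A P (n - m)" by (rule abelian_group_HH[OF P])
    have "((- 1) ^ (m * (n - m)) :: int) = 1" using that(2) by auto
    then show ?thesis using tilde[OF that(1,3,4)] H.add.int_pow_1 by simp
  qed
  show ?thesis
    by (intro conjI allI ballI impI; (elim conjE)?) (rule first second third; assumption)+
qed

end
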